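(* Let $\Omega\subset\mathbb{R}^n$ be a smooth bounded domain and let $p:\Omega\to[1,+\infty)$ be measurable with $1<p^-\le p^+<+\infty$, where $p^-:=\operatorname{ess\,inf}_\Omega p$ and $p^+:=\operatorname{ess\,sup}_\Omega p$. Let $\varphi:\mathbb{R}^n\times[0,+\infty)\to[0,+\infty)$ be a continuous function, except at a finite number of points in $(0,+\infty)$, such that $\varphi(x,0)=0$ for a.e. $x\in\mathbb{R}^n$. Assume that there exist constants $a\ge0$ and $b\ge0$ such that $$\varphi(x,t)\le a\,t^{p(x)+1}\quad\forall t\in[0,1],\ \text{for a.e. } x\in\Omega,\qquad \varphi(x,t)\le b\quad\forall t\in\mathbb{R}^+,\ \text{for a.e. } x\in\mathbb{R}^n,$$ and that $$\gamma_{n,p(x)}\int_0^{+\infty}\varphi(x,t)\,t^{-(p(x)+1)}\,dt=1\quad\text{for a.e. } x\in\Omega .$$ Let $u\in W^{1,p^+}(\Omega)\cap W^{1,p^-}(\Omega)$. Then: (a) there exists $C>0$, depending on $p^\pm$ and the domain $\Omega$, such that for every $\delta>0$ $$\Lambda_\delta(u)\le C\left(\|\nabla u\|_{L^{p^+}(\Omega)}^{p^+}+\|\nabla u\|_{L^{p^-}(\Omega)}^{p^-}\right);$$ (b) we have $$\lim_{\delta\to0^+}\Lambda_\delta(u)=\int_\Omega|\nabla u(x)|^{p(x)}\,dx .$$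
   Context: For $x\in\Omega$, $\gamma_{n,p(x)}:=\int_{\mathbb{S}^{n-1}}|\omega\cdot\mathbf{e}|^{p(x)}\,d\mathcal{H}^{n-1}(\omega)$, where $\mathbf{e}\in\mathbb{S}^{n-1}$ is any unit vector (the value does not depend on $\mathbf e$) and $\mathcal{H}^{n-1}$ is the surface measure on the unit sphere $\mathbb{S}^{n-1}$. For $\delta>0$, $$\Lambda_\delta(u):=\int_\Omega\int_\Omega\frac{\delta^{p(x)}\,\varphi\left(x,|u(x)-u(y)|/\delta\right)}{|x-y|^{n+p(x)}}\,dx\,dy .$$
   Formalization: In (a) the constant C may depend on a and b as well as on p^± and Ω; independence of a and b fails, since φ is not assumed monotone: normalised spikes of height k at t = 2, with u equal to 0 and 2 on two sets of positive measure, give Λ_1(u) ≥ ck. *)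

theory Defs
  imports "HOL-Probability.Essential_Supremum"
begin

section \<open>Hausdorff measure\<close>

text \<open>
  The measure is normalised by \<open>\<omega>\<^sub>k / 2\<^sup>k\<close>, with \<open>\<omega>\<^sub>k\<close> the volume of the unit ball of dimension \<open>k\<close>,
  so that on \<open>k\<close>-dimensional surfaces it is the usual surface measure. Empty covering sets
  contribute nothing; this only matters for \<open>k = 0\<close> (counting measure), since \<open>0 ^ 0 = 1\<close>.
  Covering sets are required to be bounded because \<open>diameter\<close> has no meaning otherwise.
\<close>

definition hausdorff_gauge :: "nat \<Rightarrow> 'a::metric_space set \<Rightarrow> ennreal" where
  "hausdorff_gauge k U =
     (if U = {} then 0 else ennreal (unit_ball_vol (real k) * (diameter U / 2) ^ k))"

definition hausdorff_content :: "nat \<Rightarrow> real \<Rightarrow> 'a::metric_space set \<Rightarrow> ennreal" where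
  "hausdorff_content k d A =
     (INF U \<in> {U :: nat \<Rightarrow> 'a set. A \<subseteq> (\<Union>i. U i) \<and> (\<forall>i. bounded (U i) \<and> diameter (U i) \<le> d)}.
        \<Sum>i. hausdorff_gauge k (U i))"

definition hausdorff_outer :: "nat \<Rightarrow> 'a::metric_space set \<Rightarrow> ennreal" where
  "hausdorff_outer k A = (SUP d \<in> {0<..}. hausdorff_content k d A)"

definition hausdorff_measure :: "nat \<Rightarrow> 'a::metric_space measure" where
  "hausdorff_measure k = measure_of UNIV (sets borel) (hausdorff_outer k)"

text \<open>
  \<^const>\<open>measure_of\<close> would return the zero measure if the set function were not countably
  additive on the Borel sets; the following lemmas, culminating in \<open>emeasure_hausdorff_measure\<close>, show that
  this is not the case.
\<close>

lemma hausdorff_content_empty: "0 < d \<Longrightarrow> hausdorff_content k d {} = 0"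
  unfolding hausdorff_content_def
  by (intro antisym INF_lower2[of "\<lambda>_. {}"]) (auto simp: hausdorff_gauge_def diameter_def)

lemma hausdorff_outer_empty: "hausdorff_outer k {} = 0"
  unfolding hausdorff_outer_def by (simp add: hausdorff_content_empty cong: SUP_cong_simp)

lemma hausdorff_content_mono: "A \<subseteq> B \<Longrightarrow> hausdorff_content k d A \<le> hausdorff_content k d B"
  unfolding hausdorff_content_def by (rule INF_superset_mono) auto

lemma hausdorff_content_antimono:
  "d \<le> d' \<Longrightarrow> hausdorff_content k d' A \<le> hausdorff_content k d A"
  unfolding hausdorff_content_def by (rule INF_superset_mono) (auto intro: order_trans)

lemma hausdorff_outer_mono: "A \<subseteq> B \<Longrightarrow> hausdorff_outer k A \<le> hausdorff_outer k B"
  unfolding hausdorff_outer_def by (intro SUP_mono) (auto intro: hausdorff_content_mono)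

lemma hausdorff_content_close:
  assumes "hausdorff_content k d A < e"
  obtains U :: "nat \<Rightarrow> 'a::metric_space set" where
    "A \<subseteq> (\<Union>i. U i)" "\<And>i. bounded (U i)" "\<And>i. diameter (U i) \<le> d"
    "(\<Sum>i. hausdorff_gauge k (U i)) < e"
  using assms unfolding hausdorff_content_def INF_less_iff by auto

lemma hausdorff_content_le:
  assumes "A \<subseteq> (\<Union>i. U i)" "\<And>i. bounded (U i)" "\<And>i. diameter (U i) \<le> d"
  shows "hausdorff_content k d A \<le> (\<Sum>i. hausdorff_gauge k (U i))"
  unfolding hausdorff_content_def using assms by (intro INF_lower) auto

lemma hausdorff_content_countably_subadditive:
  fixes A :: "nat \<Rightarrow> 'a::metric_space set"
  shows "hausdorff_content k d (\<Union>i. A i) \<le> (\<Sum>i. hausdorff_content k d (A i))"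
proof (rule ennreal_le_epsilon)
  fix e :: real
  assume e: "0 < e" and fin: "(\<Sum>i. hausdorff_content k d (A i)) < top"
  let ?h = "\<lambda>n. ennreal (e * (1/2) ^ Suc n)"
  have "\<exists>U :: nat \<Rightarrow> 'a set. A n \<subseteq> (\<Union>i. U i) \<and> (\<forall>i. bounded (U i) \<and> diameter (U i) \<le> d)
      \<and> (\<Sum>i. hausdorff_gauge k (U i)) \<le> hausdorff_content k d (A n) + ?h n" for n
  proof -
    have "hausdorff_content k d (A n) < top"
      using ennreal_suminf_lessD[OF fin, of n] .
    then have "hausdorff_content k d (A n) < hausdorff_content k d (A n) + ?h n"
      using e by (simp add: ennreal_zero_less_mult_iff)
    from hausdorff_content_close[OF this] show ?thesis by (metis less_imp_le)
  qed
  then obtain U :: "nat \<Rightarrow> nat \<Rightarrow> 'a set" where U: "\<And>n. A n \<subseteq> (\<Union>i. U n i)"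
      "\<And>n i. bounded (U n i)" "\<And>n i. diameter (U n i) \<le> d"
      "\<And>n. (\<Sum>i. hausdorff_gauge k (U n i)) \<le> hausdorff_content k d (A n) + ?h n"
    by metis
  define V where "V = (\<lambda>(n, i). U n i) \<circ> prod_decode"
  have "(\<Union>n. A n) \<subseteq> (\<Union>j. V j)"
  proof
    fix x assume "x \<in> (\<Union>n. A n)"
    then obtain n i where "x \<in> U n i" using U(1) by blast
    then have "x \<in> V (prod_encode (n, i))" by (simp add: V_def)
    then show "x \<in> (\<Union>j. V j)" by blast
  qed
  then have "hausdorff_content k d (\<Union>i. A i) \<le> (\<Sum>j. hausdorff_gauge k (V j))"
    by (rule hausdorff_content_le) (auto simp: V_def U split: prod.split)
  also have "\<dots> = (\<Sum>n. \<Sum>i. hausdorff_gauge k (U n i))"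
    using suminf_ennreal_2dimen[of "\<lambda>n. \<Sum>i. hausdorff_gauge k (U n i)"
        "\<lambda>(n, i). hausdorff_gauge k (U n i)"]
    by (simp add: V_def case_prod_beta')
  also have "\<dots> \<le> (\<Sum>n. hausdorff_content k d (A n) + ?h n)"
    by (intro suminf_le U(4)) auto
  also have "\<dots> = (\<Sum>n. hausdorff_content k d (A n)) + (\<Sum>n. ?h n)"
    by (rule suminf_add[symmetric]) auto
  also have "(\<Sum>n. ?h n) = ennreal e"
  proof (rule suminf_ennreal_eq)
    show "(\<lambda>n. e * (1/2) ^ Suc n) sums e"
      using sums_mult[OF power_half_series, of e] by (simp only: mult_1_right)
    show "0 \<le> e * (1/2) ^ Suc n" for n
      using e by (intro mult_nonneg_nonneg zero_le_power) auto
  qed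
  finally show "hausdorff_content k d (\<Union>i. A i) \<le> (\<Sum>i. hausdorff_content k d (A i)) + ennreal e" .
qed

lemma hausdorff_outer_countably_subadditive:
  "hausdorff_outer k (\<Union>i. A i) \<le> (\<Sum>i. hausdorff_outer k (A i))" for A :: "nat \<Rightarrow> _"
  unfolding hausdorff_outer_def[of k "\<Union>i. A i"]
proof (rule SUP_least)
  fix d :: real assume d: "d \<in> {0<..}"
  have "hausdorff_content k d (\<Union>i. A i) \<le> (\<Sum>i. hausdorff_content k d (A i))"
    by (rule hausdorff_content_countably_subadditive)
  also have "\<dots> \<le> (\<Sum>i. hausdorff_outer k (A i))"
    using d by (intro suminf_le) (auto simp: hausdorff_outer_def intro!: SUP_upper)
  finally show "hausdorff_content k d (\<Union>i. A i) \<le> (\<Sum>i. hausdorff_outer k (A i))" .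
qed

lemma outer_measure_space_hausdorff: "outer_measure_space (Pow UNIV) (hausdorff_outer k)"
  unfolding outer_measure_space_def positive_def increasing_def countably_subadditive_def
  by (auto simp: hausdorff_outer_empty intro: hausdorff_outer_mono
      hausdorff_outer_countably_subadditive)

lemma hausdorff_outer_Un:
  "hausdorff_outer k (A \<union> B) \<le> hausdorff_outer k A + hausdorff_outer k B"
proof -
  have "hausdorff_outer k (\<Union>i. binaryset A B i) \<le> (\<Sum>i. hausdorff_outer k (binaryset A B i))"
    by (rule hausdorff_outer_countably_subadditive)
  also have "\<dots> = hausdorff_outer k A + hausdorff_outer k B"
    by (rule suminf_binaryset_eq) (rule hausdorff_outer_empty)
  finally show ?thesis by (simp add: UN_binaryset_eq)
qed

lemma hausdorff_outer_separated:
  fixes A B :: "'a::metric_space set"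
  assumes r: "0 < r" and sep: "\<And>x y. x \<in> A \<Longrightarrow> y \<in> B \<Longrightarrow> r \<le> dist x y"
  shows "hausdorff_outer k A + hausdorff_outer k B \<le> hausdorff_outer k (A \<union> B)"
proof -
  have content: "hausdorff_content k d A + hausdorff_content k d B \<le> hausdorff_content k d (A \<union> B)"
    if d: "0 < d" "d < r" for d
    unfolding hausdorff_content_def[of k d "A \<union> B"]
  proof (rule INF_greatest, safe)
    fix U :: "nat \<Rightarrow> 'a set"
    assume cov: "A \<union> B \<subseteq> (\<Union>i. U i)" and U: "\<forall>i. bounded (U i) \<and> diameter (U i) \<le> d"
    define V where "V i = (if U i \<inter> A = {} then {} else U i)" for i
    define W where "W i = (if U i \<inter> B = {} then {} else U i)" for i
    have disj: "U i \<inter> A = {} \<or> U i \<inter> B = {}" for i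
    proof (rule ccontr)
      assume "\<not> ?thesis"
      then obtain x y where "x \<in> U i" "x \<in> A" "y \<in> U i" "y \<in> B" by auto
      then have "r \<le> d"
        using sep[of x y] diameter_bounded_bound[of "U i" x y] U[rule_format, of i] by auto
      then show False using d by simp
    qed
    have "A \<subseteq> (\<Union>i. V i)" "B \<subseteq> (\<Union>i. W i)"
      using cov by (fastforce simp: V_def W_def)+
    moreover have "bounded (V i)" "diameter (V i) \<le> d" "bounded (W i)" "diameter (W i) \<le> d" for i
      using U d by (auto simp: V_def W_def)
    ultimately have "hausdorff_content k d A \<le> (\<Sum>i. hausdorff_gauge k (V i))"
      "hausdorff_content k d B \<le> (\<Sum>i. hausdorff_gauge k (W i))"
      by (simp_all only: hausdorff_content_le)
    then have "hausdorff_content k d A + hausdorff_content k d B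
        \<le> (\<Sum>i. hausdorff_gauge k (V i)) + (\<Sum>i. hausdorff_gauge k (W i))"
      by (rule add_mono)
    also have "\<dots> = (\<Sum>i. hausdorff_gauge k (V i) + hausdorff_gauge k (W i))"
      by (rule suminf_add) auto
    also have "\<dots> \<le> (\<Sum>i. hausdorff_gauge k (U i))"
    proof (intro suminf_le)
      show "hausdorff_gauge k (V i) + hausdorff_gauge k (W i) \<le> hausdorff_gauge k (U i)" for i
        using disj[of i] by (auto simp: V_def W_def hausdorff_gauge_def)
    qed auto
    finally show "hausdorff_content k d A + hausdorff_content k d B
        \<le> (\<Sum>i. hausdorff_gauge k (U i))" .
  qed
  have "hausdorff_outer k A + hausdorff_outer k B
      = (SUP d \<in> {0<..}. hausdorff_content k d A + hausdorff_content k d B)"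
    unfolding hausdorff_outer_def
  proof (rule SUP_add_directed_ennreal[symmetric])
    fix d e :: real assume "d \<in> {0<..}" "e \<in> {0<..}"
    then show "\<exists>c\<in>{0<..}. hausdorff_content k d A + hausdorff_content k e B
        \<le> hausdorff_content k c A + hausdorff_content k c B"
      by (intro bexI[of _ "min d e"] add_mono hausdorff_content_antimono) auto
  qed
  also have "\<dots> \<le> hausdorff_outer k (A \<union> B)"
  proof (rule SUP_least)
    fix d :: real assume d: "d \<in> {0<..}"
    let ?c = "min d (r/2)"
    have "hausdorff_content k d A + hausdorff_content k d B
        \<le> hausdorff_content k ?c A + hausdorff_content k ?c B"
      by (intro add_mono hausdorff_content_antimono) auto
    also have "\<dots> \<le> hausdorff_content k ?c (A \<union> B)"
      using d r by (intro content) auto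
    also have "\<dots> \<le> hausdorff_outer k (A \<union> B)"
      unfolding hausdorff_outer_def using d r by (intro SUP_upper) auto
    finally show "hausdorff_content k d A + hausdorff_content k d B
        \<le> hausdorff_outer k (A \<union> B)" .
  qed
  finally show ?thesis .
qed

lemma hausdorff_closed_caratheodory:
  fixes C :: "'a::metric_space set"
  assumes C: "closed C"
  shows "hausdorff_outer k (A \<inter> C) + hausdorff_outer k (A - C) \<le> hausdorff_outer k A"
proof (cases "C = {} \<or> hausdorff_outer k A = top")
  case True
  then show ?thesis by (auto simp: hausdorff_outer_empty)
next
  case False
  then have C0: "C \<noteq> {}" and fin: "hausdorff_outer k A < top" by (auto simp: less_top)
  let ?\<mu> = "hausdorff_outer k"
  define B where "B j = {x \<in> A. 1 / real (Suc j) \<le> infdist x C}" for j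
  define R where "R j = B (Suc j) - B j" for j
  have B_mono: "B i \<subseteq> B j" if "i \<le> j" for i j
  proof -
    have "1 / real (Suc j) \<le> 1 / real (Suc i)" using that by (simp add: frac_le)
    then show ?thesis by (auto simp: B_def)
  qed
  have near: "\<bar>infdist x C - infdist y C\<bar> \<le> dist x y" for x y
    by (rule infdist_triangle_abs)
  have sepC: "?\<mu> (A \<inter> C) + ?\<mu> (B j) \<le> ?\<mu> A" for j
  proof -
    have "?\<mu> (A \<inter> C) + ?\<mu> (B j) \<le> ?\<mu> (A \<inter> C \<union> B j)"
    proof (rule hausdorff_outer_separated[of "1 / real (Suc j)"])
      fix x y assume "x \<in> A \<inter> C" "y \<in> B j"
      then show "1 / real (Suc j) \<le> dist x y"
        using near[of x y] by (auto simp: B_def)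
    qed simp
    also have "\<dots> \<le> ?\<mu> A" by (rule hausdorff_outer_mono) (auto simp: B_def)
    finally show ?thesis .
  qed
  have sepR: "?\<mu> (B i) + ?\<mu> (R (Suc i)) \<le> ?\<mu> (B i \<union> R (Suc i))" for i
  proof (rule hausdorff_outer_separated[of "1 / real (Suc i) - 1 / real (Suc (Suc i))"])
    show "0 < 1 / real (Suc i) - 1 / real (Suc (Suc i))"
      by (simp add: frac_less2)
    fix x y assume "x \<in> B i" "y \<in> R (Suc i)"
    then show "1 / real (Suc i) - 1 / real (Suc (Suc i)) \<le> dist x y"
      using near[of x y] by (auto simp: B_def R_def)
  qed
  have partial: "(\<Sum>i<m. ?\<mu> (R (Suc (2 * i + c)))) \<le> ?\<mu> (B (2 * m + c))" for m c :: nat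
  proof (induction m)
    case (Suc m)
    have "(\<Sum>i<Suc m. ?\<mu> (R (Suc (2 * i + c)))) \<le> ?\<mu> (B (2 * m + c)) + ?\<mu> (R (Suc (2 * m + c)))"
      using Suc by (simp add: add_right_mono)
    also have "\<dots> \<le> ?\<mu> (B (2 * m + c) \<union> R (Suc (2 * m + c)))"
      by (rule sepR)
    also have "\<dots> \<le> ?\<mu> (B (2 * Suc m + c))"
      using B_mono[of "2 * m + c" "2 * Suc m + c"]
      by (intro hausdorff_outer_mono) (auto simp: R_def)
    finally show ?case .
  qed simp
  have BA: "?\<mu> (B j) \<le> ?\<mu> A" for j
    by (rule hausdorff_outer_mono) (auto simp: B_def)
  define r where "r i = ?\<mu> (R (Suc i))" for i
  have "(\<Sum>i. r i) \<le> ?\<mu> A + ?\<mu> A"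
  proof (rule suminf_le_const)
    fix m
    have "(\<Sum>i<m. r i) \<le> (\<Sum>i<2 * m. r i)"
      by (rule sum_mono2) auto
    also have "\<dots> = (\<Sum>i<m. r (2 * i + 0)) + (\<Sum>i<m. r (2 * i + 1))"
      by (induction m) (auto simp: algebra_simps)
    also have "\<dots> \<le> ?\<mu> A + ?\<mu> A"
      using order_trans[OF partial[of 0 m] BA]
        order_trans[OF partial[of 1 m] BA]
      by (intro add_mono) (simp_all add: r_def)
    finally show "(\<Sum>i<m. r i) \<le> ?\<mu> A + ?\<mu> A" .
  qed auto
  then have r_fin: "(\<Sum>i. r i) < top"
    by (rule order.strict_trans1) (simp add: fin)
  have tail: "?\<mu> (A - C) \<le> ?\<mu> (B (Suc j)) + (\<Sum>i. r (i + j))" for j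
  proof -
    have "A - C \<subseteq> B (Suc j) \<union> (\<Union>i. R (Suc (i + j)))"
    proof
      fix x assume x: "x \<in> A - C"
      then have "0 < infdist x C"
        using in_closed_iff_infdist_zero[OF C C0, of x] infdist_nonneg[of x C] by auto
      then obtain m where "inverse (real (Suc m)) < infdist x C"
        using reals_Archimedean by blast
      then have "x \<in> B m" using x by (auto simp: B_def inverse_eq_divide)
      then have l: "x \<in> B (LEAST m. x \<in> B m)" by (rule LeastI)
      show "x \<in> B (Suc j) \<union> (\<Union>i. R (Suc (i + j)))"
      proof (cases "(LEAST m. x \<in> B m) \<le> Suc j")
        case True
        then show ?thesis using l B_mono by blast
      next
        case False
        then obtain i where i: "(LEAST m. x \<in> B m) = Suc (Suc (i + j))"
          using less_imp_Suc_add[of "Suc j" "LEAST m. x \<in> B m"] by (auto simp: add.commute)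
        then have "x \<notin> B (Suc (i + j))"
          using not_less_Least[of "Suc (i + j)" "\<lambda>m. x \<in> B m"] by simp
        then show ?thesis using l i by (auto simp: R_def)
      qed
    qed
    then have "?\<mu> (A - C) \<le> ?\<mu> (B (Suc j)) + ?\<mu> (\<Union>i. R (Suc (i + j)))"
      by (rule order_trans[OF hausdorff_outer_mono hausdorff_outer_Un])
    also have "\<dots> \<le> ?\<mu> (B (Suc j)) + (\<Sum>i. r (i + j))"
      unfolding r_def by (intro add_left_mono hausdorff_outer_countably_subadditive)
    finally show ?thesis .
  qed
  have "?\<mu> (A \<inter> C) + ?\<mu> (A - C) + (\<Sum>i. r i) \<le> ?\<mu> A + (\<Sum>i. r i)"
  proof -
    have "?\<mu> (A \<inter> C) + ?\<mu> (A - C) + (\<Sum>i. r i)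
        = (SUP j. ?\<mu> (A \<inter> C) + ?\<mu> (A - C) + (\<Sum>i<j. r i))"
      unfolding suminf_eq_SUP[of r] by (subst ennreal_SUP_add_right) auto
    also have "\<dots> \<le> ?\<mu> A + (\<Sum>i. r i)"
    proof (rule SUP_least)
      fix j
      have "?\<mu> (A \<inter> C) + ?\<mu> (A - C) + (\<Sum>i<j. r i)
          \<le> ?\<mu> (A \<inter> C) + (?\<mu> (B (Suc j)) + (\<Sum>i. r (i + j))) + (\<Sum>i<j. r i)"
        by (intro add_mono tail order_refl)
      also have "\<dots> = (?\<mu> (A \<inter> C) + ?\<mu> (B (Suc j))) + (\<Sum>i. r i)"
        by (subst suminf_offset[of r j]) (auto simp only: summableI ac_simps)
      also have "\<dots> \<le> ?\<mu> A + (\<Sum>i. r i)"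
        by (intro add_right_mono sepC)
      finally show "?\<mu> (A \<inter> C) + ?\<mu> (A - C) + (\<Sum>i<j. r i) \<le> ?\<mu> A + (\<Sum>i. r i)" .
    qed
    finally show ?thesis .
  qed
  then have "(\<Sum>i. r i) + (?\<mu> (A \<inter> C) + ?\<mu> (A - C)) \<le> (\<Sum>i. r i) + ?\<mu> A"
    by (simp only: add.commute)
  then show ?thesis
    using r_fin unfolding ennreal_add_left_cancel_le by auto
qed

lemma hausdorff_measure_space: "measure_space UNIV (sets borel) (hausdorff_outer k)"
proof (rule measure_down[OF sigma_algebra.caratheodory_lemma])
  show "sigma_algebra (UNIV :: 'a set) (Pow UNIV)" by (rule sigma_algebra_Pow)
  show "outer_measure_space (Pow UNIV) (hausdorff_outer k :: 'a set \<Rightarrow> _)"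
    by (rule outer_measure_space_hausdorff)
  show "sigma_algebra UNIV (sets (borel :: 'a measure))"
    using sets.sigma_algebra_axioms[of borel] by simp
  have "sigma_algebra (UNIV :: 'a set) (lambda_system UNIV (Pow UNIV) (hausdorff_outer k))"
    using sigma_algebra.caratheodory_lemma[OF sigma_algebra_Pow outer_measure_space_hausdorff]
    by (auto simp: measure_space_def)
  moreover have "C \<in> lambda_system UNIV (Pow UNIV) (hausdorff_outer k)" if "closed C" for C :: "'a set"
  proof -
    have "hausdorff_outer k (A \<inter> C) + hausdorff_outer k (A - C) = hausdorff_outer k A" for A :: "'a set"
      using hausdorff_closed_caratheodory[OF that, of k A] hausdorff_outer_Un[of k "A \<inter> C" "A - C"]
      by (simp add: Int_Diff_Un antisym)
    then show ?thesis
      using algebra.lambda_system_eq[OF algebra_Pow, of "UNIV :: 'a set" "hausdorff_outer k"] by auto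
  qed
  ultimately show "sets (borel :: 'a measure) \<subseteq> lambda_system UNIV (Pow UNIV) (hausdorff_outer k)"
    unfolding borel_eq_closed
    by (subst sets_measure_of, simp) (rule sigma_algebra.sigma_sets_subset, auto)
qed

lemma sets_hausdorff_measure [simp, measurable_cong]: "sets (hausdorff_measure k) = sets borel"
  unfolding hausdorff_measure_def using sets.sets_measure_of_eq[of borel] by simp

lemma space_hausdorff_measure [simp]: "space (hausdorff_measure k) = UNIV"
  unfolding hausdorff_measure_def by (simp add: space_measure_of_conv)

lemma emeasure_hausdorff_measure:
  fixes A :: "'a::metric_space set"
  shows "A \<in> sets borel \<Longrightarrow> emeasure (hausdorff_measure k) A = hausdorff_outer k A"
  using hausdorff_measure_space[where k = k and 'a = 'a] unfolding measure_space_def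
  by (intro emeasure_measure_of[OF hausdorff_measure_def]) simp_all


section \<open>Smooth functions and smooth domains\<close>

text \<open>\<open>C\<^sup>k\<close> on an open set, through iterated partial derivatives.\<close>

primrec Ck_on :: "nat \<Rightarrow> 'a::euclidean_space set \<Rightarrow> ('a \<Rightarrow> real) \<Rightarrow> bool" where
  "Ck_on 0 S f \<longleftrightarrow> continuous_on S f"
| "Ck_on (Suc k) S f \<longleftrightarrow>
     f differentiable_on S \<and> (\<forall>i\<in>Basis. Ck_on k S (\<lambda>x. frechet_derivative f (at x) i))"

definition smooth_on :: "'a::euclidean_space set \<Rightarrow> ('a \<Rightarrow> real) \<Rightarrow> bool" where
  "smooth_on S f \<longleftrightarrow> (\<forall>k. Ck_on k S f)"

text \<open>
  Near each boundary point the set is the region strictly above the graph of a smooth function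
  over the hyperplane orthogonal to some unit vector \<open>\<nu>\<close>. The point \<open>x - (x \<bullet> \<nu>) *\<^sub>R \<nu>\<close> is the
  projection of \<open>x\<close> to that hyperplane, so only the values of \<open>h\<close> there matter.
\<close>

definition smooth_boundary :: "'a::euclidean_space set \<Rightarrow> bool" where
  "smooth_boundary \<Omega> \<longleftrightarrow>
     (\<forall>z\<in>frontier \<Omega>. \<exists>r>0. \<exists>\<nu> h. norm \<nu> = 1 \<and> smooth_on UNIV h \<and>
        (\<forall>x\<in>ball z r. x \<in> \<Omega> \<longleftrightarrow> h (x - (x \<bullet> \<nu>) *\<^sub>R \<nu>) < x \<bullet> \<nu>))"

definition smooth_bounded_domain :: "'a::euclidean_space set \<Rightarrow> bool" where
  "smooth_bounded_domain \<Omega> \<longleftrightarrow>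
     open \<Omega> \<and> connected \<Omega> \<and> \<Omega> \<noteq> {} \<and> bounded \<Omega> \<and> smooth_boundary \<Omega>"


section \<open>Lebesgue and Sobolev spaces\<close>

definition Lp_space :: "real \<Rightarrow> 'a::euclidean_space set \<Rightarrow> ('a \<Rightarrow> 'b::euclidean_space) set" where
  "Lp_space p \<Omega> =
     {f \<in> borel_measurable (lebesgue_on \<Omega>). integrable (lebesgue_on \<Omega>) (\<lambda>x. norm (f x) powr p)}"

definition Lp_norm :: "real \<Rightarrow> 'a::euclidean_space set \<Rightarrow> ('a \<Rightarrow> 'b::euclidean_space) \<Rightarrow> real" where
  "Lp_norm p \<Omega> f = (LINT x|lebesgue_on \<Omega>. norm (f x) powr p) powr (1 / p)"

definition locally_integrable_on :: "('a::euclidean_space \<Rightarrow> 'b::euclidean_space) \<Rightarrow> 'a set \<Rightarrow> bool"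
  (infixr "locally'_integrable'_on" 46) where
  "f locally_integrable_on \<Omega> \<longleftrightarrow> (\<forall>K. compact K \<and> K \<subseteq> \<Omega> \<longrightarrow> integrable (lebesgue_on K) f)"

definition test_function :: "'a::euclidean_space set \<Rightarrow> ('a \<Rightarrow> real) \<Rightarrow> bool" where
  "test_function \<Omega> \<psi> \<longleftrightarrow> smooth_on UNIV \<psi> \<and>
     compact (closure {x. \<psi> x \<noteq> 0}) \<and> closure {x. \<psi> x \<noteq> 0} \<subseteq> \<Omega>"

definition weak_gradient :: "'a::euclidean_space set \<Rightarrow> ('a \<Rightarrow> real) \<Rightarrow> ('a \<Rightarrow> 'a) \<Rightarrow> bool" where
  "weak_gradient \<Omega> u g \<longleftrightarrow> u locally_integrable_on \<Omega> \<and> g locally_integrable_on \<Omega> \<and>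
     (\<forall>\<psi>. test_function \<Omega> \<psi> \<longrightarrow> (\<forall>i\<in>Basis.
        (LINT x|lebesgue_on \<Omega>. u x * frechet_derivative \<psi> (at x) i) =
        - (LINT x|lebesgue_on \<Omega>. (g x \<bullet> i) * \<psi> x)))"

definition Sobolev_W1 :: "real \<Rightarrow> 'a::euclidean_space set \<Rightarrow> ('a \<Rightarrow> real) set" where
  "Sobolev_W1 p \<Omega> =
     {u \<in> Lp_space p \<Omega>. \<exists>g \<in> Lp_space p \<Omega>. weak_gradient \<Omega> u g}"

text \<open>A representative of the weak gradient, which is unique up to null sets.\<close>

definition wgrad :: "'a::euclidean_space set \<Rightarrow> ('a \<Rightarrow> real) \<Rightarrow> 'a \<Rightarrow> 'a" where
  "wgrad \<Omega> u = (SOME g. weak_gradient \<Omega> u g)"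


section \<open>The exponent and the functional\<close>

definition ess_sup_on :: "'a::euclidean_space set \<Rightarrow> ('a \<Rightarrow> real) \<Rightarrow> ereal" where
  "ess_sup_on \<Omega> p = esssup (lebesgue_on \<Omega>) (\<lambda>x. ereal (p x))"

definition ess_inf_on :: "'a::euclidean_space set \<Rightarrow> ('a \<Rightarrow> real) \<Rightarrow> ereal" where
  "ess_inf_on \<Omega> p = - esssup (lebesgue_on \<Omega>) (\<lambda>x. - ereal (p x))"

definition sphere_gamma :: "'a::euclidean_space \<Rightarrow> real \<Rightarrow> real" where
  "sphere_gamma e q =
     (LINT \<omega>|restrict_space (hausdorff_measure (DIM('a) - 1)) (sphere 0 1). \<bar>\<omega> \<bullet> e\<bar> powr q)"

text \<open>
  The integral is taken in \<^typ>\<open>ennreal\<close>, so that the value \<open>\<infinity>\<close> is allowed. On the diagonal the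
  quotient is \<open>0\<close> by the convention \<open>x / 0 = 0\<close>, which is harmless: the diagonal is a null set.
\<close>

definition Lambda ::
  "'a::euclidean_space set \<Rightarrow> ('a \<Rightarrow> real) \<Rightarrow> ('a \<Rightarrow> real \<Rightarrow> real) \<Rightarrow> real \<Rightarrow> ('a \<Rightarrow> real) \<Rightarrow> ennreal"
where
  "Lambda \<Omega> p \<phi> \<delta> u =
     (\<integral>\<^sup>+y. (\<integral>\<^sup>+x. ennreal (\<delta> powr p x * \<phi> x (\<bar>u x - u y\<bar> / \<delta>) / norm (x - y) powr (real DIM('a) + p x))
        \<partial>lebesgue_on \<Omega>) \<partial>lebesgue_on \<Omega>)"

end

theory Submission
  imports Defs "HOL-Real_Asymp.Real_Asymp"
begin

text \<open>
  Near each of its points \<open>\<Omega>\<close> satisfies a cone condition; averaging the fundamental theorem of calculus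
  over segments in the cones and chaining by connectedness bounds \<open>\<bar>u x - u y\<bar>\<close> by \<open>\<bar>x - y\<bar> (G x + G y)\<close>
  with \<open>G\<close> a multiple of the maximal function of \<open>\<bar>\<nabla>u\<bar>\<close>. Charging each pair of points to the one where
  \<open>G\<close> is larger and integrating the growth condition on \<open>\<phi>\<close> radially gives the uniform bound, by the
  maximal inequality in \<open>L\<^sup>q\<close> for \<open>q = p\<^sup>\<plusminus>\<close>. The same argument on the set where \<open>G\<close> is large makes the
  tails uniformly small; on the rest the substitution \<open>y = x + \<delta> v\<close> gives a dominated integrand. The
  difference quotients of \<open>u\<close> converge to \<open>\<nabla>u \<bullet> v\<close> in the mean because translations are continuous in
  \<open>L\<^sup>1\<close>, and the limiting integral in \<open>v\<close> is \<open>\<bar>\<nabla>u\<bar> powr p\<close> by polar coordinates and the normalisation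
  of \<open>\<phi>\<close>. The surface measure of polar coordinates is the Hausdorff measure: both are rotation invariant
  on the sphere, and a Vitali packing by small caps together with the isodiametric inequality
  identifies the total mass.
\<close>

section \<open>The Hardy--Littlewood maximal function\<close>

text \<open>The exponent is only measurable, so no maximal inequality applies to \<open>p x\<close>
  itself. Each power \<open>A powr p x\<close> is majorised by \<open>A powr pm + A powr pp\<close>,
  whence the two norms of the gradient. The majorant no longer mentions \<open>p x\<close>, so a
  pair may be charged to \<open>y\<close> although the exponent sits at \<open>x\<close>. As \<phi>
  need not be monotone in its second argument, it is first replaced by
  \<open>c * min 1 (t powr (p x + 1))\<close>: the power gives integrability near the diagonal,
  boundedness gives it far away. The maximal function is that of the gradient extended by zero;
  cones keep the segments inside the domain, where the gradient is the true one. In the limit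
  \<open>G\<close> is unbounded and yields no dominating function; a cut at level \<open>K\<close>
  leaves a dominated part and a tail small uniformly in \<delta>. Convergence in the mean is
  pointwise only along fast sequences, which suffices because a failing limit already fails along
  such a sequence. Jumps of \<phi> do not matter: \<open>\<bar>g x \<bullet> v\<bar>\<close> avoids
  them for almost all \<open>v\<close> if \<open>g x\<close> is nonzero, and is 0, never a jump,
  otherwise.\<close>

definition max_fun :: "real \<Rightarrow> ('a::euclidean_space \<Rightarrow> ennreal) \<Rightarrow> 'a \<Rightarrow> ennreal" where
  "max_fun R g x = (SUP (c, r) \<in> {(c, r). 0 < r \<and> r \<le> R \<and> x \<in> ball c r}.
     (\<integral>\<^sup>+y\<in>ball c r. g y \<partial>lborel) / emeasure lborel (ball c r))"

lemma emeasure_ball_pos: "0 < r \<Longrightarrow> emeasure lborel (ball (c::'a::euclidean_space) r) \<noteq> 0"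
  by (subst emeasure_ball) (auto simp: ennreal_eq_0_iff not_le intro!: mult_pos_pos)

lemma emeasure_ball_finite: "emeasure lborel (ball (c::'a::euclidean_space) r) \<noteq> \<infinity>"
  by (cases "0 \<le> r") (simp_all add: emeasure_ball ball_empty)

lemma ennreal_less_divide_iff:
  fixes a b l :: ennreal
  assumes "b \<noteq> 0" "b \<noteq> \<infinity>"
  shows "l < a / b \<longleftrightarrow> l * b < a"
proof -
  have "a / b \<le> l \<longleftrightarrow> a \<le> l * b"
  proof
    assume "a / b \<le> l"
    then have "a / b * b \<le> l * b" by (rule mult_right_mono) simp
    then show "a \<le> l * b"
      using assms by (simp add: ennreal_divide_times ennreal_times_divide mult_divide_eq_ennreal)
  next
    assume "a \<le> l * b"
    then have "a / b \<le> l * b / b" by (rule divide_right_mono_ennreal)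
    then show "a / b \<le> l" using assms by (simp add: mult_divide_eq_ennreal)
  qed
  then show ?thesis by (metis not_le)
qed

text \<open>Balls need only contain \<open>x\<close>, not be centred there, so superlevel sets are
  unions of open balls whatever \<open>g\<close> is; this gives measurability. The cap
  \<open>R\<close> on the radii is what the Vitali covering requires, and later
  \<open>ball 0 R\<close> will contain the whole domain.\<close>

lemma max_fun_superlevel:
  fixes g :: "'a::euclidean_space \<Rightarrow> ennreal"
  shows "{x. l < max_fun R g x} =
    (\<Union>(c, r)\<in>{(c, r). 0 < r \<and> r \<le> R \<and> l * emeasure lborel (ball c r) < (\<integral>\<^sup>+y\<in>ball c r. g y \<partial>lborel)}. ball c r)"
proof -
  have "l < (\<integral>\<^sup>+y\<in>ball c r. g y \<partial>lborel) / emeasure lborel (ball c r) \<longleftrightarrow>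
      l * emeasure lborel (ball c r) < (\<integral>\<^sup>+y\<in>ball c r. g y \<partial>lborel)" if "0 < r" for c :: 'a and r
    using emeasure_ball_pos[OF that, of c] emeasure_ball_finite[of c r]
    by (rule ennreal_less_divide_iff)
  then show ?thesis
    unfolding max_fun_def less_SUP_iff by fastforce
qed

lemma open_max_fun_superlevel: "open {x. l < max_fun R g x}"
  unfolding max_fun_superlevel by auto

lemma borel_measurable_max_fun [measurable]: "max_fun R g \<in> borel_measurable borel"
proof (rule borel_measurableI_greater)
  fix l
  show "{x \<in> space borel. l < max_fun R g x} \<in> sets borel"
    using borel_open[OF open_max_fun_superlevel[of l R g]] by simp
qed

lemma nn_integral_ball_le_max_fun:
  fixes g :: "'a::euclidean_space \<Rightarrow> ennreal"
  assumes "0 < r" "r \<le> R" "x \<in> ball c r"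
  shows "(\<integral>\<^sup>+y\<in>ball c r. g y \<partial>lborel) \<le> emeasure lborel (ball c r) * max_fun R g x"
proof -
  have "(\<integral>\<^sup>+y\<in>ball c r. g y \<partial>lborel) / emeasure lborel (ball c r) \<le> max_fun R g x"
    unfolding max_fun_def using assms by (intro SUP_upper2[of "(c, r)"]) auto
  then have "\<not> max_fun R g x * emeasure lborel (ball c r) < (\<integral>\<^sup>+y\<in>ball c r. g y \<partial>lborel)"
    using ennreal_less_divide_iff[OF emeasure_ball_pos[OF \<open>0 < r\<close>, of c] emeasure_ball_finite[of c r]]
    by (metis not_le)
  then show ?thesis by (simp add: mult.commute)
qed

lemma emeasure_UN_countable_le:
  assumes I: "countable I" and [measurable]: "\<And>i. i \<in> I \<Longrightarrow> X i \<in> sets M"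
  shows "emeasure M (\<Union>i\<in>I. X i) \<le> (\<integral>\<^sup>+i. emeasure M (X i) \<partial>count_space I)"
proof -
  have [measurable]: "(\<Union>i\<in>I. X i) \<in> sets M" using I by auto
  have "emeasure M (\<Union>i\<in>I. X i) = (\<integral>\<^sup>+x. indicator (\<Union>i\<in>I. X i) x \<partial>M)" by simp
  also have "\<dots> \<le> (\<integral>\<^sup>+x. (\<integral>\<^sup>+i. indicator (X i) x \<partial>count_space I) \<partial>M)"
  proof (rule nn_integral_mono)
    fix x
    show "indicator (\<Union>i\<in>I. X i) x \<le> (\<integral>\<^sup>+i. indicator (X i) x \<partial>count_space I)"
    proof (cases "x \<in> (\<Union>i\<in>I. X i)")
      case True
      then obtain j where "j \<in> I" "x \<in> X j" by auto
      then show ?thesis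
        using nn_integral_ge_point[of j I "\<lambda>i. indicator (X i) x"] True by (simp only: indicator_simps)
    qed simp
  qed
  also have "\<dots> = (\<integral>\<^sup>+i. (\<integral>\<^sup>+x. indicator (X i) x \<partial>M) \<partial>count_space I)"
    using I by (intro nn_integral_count_space_nn_integral) auto
  also have "\<dots> = (\<integral>\<^sup>+i. emeasure M (X i) \<partial>count_space I)"
    by (intro nn_integral_cong) simp
  finally show ?thesis .
qed

text \<open>Vitali selects countably many disjoint balls, each carrying mass above \<open>l\<close>
  times its volume, whose fivefold dilates cover the superlevel set. Disjointness bounds the total
  mass by the integral of \<open>g\<close>, and the dilation costs the factor
  \<open>5 ^ DIM('a)\<close>.\<close>

lemma max_fun_weak_type:
  fixes g :: "'a::euclidean_space \<Rightarrow> ennreal"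
  assumes [measurable]: "g \<in> borel_measurable borel"
  shows "l * emeasure lborel {x. l < max_fun R g x} \<le> 5 ^ DIM('a) * (\<integral>\<^sup>+y. g y \<partial>lborel)"
proof -
  let ?K = "{(c::'a, r). 0 < r \<and> r \<le> R \<and> l * emeasure lborel (ball c r) < (\<integral>\<^sup>+y\<in>ball c r. g y \<partial>lborel)}"
  have K1: "{x. l < max_fun R g x} \<subseteq> (\<Union>i\<in>?K. ball (fst i) (snd i))"
    unfolding max_fun_superlevel by auto
  have K2: "0 < snd i \<and> snd i \<le> R" if "i \<in> ?K" for i
    using that by auto
  obtain C where C: "countable C" "C \<subseteq> ?K"
      and disj: "pairwise (\<lambda>i j. disjnt (ball (fst i) (snd i)) (ball (fst j) (snd j))) C"
      and cov: "{x. l < max_fun R g x} \<subseteq> (\<Union>i\<in>C. ball (fst i) (5 * snd i))"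
    by (rule Vitali_covering_lemma_balls[OF K1 K2]) (assumption | rule that)+
  have dis: "disjoint_family_on (\<lambda>i. ball (fst i) (snd i)) C"
    using disj by (auto simp: disjoint_family_on_def pairwise_def disjnt_def)
  have "emeasure lborel {x. l < max_fun R g x} \<le> emeasure lborel (\<Union>i\<in>C. ball (fst i) (5 * snd i))"
    using cov by (intro emeasure_mono) (auto intro!: borel_open)
  also have "\<dots> \<le> (\<integral>\<^sup>+i. emeasure lborel (ball (fst i) (5 * snd i)) \<partial>count_space C)"
    using C(1) by (intro emeasure_UN_countable_le) auto
  also have "\<dots> = (\<integral>\<^sup>+i. 5 ^ DIM('a) * emeasure lborel (ball (fst i) (snd i)) \<partial>count_space C)"
  proof (intro nn_integral_cong)
    fix i assume "i \<in> space (count_space C)"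
    then have "0 < snd i" using C(2) by auto
    then show "emeasure lborel (ball (fst i) (5 * snd i)) = 5 ^ DIM('a) * emeasure lborel (ball (fst i) (snd i))"
      using ennreal_mult'[of "5 ^ DIM('a)" "unit_ball_vol (real DIM('a)) * snd i ^ DIM('a)"] ennreal_power[of 5 "DIM('a)"]
      by (simp add: emeasure_ball power_mult_distrib mult.left_commute)
  qed
  finally have "l * emeasure lborel {x. l < max_fun R g x} \<le>
      l * (\<integral>\<^sup>+i. 5 ^ DIM('a) * emeasure lborel (ball (fst i) (snd i)) \<partial>count_space C)"
    by (rule mult_left_mono) simp
  also have "\<dots> = 5 ^ DIM('a) * (\<integral>\<^sup>+i. l * emeasure lborel (ball (fst i) (snd i)) \<partial>count_space C)"
    by (simp add: nn_integral_cmult mult_ac)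
  also have "\<dots> \<le> 5 ^ DIM('a) * (\<integral>\<^sup>+i. (\<integral>\<^sup>+y\<in>ball (fst i) (snd i). g y \<partial>lborel) \<partial>count_space C)"
    using C(2) by (intro mult_left_mono nn_integral_mono) (auto simp: less_imp_le)
  also have "(\<integral>\<^sup>+i. (\<integral>\<^sup>+y\<in>ball (fst i) (snd i). g y \<partial>lborel) \<partial>count_space C) =
     (\<integral>\<^sup>+i. emeasure (density lborel g) (ball (fst i) (snd i)) \<partial>count_space C)"
    by (simp add: emeasure_density)
  also have "\<dots> = emeasure (density lborel g) (\<Union>i\<in>C. ball (fst i) (snd i))"
    using C(1) dis by (intro emeasure_UN_countable[symmetric]) auto
  also have "\<dots> \<le> emeasure (density lborel g) UNIV"
    by (intro emeasure_mono) auto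
  also have "\<dots> = (\<integral>\<^sup>+y. g y \<partial>lborel)"
    by (simp add: emeasure_density)
  finally show ?thesis by (simp add: mult_left_mono)
qed

text \<open>The part of \<open>g\<close> with values at most \<open>h\<close> has average at most
  \<open>h\<close> on every ball.\<close>

lemma max_fun_split:
  fixes g :: "'a::euclidean_space \<Rightarrow> ennreal"
  assumes [measurable]: "g \<in> borel_measurable borel"
  shows "max_fun R g x \<le> max_fun R (\<lambda>y. g y * indicator {y. h < g y} y) x + h"
  unfolding max_fun_def[of R g]
proof (rule SUP_least, safe)
  fix c :: 'a and r assume r: "0 < r" "r \<le> R" "x \<in> ball c r"
  let ?b = "emeasure lborel (ball c r)" and ?k = "\<lambda>y. g y * indicator {y. h < g y} y"
  note b = emeasure_ball_pos[OF r(1), of c] emeasure_ball_finite[of c r]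
  have [measurable]: "ball c r \<in> sets borel" by simp
  have "(\<integral>\<^sup>+y\<in>ball c r. g y \<partial>lborel) \<le> (\<integral>\<^sup>+y. ?k y * indicator (ball c r) y + h * indicator (ball c r) y \<partial>lborel)"
    by (intro nn_integral_mono) (auto simp: indicator_def)
  also have "\<dots> = (\<integral>\<^sup>+y\<in>ball c r. ?k y \<partial>lborel) + h * ?b"
    by (subst nn_integral_add, measurable) (simp add: nn_integral_cmult_indicator)
  finally have "(\<integral>\<^sup>+y\<in>ball c r. g y \<partial>lborel) / ?b \<le> ((\<integral>\<^sup>+y\<in>ball c r. ?k y \<partial>lborel) + h * ?b) / ?b"
    by (rule divide_right_mono_ennreal)
  also have "\<dots> = (\<integral>\<^sup>+y\<in>ball c r. ?k y \<partial>lborel) / ?b + h"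
    using b by (simp add: add_divide_distrib_ennreal mult_divide_eq_ennreal)
  also have "\<dots> \<le> max_fun R ?k x + h"
    unfolding max_fun_def using r by (intro add_right_mono SUP_upper2[of "(c, r)"]) auto
  finally show "(\<integral>\<^sup>+y\<in>ball c r. g y \<partial>lborel) / ?b \<le> max_fun R ?k x + h" .
qed

text \<open>At level \<open>2 * h\<close> the small values of \<open>g\<close> account for at most
  half, so only values above \<open>h\<close> enter the weak type bound. This sharpening makes the
  integral over all levels converge in the strong type inequality.\<close>

lemma max_fun_weak_type_split:
  fixes g :: "'a::euclidean_space \<Rightarrow> ennreal"
  assumes [measurable]: "g \<in> borel_measurable borel" and h: "h < \<infinity>"
  shows "h * emeasure lborel {x. 2 * h < max_fun R g x} \<le> 5 ^ DIM('a) * (\<integral>\<^sup>+y\<in>{y. h < g y}. g y \<partial>lborel)"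
proof -
  let ?k = "\<lambda>y. g y * indicator {y. h < g y} y"
  have "{x. 2 * h < max_fun R g x} \<subseteq> {x. h < max_fun R ?k x}"
  proof safe
    fix x assume "2 * h < max_fun R g x"
    then have "h + h < max_fun R ?k x + h"
      using max_fun_split[of g R x h] by (simp add: mult_2 order.strict_trans2)
    then show "h < max_fun R ?k x"
      using h by (metis add_right_mono leD not_less)
  qed
  then have "h * emeasure lborel {x. 2 * h < max_fun R g x} \<le> h * emeasure lborel {x. h < max_fun R ?k x}"
    by (intro mult_left_mono emeasure_mono) (auto intro!: borel_open open_max_fun_superlevel)
  also have "\<dots> \<le> 5 ^ DIM('a) * (\<integral>\<^sup>+y. ?k y \<partial>lborel)"
    by (rule max_fun_weak_type) simp
  finally show ?thesis .
qed

text \<open>The weak type bound at every level \<open>n\<close> keeps \<open>n\<close> times the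
  measure of the infinity set below one finite constant.\<close>

lemma max_fun_AE_finite:
  fixes g :: "'a::euclidean_space \<Rightarrow> ennreal"
  assumes [measurable]: "g \<in> borel_measurable borel" and fin: "(\<integral>\<^sup>+y. g y \<partial>lborel) < \<infinity>"
  shows "AE x in lborel. max_fun R g x < \<infinity>"
proof -
  let ?E = "{x. max_fun R g x = \<infinity>}"
  let ?I = "5 ^ DIM('a) * (\<integral>\<^sup>+y. g y \<partial>lborel)"
  have I: "?I < \<infinity>" using fin by (simp add: ennreal_mult_less_top power_less_top_ennreal)
  have bd: "ennreal (real n) * emeasure lborel ?E \<le> ?I" for n
  proof -
    have "ennreal (real n) * emeasure lborel ?E \<le> ennreal (real n) * emeasure lborel {x. ennreal (real n) < max_fun R g x}"
      by (intro mult_left_mono emeasure_mono) (auto intro!: borel_open open_max_fun_superlevel)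
    also have "\<dots> \<le> ?I" by (rule max_fun_weak_type) simp
    finally show ?thesis .
  qed
  have "emeasure lborel ?E = 0"
  proof (rule ccontr)
    assume "emeasure lborel ?E \<noteq> 0"
    then have "(\<infinity>::ennreal) = (SUP n. ennreal (real n)) * emeasure lborel ?E"
      unfolding ennreal_of_nat_eq_real_of_nat[symmetric] ennreal_SUP_of_nat_eq_top by (simp add: ennreal_top_mult)
    also have "\<dots> = (SUP n. ennreal (real n) * emeasure lborel ?E)"
      by (simp add: SUP_mult_right_ennreal)
    also have "\<dots> \<le> ?I" using bd by (intro SUP_least) auto
    finally show False using I by auto
  qed
  moreover have "?E \<in> sets lborel" by measurable
  ultimately have "AE x in lborel. x \<notin> ?E" by (intro AE_not_in) (auto simp: null_sets_def)
  then show ?thesis by (auto simp: less_top)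
qed

section \<open>Strong type inequality by integration over levels\<close>

lemma borel_measurable_indicator_Ioo [measurable (raw)]:
  fixes f h :: "'b \<Rightarrow> real"
  assumes [measurable]: "f \<in> borel_measurable M" "h \<in> borel_measurable M"
  shows "(\<lambda>z. indicator {0<..<f z} (h z) :: ennreal) \<in> borel_measurable M"
proof -
  have "(\<lambda>z. indicator {0<..<f z} (h z) :: ennreal) = (\<lambda>z. if 0 < h z \<and> h z < f z then 1 else 0)"
    by (auto simp: indicator_def)
  then show ?thesis by simp
qed

lemma nn_integral_powr_from_0:
  fixes a c :: real
  assumes "a > -1" "c \<ge> 0"
  shows "(\<integral>\<^sup>+t. ennreal (t powr a) * indicator {0<..<c} t \<partial>lborel) = ennreal (c powr (a + 1) / (a + 1))"
proof -
  have "(\<integral>\<^sup>+t. ennreal (t powr a) * indicator {0<..<c} t \<partial>lborel) =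
      (\<integral>\<^sup>+t. ennreal (t powr a) * indicator {0..c} t \<partial>lborel)"
  proof (rule nn_integral_cong_AE)
    have "AE t in lborel. t \<noteq> 0 \<and> t \<noteq> c" by (intro AE_conjI AE_lborel_singleton)
    then show "AE t in lborel. ennreal (t powr a) * indicator {0<..<c} t = ennreal (t powr a) * indicator {0..c} t"
      by eventually_elim (auto simp: indicator_def)
  qed
  also have "\<dots> = ennreal (c powr (a + 1) / (a + 1))"
    using has_integral_powr_from_0[OF assms] by (intro nn_integral_has_integral_lebesgue') auto
  finally show ?thesis .
qed

text \<open>Marcinkiewicz interpolation in layer cake form, between the weak type bound and the
  trivial bound by the supremum. \<open>enn2real\<close> sends \<infinity> to 0, which only
  decreases the left side.\<close>

theorem max_fun_strong_type:
  fixes g :: "'a::euclidean_space \<Rightarrow> real"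
  assumes [measurable]: "g \<in> borel_measurable borel" and g0: "\<And>x. 0 \<le> g x" and q: "1 < q"
  shows "(\<integral>\<^sup>+x. ennreal (enn2real (max_fun R g x) powr q) \<partial>lborel) \<le>
    ennreal (5 ^ DIM('a) * 2 powr q * q / (q - 1)) * (\<integral>\<^sup>+x. ennreal (g x powr q) \<partial>lborel)"
proof -
  let ?m = "\<lambda>x. enn2real (max_fun R g x)"
  let ?D = "5 ^ DIM('a) :: real"
  have "(\<integral>\<^sup>+x. ennreal (?m x powr q) \<partial>lborel) =
     (\<integral>\<^sup>+x. (\<integral>\<^sup>+t. ennreal (q * t powr (q - 1)) * indicator {0<..<?m x} t \<partial>lborel) \<partial>lborel)"
  proof (rule nn_integral_cong)
    fix x :: 'a
    have "(\<integral>\<^sup>+t. ennreal (q * t powr (q - 1)) * indicator {0<..<?m x} t \<partial>lborel) =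
       (\<integral>\<^sup>+t. ennreal q * (ennreal (t powr (q - 1)) * indicator {0<..<?m x} t) \<partial>lborel)"
      using q by (intro nn_integral_cong) (simp add: ennreal_mult' mult.assoc)
    also have "\<dots> = ennreal (?m x powr q)"
      using q by (simp add: nn_integral_cmult nn_integral_powr_from_0 ennreal_mult'[symmetric])
    finally show "ennreal (?m x powr q) = (\<integral>\<^sup>+t. ennreal (q * t powr (q - 1)) * indicator {0<..<?m x} t \<partial>lborel)" ..
  qed
  also have "\<dots> = (\<integral>\<^sup>+t. (\<integral>\<^sup>+x. ennreal (q * t powr (q - 1)) * indicator {0<..<?m x} t \<partial>lborel) \<partial>lborel)"
    by (rule lborel_pair.Fubini') measurable
  \<comment> \<open>Weak type bound at level \<open>t\<close>, with \<open>g\<close> split at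
    \<open>t / 2\<close>: dividing by \<open>t / 2\<close> lowers the power of \<open>t\<close> by
    one and creates a factor 2.\<close>
  also have "\<dots> \<le> (\<integral>\<^sup>+t. (\<integral>\<^sup>+x. ennreal (2 * ?D * q) * (ennreal (g x) * (ennreal (t powr (q - 2)) * indicator {0<..<2 * g x} t)) \<partial>lborel) \<partial>lborel)"
  proof (rule nn_integral_mono)
    fix t :: real
    show "(\<integral>\<^sup>+x. ennreal (q * t powr (q - 1)) * indicator {0<..<?m x} t \<partial>lborel) \<le>
      (\<integral>\<^sup>+x. ennreal (2 * ?D * q) * (ennreal (g x) * (ennreal (t powr (q - 2)) * indicator {0<..<2 * g x} t)) \<partial>lborel)"
    proof (cases "0 < t")
      case True
      have "(\<integral>\<^sup>+x. ennreal (q * t powr (q - 1)) * indicator {0<..<?m x} t \<partial>lborel) =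
         (\<integral>\<^sup>+x. ennreal (q * t powr (q - 1)) * indicator {x. t < ?m x} x \<partial>lborel)"
        using True by (intro nn_integral_cong) (auto simp: indicator_def)
      also have "\<dots> = ennreal (q * t powr (q - 1)) * emeasure lborel {x. t < ?m x}"
        by (subst nn_integral_cmult_indicator) auto
      also have "\<dots> \<le> ennreal (q * t powr (q - 1)) * emeasure lborel {x. 2 * ennreal (t / 2) < max_fun R g x}"
      proof (intro mult_left_mono emeasure_mono)
        have "ennreal t < max_fun R g x" if "t < ?m x" for x
          using that True by (cases "max_fun R g x") (auto simp: ennreal_less_iff)
        then show "{x. t < ?m x} \<subseteq> {x. 2 * ennreal (t / 2) < max_fun R g x}"
          using True using ennreal_mult''[of "t / 2" 2] by auto
      qed (auto intro!: borel_open open_max_fun_superlevel)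
      also have "\<dots> = ennreal (2 * q * t powr (q - 2)) * (ennreal (t / 2) * emeasure lborel {x. 2 * ennreal (t / 2) < max_fun R g x})"
      proof -
        have "q * t powr (q - 1) = 2 * q * t powr (q - 2) * (t / 2)"
          using True by (simp add: powr_diff power2_eq_square field_simps powr_minus)
        then show ?thesis using True q by (simp only: ennreal_mult''[symmetric] mult.assoc[symmetric])
      qed
      also have "\<dots> \<le> ennreal (2 * q * t powr (q - 2)) * (5 ^ DIM('a) * (\<integral>\<^sup>+y\<in>{y. ennreal (t / 2) < g y}. g y \<partial>lborel))"
        by (intro mult_left_mono max_fun_weak_type_split) auto
      also have "\<dots> = (\<integral>\<^sup>+x. ennreal (2 * q * t powr (q - 2)) * (ennreal ?D * (ennreal (g x) * indicator {y. ennreal (t / 2) < g y} x)) \<partial>lborel)"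
        using ennreal_power[of 5 "DIM('a)"] by (simp add: nn_integral_cmult)
      also have "\<dots> = (\<integral>\<^sup>+x. ennreal (2 * ?D * q) * (ennreal (g x) * (ennreal (t powr (q - 2)) * indicator {0<..<2 * g x} t)) \<partial>lborel)"
      proof (intro nn_integral_cong)
        fix x :: 'a
        have *: "ennreal (t / 2) < ennreal (g x) \<longleftrightarrow> t < 2 * g x"
          using True by (auto simp: ennreal_less_iff)
        have "ennreal (2 * q * t powr (q - 2)) * (ennreal ?D * ennreal (g x)) =
            ennreal (2 * ?D * q) * (ennreal (g x) * ennreal (t powr (q - 2)))"
          using q g0[of x] by (simp only: ennreal_mult''[symmetric] powr_ge_zero zero_le_power zero_le_numeral mult_nonneg_nonneg) (simp add: mult_ac)
        then show "ennreal (2 * q * t powr (q - 2)) * (ennreal ?D * (ennreal (g x) * indicator {y. ennreal (t / 2) < g y} x)) =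
            ennreal (2 * ?D * q) * (ennreal (g x) * (ennreal (t powr (q - 2)) * indicator {0<..<2 * g x} t))"
          using True * by (cases "t < 2 * g x") (simp_all only: indicator_simps mem_Collect_eq greaterThanLessThan_iff mult_1_right mult_zero_right simp_thms)
      qed
      finally show ?thesis .
    qed (simp add: indicator_def)
  qed
  also have "\<dots> = (\<integral>\<^sup>+x. (\<integral>\<^sup>+t. ennreal (2 * ?D * q) * (ennreal (g x) * (ennreal (t powr (q - 2)) * indicator {0<..<2 * g x} t)) \<partial>lborel) \<partial>lborel)"
    by (rule lborel_pair.Fubini') measurable
  \<comment> \<open>The integral of \<open>t powr (q - 2)\<close> over \<open>{0<..<2 * g x}\<close>
    converges because \<open>q > 1\<close> and equals
    \<open>(2 * g x) powr (q - 1) / (q - 1)\<close>.\<close>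
  also have "\<dots> = (\<integral>\<^sup>+x. ennreal (?D * 2 powr q * q / (q - 1)) * ennreal (g x powr q) \<partial>lborel)"
  proof (rule nn_integral_cong)
    fix x :: 'a
    have "(\<integral>\<^sup>+t. ennreal (2 * ?D * q) * (ennreal (g x) * (ennreal (t powr (q - 2)) * indicator {0<..<2 * g x} t)) \<partial>lborel) =
      ennreal (2 * ?D * q) * (ennreal (g x) * ennreal ((2 * g x) powr (q - 2 + 1) / (q - 2 + 1)))"
      using q g0[of x]
      by (subst nn_integral_cmult, measurable, subst nn_integral_cmult, measurable, subst nn_integral_powr_from_0) auto
    also have "\<dots> = ennreal (2 * ?D * q * (g x * ((2 * g x) powr (q - 1) / (q - 1))))"
      using q g0[of x] by (simp add: ennreal_mult'[symmetric])
    also have "2 * ?D * q * (g x * ((2 * g x) powr (q - 1) / (q - 1))) = ?D * 2 powr q * q / (q - 1) * (g x powr q)"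
      using q g0[of x] by (cases "g x = 0") (auto simp: powr_mult powr_diff field_simps)
    finally show "(\<integral>\<^sup>+t. ennreal (2 * ?D * q) * (ennreal (g x) * (ennreal (t powr (q - 2)) * indicator {0<..<2 * g x} t)) \<partial>lborel) = ennreal (?D * 2 powr q * q / (q - 1)) * ennreal (g x powr q)"
      using q by (simp only: ennreal_mult''[OF powr_ge_zero])
  qed
  also have "\<dots> = ennreal (?D * 2 powr q * q / (q - 1)) * (\<integral>\<^sup>+x. ennreal (g x powr q) \<partial>lborel)"
    by (simp add: nn_integral_cmult)
  finally show ?thesis .
qed

section \<open>Test functions\<close>

lemma Ck_on_Suc_imp: "Ck_on (Suc k) S f \<Longrightarrow> Ck_on k S f"
proof (induction k arbitrary: f)
  case 0
  then show ?case by (simp add: differentiable_imp_continuous_on)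
next
  case (Suc k)
  then show ?case by simp
qed

lemma Ck_on_SucI:
  assumes "\<And>x. (f has_derivative f' x) (at x)" and "\<And>i. i \<in> Basis \<Longrightarrow> Ck_on k UNIV (\<lambda>x. f' x i)"
  shows "Ck_on (Suc k) UNIV f"
proof -
  have "frechet_derivative f (at x) = f' x" for x
    using frechet_derivative_at[OF assms(1)] by simp
  then show ?thesis
    using assms by (auto simp: differentiable_on_def differentiable_def)
qed

lemma Ck_on_const: "Ck_on k UNIV (\<lambda>x. c)"
proof (induction k arbitrary: c)
  case (Suc k)
  show ?case
    by (rule Ck_on_SucI[where f' = "\<lambda>x i. 0"]) (use Suc in \<open>auto intro!: derivative_eq_intros\<close>)
qed simp

lemma Ck_on_SucD:
  assumes "Ck_on (Suc k) UNIV f"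
  shows "(f has_derivative frechet_derivative f (at x)) (at x)"
    and "i \<in> Basis \<Longrightarrow> Ck_on k UNIV (\<lambda>x. frechet_derivative f (at x) i)"
  using assms by (auto simp: differentiable_on_def frechet_derivative_works)

lemma Ck_on_add: "Ck_on k UNIV f \<Longrightarrow> Ck_on k UNIV g \<Longrightarrow> Ck_on k UNIV (\<lambda>x. f x + g x)"
proof (induction k arbitrary: f g)
  case 0
  then show ?case by (auto intro: continuous_intros)
next
  case (Suc k)
  show ?case
    by (rule Ck_on_SucI[where f' = "\<lambda>x i. frechet_derivative f (at x) i + frechet_derivative g (at x) i"])
      (auto intro!: has_derivative_add Ck_on_SucD[OF Suc.prems(1)] Ck_on_SucD[OF Suc.prems(2)] Suc.IH simp del: Ck_on.simps)
qed

lemma Ck_on_mult: "Ck_on k UNIV f \<Longrightarrow> Ck_on k UNIV g \<Longrightarrow> Ck_on k UNIV (\<lambda>x. f x * g x)"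
proof (induction k arbitrary: f g)
  case 0
  then show ?case by (auto intro: continuous_intros)
next
  case (Suc k)
  note f = Ck_on_SucD[OF Suc.prems(1)] Ck_on_Suc_imp[OF Suc.prems(1)]
  note g = Ck_on_SucD[OF Suc.prems(2)] Ck_on_Suc_imp[OF Suc.prems(2)]
  show ?case
    by (rule Ck_on_SucI[where f' = "\<lambda>x i. f x * frechet_derivative g (at x) i + frechet_derivative f (at x) i * g x"])
      (auto intro!: has_derivative_mult f g Ck_on_add Suc.IH simp del: Ck_on.simps)
qed

lemma Ck_on_prod: "finite I \<Longrightarrow> (\<And>i. i \<in> I \<Longrightarrow> Ck_on k UNIV (f i)) \<Longrightarrow> Ck_on k UNIV (\<lambda>x. \<Prod>i\<in>I. f i x)"
  by (induction I rule: finite_induct) (auto intro: Ck_on_const Ck_on_mult)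

lemma Ck_on_translate: "Ck_on k UNIV f \<Longrightarrow> Ck_on k UNIV (\<lambda>x. f (x - w))"
proof (induction k arbitrary: f)
  case 0
  then show ?case by (auto intro!: continuous_on_compose2[of UNIV f] continuous_intros)
next
  case (Suc k)
  have "((\<lambda>x. x - w) has_derivative (\<lambda>i. i)) (at x)" for x
    by (auto intro!: derivative_eq_intros)
  from has_derivative_compose[OF this Ck_on_SucD(1)[OF Suc.prems]]
  have "((\<lambda>x. f (x - w)) has_derivative frechet_derivative f (at (x - w))) (at x)" for x
    by simp
  then show ?case
    by (rule Ck_on_SucI[where f' = "\<lambda>x. frechet_derivative f (at (x - w))"])
      (auto intro!: Suc.IH Ck_on_SucD(2)[OF Suc.prems])
qed

text \<open>The derivatives of \<open>t \<mapsto> exp (-1/t)\<close> are of the form \<open>P (1/t) * exp (-1/t)\<close> with a polynomial \<open>P\<close>.\<close>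

definition flat :: "real poly \<Rightarrow> real \<Rightarrow> real" where
  "flat P t = (if t \<le> 0 then 0 else poly P (inverse t) * exp (- inverse t))"

lemma flat_tendsto_0: "(flat P \<longlongrightarrow> 0) (at 0)"
proof -
  have "((\<lambda>x. \<Sum>i\<le>degree P. coeff P i * (x ^ i / exp x)) \<longlongrightarrow> (\<Sum>i\<le>degree P. coeff P i * 0)) at_top"
    by (intro tendsto_intros tendsto_power_div_exp_0)
  then have "((\<lambda>x. poly P x * exp (- x)) \<longlongrightarrow> 0) at_top"
    by (simp add: poly_altdef sum_divide_distrib exp_minus field_simps)
  then have "((\<lambda>t. poly P (inverse t) * exp (- inverse t)) \<longlongrightarrow> 0) (at_right 0)"
    by (rule filterlim_compose[OF _ filterlim_inverse_at_top_right])
  then have "(flat P \<longlongrightarrow> 0) (at_right 0)"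
    by (rule Lim_transform_eventually) (auto simp: eventually_at_filter flat_def)
  moreover have "(flat P \<longlongrightarrow> 0) (at_left 0)"
    by (rule Lim_transform_eventually[OF tendsto_const]) (auto simp: eventually_at_filter flat_def)
  ultimately show ?thesis by (simp add: filterlim_at_split)
qed

text \<open>The factor \<open>[:0, 0, 1:]\<close> is the \<open>1/t^2\<close> from differentiating
  \<open>1/t\<close>; the difference \<open>P - pderiv P\<close> collects the derivatives of the
  exponential and of the polynomial.\<close>

lemma flat_has_derivative:
  "(flat P has_real_derivative flat ([:0, 0, 1:] * (P - pderiv P)) t) (at t)"
proof -
  consider "t < 0" | "t = 0" | "0 < t" by linarith
  then show ?thesis
  proof cases
    case 1
    have "(flat P has_real_derivative 0) (at t)"
      by (rule has_field_derivative_transform_within_open[where f = "\<lambda>_. 0" and S = "{..<0}"])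
        (use 1 in \<open>auto simp: flat_def\<close>)
    then show ?thesis using 1 by (simp add: flat_def)
  next
    case 2
    \<comment> \<open>The difference quotient at 0 is again of the form \<open>flat\<close>, with
      the polynomial multiplied by the variable.\<close>
    have "((\<lambda>h. flat ([:0, 1:] * P) h) \<longlongrightarrow> 0) (at 0)"
      by (rule flat_tendsto_0)
    then have "((\<lambda>h. (flat P (0 + h) - flat P 0) / h) \<longlongrightarrow> 0) (at 0)"
      by (rule Lim_transform_eventually) (auto simp: eventually_at_filter flat_def field_simps)
    then show ?thesis using 2 by (simp add: DERIV_def flat_def)
  next
    case 3
    have "((\<lambda>t. poly P (inverse t) * exp (- inverse t)) has_real_derivative
       flat ([:0, 0, 1:] * (P - pderiv P)) t) (at t)"
      using 3 by (auto intro!: derivative_eq_intros poly_DERIV[THEN DERIV_chain2]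
          simp: flat_def power2_eq_square algebra_simps)
    then show ?thesis
      by (rule has_field_derivative_transform_within_open[where S = "{0<..}"])
        (use 3 in \<open>auto simp: flat_def\<close>)
  qed
qed

lemma Ck_on_flat: "Ck_on k UNIV (\<lambda>x. flat P (c * (x \<bullet> b) + d))"
proof (induction k arbitrary: P)
  case 0
  have "continuous_on UNIV (flat P)"
    by (rule DERIV_continuous_on) (rule flat_has_derivative)
  then show ?case
    by (auto intro!: continuous_on_compose2[of UNIV "flat P"] continuous_intros)
next
  case (Suc k)
  let ?Q = "[:0, 0, 1:] * (P - pderiv P)"
  show ?case
  proof (rule Ck_on_SucI[where f' = "\<lambda>x i. (c * (i \<bullet> b)) * flat ?Q (c * (x \<bullet> b) + d)"])
    show "((\<lambda>x. flat P (c * (x \<bullet> b) + d)) has_derivative (\<lambda>i. (c * (i \<bullet> b)) * flat ?Q (c * (x \<bullet> b) + d))) (at x)" for x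
    proof -
      have "((\<lambda>x. c * (x \<bullet> b) + d) has_derivative (\<lambda>i. c * (i \<bullet> b))) (at x)"
        by (auto intro!: derivative_eq_intros)
      from DERIV_compose_FDERIV[OF flat_has_derivative this] show ?thesis by simp
    qed
  qed (intro Ck_on_mult Ck_on_const Suc.IH)
qed

section \<open>Bumps on boxes and the fundamental lemma\<close>

text \<open>A product over the coordinates of values \<open>exp (-1/s)\<close>, where
  \<open>s\<close> is \<open>k\<close> times the distance to a face. As \<open>k\<close> grows it
  converges to the indicator of the open box.\<close>

definition box_bump :: "'a::euclidean_space \<Rightarrow> 'a \<Rightarrow> real \<Rightarrow> 'a \<Rightarrow> real" where
  "box_bump l u k x = (\<Prod>b\<in>Basis. flat 1 (k * (x \<bullet> b - l \<bullet> b)) * flat 1 (k * (u \<bullet> b - x \<bullet> b)))"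

lemma smooth_on_box_bump: "smooth_on UNIV (box_bump l u k)"
  unfolding smooth_on_def
proof
  fix m
  have "Ck_on m UNIV (\<lambda>x. \<Prod>b\<in>Basis. flat 1 (k * (x \<bullet> b) + (- (k * (l \<bullet> b)))) * flat 1 ((- k) * (x \<bullet> b) + k * (u \<bullet> b)))"
    by (intro Ck_on_prod Ck_on_mult Ck_on_flat) auto
  also have "(\<lambda>x. \<Prod>b\<in>Basis. flat 1 (k * (x \<bullet> b) + (- (k * (l \<bullet> b)))) * flat 1 ((- k) * (x \<bullet> b) + k * (u \<bullet> b))) = box_bump l u k"
    by (simp add: box_bump_def[abs_def] algebra_simps)
  finally show "Ck_on m UNIV (box_bump l u k)" .
qed

lemma flat_one_bounds: "0 \<le> flat 1 t" "flat 1 t \<le> 1"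
  by (auto simp: flat_def)

lemma box_bump_bounds: "0 \<le> box_bump l u k x" "box_bump l u k x \<le> 1"
  unfolding box_bump_def by (auto intro!: prod_nonneg prod_le_1 mult_le_one mult_nonneg_nonneg flat_one_bounds)

lemma box_bump_outside:
  assumes "0 < k" "x \<notin> box l u"
  shows "box_bump l u k x = 0"
proof -
  obtain b where "b \<in> Basis" "x \<bullet> b \<le> l \<bullet> b \<or> u \<bullet> b \<le> x \<bullet> b"
    using assms by (auto simp: mem_box not_less)
  then have "flat 1 (k * (x \<bullet> b - l \<bullet> b)) * flat 1 (k * (u \<bullet> b - x \<bullet> b)) = 0"
    using assms by (auto simp: flat_def mult_le_0_iff)
  then show ?thesis
    unfolding box_bump_def using \<open>b \<in> Basis\<close> by (auto simp: prod_zero_iff)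
qed

lemma test_function_box_bump:
  assumes "0 < k" "cbox l u \<subseteq> \<Omega>"
  shows "test_function \<Omega> (box_bump l u k)"
proof -
  have "{x. box_bump l u k x \<noteq> 0} \<subseteq> cbox l u"
    using box_bump_outside[OF assms(1)] box_subset_cbox by blast
  then have "closure {x. box_bump l u k x \<noteq> 0} \<subseteq> cbox l u"
    by (rule closure_minimal) (rule closed_cbox)
  then show ?thesis
    unfolding test_function_def
    using assms smooth_on_box_bump compact_Int_closed[OF compact_cbox closed_closure, of l u "{x. box_bump l u k x \<noteq> 0}"]
    by (auto simp: Int_absorb1 intro: subset_trans)
qed

lemma box_bump_tendsto: "(\<lambda>k. box_bump l u (real (Suc k)) x) \<longlonglongrightarrow> indicator (box l u) x"
proof (cases "x \<in> box l u")
  case True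
  have flat: "(\<lambda>k. flat 1 (real (Suc k) * c)) \<longlonglongrightarrow> 1" if "0 < c" for c
  proof -
    have "(\<lambda>k. exp (- inverse (real (Suc k) * c))) \<longlonglongrightarrow> 1"
      using that by real_asymp
    then show ?thesis using that by (simp add: flat_def mult_le_0_iff)
  qed
  have "(\<lambda>k. box_bump l u (real (Suc k)) x) \<longlonglongrightarrow> (\<Prod>b\<in>(Basis::'a set). 1 * 1)"
    unfolding box_bump_def using True
    by (intro tendsto_prod tendsto_mult flat) (auto simp: mem_box)
  then show ?thesis using True by simp
next
  case False
  then show ?thesis by (simp add: box_bump_outside)
qed

text \<open>Open boxes are stable under intersection and generate the Borel sets; the total integral
  takes care of complements.\<close>

lemma AE_eq_0_if_integral_box_0:
  fixes h :: "'a::euclidean_space \<Rightarrow> real"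
  assumes h: "integrable lborel h" and box: "\<And>l u. (LINT x:box l u|lborel. h x) = 0"
    and tot: "(LINT x|lborel. h x) = 0"
  shows "AE x in lborel. h x = 0"
proof (rule sigma_finite_measure.density_zero[OF sigma_finite_lborel h])
  fix A :: "'a set" assume "A \<in> sets lborel"
  then have A: "A \<in> sigma_sets UNIV (range (\<lambda>(a, b). box a b))"
    by (simp add: borel_eq_box)
  have hA: "integrable lborel (\<lambda>x. indicator B x *\<^sub>R h x)" if "B \<in> sets lborel" for B
    using that h by (rule integrable_mult_indicator)
  have stable: "Int_stable (range (\<lambda>(a, b). box a b :: 'a set))"
    by (auto simp: Int_stable_def box_Int_box)
  have sub: "range (\<lambda>(a, b). box a b :: 'a set) \<subseteq> Pow UNIV" by simp
  from stable sub A show "(LINT x:A|lborel. h x) = 0"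
  proof (induction rule: sigma_sets_induct_disjoint)
    case (basic A)
    then show ?case using box by auto
  next
    case empty
    show ?case by (simp add: set_lebesgue_integral_def)
  next
    case (compl A)
    then have [measurable]: "A \<in> sets lborel" by (simp add: borel_eq_box)
    have "(LINT x:UNIV - A|lborel. h x) = (LINT x|lborel. h x - indicator A x *\<^sub>R h x)"
      unfolding set_lebesgue_integral_def by (intro Bochner_Integration.integral_cong) (auto simp: indicator_def)
    also have "\<dots> = (LINT x|lborel. h x) - (LINT x:A|lborel. h x)"
      unfolding set_lebesgue_integral_def
      by (intro Bochner_Integration.integral_diff hA h) fact
    finally show ?case using compl tot by (simp add: set_lebesgue_integral_def)
  next
    case (union A)
    then have A: "A i \<in> sets lborel" for i by (auto simp: borel_eq_box)
    have "(LINT x:(\<Union>i. A i)|lborel. h x) = (\<Sum>i. (LINT x:A i|lborel. h x))"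
      using union(1) by (intro lebesgue_integral_countable_add)
        (auto simp: disjoint_family_on_def set_integrable_def A[simplified] intro!: hA simp del: real_scaleR_def)
    then show ?case using union by simp
  qed
qed

definition loc_int :: "'a::euclidean_space set \<Rightarrow> ('a \<Rightarrow> 'b::{banach, second_countable_topology}) \<Rightarrow> bool" where
  "loc_int \<Omega> f \<longleftrightarrow> f \<in> borel_measurable borel \<and> (\<forall>K. compact K \<and> K \<subseteq> \<Omega> \<longrightarrow> set_integrable lborel K f)"

text \<open>Box bumps converge boundedly to indicators of open boxes, so \<open>g\<close> has
  integral 0 over every open box whose closed box lies in \<Omega>. The closed boxes of a countable
  cover of \<Omega> are then treated one by one, \<open>g\<close> being integrable on each.\<close>

theorem fundamental_lemma:
  fixes g :: "'a::euclidean_space \<Rightarrow> real"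
  assumes \<Omega>: "open \<Omega>" and g: "loc_int \<Omega> g"
    and test: "\<And>\<psi>. test_function \<Omega> \<psi> \<Longrightarrow> (LINT x|lborel. g x * \<psi> x) = 0"
  shows "AE x in lborel. x \<in> \<Omega> \<longrightarrow> g x = 0"
proof -
  have [measurable]: "g \<in> borel_measurable borel" using g by (simp add: loc_int_def)
  have zero: "(LINT x:box l u|lborel. g x) = 0" if sub: "cbox l u \<subseteq> \<Omega>" for l u
  proof -
    have int: "set_integrable lborel (cbox l u) g"
      using g sub by (auto simp: loc_int_def)
    have "(\<lambda>k. LINT x|lborel. g x * box_bump l u (real (Suc k)) x) \<longlonglongrightarrow> (LINT x|lborel. g x * indicator (box l u) x)"
    proof (rule integral_dominated_convergence[where w = "\<lambda>x. norm (indicator (cbox l u) x *\<^sub>R g x)"])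
      show "integrable lborel (\<lambda>x. norm (indicator (cbox l u) x *\<^sub>R g x))"
        using int by (intro integrable_norm) (simp add: set_integrable_def)
      show "AE x in lborel. (\<lambda>k. g x * box_bump l u (real (Suc k)) x) \<longlonglongrightarrow> g x * indicator (box l u) x"
        by (intro AE_I2 tendsto_intros box_bump_tendsto)
      show "AE x in lborel. norm (g x * box_bump l u (real (Suc k)) x) \<le> norm (indicator (cbox l u) x *\<^sub>R g x)" for k
      proof (intro AE_I2)
        fix x
        show "norm (g x * box_bump l u (real (Suc k)) x) \<le> norm (indicator (cbox l u) x *\<^sub>R g x)"
        proof (cases "x \<in> cbox l u")
          case True
          then show ?thesis using box_bump_bounds[of l u "real (Suc k)" x]
            by (simp add: abs_mult mult_left_le)
        next
          case False
          then have "box_bump l u (real (Suc k)) x = 0"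
            using box_subset_cbox[of l u] by (intro box_bump_outside) auto
          then show ?thesis by simp
        qed
      qed
      have "continuous_on UNIV (box_bump l u (real (Suc k)))" for k
        using smooth_on_box_bump[of l u "real (Suc k)"] by (auto simp: smooth_on_def dest: spec[of _ 0])
      then have [measurable]: "box_bump l u (real (Suc k)) \<in> borel_measurable borel" for k
        by (rule borel_measurable_continuous_onI)
      show "(\<lambda>x. g x * box_bump l u (real (Suc k)) x) \<in> borel_measurable lborel" for k by measurable
    qed simp
    moreover have "(LINT x|lborel. g x * box_bump l u (real (Suc k)) x) = 0" for k
      by (rule test[OF test_function_box_bump[OF _ sub]]) simp
    ultimately have "(LINT x|lborel. g x * indicator (box l u) x) = 0"
      by (simp add: LIMSEQ_const_iff)
    then show ?thesis by (simp add: set_lebesgue_integral_def mult.commute)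
  qed
  obtain D where D: "countable D" "\<And>X. X \<in> D \<Longrightarrow> X \<subseteq> \<Omega> \<and> (\<exists>a b. X = cbox a b)" "\<Union>D = \<Omega>"
    by (rule open_countable_Union_open_cbox[OF \<Omega>]) (rule that, auto)
  have "AE x in lborel. x \<in> X \<longrightarrow> g x = 0" if X: "X \<in> D" for X
  proof -
    obtain c d where X': "X = cbox c d" using D(2)[OF X] by auto
    have sub: "cbox c d \<subseteq> \<Omega>" using D(2)[OF X] X' by simp
    let ?h = "\<lambda>x. indicator (box c d) x *\<^sub>R g x"
    have "set_integrable lborel (cbox c d) g"
      using g sub by (auto simp: loc_int_def)
    then have "set_integrable lborel (box c d) g"
      by (rule set_integrable_subset) (simp_all add: box_subset_cbox)
    then have int: "integrable lborel ?h" by (simp add: set_integrable_def)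
    have "AE x in lborel. ?h x = 0"
    proof (rule AE_eq_0_if_integral_box_0[OF int])
      show "(LINT x:box l u|lborel. ?h x) = 0" for l u
      proof -
        obtain l' u' where *: "box l u \<inter> box c d = box l' u'"
          using box_Int_box by blast
        show ?thesis
        proof (cases "box l' u' = {}")
          case True
          then have "indicator (box l u) x *\<^sub>R ?h x = 0" for x
            using * by (auto simp: indicator_def)
          then show ?thesis by (simp only: set_lebesgue_integral_def) simp
        next
          case False
          then have "cbox l' u' \<subseteq> cbox c d"
            using * closure_box[OF False] closure_mono[of "box l' u'" "cbox c d"] box_subset_cbox[of c d] by auto
          then have "(LINT x:box l' u'|lborel. g x) = 0" using sub by (intro zero) auto
          then show ?thesis
            by (simp add: set_lebesgue_integral_def *[symmetric] indicator_inter_arith mult.assoc)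
        qed
      qed
      show "(LINT x|lborel. ?h x) = 0"
        using zero[OF sub] by (simp add: set_lebesgue_integral_def)
    qed
    \<comment> \<open>The argument concerns the open box while the cover uses closed ones; the
      difference is null.\<close>
    moreover have "AE x in lborel. x \<notin> frontier (cbox c d)"
      by (intro AE_not_in) (use negligible_frontier_interval[of c d] in \<open>auto simp: negligible_iff_null_sets null_sets_completion_iff frontier_cbox\<close>)
    ultimately show ?thesis
      unfolding X' by eventually_elim (auto simp: frontier_cbox indicator_def split: if_splits)
  qed
  then have "AE x in lborel. \<forall>X\<in>D. x \<in> X \<longrightarrow> g x = 0"
    unfolding AE_ball_countable[OF D(1)] by blast
  then show ?thesis by eventually_elim (use D(3) in blast)
qed

section \<open>Weak gradients along segments\<close>

lemma distr_lborel_plus: "distr lborel borel (\<lambda>x. x + (a::'a::euclidean_space)) = lborel"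
  using lborel_affine[of 1 a] by (simp add: density_1 add.commute)

lemma nn_integral_lborel_plus:
  fixes f :: "'a::euclidean_space \<Rightarrow> ennreal"
  assumes [measurable]: "f \<in> borel_measurable borel"
  shows "(\<integral>\<^sup>+x. f (x + a) \<partial>lborel) = (\<integral>\<^sup>+x. f x \<partial>lborel)"
  by (subst distr_lborel_plus[symmetric, of a], subst nn_integral_distr) simp_all

lemma integral_lborel_plus:
  fixes f :: "'a::euclidean_space \<Rightarrow> 'b::{banach, second_countable_topology}"
  assumes [measurable]: "f \<in> borel_measurable borel"
  shows "(LINT x|lborel. f (x + a)) = (LINT x|lborel. f x)"
  by (subst distr_lborel_plus[symmetric, of a], subst integral_distr) simp_all

lemma integrable_lborel_plus:
  fixes f :: "'a::euclidean_space \<Rightarrow> 'b::{banach, second_countable_topology}"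
  assumes "f \<in> borel_measurable borel"
  shows "integrable lborel (\<lambda>x. f (x + a)) \<longleftrightarrow> integrable lborel f"
  using integrable_distr_eq[of "\<lambda>x. x + a" lborel borel f] assms by (simp add: distr_lborel_plus)

section \<open>Segments inside the domain\<close>

definition seg_dom :: "'a::euclidean_space set \<Rightarrow> 'a \<Rightarrow> 'a set" where
  "seg_dom \<Omega> v = {x. \<forall>t\<in>{0..1}. x + t *\<^sub>R v \<in> \<Omega>}"

definition seg_hull :: "'a::euclidean_space set \<Rightarrow> 'a \<Rightarrow> 'a set" where
  "seg_hull K v = (\<lambda>(x, t). x + t *\<^sub>R v) ` (K \<times> {0..1})"

lemma compact_seg_hull: "compact K \<Longrightarrow> compact (seg_hull K v)"
  unfolding seg_hull_def
  by (intro compact_continuous_image compact_Times) (auto intro!: continuous_intros simp: case_prod_beta')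

lemma seg_hull_subset: "K \<subseteq> seg_dom \<Omega> v \<Longrightarrow> seg_hull K v \<subseteq> \<Omega>"
  by (auto simp: seg_hull_def seg_dom_def)

text \<open>Openness in both variables jointly supplies the measurability needed later to exchange
  the almost-everywhere quantifiers in \<open>x\<close> and \<open>v\<close>. The segment is compact
  and so has an \<open>e\<close>-neighbourhood inside \<Omega>; changing base point and vector by
  less than \<open>e / 2\<close> each stays within it.\<close>

lemma open_seg_pairs:
  assumes "open \<Omega>"
  shows "open {(x, v). x \<in> seg_dom \<Omega> v}"
  unfolding open_dist
proof safe
  fix x v :: 'a assume "x \<in> seg_dom \<Omega> v"
  then have "seg_hull {x} v \<subseteq> \<Omega>" by (intro seg_hull_subset) auto
  then obtain e where e: "0 < e" "(\<Union>z\<in>seg_hull {x} v. ball z e) \<subseteq> \<Omega>"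
    using compact_subset_open_imp_ball_epsilon_subset[OF compact_seg_hull[of "{x}" v] assms] by auto
  show "\<exists>e>0. \<forall>p. dist p (x, v) < e \<longrightarrow> p \<in> {(x, v). x \<in> seg_dom \<Omega> v}"
  proof (intro exI[of _ "e / 2"] conjI allI impI)
    fix p assume p: "dist p (x, v) < e / 2"
    obtain y w where yw: "p = (y, w)" by (cases p)
    have d: "dist y x < e / 2" "dist w v < e / 2"
      using p dist_fst_le[of p "(x, v)"] dist_snd_le[of p "(x, v)"] by (auto simp: yw)
    have "y + t *\<^sub>R w \<in> \<Omega>" if t: "t \<in> {0..1}" for t
    proof -
      have "dist (x + t *\<^sub>R v) (y + t *\<^sub>R w) = norm ((x - y) + t *\<^sub>R (v - w))"
        by (simp add: dist_norm algebra_simps)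
      also have "\<dots> \<le> norm (x - y) + t * norm (v - w)"
        using t by (intro norm_triangle_le) auto
      also have "\<dots> \<le> norm (x - y) + 1 * norm (v - w)"
        using t by (intro add_left_mono mult_right_mono) auto
      also have "\<dots> < e" using d by (simp add: dist_norm norm_minus_commute)
      finally have "y + t *\<^sub>R w \<in> ball (x + t *\<^sub>R v) e" by simp
      moreover have "x + t *\<^sub>R v \<in> seg_hull {x} v" using t by (auto simp: seg_hull_def)
      ultimately show ?thesis using e(2) by blast
    qed
    then show "p \<in> {(x, v). x \<in> seg_dom \<Omega> v}" by (simp add: yw seg_dom_def)
  qed (use e in auto)
qed

lemma open_seg_dom: "open \<Omega> \<Longrightarrow> open (seg_dom \<Omega> v)"
  using open_vimage[OF open_seg_pairs, of \<Omega> "\<lambda>x. (x, v)"]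
  by (simp add: vimage_def continuous_on_Pair continuous_on_id continuous_on_const)

definition borel_weak_gradient :: "'a::euclidean_space set \<Rightarrow> ('a \<Rightarrow> real) \<Rightarrow> ('a \<Rightarrow> 'a) \<Rightarrow> bool" where
  "borel_weak_gradient \<Omega> u g \<longleftrightarrow> loc_int \<Omega> u \<and> loc_int \<Omega> g \<and>
     (\<forall>\<psi>. test_function \<Omega> \<psi> \<longrightarrow> (\<forall>i\<in>Basis.
        (LINT x|lborel. u x * frechet_derivative \<psi> (at x) i) = - (LINT x|lborel. (g x \<bullet> i) * \<psi> x)))"

lemma test_function_derivative:
  fixes \<psi> :: "'a::euclidean_space \<Rightarrow> real"
  assumes "test_function \<Omega> \<psi>"
  shows "(\<psi> has_derivative frechet_derivative \<psi> (at x)) (at x)"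
    and "i \<in> Basis \<Longrightarrow> continuous_on UNIV (\<lambda>x. frechet_derivative \<psi> (at x) i)"
    and "continuous_on UNIV \<psi>"
proof -
  have 1: "Ck_on (Suc 0) UNIV \<psi>" and 0: "Ck_on 0 UNIV \<psi>"
    using assms unfolding test_function_def smooth_on_def by blast+
  show "(\<psi> has_derivative frechet_derivative \<psi> (at x)) (at x)"
    using Ck_on_SucD(1)[OF 1] .
  show "continuous_on UNIV (\<lambda>x. frechet_derivative \<psi> (at x) i)" if "i \<in> Basis"
    using Ck_on_SucD(2)[OF 1 that] by simp
  show "continuous_on UNIV \<psi>" using 0 by simp
qed

lemma test_function_supp:
  fixes \<psi> :: "'a::euclidean_space \<Rightarrow> real"
  assumes "test_function \<Omega> \<psi>"
  obtains K where "compact K" "K \<subseteq> \<Omega>" "\<And>x. x \<notin> K \<Longrightarrow> \<psi> x = 0"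
    "\<And>x i. x \<notin> K \<Longrightarrow> frechet_derivative \<psi> (at x) i = 0"
proof -
  let ?K = "closure {x. \<psi> x \<noteq> 0}"
  have 0: "\<psi> x = 0" if "x \<notin> ?K" for x
    using that closure_subset[of "{x. \<psi> x \<noteq> 0}"] by auto
  have "frechet_derivative \<psi> (at x) i = 0" if x: "x \<notin> ?K" for x i
  proof -
    have "(\<psi> has_derivative (\<lambda>_. 0)) (at x)"
    proof (rule has_derivative_transform_within_open[where f = "\<lambda>_. 0" and s = "- ?K"])
      show "open (- ?K)" by (intro open_Compl closed_closure)
      show "x \<in> - ?K" using x by blast
      show "0 = \<psi> y" if "y \<in> - ?K" for y
        using 0[of y] that by (metis ComplD)
    qed (rule has_derivative_const)
    from frechet_derivative_at[OF this] show ?thesis by (simp add: fun_eq_iff)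
  qed
  moreover have "compact ?K" "?K \<subseteq> \<Omega>"
    using assms unfolding test_function_def by blast+
  ultimately show ?thesis using 0 that[of ?K] by blast
qed

lemma test_function_translate:
  fixes \<psi> :: "'a::euclidean_space \<Rightarrow> real"
  assumes \<psi>: "test_function \<Omega> \<psi>" and sub: "(\<lambda>x. x + w) ` \<Omega> \<subseteq> \<Omega>'"
  shows "test_function \<Omega>' (\<lambda>x. \<psi> (x - w))"
proof -
  have "{x. \<psi> (x - w) \<noteq> 0} = (\<lambda>x. w + x) ` {x. \<psi> x \<noteq> 0}"
    by (auto simp: image_iff) (metis add.commute diff_add_cancel)
  then have *: "closure {x. \<psi> (x - w) \<noteq> 0} = (\<lambda>x. w + x) ` closure {x. \<psi> x \<noteq> 0}"
    by (simp add: closure_translation)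
  show ?thesis
    unfolding test_function_def *
  proof (intro conjI)
    show "smooth_on UNIV (\<lambda>x. \<psi> (x - w))"
      using \<psi> by (simp add: test_function_def smooth_on_def Ck_on_translate)
    show "compact ((+) w ` closure {x. \<psi> x \<noteq> 0})"
      using \<psi> by (intro compact_translation) (simp add: test_function_def)
    have "(+) w ` closure {x. \<psi> x \<noteq> 0} \<subseteq> (\<lambda>x. x + w) ` \<Omega>"
      using \<psi> by (auto simp: test_function_def add.commute)
    then show "(+) w ` closure {x. \<psi> x \<noteq> 0} \<subseteq> \<Omega>'" using sub by blast
  qed
qed

lemma frechet_derivative_translate:
  fixes \<psi> :: "'a::euclidean_space \<Rightarrow> real"
  assumes "\<And>x. (\<psi> has_derivative frechet_derivative \<psi> (at x)) (at x)"
  shows "frechet_derivative (\<lambda>x. \<psi> (x - w)) (at x) = frechet_derivative \<psi> (at (x - w))"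
proof -
  have "((\<lambda>x. x - w) has_derivative (\<lambda>i. i)) (at x)"
    by (auto intro!: derivative_eq_intros)
  from frechet_derivative_at[OF has_derivative_compose[OF this assms]] show ?thesis by simp
qed

lemma frechet_derivative_sum_Basis:
  fixes \<psi> :: "'a::euclidean_space \<Rightarrow> real"
  assumes "(\<psi> has_derivative frechet_derivative \<psi> (at x)) (at x)"
  shows "frechet_derivative \<psi> (at x) v = (\<Sum>i\<in>Basis. (v \<bullet> i) * frechet_derivative \<psi> (at x) i)"
proof -
  have lin: "linear (frechet_derivative \<psi> (at x))"
    using assms by (intro linear_frechet_derivative) (auto simp: differentiable_def)
  show ?thesis
    using Linear_Algebra.linear_componentwise[OF lin, of v 1] by simp
qed

text \<open>The segments starting in \<open>K\<close> sweep out the compact set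
  \<open>seg_hull K v\<close> inside \<Omega>. For each \<open>t\<close>, translation invariance
  bounds the integral in \<open>x\<close> by the same integral of \<open>norm (g x)\<close> over the
  hull.\<close>

lemma integrable_seg:
  fixes g :: "'a::euclidean_space \<Rightarrow> 'a"
  assumes g: "loc_int \<Omega> g" and K: "compact K" "K \<subseteq> seg_dom \<Omega> v"
  shows "integrable (lborel \<Otimes>\<^sub>M lborel) (\<lambda>(x, t). indicator K x * (indicator {0..1} t * (g (x + t *\<^sub>R v) \<bullet> v)))"
    (is "integrable _ ?f")
proof -
  have [measurable]: "g \<in> borel_measurable borel" using g by (simp add: loc_int_def)
  have [measurable]: "K \<in> sets borel" using K(1) by (simp add: borel_compact)
  let ?H = "seg_hull K v"
  have H: "compact ?H" "?H \<subseteq> \<Omega>" using compact_seg_hull[OF K(1)] seg_hull_subset[OF K(2)] .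
  then have [measurable]: "?H \<in> sets borel" by (simp add: borel_compact)
  have int: "integrable lborel (\<lambda>x. indicator ?H x *\<^sub>R g x)"
    using g H by (simp add: loc_int_def set_integrable_def)
  show ?thesis
  proof (rule integrableI_bounded)
    show "?f \<in> borel_measurable (lborel \<Otimes>\<^sub>M lborel)" by measurable
    have "(\<integral>\<^sup>+z. ennreal (norm (?f z)) \<partial>(lborel \<Otimes>\<^sub>M lborel)) =
       (\<integral>\<^sup>+t. (\<integral>\<^sup>+x. ennreal (norm (?f (x, t))) \<partial>lborel) \<partial>lborel)"
      by (subst lborel_pair.nn_integral_snd[symmetric]) auto
    also have "\<dots> \<le> (\<integral>\<^sup>+t. indicator {0..1::real} t * (\<integral>\<^sup>+x. ennreal (norm v * norm (indicator ?H (x + t *\<^sub>R v) *\<^sub>R g (x + t *\<^sub>R v))) \<partial>lborel) \<partial>lborel)"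
    proof (intro nn_integral_mono)
      fix t :: real
      show "(\<integral>\<^sup>+x. ennreal (norm (?f (x, t))) \<partial>lborel) \<le>
        indicator {0..1::real} t * (\<integral>\<^sup>+x. ennreal (norm v * norm (indicator ?H (x + t *\<^sub>R v) *\<^sub>R g (x + t *\<^sub>R v))) \<partial>lborel)"
      proof (cases "t \<in> {0..1}")
        case True
        then have "norm (?f (x, t)) \<le> norm v * norm (indicator ?H (x + t *\<^sub>R v) *\<^sub>R g (x + t *\<^sub>R v))" for x
          using Cauchy_Schwarz_ineq2[of "g (x + t *\<^sub>R v)" v]
          by (auto simp: indicator_def seg_hull_def mult.commute)
        then show ?thesis using True by (simp add: nn_integral_mono ennreal_leI)
      qed simp
    qed
    also have "\<dots> = (\<integral>\<^sup>+t. indicator {0..1::real} t * (\<integral>\<^sup>+x. ennreal (norm v * norm (indicator ?H x *\<^sub>R g x)) \<partial>lborel) \<partial>lborel)"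
      by (subst nn_integral_lborel_plus[of "\<lambda>x. ennreal (norm v * norm (indicator ?H x *\<^sub>R g x))"]) auto
    also have "\<dots> = (\<integral>\<^sup>+x. ennreal (norm v * norm (indicator ?H x *\<^sub>R g x)) \<partial>lborel)"
      by (subst nn_integral_multc) auto
    also have "\<dots> < \<infinity>"
      using integrable_norm[OF int, THEN integrable_mult_right, of "norm v"]
      unfolding integrable_iff_bounded by simp
    finally show "(\<integral>\<^sup>+z. ennreal (norm (?f z)) \<partial>(lborel \<Otimes>\<^sub>M lborel)) < \<infinity>" .
  qed
qed

lemma integrable_loc_int_mult:
  fixes f \<psi> :: "'a::euclidean_space \<Rightarrow> real"
  assumes f: "loc_int \<Omega> f" and K: "compact K" "K \<subseteq> \<Omega>" and \<psi>: "continuous_on UNIV \<psi>"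
    and supp: "\<And>x. x \<notin> K \<Longrightarrow> \<psi> x = 0"
  shows "integrable lborel (\<lambda>x. f x * \<psi> x)"
proof -
  have "bounded (\<psi> ` K)"
    by (intro compact_imp_bounded compact_continuous_image continuous_on_subset[OF \<psi>] K) auto
  then obtain B where B: "\<And>x. x \<in> K \<Longrightarrow> norm (\<psi> x) \<le> B" by (auto simp: bounded_iff)
  have [measurable]: "f \<in> borel_measurable borel" "\<psi> \<in> borel_measurable borel"
    using f \<psi> by (auto simp: loc_int_def intro: borel_measurable_continuous_onI)
  have "integrable lborel (\<lambda>x. indicator K x *\<^sub>R f x)"
    using f K by (simp add: loc_int_def set_integrable_def)
  then have "integrable lborel (\<lambda>x. B * (indicator K x *\<^sub>R f x))" by (rule integrable_mult_right)
  then show ?thesis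
  proof (rule Bochner_Integration.integrable_bound)
    show "AE x in lborel. norm (f x * \<psi> x) \<le> norm (B * (indicator K x *\<^sub>R f x))"
    proof (intro AE_I2)
      fix x show "norm (f x * \<psi> x) \<le> norm (B * (indicator K x *\<^sub>R f x))"
        using B[of x] supp[of x] by (cases "x \<in> K") (auto simp: abs_mult mult.commute intro!: mult_right_mono)
    qed
  qed simp
qed

lemma integrable_mult_indicator_Icc:
  fixes w :: "'a::euclidean_space \<Rightarrow> real"
  assumes w: "integrable lborel w"
  shows "integrable (lborel \<Otimes>\<^sub>M lborel) (\<lambda>(x, t). w x * indicator {0..1::real} t)"
proof (rule lborel_pair.Fubini_integrable)
  show "integrable lborel (\<lambda>x. LINT t|lborel. norm (case (x, t) of (x, t) \<Rightarrow> w x * indicator {0..1::real} t))"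
    using integrable_norm[OF w] by (simp add: abs_mult)
qed (use w in auto)

text \<open>Proved by duality. The difference of both sides is tested against \<psi> and the
  translation is moved onto \<psi>, for which the formula is the fundamental theorem of calculus.
  For every \<open>t\<close> the shifted test function is admissible in the definition of the weak
  gradient, and shifting back produces the segment integral of \<open>g\<close>.\<close>

theorem segment_formula:
  fixes u :: "'a::euclidean_space \<Rightarrow> real"
  assumes \<Omega>: "open \<Omega>" and ug: "borel_weak_gradient \<Omega> u g"
  shows "AE x in lborel. x \<in> seg_dom \<Omega> v \<longrightarrow>
    u (x + v) - u x = (LINT t|lborel. indicator {0..1} t * (g (x + t *\<^sub>R v) \<bullet> v))"
proof -
  have u: "loc_int \<Omega> u" and g: "loc_int \<Omega> g" using ug by (auto simp: borel_weak_gradient_def)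
  then have [measurable]: "u \<in> borel_measurable borel" "g \<in> borel_measurable borel"
    by (auto simp: loc_int_def)
  define I where "I x = (LINT t|lborel. indicator {0..1} t * (g (x + t *\<^sub>R v) \<bullet> v))" for x
  have [measurable]: "I \<in> borel_measurable borel"
    unfolding I_def by measurable
  let ?\<Omega> = "seg_dom \<Omega> v"
  have sub: "?\<Omega> \<subseteq> \<Omega>"
    by (auto simp: seg_dom_def dest: bspec[of _ _ 0])
  have subv: "x + t *\<^sub>R v \<in> \<Omega>" if "x \<in> ?\<Omega>" "t \<in> {0..1}" for x t
    using that by (simp add: seg_dom_def)
  have luv: "loc_int ?\<Omega> (\<lambda>x. u (x + v))"
    unfolding loc_int_def
  proof (intro conjI allI impI)
    fix K assume "compact K \<and> K \<subseteq> ?\<Omega>"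
    then have K: "compact K" "K \<subseteq> ?\<Omega>" by auto
    have [measurable]: "K \<in> sets borel" using K(1) by (simp add: borel_compact)
    have "(+) v ` K \<subseteq> \<Omega>"
      using K(2) subv[of _ 1] by (auto simp: add.commute)
    then have "set_integrable lborel ((+) v ` K) u"
      using u K(1) by (simp add: loc_int_def compact_translation)
    moreover have "indicator ((+) v ` K) x = (indicator K (x - v) :: real)" for x
      by (auto simp: indicator_def image_iff) (metis add.commute diff_add_cancel)
    ultimately have "integrable lborel (\<lambda>x. indicator K (x - v) *\<^sub>R u x)"
      by (simp add: set_integrable_def)
    then have "integrable lborel (\<lambda>x. indicator K (x + v - v) *\<^sub>R u (x + v))"
      by (subst integrable_lborel_plus[of "\<lambda>x. indicator K (x - v) *\<^sub>R u x"]) auto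
    then show "set_integrable lborel K (\<lambda>x. u (x + v))" by (simp add: set_integrable_def)
  qed simp
  have lu: "loc_int ?\<Omega> u"
    using u sub by (auto simp: loc_int_def)
  have lI: "loc_int ?\<Omega> I"
    unfolding loc_int_def
  proof (intro conjI allI impI)
    fix K assume "compact K \<and> K \<subseteq> ?\<Omega>"
    then have K: "compact K" "K \<subseteq> ?\<Omega>" by auto
    from lborel_pair.integrable_fst'[OF integrable_seg[OF g K]]
    show "set_integrable lborel K I" by (simp add: set_integrable_def I_def)
  qed simp
  have "AE x in lborel. x \<in> ?\<Omega> \<longrightarrow> u (x + v) - u x - I x = 0"
  proof (rule fundamental_lemma[OF open_seg_dom[OF \<Omega>]])
    show "loc_int ?\<Omega> (\<lambda>x. u (x + v) - u x - I x)"
      using luv lu lI unfolding loc_int_def by (auto intro!: set_integral_diff)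
  next
    fix \<psi> assume \<psi>: "test_function ?\<Omega> \<psi>"
    obtain K where K: "compact K" "K \<subseteq> ?\<Omega>" and K0: "\<And>x. x \<notin> K \<Longrightarrow> \<psi> x = 0"
      "\<And>x i. x \<notin> K \<Longrightarrow> frechet_derivative \<psi> (at x) i = 0"
      using test_function_supp[OF \<psi>] by metis
    note \<psi>' = test_function_derivative[OF \<psi>]
    have [measurable]: "\<psi> \<in> borel_measurable borel" by (rule borel_measurable_continuous_onI[OF \<psi>'(3)])
    define D where "D x = frechet_derivative \<psi> (at x) v" for x
    have D: "D x = (\<Sum>i\<in>Basis. (v \<bullet> i) * frechet_derivative \<psi> (at x) i)" for x
      unfolding D_def by (rule frechet_derivative_sum_Basis[OF \<psi>'(1)])
    have Dc: "continuous_on UNIV D"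
      unfolding D by (intro continuous_intros \<psi>'(2))
    then have [measurable]: "D \<in> borel_measurable borel" by (rule borel_measurable_continuous_onI)
    have "bounded (D ` K)"
      by (intro compact_imp_bounded compact_continuous_image continuous_on_subset[OF Dc] K) auto
    then obtain C where C': "\<And>x. x \<in> K \<Longrightarrow> \<bar>D x\<bar> \<le> C" by (auto simp: bounded_iff)
    have C: "\<bar>D x\<bar> \<le> \<bar>C\<bar>" for x
      using C'[of x] K0(2)[of x v] by (cases "x \<in> K") (auto simp: D_def)
    note int = integrable_loc_int_mult[OF _ K \<psi>'(3) K0(1)]
    let ?H = "seg_hull K v"
    have H: "compact ?H" "?H \<subseteq> \<Omega>" using compact_seg_hull[OF K(1)] seg_hull_subset[OF K(2)] .
    then have [measurable]: "?H \<in> sets borel" by (simp add: borel_compact)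
    have inH: "x \<in> ?H" if "x - t *\<^sub>R v \<in> K" "t \<in> {0..1}" for x t
      using that unfolding seg_hull_def by (intro image_eqI[of _ _ "(x - t *\<^sub>R v, t)"]) auto
    have FTC: "\<psi> (x - v) - \<psi> x = (LINT t|lborel. - D (x - t *\<^sub>R v) * indicator {0..1} t)" for x
    proof -
      have "((\<lambda>t. \<psi> (x - t *\<^sub>R v)) has_real_derivative - D (x - t *\<^sub>R v)) (at t)" for t
      proof -
        have "((\<lambda>t. x - t *\<^sub>R v) has_derivative (\<lambda>s. - (s *\<^sub>R v))) (at t)"
          by (auto intro!: derivative_eq_intros)
        from has_derivative_compose[OF this \<psi>'(1)]
        have "((\<lambda>t. \<psi> (x - t *\<^sub>R v)) has_derivative (\<lambda>s. frechet_derivative \<psi> (at (x - t *\<^sub>R v)) (- (s *\<^sub>R v)))) (at t)" .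
        moreover have "frechet_derivative \<psi> (at (x - t *\<^sub>R v)) (- (s *\<^sub>R v)) = (- D (x - t *\<^sub>R v)) * s" for s
        proof -
          have "linear (frechet_derivative \<psi> (at (x - t *\<^sub>R v)))"
            using \<psi>'(1) by (intro linear_frechet_derivative) (auto simp: differentiable_def)
          from linear_cmul[OF this, of "- s" v] show ?thesis by (simp add: D_def)
        qed
        ultimately show ?thesis by (intro has_derivative_imp_has_field_derivative) (auto simp: mult.commute)
      qed
      moreover have "isCont (\<lambda>t. - D (x - t *\<^sub>R v)) t" for t
        using continuous_on_compose2[OF Dc, of UNIV "\<lambda>t. x - t *\<^sub>R v"]
        by (auto intro!: continuous_intros simp: continuous_on_eq_continuous_at)
      ultimately show ?thesis
        using integral_FTC_Icc_real[of 0 1 "\<lambda>t. \<psi> (x - t *\<^sub>R v)" "\<lambda>t. - D (x - t *\<^sub>R v)"] by simp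
    qed
    \<comment> \<open>Domination for Fubini: where \<open>D (x - t *\<^sub>R v)\<close> does not
      vanish and \<open>t\<close> lies in the unit interval, \<open>x\<close> belongs to the
      hull.\<close>
    have "integrable lborel (\<lambda>x. indicator ?H x *\<^sub>R u x)"
      using u H by (simp add: loc_int_def set_integrable_def)
    then have "integrable lborel (\<lambda>x. C * (indicator ?H x *\<^sub>R u x))" by (rule integrable_mult_right)
    then have "integrable (lborel \<Otimes>\<^sub>M lborel) (\<lambda>(x, t). (C * (indicator ?H x *\<^sub>R u x)) * indicator {0..1::real} t)"
      by (rule integrable_mult_indicator_Icc)
    then have int2: "integrable (lborel \<Otimes>\<^sub>M lborel) (\<lambda>(x, t). u x * (- D (x - t *\<^sub>R v) * indicator {0..1::real} t))"
    proof (rule Bochner_Integration.integrable_bound)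
      show "(\<lambda>(x, t). u x * (- D (x - t *\<^sub>R v) * indicator {0..1} t)) \<in> borel_measurable (lborel \<Otimes>\<^sub>M lborel)"
        by measurable
      have "\<bar>u x * (- D (x - t *\<^sub>R v) * indicator {0..1::real} t)\<bar> \<le> \<bar>(C * (indicator ?H x *\<^sub>R u x)) * indicator {0..1::real} t\<bar>" for x t
      proof (cases "x - t *\<^sub>R v \<in> K \<and> t \<in> {0..1}")
        case True
        then have "x \<in> ?H" "t \<in> {0..1}" using inH by auto
        then show ?thesis
          using mult_left_mono[OF C[of "x - t *\<^sub>R v"], of "\<bar>u x\<bar>"] by (simp add: abs_mult mult.commute)
      next
        case False
        then show ?thesis
          using K0(2)[of "x - t *\<^sub>R v" v] by (auto simp: D_def indicator_def)
      qed
      then show "AE p in lborel \<Otimes>\<^sub>M lborel. norm (case p of (x, t) \<Rightarrow> u x * (- D (x - t *\<^sub>R v) * indicator {0..1} t)) \<le>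
          norm (case p of (x, t) \<Rightarrow> C * (indicator ?H x *\<^sub>R u x) * indicator {0..1::real} t)"
        by (auto simp: case_prod_beta')
    qed
    have "(LINT x|lborel. u (x + v) * \<psi> x) - (LINT x|lborel. u x * \<psi> x) =
      (LINT x|lborel. u x * \<psi> (x - v)) - (LINT x|lborel. u x * \<psi> x)"
      using integral_lborel_plus[of "\<lambda>x. u x * \<psi> (x - v)" v] by simp
    also have "\<dots> = (LINT x|lborel. u x * \<psi> (x - v) - u x * \<psi> x)"
    proof (rule Bochner_Integration.integral_diff[symmetric])
      show "integrable lborel (\<lambda>x. u x * \<psi> (x - v))"
        using int[OF luv] integrable_lborel_plus[of "\<lambda>x. u x * \<psi> (x - v)" v] by simp
    qed (rule int[OF lu])
    also have "\<dots> = (LINT x|lborel. (LINT t|lborel. u x * (- D (x - t *\<^sub>R v) * indicator {0..1} t)))"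
      using FTC by (simp add: right_diff_distrib[symmetric])
    also have "\<dots> = (LINT t|lborel. (LINT x|lborel. u x * (- D (x - t *\<^sub>R v) * indicator {0..1} t)))"
      using lborel_pair.Fubini_integral[OF int2] by simp
    also have "\<dots> = (LINT t|lborel. (LINT x|lborel. \<psi> x * (indicator {0..1} t * (g (x + t *\<^sub>R v) \<bullet> v))))"
    proof (rule Bochner_Integration.integral_cong[OF refl])
      fix t :: real
      show "(LINT x|lborel. u x * (- D (x - t *\<^sub>R v) * indicator {0..1} t)) =
         (LINT x|lborel. \<psi> x * (indicator {0..1} t * (g (x + t *\<^sub>R v) \<bullet> v)))"
      proof (cases "t \<in> {0..1}")
        case True
        let ?\<psi> = "\<lambda>x. \<psi> (x - t *\<^sub>R v)"
        \<comment> \<open>The support is moved by \<open>t *\<^sub>R v\<close> and stays in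
          \<Omega>, because the support of \<psi> lies in \<open>seg_dom \<Omega> v\<close>.\<close>
        have \<psi>t: "test_function \<Omega> ?\<psi>"
          by (rule test_function_translate[OF \<psi>]) (use subv True in auto)
        have dt: "frechet_derivative ?\<psi> (at x) = frechet_derivative \<psi> (at (x - t *\<^sub>R v))" for x
          by (rule frechet_derivative_translate[OF \<psi>'(1)])
        note \<psi>t' = test_function_derivative[OF \<psi>t]
        obtain L where L: "compact L" "L \<subseteq> \<Omega>" "\<And>x. x \<notin> L \<Longrightarrow> ?\<psi> x = 0"
            "\<And>x i. x \<notin> L \<Longrightarrow> frechet_derivative ?\<psi> (at x) i = 0"
          using test_function_supp[OF \<psi>t] by metis
        have gi: "loc_int \<Omega> (\<lambda>x. g x \<bullet> i)" for i
          using g unfolding loc_int_def set_integrable_def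
          by (auto simp flip: inner_scaleR_left intro!: integrable_inner_left)
        have "(LINT x|lborel. u x * (- D (x - t *\<^sub>R v) * indicator {0..1} t)) =
            - (LINT x|lborel. (\<Sum>i\<in>Basis. (v \<bullet> i) * (u x * frechet_derivative ?\<psi> (at x) i)))"
          using True by (simp add: D dt sum_distrib_left mult_ac)
        also have "\<dots> = - (\<Sum>i\<in>Basis. (v \<bullet> i) * (LINT x|lborel. u x * frechet_derivative ?\<psi> (at x) i))"
          using integrable_loc_int_mult[OF u L(1,2) \<psi>t'(2) L(4)]
          by (subst Bochner_Integration.integral_sum) (auto intro!: integrable_mult_right)
        also have "\<dots> = (\<Sum>i\<in>Basis. (v \<bullet> i) * (LINT x|lborel. (g x \<bullet> i) * ?\<psi> x))"
          using ug \<psi>t by (simp add: borel_weak_gradient_def sum_negf)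
        also have "\<dots> = (LINT x|lborel. (\<Sum>i\<in>Basis. (v \<bullet> i) * ((g x \<bullet> i) * ?\<psi> x)))"
          using integrable_loc_int_mult[OF gi L(1,2) \<psi>t'(3) L(3)]
          by (subst Bochner_Integration.integral_sum) (auto intro!: integrable_mult_right)
        also have "\<dots> = (LINT x|lborel. (g x \<bullet> v) * ?\<psi> x)"
          by (intro Bochner_Integration.integral_cong)
            (auto simp: euclidean_inner[of _ v] sum_distrib_left mult_ac)
        also have "\<dots> = (LINT x|lborel. (g (x + t *\<^sub>R v) \<bullet> v) * \<psi> x)"
          using integral_lborel_plus[of "\<lambda>x. (g x \<bullet> v) * ?\<psi> x" "t *\<^sub>R v"] by simp
        finally show ?thesis using True by (simp add: mult.commute)
      qed simp
    qed
    also have "\<dots> = (LINT x|lborel. (LINT t|lborel. \<psi> x * (indicator {0..1} t * (g (x + t *\<^sub>R v) \<bullet> v))))"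
    proof -
      have "bounded (\<psi> ` K)"
        by (intro compact_imp_bounded compact_continuous_image continuous_on_subset[OF \<psi>'(3)] K) auto
      then obtain B where B: "\<And>x. x \<in> K \<Longrightarrow> norm (\<psi> x) \<le> B" by (auto simp: bounded_iff)
      have "integrable (lborel \<Otimes>\<^sub>M lborel) (\<lambda>p. B * (case p of (x, t) \<Rightarrow> indicator K x * (indicator {0..1} t * (g (x + t *\<^sub>R v) \<bullet> v))))"
        by (intro integrable_mult_right integrable_seg[OF g K])
      then have "integrable (lborel \<Otimes>\<^sub>M lborel) (\<lambda>(x, t). \<psi> x * (indicator {0..1} t * (g (x + t *\<^sub>R v) \<bullet> v)))"
      proof (rule Bochner_Integration.integrable_bound)
        have "\<bar>\<psi> x * w\<bar> \<le> \<bar>B * (indicator K x * w)\<bar>" for x w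
          using B[of x] K0(1)[of x] by (cases "x \<in> K") (auto simp: abs_mult intro!: mult_right_mono)
        then show "AE p in lborel \<Otimes>\<^sub>M lborel. norm (case p of (x, t) \<Rightarrow> \<psi> x * (indicator {0..1} t * (g (x + t *\<^sub>R v) \<bullet> v))) \<le>
          norm (B * (case p of (x, t) \<Rightarrow> indicator K x * (indicator {0..1} t * (g (x + t *\<^sub>R v) \<bullet> v))))"
          by (auto simp: case_prod_beta')
      qed measurable
      from lborel_pair.Fubini_integral[OF this] show ?thesis by simp
    qed
    also have "\<dots> = (LINT x|lborel. I x * \<psi> x)"
      by (simp add: I_def mult.commute)
    finally have "(LINT x|lborel. u (x + v) * \<psi> x) - (LINT x|lborel. u x * \<psi> x) = (LINT x|lborel. I x * \<psi> x)" .
    then show "(LINT x|lborel. (u (x + v) - u x - I x) * \<psi> x) = 0"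
      using int[OF luv] int[OF lu] int[OF lI] by (simp add: left_diff_distrib)
  qed
  then show ?thesis by eventually_elim (simp add: I_def)
qed

section \<open>Pointwise estimates by the maximal function\<close>

definition seg_avg :: "('a::euclidean_space \<Rightarrow> ennreal) \<Rightarrow> 'a \<Rightarrow> 'a \<Rightarrow> ennreal" where
  "seg_avg g x v = (\<integral>\<^sup>+t\<in>{0..1}. g (x + t *\<^sub>R v) \<partial>lborel)"

lemma borel_measurable_seg_avg [measurable]:
  assumes [measurable]: "g \<in> borel_measurable borel" "f \<in> borel_measurable M" "h \<in> borel_measurable M"
  shows "(\<lambda>z. seg_avg g (f z) (h z)) \<in> borel_measurable M"
proof -
  have "(\<lambda>p. seg_avg g (fst p) (snd p)) \<in> borel_measurable (borel \<Otimes>\<^sub>M borel)"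
    unfolding seg_avg_def by measurable
  from measurable_compose[OF measurable_Pair[OF assms(2,3)] this] show ?thesis by simp
qed

text \<open>\<open>g\<close> plays the role of \<open>\<bar>\<nabla>u\<bar>\<close>, extended by \<open>0\<close> outside \<open>\<Omega>\<close>.\<close>

definition upper_gradient :: "'a::euclidean_space set \<Rightarrow> ('a \<Rightarrow> real) \<Rightarrow> ('a \<Rightarrow> ennreal) \<Rightarrow> bool" where
  "upper_gradient \<Omega> u g \<longleftrightarrow> u \<in> borel_measurable borel \<and> g \<in> borel_measurable borel \<and>
     (\<forall>x. x \<notin> \<Omega> \<longrightarrow> g x = 0) \<and> (\<integral>\<^sup>+x. g x \<partial>lborel) < \<infinity> \<and>
     (AE x in lborel. AE y in lborel. x \<in> seg_dom \<Omega> (y - x) \<longrightarrow>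
        ennreal \<bar>u y - u x\<bar> \<le> ennreal (norm (y - x)) * seg_avg g x (y - x))"

lemma AE_lborel_minus:
  fixes P :: "'a::euclidean_space \<Rightarrow> bool"
  assumes [measurable]: "Measurable.pred borel P" and "AE v in lborel. P v"
  shows "AE y in lborel. P (y - x)"
proof -
  have "AE v in distr lborel borel (\<lambda>y. y + (- x)). P v"
    using assms(2) by (simp only: distr_lborel_plus)
  then show ?thesis by (subst (asm) AE_distr_iff) auto
qed

text \<open>Segment estimates are available for each fixed \<open>v\<close> and almost all
  \<open>x\<close>. Fubini for null sets turns this into almost all \<open>v\<close> for almost all
  \<open>x\<close>, and then \<open>v\<close> is taken to be \<open>y - x\<close>.\<close>

lemma upper_gradientI:
  fixes u :: "'a::euclidean_space \<Rightarrow> real"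
  assumes \<Omega>: "open \<Omega>" and [measurable]: "u \<in> borel_measurable borel" "g \<in> borel_measurable borel"
    and "\<And>x. x \<notin> \<Omega> \<Longrightarrow> g x = 0" "(\<integral>\<^sup>+x. g x \<partial>lborel) < \<infinity>"
    and seg: "\<And>v. AE x in lborel. x \<in> seg_dom \<Omega> v \<longrightarrow> ennreal \<bar>u (x + v) - u x\<bar> \<le> ennreal (norm v) * seg_avg g x v"
  shows "upper_gradient \<Omega> u g"
proof -
  let ?P = "\<lambda>x v. x \<in> seg_dom \<Omega> v \<longrightarrow> ennreal \<bar>u (x + v) - u x\<bar> \<le> ennreal (norm v) * seg_avg g x v"
  have "{(x, v). x \<in> seg_dom \<Omega> v} \<in> sets (borel \<Otimes>\<^sub>M borel)"
    unfolding borel_prod by (rule borel_open[OF open_seg_pairs[OF \<Omega>]])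
  then have S: "Measurable.pred (borel \<Otimes>\<^sub>M borel) (\<lambda>p. fst p \<in> seg_dom \<Omega> (snd p))"
    by (simp add: pred_def case_prod_beta' space_pair_measure)
  have [measurable]: "Measurable.pred (borel \<Otimes>\<^sub>M borel) (\<lambda>p. ?P (fst p) (snd p))"
    by (intro pred_intros_logic S) measurable
  have "AE v in lborel. AE x in lborel. ?P x v" using seg by simp
  then have *: "AE x in lborel. AE v in lborel. ?P x v"
  proof (subst lborel_pair.AE_commute)
    show "{x \<in> space (lborel \<Otimes>\<^sub>M lborel). ?P (fst x) (snd x)} \<in> sets (lborel \<Otimes>\<^sub>M lborel)"
      by measurable
  qed
  have "AE x in lborel. AE y in lborel. ?P x (y - x)"
    using *
  proof eventually_elim
    case (elim x)
    have "Measurable.pred borel (\<lambda>v. ?P (fst (x, v)) (snd (x, v)))"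
      by measurable
    then have "Measurable.pred borel (?P x)" by simp
    from AE_lborel_minus[OF this elim] show ?case .
  qed
  then show ?thesis
    using assms by (simp add: upper_gradient_def)
qed

section \<open>Cone condition and local Lipschitz estimates\<close>

definition cone_condition :: "'a::euclidean_space set \<Rightarrow> 'a \<Rightarrow> real \<Rightarrow> 'a \<Rightarrow> real \<Rightarrow> bool" where
  "cone_condition \<Omega> z R \<nu> L \<longleftrightarrow> 0 < R \<and> norm \<nu> = 1 \<and> 0 \<le> L \<and>
     (\<forall>x\<in>\<Omega> \<inter> ball z R. \<forall>w. norm w < R \<and> L * norm (w - (w \<bullet> \<nu>) *\<^sub>R \<nu>) < w \<bullet> \<nu> \<longrightarrow> x + w \<in> \<Omega>)"

lemma nn_integral_lborel_affine:
  fixes f :: "'a::euclidean_space \<Rightarrow> ennreal"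
  assumes [measurable]: "f \<in> borel_measurable borel" and c: "0 < c"
  shows "ennreal (c ^ DIM('a)) * (\<integral>\<^sup>+x. f (a + c *\<^sub>R x) \<partial>lborel) = (\<integral>\<^sup>+x. f x \<partial>lborel)"
  using c by (subst (2) lborel_affine[of c a]) (auto simp: nn_integral_density nn_integral_distr nn_integral_cmult)

text \<open>The substitution \<open>w \<mapsto> x + t (w - x)\<close> turns the average over \<open>B\<close> into an average over a ball
  around \<open>x\<close> of radius proportional to \<open>t\<close>, which the maximal function bounds for every \<open>t\<close>.\<close>

lemma nn_integral_seg_avg_le:
  fixes g :: "'a::euclidean_space \<Rightarrow> ennreal"
  assumes [measurable]: "g \<in> borel_measurable borel"
    and B: "B \<subseteq> ball x s" "B \<in> sets borel" and s: "0 < s" "s \<le> R"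
  shows "(\<integral>\<^sup>+w\<in>B. seg_avg g x (w - x) \<partial>lborel) \<le> emeasure lborel (ball x s) * max_fun R g x"
proof -
  have [measurable]: "B \<in> sets borel" by fact
  have "(\<integral>\<^sup>+w\<in>B. seg_avg g x (w - x) \<partial>lborel) =
      (\<integral>\<^sup>+w. (\<integral>\<^sup>+t. g (x + t *\<^sub>R (w - x)) * indicator {0..1} t * indicator B w \<partial>lborel) \<partial>lborel)"
    unfolding seg_avg_def by (intro nn_integral_cong) (simp add: nn_integral_multc)
  also have "\<dots> = (\<integral>\<^sup>+t. (\<integral>\<^sup>+w. g (x + t *\<^sub>R (w - x)) * indicator {0..1} t * indicator B w \<partial>lborel) \<partial>lborel)"
    by (rule lborel_pair.Fubini') measurable
  also have "\<dots> \<le> (\<integral>\<^sup>+t. (emeasure lborel (ball x s) * max_fun R g x) * indicator {0..1::real} t \<partial>lborel)"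
  proof (rule nn_integral_mono_AE)
    \<comment> \<open>The substitution needs \<open>t > 0\<close>; both sides then carry the factor
      \<open>t ^ DIM('a)\<close>, which cancels.\<close>
    have "AE t in lborel. t \<noteq> (0::real)" by (rule AE_lborel_singleton)
    then show "AE t in lborel. (\<integral>\<^sup>+w. g (x + t *\<^sub>R (w - x)) * indicator {0..1} t * indicator B w \<partial>lborel) \<le>
        (emeasure lborel (ball x s) * max_fun R g x) * indicator {0..1::real} t"
    proof eventually_elim
      case (elim t)
      show ?case
      proof (cases "t \<in> {0..1}")
        case True
        then have t: "0 < t" "t \<le> 1" using elim by auto
        let ?f = "\<lambda>y. g y * indicator (ball x (t * s)) y"
        have [measurable]: "ball x (t * s) \<in> sets borel" by simp
        have [measurable]: "?f \<in> borel_measurable borel" by measurable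
        have "t *\<^sub>R (w - x) + x \<in> ball x (t * s)" if "w \<in> B" for w
          using that t B(1) by (auto simp: dist_norm norm_minus_commute)
        then have le: "g (x + t *\<^sub>R (w - x)) * indicator B w \<le> ?f ((x - t *\<^sub>R x) + t *\<^sub>R w)" for w
          by (auto simp: indicator_def algebra_simps)
        have "ennreal (t ^ DIM('a)) * (\<integral>\<^sup>+w. g (x + t *\<^sub>R (w - x)) * indicator B w \<partial>lborel) \<le>
            ennreal (t ^ DIM('a)) * (\<integral>\<^sup>+w. ?f ((x - t *\<^sub>R x) + t *\<^sub>R w) \<partial>lborel)"
          by (intro mult_left_mono nn_integral_mono le) auto
        also have "\<dots> = (\<integral>\<^sup>+y. ?f y \<partial>lborel)"
          by (rule nn_integral_lborel_affine) (use t in auto)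
        also have "\<dots> \<le> emeasure lborel (ball x (t * s)) * max_fun R g x"
        proof (rule nn_integral_ball_le_max_fun)
          have "t * s \<le> 1 * s" using t s by (intro mult_right_mono) auto
          then show "t * s \<le> R" using s by linarith
        qed (use t s in auto)
        also have "emeasure lborel (ball x (t * s)) = ennreal (t ^ DIM('a)) * emeasure lborel (ball x s)"
          using t s by (simp add: emeasure_ball power_mult_distrib ennreal_mult''[symmetric] mult_ac)
        finally have "ennreal (t ^ DIM('a)) * (\<integral>\<^sup>+w. g (x + t *\<^sub>R (w - x)) * indicator B w \<partial>lborel) \<le>
          ennreal (t ^ DIM('a)) * (emeasure lborel (ball x s) * max_fun R g x)" by (simp add: mult.assoc)
        moreover have "ennreal (t ^ DIM('a)) \<noteq> 0" "ennreal (t ^ DIM('a)) \<noteq> top" using t by auto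
        ultimately have "(\<integral>\<^sup>+w. g (x + t *\<^sub>R (w - x)) * indicator B w \<partial>lborel) \<le> emeasure lborel (ball x s) * max_fun R g x"
          by (simp add: ennreal_mult_le_mult_iff)
        then show ?thesis using True by simp
      qed simp
    qed
  qed
  also have "\<dots> = emeasure lborel (ball x s) * max_fun R g x"
    by (simp add: nn_integral_cmult)
  finally show ?thesis .
qed

text \<open>Here \<open>w\<close> lies within \<open>2 * r\<close> of the point at height
  \<open>(2 * L + 3) * r\<close> above \<open>p\<close> in direction \<nu>. Its height exceeds
  \<open>(2 * L + 1) * r\<close> while its lateral offset is at most \<open>2 * r\<close>, so the
  cone inequality of slope \<open>L\<close> holds for it, and by homogeneity along the segment. The
  radius \<open>2 * r\<close> instead of \<open>r\<close> leaves room for a second apex at distance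
  \<open>r\<close>.\<close>

lemma seg_dom_cone:
  fixes \<nu> :: "'a::euclidean_space"
  assumes cone: "cone_condition \<Omega> z R \<nu> L" and p: "p \<in> \<Omega> \<inter> ball z R" and r: "0 < r" "(2 * L + 5) * r \<le> R"
    and w: "norm (w - p - ((2 * L + 3) * r) *\<^sub>R \<nu>) < 2 * r"
  shows "p \<in> seg_dom \<Omega> (w - p)" "norm (w - p) < (2 * L + 5) * r"
proof -
  have \<nu>: "norm \<nu> = 1" and L: "0 \<le> L" using cone by (auto simp: cone_condition_def)
  define K where "K = 2 * L + 3"
  define b where "b = w - p - (K * r) *\<^sub>R \<nu>"
  have b: "norm b < 2 * r" using w by (simp add: b_def K_def)
  have wp: "w - p = (K * r) *\<^sub>R \<nu> + b" by (simp add: b_def)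
  have "norm (w - p) \<le> norm ((K * r) *\<^sub>R \<nu>) + norm b"
    unfolding wp by (rule norm_triangle_ineq)
  also have "\<dots> < K * r + 2 * r" using b \<nu> L r by (simp add: K_def)
  finally show nwp: "norm (w - p) < (2 * L + 5) * r" by (simp add: K_def algebra_simps)
  have \<nu>\<nu>: "\<nu> \<bullet> \<nu> = 1" using \<nu> by (simp add: norm_eq_1)
  have dot: "(w - p) \<bullet> \<nu> = K * r + b \<bullet> \<nu>" by (simp add: wp inner_add_left \<nu>\<nu>)
  have "\<bar>b \<bullet> \<nu>\<bar> \<le> norm b" using Cauchy_Schwarz_ineq2[of b \<nu>] \<nu> by simp
  then have dot': "(2 * L + 1) * r < (w - p) \<bullet> \<nu>"
    unfolding dot using b by (simp add: K_def algebra_simps abs_le_iff)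
  have perp: "norm ((w - p) - ((w - p) \<bullet> \<nu>) *\<^sub>R \<nu>) \<le> 2 * r"
  proof -
    have eq: "(w - p) - ((w - p) \<bullet> \<nu>) *\<^sub>R \<nu> = b - (b \<bullet> \<nu>) *\<^sub>R \<nu>"
      by (simp only: dot) (simp add: wp algebra_simps)
    have "(norm (b - (b \<bullet> \<nu>) *\<^sub>R \<nu>))\<^sup>2 = (norm b)\<^sup>2 - (b \<bullet> \<nu>) * (b \<bullet> \<nu>)"
      by (simp add: power2_norm_eq_inner inner_diff_left inner_diff_right \<nu>\<nu> inner_commute)
    then have "(norm (b - (b \<bullet> \<nu>) *\<^sub>R \<nu>))\<^sup>2 \<le> (norm b)\<^sup>2" by simp
    then have "norm (b - (b \<bullet> \<nu>) *\<^sub>R \<nu>) \<le> norm b" by (rule power2_le_imp_le) simp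
    then show ?thesis using b eq by simp
  qed
  have "L * norm ((w - p) - ((w - p) \<bullet> \<nu>) *\<^sub>R \<nu>) \<le> L * (2 * r)"
    using perp L by (rule mult_left_mono)
  also have "\<dots> < (2 * L + 1) * r" using r by (simp add: algebra_simps)
  also note dot'
  finally have cn: "L * norm ((w - p) - ((w - p) \<bullet> \<nu>) *\<^sub>R \<nu>) < (w - p) \<bullet> \<nu>" .
  show "p \<in> seg_dom \<Omega> (w - p)"
    unfolding seg_dom_def
  proof safe
    fix t :: real assume t: "t \<in> {0..1}"
    show "p + t *\<^sub>R (w - p) \<in> \<Omega>"
    proof (cases "t = 0")
      case False
      then have t': "0 < t" "t \<le> 1" using t by auto
      let ?q = "t *\<^sub>R (w - p)"
      have "norm ?q \<le> 1 * norm (w - p)" using t' by (simp add: mult_left_le_one_le)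
      then have 1: "norm ?q < R" using nwp r by simp
      have "?q - (?q \<bullet> \<nu>) *\<^sub>R \<nu> = t *\<^sub>R ((w - p) - ((w - p) \<bullet> \<nu>) *\<^sub>R \<nu>)"
        by (simp add: scaleR_diff_right inner_diff_left algebra_simps)
      then have "L * norm (?q - (?q \<bullet> \<nu>) *\<^sub>R \<nu>) = t * (L * norm ((w - p) - ((w - p) \<bullet> \<nu>) *\<^sub>R \<nu>))"
        using t' by simp
      also have "\<dots> < t * ((w - p) \<bullet> \<nu>)" using cn t' by simp
      finally have 2: "L * norm (?q - (?q \<bullet> \<nu>) *\<^sub>R \<nu>) < ?q \<bullet> \<nu>" by simp
      show ?thesis using cone p 1 2 unfolding cone_condition_def by blast
    qed (use p in simp)
  qed
qed

text \<open>Chaining through an intermediate point loses the distance between the end points, so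
  bounds are glued without the distance factor of \<open>lip_bound\<close>; the factor is restored
  for pairs that are not close.\<close>

definition osc_bound :: "'a::euclidean_space set \<Rightarrow> real \<Rightarrow> 'a set \<Rightarrow> real \<Rightarrow> bool" where
  "osc_bound \<Omega> R U C \<longleftrightarrow> (\<forall>u g. upper_gradient \<Omega> u g \<longrightarrow>
     (AE x in lborel. x \<in> U \<longrightarrow> (AE y in lborel. y \<in> U \<longrightarrow>
        ennreal \<bar>u x - u y\<bar> \<le> ennreal C * (max_fun R g x + max_fun R g y))))"

definition lip_bound :: "'a::euclidean_space set \<Rightarrow> real \<Rightarrow> 'a set \<Rightarrow> real \<Rightarrow> bool" where
  "lip_bound \<Omega> R U C \<longleftrightarrow> (\<forall>u g. upper_gradient \<Omega> u g \<longrightarrow>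
     (AE x in lborel. x \<in> U \<longrightarrow> (AE y in lborel. y \<in> U \<longrightarrow>
        ennreal \<bar>u x - u y\<bar> \<le> ennreal (C * norm (x - y)) * (max_fun R g x + max_fun R g y))))"

text \<open>With \<open>r = norm (x - y)\<close>, a ball \<open>B\<close> of radius \<open>r\<close>
  at height \<open>(2 * L + 3) * r\<close> lies in the cones at both \<open>x\<close> and
  \<open>y\<close>, and \<open>\<bar>u w - u x\<bar> + \<bar>u w - u y\<bar>\<close> is averaged
  over \<open>w \<in> B\<close>. One factor \<open>2 * L + 5\<close> is the length of the segments
  relative to \<open>r\<close>, the other \<open>DIM('a)\<close> compare the volume of
  \<open>ball x ((2 * L + 5) * r)\<close> with that of \<open>B\<close>.\<close>

lemma lip_bound_cone:
  fixes \<Omega> :: "'a::euclidean_space set"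
  assumes cone: "cone_condition \<Omega> z R \<nu> L" and R: "R \<le> R'"
  shows "lip_bound \<Omega> R' (\<Omega> \<inter> ball z (R / (2 * (2 * L + 5)))) ((2 * L + 5) ^ Suc (DIM('a)))"
  unfolding lip_bound_def
proof (intro allI impI)
  fix u g assume ug: "upper_gradient \<Omega> u g"
  let ?M = "max_fun R' g" and ?K = "2 * L + 5" and ?\<rho> = "R / (2 * (2 * L + 5))"
  have \<nu>: "norm \<nu> = 1" and L: "0 \<le> L" and R0: "0 < R" using cone by (auto simp: cone_condition_def)
  have [measurable]: "u \<in> borel_measurable borel" "g \<in> borel_measurable borel"
    using ug by (auto simp: upper_gradient_def)
  have \<rho>R: "?\<rho> \<le> R" using L R0 by (simp add: divide_le_eq)
  let ?P = "\<lambda>x w. x \<in> seg_dom \<Omega> (w - x) \<longrightarrow> ennreal \<bar>u w - u x\<bar> \<le> ennreal (norm (w - x)) * seg_avg g x (w - x)"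
  have ae: "AE x in lborel. AE w in lborel. ?P x w"
    using ug by (simp add: upper_gradient_def)
  have main: "ennreal \<bar>u x - u y\<bar> \<le> ennreal (?K ^ Suc (DIM('a)) * norm (x - y)) * (?M x + ?M y)"
    if x: "x \<in> \<Omega> \<inter> ball z ?\<rho>" "AE w in lborel. ?P x w" and y: "y \<in> \<Omega> \<inter> ball z ?\<rho>" "AE w in lborel. ?P y w"
    for x y
  proof (cases "x = y")
    case False
    define r where "r = norm (x - y)"
    have r: "0 < r" using False by (simp add: r_def)
    have "dist x y < 2 * ?\<rho>"
      using x(1) y(1) dist_triangle2[of x y z] by (auto simp: dist_commute)
    then have rR: "?K * r \<le> R" using L by (simp add: r_def dist_norm field_simps)
    define B where "B = ball (x + ((2 * L + 3) * r) *\<^sub>R \<nu>) r"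
    have [measurable]: "B \<in> sets borel" by (simp add: B_def)
    have px: "p \<in> \<Omega> \<inter> ball z R" if "p \<in> \<Omega> \<inter> ball z ?\<rho>" for p using that \<rho>R by auto
    have wx: "norm (w - x - ((2 * L + 3) * r) *\<^sub>R \<nu>) < 2 * r" if "w \<in> B" for w
      using that r by (simp add: B_def dist_norm norm_minus_commute algebra_simps)
    have wy: "norm (w - y - ((2 * L + 3) * r) *\<^sub>R \<nu>) < 2 * r" if "w \<in> B" for w
    proof -
      have "norm (w - y - ((2 * L + 3) * r) *\<^sub>R \<nu>) = norm ((x - y) + (w - (x + ((2 * L + 3) * r) *\<^sub>R \<nu>)))"
        by (simp add: algebra_simps)
      also have "\<dots> \<le> norm (x - y) + norm (w - (x + ((2 * L + 3) * r) *\<^sub>R \<nu>))" by (rule norm_triangle_ineq)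
      also have "\<dots> < r + r" using that by (simp add: B_def dist_norm norm_minus_commute r_def)
      finally show ?thesis by simp
    qed
    note cx = seg_dom_cone[OF cone px[OF x(1)] r rR wx] and cy = seg_dom_cone[OF cone px[OF y(1)] r rR wy]
    have Bx: "B \<subseteq> ball x (?K * r)" and By: "B \<subseteq> ball y (?K * r)"
      using cx(2) cy(2) by (auto simp: dist_norm norm_minus_commute)
    have Kr: "0 < ?K * r" "?K * r \<le> R'" using r L rR R by auto
    have "AE w in lborel. ennreal \<bar>u x - u y\<bar> * indicator B w \<le>
        ennreal (?K * r) * (seg_avg g x (w - x) * indicator B w + seg_avg g y (w - y) * indicator B w)"
      using x(2) y(2)
    proof eventually_elim
      case (elim w)
      show ?case
      proof (cases "w \<in> B")
        case True
        have "\<bar>u x - u y\<bar> \<le> \<bar>u w - u x\<bar> + \<bar>u w - u y\<bar>" by simp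
        then have "ennreal \<bar>u x - u y\<bar> \<le> ennreal \<bar>u w - u x\<bar> + ennreal \<bar>u w - u y\<bar>"
          by (simp flip: ennreal_plus)
        also have "\<dots> \<le> ennreal (norm (w - x)) * seg_avg g x (w - x) + ennreal (norm (w - y)) * seg_avg g y (w - y)"
          using elim cx(1)[OF True] cy(1)[OF True] by (intro add_mono) auto
        also have "\<dots> \<le> ennreal (?K * r) * seg_avg g x (w - x) + ennreal (?K * r) * seg_avg g y (w - y)"
          using cx(2)[OF True] cy(2)[OF True] by (intro add_mono mult_right_mono ennreal_leI) auto
        finally show ?thesis using True by (simp add: distrib_left)
      qed simp
    qed
    then have "(\<integral>\<^sup>+w. ennreal \<bar>u x - u y\<bar> * indicator B w \<partial>lborel) \<le>
        (\<integral>\<^sup>+w. ennreal (?K * r) * (seg_avg g x (w - x) * indicator B w + seg_avg g y (w - y) * indicator B w) \<partial>lborel)"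
      by (rule nn_integral_mono_AE)
    also have "\<dots> = ennreal (?K * r) * ((\<integral>\<^sup>+w\<in>B. seg_avg g x (w - x) \<partial>lborel) + (\<integral>\<^sup>+w\<in>B. seg_avg g y (w - y) \<partial>lborel))"
      by (simp add: nn_integral_cmult nn_integral_add)
    also have "\<dots> \<le> ennreal (?K * r) * (emeasure lborel (ball x (?K * r)) * ?M x + emeasure lborel (ball y (?K * r)) * ?M y)"
      using Bx By Kr by (intro mult_left_mono add_mono nn_integral_seg_avg_le) auto
    also have "\<dots> = ennreal (?K * r) * (emeasure lborel (ball x (?K * r)) * (?M x + ?M y))"
      using r L by (simp add: emeasure_ball distrib_left)
    also have "emeasure lborel (ball x (?K * r)) = ennreal (?K ^ DIM('a)) * emeasure lborel B"
      using r L unfolding B_def by (simp add: emeasure_ball power_mult_distrib ennreal_mult''[symmetric] mult_ac)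
    also have "(\<integral>\<^sup>+w. ennreal \<bar>u x - u y\<bar> * indicator B w \<partial>lborel) = ennreal \<bar>u x - u y\<bar> * emeasure lborel B"
      by (rule nn_integral_cmult_indicator) simp
    finally have "ennreal \<bar>u x - u y\<bar> * emeasure lborel B \<le>
      (ennreal (?K * r) * (ennreal (?K ^ DIM('a)) * (?M x + ?M y))) * emeasure lborel B"
      by (simp add: mult_ac)
    moreover have "emeasure lborel B \<noteq> 0" "emeasure lborel B \<noteq> top"
      using emeasure_ball_pos[OF r] emeasure_ball_finite unfolding B_def by auto
    ultimately have "ennreal \<bar>u x - u y\<bar> \<le> ennreal (?K * r) * (ennreal (?K ^ DIM('a)) * (?M x + ?M y))"
      by (simp add: ennreal_mult_le_mult_iff mult.commute[of _ "emeasure lborel B"])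
    also have "\<dots> = ennreal (?K * r * ?K ^ DIM('a)) * (?M x + ?M y)"
      using L by (subst ennreal_mult'') (auto simp: mult.assoc)
    also have "?K * r * ?K ^ DIM('a) = ?K ^ Suc (DIM('a)) * norm (x - y)"
      by (simp add: r_def)
    finally show ?thesis .
  qed simp
  show "AE x in lborel. x \<in> \<Omega> \<inter> ball z ?\<rho> \<longrightarrow> (AE y in lborel. y \<in> \<Omega> \<inter> ball z ?\<rho> \<longrightarrow>
        ennreal \<bar>u x - u y\<bar> \<le> ennreal (?K ^ Suc (DIM('a)) * norm (x - y)) * (?M x + ?M y))"
    using ae
  proof eventually_elim
    case (elim x)
    note x = elim
    show ?case
    proof
      assume xU: "x \<in> \<Omega> \<inter> ball z ?\<rho>"
      show "AE y in lborel. y \<in> \<Omega> \<inter> ball z ?\<rho> \<longrightarrow>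
          ennreal \<bar>u x - u y\<bar> \<le> ennreal (?K ^ Suc (DIM('a)) * norm (x - y)) * (?M x + ?M y)"
        using ae
      proof eventually_elim
        case (elim y)
        show ?case
        proof
          assume "y \<in> \<Omega> \<inter> ball z ?\<rho>"
          from main[OF xU x this elim] show "ennreal \<bar>u x - u y\<bar> \<le> ennreal (?K ^ Suc (DIM('a)) * norm (x - y)) * (?M x + ?M y)" .
        qed
      qed
    qed
  qed
qed

section \<open>Gluing oscillation bounds\<close>

text \<open>If the maximal function exceeded \<open>c\<close> times the integral almost everywhere
  on \<open>W\<close>, the weak type inequality would bound \<open>c\<close> times the volume of
  \<open>W\<close> by \<open>5 ^ DIM('a)\<close>. The predicate \<open>P\<close> allows the point to
  be taken outside a null set.\<close>

lemma max_fun_small_on_set: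
  fixes g :: "'a::euclidean_space \<Rightarrow> ennreal"
  assumes [measurable]: "g \<in> borel_measurable borel" and fin: "(\<integral>\<^sup>+x. g x \<partial>lborel) < \<infinity>"
    and W: "W \<in> sets borel" and P: "AE w in lborel. P w"
    and c: "0 < emeasure lborel W" "5 ^ DIM('a) < ennreal c * emeasure lborel W"
  obtains w where "w \<in> W" "P w" "max_fun R g w \<le> ennreal c * (\<integral>\<^sup>+x. g x \<partial>lborel)"
proof -
  let ?I = "\<integral>\<^sup>+x. g x \<partial>lborel" and ?M = "max_fun R g"
  have "\<exists>w. w \<in> W \<and> P w \<and> ?M w \<le> ennreal c * ?I"
  proof (rule ccontr)
    assume "\<not> ?thesis"
    then have no: "\<And>w. w \<in> W \<Longrightarrow> P w \<Longrightarrow> ennreal c * ?I < ?M w" by (auto simp: not_le)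
    \<comment> \<open>A vanishing integral cannot be cancelled in the weak type bound, but then the
      maximal function vanishes identically.\<close>
    show False
    proof (cases "?I = 0")
      case True
      have "?M w = 0" for w
      proof -
        have "(\<integral>\<^sup>+y\<in>ball a r. g y \<partial>lborel) \<le> ?I" for a r
          by (intro nn_integral_mono) (auto simp: indicator_def)
        then have "(\<integral>\<^sup>+y\<in>ball a r. g y \<partial>lborel) = 0" for a r using True by simp
        then show ?thesis unfolding max_fun_def by (auto simp: SUP_eq_iff bot_ennreal intro!: antisym SUP_least)
      qed
      then have "AE w in lborel. w \<notin> W" using P no by (auto elim!: eventually_mono)
      then have "emeasure lborel W = 0" using W by (simp add: AE_iff_measurable[of W])
      then show False using c by simp
    next
      case False
      have "W \<in> sets lborel" "{x. ennreal c * ?I < ?M x} \<in> sets lborel" using W by measurable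
      then have "emeasure lborel W \<le> emeasure lborel {x. ennreal c * ?I < ?M x}"
        using P no by (intro emeasure_mono_AE) (auto elim!: eventually_mono)
      then have "(ennreal c * ?I) * emeasure lborel W \<le> (ennreal c * ?I) * emeasure lborel {x. ennreal c * ?I < ?M x}"
        by (rule mult_left_mono) simp
      also have "\<dots> \<le> 5 ^ DIM('a) * ?I" by (rule max_fun_weak_type) simp
      finally have "?I * (ennreal c * emeasure lborel W) \<le> ?I * 5 ^ DIM('a)" by (simp add: mult_ac)
      then have "ennreal c * emeasure lborel W \<le> 5 ^ DIM('a)"
        using False fin by (simp add: ennreal_mult_le_mult_iff)
      then show False using c by simp
    qed
  qed
  then show ?thesis using that by blast
qed

lemma emeasure_open_pos:
  fixes W :: "'a::euclidean_space set"
  assumes "open W" "W \<noteq> {}"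
  shows "0 < emeasure lborel W"
proof (rule ccontr)
  assume "\<not> ?thesis"
  then have "W \<in> null_sets lborel"
    using assms by (auto simp: null_sets_def not_less)
  then have "negligible W" by (simp add: negligible_iff_null_sets null_sets_completionI)
  then show False using open_not_negligible assms by blast
qed

text \<open>A point of \<open>U\<close> and one of \<open>V\<close> are joined through a point
  \<open>w\<close> of the overlap where the maximal function is at most a multiple of the integral
  of \<open>g\<close>. That integral is at most a multiple of the maximal function at an end point,
  since \<open>ball 0 R\<close> is one of the admissible balls.\<close>

lemma osc_bound_Un:
  fixes \<Omega> :: "'a::euclidean_space set"
  assumes UV: "osc_bound \<Omega> R U C1" "osc_bound \<Omega> R V C2" "0 \<le> C1" "0 \<le> C2"
    and sub: "U \<subseteq> \<Omega>" "V \<subseteq> \<Omega>" "\<Omega> \<subseteq> ball 0 R" and W: "open (U \<inter> V)" "U \<inter> V \<noteq> {}"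
  shows "\<exists>C\<ge>0. osc_bound \<Omega> R (U \<union> V) C"
proof -
  let ?W = "U \<inter> V"
  have "emeasure lborel ?W > 0"
    using W by (rule emeasure_open_pos)
  moreover have "emeasure lborel ?W \<le> emeasure lborel (ball (0::'a) R)"
    using sub W by (intro emeasure_mono) auto
  ultimately obtain m where m: "emeasure lborel ?W = ennreal m" "0 < m"
    using emeasure_ball_finite[of "0::'a" R] by (cases "emeasure lborel ?W") (auto simp: top_unique)
  \<comment> \<open>The numerator only has to exceed \<open>5 ^ DIM('a)\<close> strictly.\<close>
  define c where "c = 6 ^ DIM('a) / m"
  have c: "0 \<le> c" "5 ^ DIM('a) < ennreal c * emeasure lborel ?W"
  proof -
    have "(5::ennreal) ^ DIM('a) = ennreal (5 ^ DIM('a))" using ennreal_power[of 5 "DIM('a)"] by simp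
    also have "\<dots> < ennreal (6 ^ DIM('a))" by (intro ennreal_lessI) (auto intro!: power_strict_mono)
    also have "\<dots> = ennreal c * emeasure lborel ?W" using m by (simp add: c_def m(1) ennreal_mult''[symmetric])
    finally show "5 ^ DIM('a) < ennreal c * emeasure lborel ?W" .
  qed (use m in \<open>simp add: c_def\<close>)
  obtain b where b: "emeasure lborel (ball (0::'a) R) = ennreal b" "0 \<le> b"
    using emeasure_ball_finite[of "0::'a" R] by (cases "emeasure lborel (ball (0::'a) R)") auto
  define C where "C = C1 + C2 + (C1 + C2) * (c * b)"
  have C: "0 \<le> C" using UV b c by (simp add: C_def)
  have "osc_bound \<Omega> R (U \<union> V) C"
    unfolding osc_bound_def
  proof (intro allI impI)
    fix u g assume ug: "upper_gradient \<Omega> u g"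
    let ?M = "max_fun R g" and ?I = "\<integral>\<^sup>+x. g x \<partial>lborel"
    have [measurable]: "g \<in> borel_measurable borel" and fin: "?I < \<infinity>"
      using ug by (auto simp: upper_gradient_def)
    have IM: "?I \<le> ennreal b * ?M x" if "x \<in> \<Omega>" for x
    proof -
      have x: "x \<in> ball 0 R" using that sub by auto
      then have R: "0 < R" by (metis mem_ball_leI mem_ball zero_le_dist le_less_trans)
      have "?I = (\<integral>\<^sup>+y\<in>ball 0 R. g y \<partial>lborel)"
        using ug sub by (intro nn_integral_cong) (auto simp: upper_gradient_def indicator_def)
      also have "\<dots> \<le> emeasure lborel (ball (0::'a) R) * ?M x"
        using R x by (intro nn_integral_ball_le_max_fun) auto
      finally show ?thesis by (simp add: b)
    qed
    let ?P = "\<lambda>S D x y. y \<in> S \<longrightarrow> ennreal \<bar>u x - u y\<bar> \<le> ennreal D * (?M x + ?M y)"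
    have mono: "ennreal D * (?M x + ?M y) \<le> ennreal C * (?M x + ?M y)" if "D \<le> C1 + C2" for D x y
    proof (intro mult_right_mono ennreal_leI)
      have "0 \<le> (C1 + C2) * (c * b)" using UV b c by (intro mult_nonneg_nonneg) auto
      then show "D \<le> C" using that by (simp add: C_def)
    qed simp
    \<comment> \<open>\<open>D1\<close> and \<open>D2\<close> stand for \<open>C1\<close> and
      \<open>C2\<close> in either order, to cover both ways of distributing \<open>x\<close> and
      \<open>y\<close> over \<open>U\<close> and \<open>V\<close>.\<close>
    have cross: "ennreal \<bar>u x - u y\<bar> \<le> ennreal C * (?M x + ?M y)"
      if x: "x \<in> \<Omega>" "AE w in lborel. ?P ?W D1 x w" and y: "y \<in> \<Omega>" "AE w in lborel. ?P ?W D2 y w"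
        and D: "D1 + D2 = C1 + C2" "0 \<le> D1" "0 \<le> D2" for x y D1 D2
    proof -
      have "AE w in lborel. ?P ?W D1 x w \<and> ?P ?W D2 y w" using x(2) y(2) by (rule AE_conjI)
      then obtain w where w: "w \<in> ?W" "?P ?W D1 x w" "?P ?W D2 y w" and Mw: "?M w \<le> ennreal c * ?I"
        using max_fun_small_on_set[of g ?W "\<lambda>w. ?P ?W D1 x w \<and> ?P ?W D2 y w" c R] fin W c m by auto
      have "?M w \<le> ennreal c * (ennreal b * ?M x)"
        using Mw IM[OF x(1)] by (meson mult_left_mono order_trans zero_le)
      also have "\<dots> = ennreal (c * b) * ?M x" using b c by (simp add: ennreal_mult mult.assoc)
      finally have Mwx: "?M w \<le> ennreal (c * b) * ?M x" .
      have "\<bar>u x - u y\<bar> \<le> \<bar>u x - u w\<bar> + \<bar>u y - u w\<bar>" by simp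
      then have "ennreal \<bar>u x - u y\<bar> \<le> ennreal \<bar>u x - u w\<bar> + ennreal \<bar>u y - u w\<bar>"
        by (simp flip: ennreal_plus)
      also have "\<dots> \<le> ennreal D1 * (?M x + ?M w) + ennreal D2 * (?M y + ?M w)"
        using w by (intro add_mono) auto
      also have "\<dots> = (ennreal D1 * ?M x + ennreal D2 * ?M y) + ennreal (C1 + C2) * ?M w"
        using D by (simp add: distrib_left distrib_right D(1)[symmetric] add_ac)
      also have "\<dots> \<le> (ennreal (C1 + C2) * ?M x + ennreal (C1 + C2) * ?M y) + ennreal (C1 + C2) * (ennreal (c * b) * ?M x)"
        using D by (intro add_mono mult_right_mono mult_left_mono Mwx ennreal_leI) auto
      also have "\<dots> \<le> (ennreal (C1 + C2) * ?M x + ennreal (C1 + C2) * ?M y) +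
          (ennreal (C1 + C2) * (ennreal (c * b) * ?M x) + ennreal (C1 + C2) * (ennreal (c * b) * ?M y))"
        by (intro add_left_mono) simp
      also have "\<dots> = ennreal C * (?M x + ?M y)"
        using UV b c by (simp add: C_def ennreal_plus ennreal_mult distrib_left distrib_right mult.assoc add_ac)
      finally show ?thesis .
    qed
    have "AE x in lborel. x \<in> U \<longrightarrow> (AE y in lborel. ?P U C1 x y)"
      "AE x in lborel. x \<in> V \<longrightarrow> (AE y in lborel. ?P V C2 x y)"
      using UV ug unfolding osc_bound_def by blast+
    then have ae: "AE x in lborel. (x \<in> U \<longrightarrow> (AE y in lborel. ?P U C1 x y)) \<and> (x \<in> V \<longrightarrow> (AE y in lborel. ?P V C2 x y))"
      by (rule AE_conjI)
    have PW: "AE w in lborel. ?P ?W D x w" if "AE w in lborel. ?P S D x w" "?W \<subseteq> S" for S D x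
      using that(1) by eventually_elim (use that(2) in blast)
    show "AE x in lborel. x \<in> U \<union> V \<longrightarrow> (AE y in lborel. ?P (U \<union> V) C x y)"
      using ae
    proof eventually_elim
      case (elim x)
      have "AE y in lborel. x \<in> U \<union> V \<longrightarrow> ?P (U \<union> V) C x y"
      proof -
        have "AE y in lborel. (x \<in> U \<longrightarrow> ?P U C1 x y) \<and> (x \<in> V \<longrightarrow> ?P V C2 x y)"
          using elim by auto
        then show ?thesis
          using ae
        proof eventually_elim
          case (elim y)
          note y = elim
          note x = \<open>(x \<in> U \<longrightarrow> (AE y in lborel. ?P U C1 x y)) \<and> (x \<in> V \<longrightarrow> (AE y in lborel. ?P V C2 x y))\<close>
          show ?case
          proof (intro impI)
            assume xy: "x \<in> U \<union> V" "y \<in> U \<union> V"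
            then consider "x \<in> U \<and> y \<in> U" | "x \<in> V \<and> y \<in> V" | "x \<in> U \<and> y \<in> V" | "x \<in> V \<and> y \<in> U" by blast
            then show "ennreal \<bar>u x - u y\<bar> \<le> ennreal C * (?M x + ?M y)"
            proof cases
              case 1
              then have "ennreal \<bar>u x - u y\<bar> \<le> ennreal C1 * (?M x + ?M y)" using y by blast
              also have "\<dots> \<le> ennreal C * (?M x + ?M y)" using UV by (intro mono) auto
              finally show ?thesis .
            next
              case 2
              then have "ennreal \<bar>u x - u y\<bar> \<le> ennreal C2 * (?M x + ?M y)" using y by blast
              also have "\<dots> \<le> ennreal C * (?M x + ?M y)" using UV by (intro mono) auto
              finally show ?thesis .
            next
              case 3
              then show ?thesis using x y sub UV
                by (intro cross[where ?D1.0 = C1 and ?D2.0 = C2] PW[where S = U and D = C1] PW[where S = V and D = C2]) auto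
            next
              case 4
              then show ?thesis using x y sub UV
                by (intro cross[where ?D1.0 = C2 and ?D2.0 = C1] PW[where S = V and D = C2] PW[where S = U and D = C1]) auto
            qed
          qed
        qed
      qed
      then show ?case by (cases "x \<in> U \<union> V") auto
    qed
  qed
  then show ?thesis using C by blast
qed

section \<open>Cones at smooth boundaries\<close>

lemma smooth_on_imp_lipschitz:
  fixes h :: "'a::euclidean_space \<Rightarrow> real"
  assumes "smooth_on UNIV h"
  obtains L where "0 \<le> L" "\<And>a b. a \<in> cball 0 \<rho> \<Longrightarrow> b \<in> cball 0 \<rho> \<Longrightarrow> \<bar>h a - h b\<bar> \<le> L * norm (a - b)"
proof -
  have C1: "Ck_on (Suc 0) UNIV h" using assms by (simp only: smooth_on_def)
  note h = Ck_on_SucD[OF C1]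
  have "\<exists>B. \<forall>x\<in>cball 0 \<rho>. norm (frechet_derivative h (at x) i) \<le> B" if "i \<in> Basis" for i
  proof -
    have "continuous_on (cball 0 \<rho>) (\<lambda>x. frechet_derivative h (at x) i)"
      using h(2)[OF that] by (auto intro: continuous_on_subset)
    then have "bounded ((\<lambda>x. frechet_derivative h (at x) i) ` cball 0 \<rho>)"
      by (intro compact_imp_bounded compact_continuous_image) auto
    then show ?thesis by (auto simp: bounded_iff)
  qed
  then obtain B where B: "\<And>i x. i \<in> Basis \<Longrightarrow> x \<in> cball 0 \<rho> \<Longrightarrow> norm (frechet_derivative h (at x) i) \<le> B i"
    by metis
  define L where "L = (\<Sum>i\<in>Basis. \<bar>B i\<bar>)"
  have on: "onorm (frechet_derivative h (at x)) \<le> L" if x: "x \<in> cball 0 \<rho>" for x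
  proof (rule onorm_le)
    fix w
    have "norm (frechet_derivative h (at x) w) \<le> (\<Sum>i\<in>Basis. norm ((w \<bullet> i) * frechet_derivative h (at x) i))"
      unfolding frechet_derivative_sum_Basis[OF h(1), of x w] by (rule norm_sum)
    also have "\<dots> \<le> (\<Sum>i\<in>Basis. norm w * \<bar>B i\<bar>)"
      using B[OF _ x] by (intro sum_mono) (fastforce simp: abs_mult intro!: mult_mono Basis_le_norm)
    also have "\<dots> = L * norm w" by (simp add: L_def sum_distrib_left mult.commute)
    finally show "norm (frechet_derivative h (at x) w) \<le> L * norm w" .
  qed
  show thesis
  proof (rule that)
    show "0 \<le> L" by (simp add: L_def sum_nonneg)
    show "\<bar>h a - h b\<bar> \<le> L * norm (a - b)" if "a \<in> cball 0 \<rho>" "b \<in> cball 0 \<rho>" for a b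
      using differentiable_bound[OF convex_cball has_derivative_at_withinI[OF h(1)] on that] by simp
  qed
qed

lemma norm_minus_proj_le:
  fixes x \<nu> :: "'a::euclidean_space"
  assumes "norm \<nu> = 1"
  shows "norm (x - (x \<bullet> \<nu>) *\<^sub>R \<nu>) \<le> 2 * norm x"
proof -
  have "norm (x - (x \<bullet> \<nu>) *\<^sub>R \<nu>) \<le> norm x + \<bar>x \<bullet> \<nu>\<bar>"
    using norm_triangle_ineq4[of x "(x \<bullet> \<nu>) *\<^sub>R \<nu>"] assms by simp
  then show ?thesis using Cauchy_Schwarz_ineq2[of x \<nu>] assms by simp
qed

text \<open>At an interior point every direction works on a small ball. At a boundary point \<Omega>
  lies above the graph of \<open>h\<close>, which is Lipschitz on bounded sets; a vector that rises
  by more than \<open>L\<close> times its lateral part keeps a point above the graph.\<close>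

lemma cone_condition_if_smooth_boundary:
  fixes \<Omega> :: "'a::euclidean_space set"
  assumes "open \<Omega>" "smooth_boundary \<Omega>" and z: "z \<in> closure \<Omega>"
  shows "\<exists>R \<nu> L. cone_condition \<Omega> z R \<nu> L"
proof (cases "z \<in> \<Omega>")
  case True
  then obtain e where e: "0 < e" "ball z e \<subseteq> \<Omega>" using assms(1) by (auto simp: open_contains_ball)
  obtain \<nu> :: 'a where \<nu>: "norm \<nu> = 1" using vector_choose_size[of 1] by auto
  have "x + w \<in> \<Omega>" if "x \<in> ball z (e / 2)" "norm w < e / 2" for x w
  proof -
    have "dist z (x + w) \<le> dist z x + norm w"
      by (metis add_diff_cancel_left' dist_norm dist_triangle norm_minus_commute)
    then show ?thesis using that e by auto
  qed
  then have "cone_condition \<Omega> z (e / 2) \<nu> 0"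
    using e \<nu> unfolding cone_condition_def by auto
  then show ?thesis by blast
next
  case False
  then have "z \<in> frontier \<Omega>" using z assms(1) by (auto simp: frontier_def interior_open)
  then obtain r \<nu> h where r: "0 < r" and \<nu>: "norm \<nu> = 1" and h: "smooth_on UNIV h"
    and iff: "\<And>x. x \<in> ball z r \<Longrightarrow> x \<in> \<Omega> \<longleftrightarrow> h (x - (x \<bullet> \<nu>) *\<^sub>R \<nu>) < x \<bullet> \<nu>"
    using assms(2) unfolding smooth_boundary_def by metis
  let ?\<pi> = "\<lambda>x. x - (x \<bullet> \<nu>) *\<^sub>R \<nu>"
  \<comment> \<open>The factor 2 matches the crude bound for the projection in
    \<open>norm_minus_proj_le\<close>.\<close>
  obtain L where L: "0 \<le> L" "\<And>a b. a \<in> cball 0 (2 * (norm z + r)) \<Longrightarrow> b \<in> cball 0 (2 * (norm z + r)) \<Longrightarrow> \<bar>h a - h b\<bar> \<le> L * norm (a - b)"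
    using smooth_on_imp_lipschitz[OF h] by metis
  have \<pi>: "?\<pi> x \<in> cball 0 (2 * (norm z + r))" if "x \<in> ball z r" for x
  proof -
    have "norm x \<le> norm z + dist z x" by (metis add.commute dist_norm norm_minus_commute norm_triangle_sub)
    then have "norm x \<le> norm z + r" using that by simp
    then show ?thesis using norm_minus_proj_le[OF \<nu>, of x] by simp
  qed
  have "cone_condition \<Omega> z (r / 2) \<nu> L"
    unfolding cone_condition_def
  proof (intro conjI ballI allI impI)
    fix x w assume x: "x \<in> \<Omega> \<inter> ball z (r / 2)" and w: "norm w < r / 2 \<and> L * norm (?\<pi> w) < w \<bullet> \<nu>"
    have xr: "x \<in> ball z r" using x r by auto
    have "dist z (x + w) \<le> dist z x + norm w"
      by (metis add_diff_cancel_left' dist_norm dist_triangle norm_minus_commute)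
    then have xw: "x + w \<in> ball z r" using x w by auto
    have eq: "?\<pi> (x + w) - ?\<pi> x = ?\<pi> w" by (simp add: algebra_simps)
    then have "h (?\<pi> (x + w)) \<le> h (?\<pi> x) + L * norm (?\<pi> w)"
      using L(2)[OF \<pi>[OF xw] \<pi>[OF xr]] unfolding eq by linarith
    also have "\<dots> < x \<bullet> \<nu> + w \<bullet> \<nu>" using iff[OF xr] x w by auto
    finally show "x + w \<in> \<Omega>" using iff[OF xw] by (simp add: inner_add_left)
  qed (use r \<nu> L in auto)
  then show ?thesis by blast
qed

lemma cone_condition_shrink:
  "cone_condition \<Omega> z R \<nu> L \<Longrightarrow> 0 < R' \<Longrightarrow> R' \<le> R \<Longrightarrow> cone_condition \<Omega> z R' \<nu> L"
  unfolding cone_condition_def by (auto simp: subset_ball)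

lemma osc_bound_if_lip_bound:
  assumes "lip_bound \<Omega> R U C" "0 \<le> C" "U \<subseteq> ball z \<rho>"
  shows "osc_bound \<Omega> R U (C * (2 * \<rho>))"
  unfolding osc_bound_def
proof (intro allI impI)
  fix u g assume ug: "upper_gradient \<Omega> u g"
  let ?M = "max_fun R g"
  have "AE x in lborel. x \<in> U \<longrightarrow> (AE y in lborel. y \<in> U \<longrightarrow>
        ennreal \<bar>u x - u y\<bar> \<le> ennreal (C * norm (x - y)) * (?M x + ?M y))"
    using assms(1) ug by (simp add: lip_bound_def)
  then show "AE x in lborel. x \<in> U \<longrightarrow> (AE y in lborel. y \<in> U \<longrightarrow>
        ennreal \<bar>u x - u y\<bar> \<le> ennreal (C * (2 * \<rho>)) * (?M x + ?M y))"
  proof eventually_elim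
    case (elim x)
    show ?case
    proof
      assume x: "x \<in> U"
      then have "AE y in lborel. y \<in> U \<longrightarrow> ennreal \<bar>u x - u y\<bar> \<le> ennreal (C * norm (x - y)) * (?M x + ?M y)"
        using elim by simp
      then show "AE y in lborel. y \<in> U \<longrightarrow> ennreal \<bar>u x - u y\<bar> \<le> ennreal (C * (2 * \<rho>)) * (?M x + ?M y)"
      proof eventually_elim
        case (elim y)
        show ?case
        proof
          assume y: "y \<in> U"
          have "norm (x - y) \<le> 2 * \<rho>"
          proof -
            have "dist z x < \<rho>" "dist z y < \<rho>" using x y assms(3) by auto
            then have "dist x y \<le> 2 * \<rho>" using dist_triangle2[of x y z] by (simp add: dist_commute)
            then show ?thesis by (simp add: dist_norm)
          qed
          then have "ennreal (C * norm (x - y)) * (?M x + ?M y) \<le> ennreal (C * (2 * \<rho>)) * (?M x + ?M y)"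
            using assms(2) by (intro mult_right_mono ennreal_leI mult_left_mono) auto
          then show "ennreal \<bar>u x - u y\<bar> \<le> ennreal (C * (2 * \<rho>)) * (?M x + ?M y)"
            using elim y by (auto intro: order_trans)
        qed
      qed
    qed
  qed
qed

text \<open>The union of a maximal subfamily satisfying an oscillation bound must be all of \<open>\<Omega>\<close>, since otherwise
  connectedness provides another member of the cover meeting it.\<close>

lemma osc_bound_connected:
  fixes \<Omega> :: "'a::euclidean_space set"
  assumes conn: "connected \<Omega>" "\<Omega> \<noteq> {}" and R: "\<Omega> \<subseteq> ball 0 R"
    and fin: "finite \<U>" and cov: "\<Union>\<U> = \<Omega>"
    and \<U>: "\<And>U. U \<in> \<U> \<Longrightarrow> open U \<and> U \<noteq> {} \<and> (\<exists>C\<ge>0. osc_bound \<Omega> R U C)"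
  shows "\<exists>C\<ge>0. osc_bound \<Omega> R \<Omega> C"
proof -
  let ?Q = "\<lambda>J. J \<subseteq> \<U> \<and> J \<noteq> {} \<and> (\<exists>C\<ge>0. osc_bound \<Omega> R (\<Union>J) C)"
  obtain U0 where "U0 \<in> \<U>" using cov conn by auto
  then have "?Q {U0}" using \<U>[of U0] by auto
  moreover have "\<forall>J. ?Q J \<longrightarrow> card J < Suc (card \<U>)"
    using fin by (auto simp: less_Suc_eq_le intro: card_mono)
  ultimately obtain J where J: "?Q J" and max: "\<And>J'. ?Q J' \<Longrightarrow> card J' \<le> card J"
    using ex_has_greatest_nat[of ?Q "{U0}" card "Suc (card \<U>)"] by auto
  have finJ: "finite J" using J fin finite_subset by blast
  have "\<Union>J = \<Omega>"
  proof (rule ccontr)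
    assume ne: "\<Union>J \<noteq> \<Omega>"
    have "\<exists>V\<in>\<U> - J. \<Union>J \<inter> V \<noteq> {}"
    proof (rule ccontr)
      assume "\<not> ?thesis"
      then have "\<Union>J \<inter> \<Union>(\<U> - J) \<inter> \<Omega> = {}" by blast
      moreover have "\<Omega> \<subseteq> \<Union>J \<union> \<Union>(\<U> - J)" using cov by blast
      moreover have "open (\<Union>J)" "open (\<Union>(\<U> - J))" using \<U> J by (intro open_Union; blast)+
      ultimately have "\<Union>J \<inter> \<Omega> = {} \<or> \<Union>(\<U> - J) \<inter> \<Omega> = {}"
        using connectedD[OF conn(1)] by blast
      then show False
      proof
        assume "\<Union>J \<inter> \<Omega> = {}"
        moreover obtain U where "U \<in> J" "U \<in> \<U>" "U \<noteq> {}" using J \<U> by blast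
        ultimately show False using cov by blast
      next
        assume "\<Union>(\<U> - J) \<inter> \<Omega> = {}"
        then show False using ne cov J by blast
      qed
    qed
    then obtain V where V: "V \<in> \<U>" "V \<notin> J" "\<Union>J \<inter> V \<noteq> {}" by auto
    obtain C1 C2 where C: "0 \<le> C1" "osc_bound \<Omega> R (\<Union>J) C1" "0 \<le> C2" "osc_bound \<Omega> R V C2"
      using J \<U>[OF V(1)] by blast
    have sub: "\<Union>J \<subseteq> \<Omega>" "V \<subseteq> \<Omega>" using J V(1) cov by auto
    have "open (\<Union>J \<inter> V)" using J \<U> V(1) by (intro open_Int open_Union) blast+
    from osc_bound_Un[OF C(2,4,1,3) sub R this V(3)]
    have "\<exists>C\<ge>0. osc_bound \<Omega> R (\<Union>(insert V J)) C" by (simp add: Un_commute)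
    then have "?Q (insert V J)" using J V by auto
    from max[OF this] show False using finJ V(2) by simp
  qed
  then show ?thesis using J by auto
qed

text \<open>Compactness leaves finitely many local Lipschitz bounds. Pairs closer than the Lebesgue
  number \<open>d\<close> of the cover share one of its balls; for all other pairs the global
  oscillation bound divided by \<open>d\<close> is already a Lipschitz bound.\<close>

theorem lip_bound_smooth_bounded_domain:
  fixes \<Omega> :: "'a::euclidean_space set"
  assumes "smooth_bounded_domain \<Omega>"
  shows "\<exists>R C. 0 \<le> C \<and> \<Omega> \<subseteq> ball 0 R \<and> lip_bound \<Omega> R \<Omega> C"
proof -
  have \<Omega>: "open \<Omega>" "connected \<Omega>" "\<Omega> \<noteq> {}" "bounded \<Omega>" "smooth_boundary \<Omega>"
    using assms by (auto simp: smooth_bounded_domain_def)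
  obtain R where R: "0 < R" "\<Omega> \<subseteq> ball 0 R" using bounded_subset_ballD[OF \<Omega>(4)] by auto
  have "\<exists>\<rho> C. 0 < \<rho> \<and> 0 \<le> C \<and> lip_bound \<Omega> R (\<Omega> \<inter> ball z \<rho>) C" if z: "z \<in> closure \<Omega>" for z
  proof -
    obtain r \<nu> L where c: "cone_condition \<Omega> z r \<nu> L"
      using cone_condition_if_smooth_boundary[OF \<Omega>(1,5) z] by blast
    \<comment> \<open>Cone radii are cut down to \<open>R\<close> so that all local estimates use
      the same maximal function.\<close>
    then have c': "cone_condition \<Omega> z (min r R) \<nu> L" and L: "0 \<le> L" and r: "0 < min r R"
      using R by (auto intro: cone_condition_shrink simp: cone_condition_def)
    have "lip_bound \<Omega> R (\<Omega> \<inter> ball z (min r R / (2 * (2 * L + 5)))) ((2 * L + 5) ^ Suc (DIM('a)))"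
      by (rule lip_bound_cone[OF c']) simp
    moreover have "0 < min r R / (2 * (2 * L + 5))" "0 \<le> (2 * L + 5) ^ Suc (DIM('a))"
      using r L by (auto intro!: divide_pos_pos)
    ultimately show ?thesis by blast
  qed
  then obtain \<rho> C where \<rho>: "\<And>z. z \<in> closure \<Omega> \<Longrightarrow> 0 < \<rho> z" "\<And>z. z \<in> closure \<Omega> \<Longrightarrow> 0 \<le> C z"
    "\<And>z. z \<in> closure \<Omega> \<Longrightarrow> lip_bound \<Omega> R (\<Omega> \<inter> ball z (\<rho> z)) (C z)" by metis
  have comp: "compact (closure \<Omega>)" using \<Omega>(4) by simp
  have "closure \<Omega> \<subseteq> (\<Union>z\<in>closure \<Omega>. ball z (\<rho> z))"
  proof
    fix z assume "z \<in> closure \<Omega>"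
    then show "z \<in> (\<Union>z\<in>closure \<Omega>. ball z (\<rho> z))" using \<rho>(1) by (intro UN_I[of z]) auto
  qed
  then obtain Z where Z: "Z \<subseteq> closure \<Omega>" "finite Z" "closure \<Omega> \<subseteq> (\<Union>z\<in>Z. ball z (\<rho> z))"
    by (rule compactE_image[OF comp, rotated]) auto
  have Zne: "Z \<noteq> {}" using Z(3) \<Omega>(3) closure_subset[of \<Omega>] by auto
  obtain d where d: "0 < d" "\<And>T. T \<subseteq> closure \<Omega> \<Longrightarrow> diameter T < d \<Longrightarrow> \<exists>B\<in>(\<lambda>z. ball z (\<rho> z)) ` Z. T \<subseteq> B"
  proof (rule Lebesgue_number_lemma[OF comp, of "(\<lambda>z. ball z (\<rho> z)) ` Z"])
    show "(\<lambda>z. ball z (\<rho> z)) ` Z \<noteq> {}" using Zne by simp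
    show "closure \<Omega> \<subseteq> (\<Union>z\<in>Z. ball z (\<rho> z))" by fact
    show "open B" if "B \<in> (\<lambda>z. ball z (\<rho> z)) ` Z" for B using that by auto
  qed (rule that)
  let ?\<U> = "{U \<in> (\<lambda>z. \<Omega> \<inter> ball z (\<rho> z)) ` Z. U \<noteq> {}}"
  have "\<exists>C\<ge>0. osc_bound \<Omega> R \<Omega> C"
  proof (rule osc_bound_connected[OF \<Omega>(2,3) R(2)])
    show "finite ?\<U>" using Z by simp
    show "\<Union>?\<U> = \<Omega>" using Z(3) closure_subset[of \<Omega>] by fastforce
    fix U assume "U \<in> ?\<U>"
    then obtain z where z: "z \<in> Z" "U = \<Omega> \<inter> ball z (\<rho> z)" "U \<noteq> {}" by auto
    then have z': "z \<in> closure \<Omega>" using Z by auto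
    have "osc_bound \<Omega> R U (C z * (2 * \<rho> z))"
      using \<rho>(2,3)[OF z'] z(2) by (intro osc_bound_if_lip_bound[where z = z]) auto
    moreover have "0 \<le> C z * (2 * \<rho> z)" using \<rho>(1,2)[OF z'] by simp
    ultimately show "open U \<and> U \<noteq> {} \<and> (\<exists>C\<ge>0. osc_bound \<Omega> R U C)"
      using z(3) open_Int[OF \<Omega>(1) open_ball, of z "\<rho> z"] unfolding z(2) by blast
  qed
  then obtain C0 where C0: "0 \<le> C0" "osc_bound \<Omega> R \<Omega> C0" by auto
  define C1 where "C1 = C0 / d + (\<Sum>z\<in>Z. C z)"
  have Cz: "C z \<le> C1" if "z \<in> Z" for z
  proof -
    have "C z \<le> (\<Sum>z\<in>Z. C z)"
      using that Z \<rho>(2) by (intro member_le_sum) auto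
    moreover have "0 \<le> C0 / d" using C0(1) d(1) by simp
    ultimately show ?thesis unfolding C1_def by linarith
  qed
  have sumC: "0 \<le> (\<Sum>z\<in>Z. C z)" using Z \<rho>(2) by (intro sum_nonneg) auto
  have "lip_bound \<Omega> R \<Omega> C1"
    unfolding lip_bound_def
  proof (intro allI impI)
    fix u g assume ug: "upper_gradient \<Omega> u g"
    let ?M = "max_fun R g"
    have "AE x in lborel. \<forall>z\<in>Z. x \<in> \<Omega> \<inter> ball z (\<rho> z) \<longrightarrow> (AE y in lborel. y \<in> \<Omega> \<inter> ball z (\<rho> z) \<longrightarrow>
        ennreal \<bar>u x - u y\<bar> \<le> ennreal (C z * norm (x - y)) * (?M x + ?M y))"
      using Z \<rho>(3) ug by (intro AE_finite_allI) (auto simp: lip_bound_def)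
    moreover have "AE x in lborel. x \<in> \<Omega> \<longrightarrow> (AE y in lborel. y \<in> \<Omega> \<longrightarrow>
        ennreal \<bar>u x - u y\<bar> \<le> ennreal C0 * (?M x + ?M y))"
      using C0 ug by (simp add: osc_bound_def)
    ultimately show "AE x in lborel. x \<in> \<Omega> \<longrightarrow> (AE y in lborel. y \<in> \<Omega> \<longrightarrow>
        ennreal \<bar>u x - u y\<bar> \<le> ennreal (C1 * norm (x - y)) * (?M x + ?M y))"
    proof eventually_elim
      case (elim x)
      show ?case
      proof
        assume x: "x \<in> \<Omega>"
        have "AE y in lborel. \<forall>z\<in>Z. x \<in> ball z (\<rho> z) \<longrightarrow> y \<in> \<Omega> \<inter> ball z (\<rho> z) \<longrightarrow>
            ennreal \<bar>u x - u y\<bar> \<le> ennreal (C z * norm (x - y)) * (?M x + ?M y)"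
          using elim(1) x Z(2) by (intro AE_finite_allI) auto
        moreover have "AE y in lborel. y \<in> \<Omega> \<longrightarrow> ennreal \<bar>u x - u y\<bar> \<le> ennreal C0 * (?M x + ?M y)"
          using elim(2) x by simp
        ultimately show "AE y in lborel. y \<in> \<Omega> \<longrightarrow>
          ennreal \<bar>u x - u y\<bar> \<le> ennreal (C1 * norm (x - y)) * (?M x + ?M y)"
        proof eventually_elim
          case (elim y)
          show ?case
          proof
            assume y: "y \<in> \<Omega>"
            show "ennreal \<bar>u x - u y\<bar> \<le> ennreal (C1 * norm (x - y)) * (?M x + ?M y)"
            proof (cases "norm (x - y) < d")
              case True
              have "diameter {x, y} \<le> norm (x - y)"
                by (rule diameter_le) (auto simp: norm_minus_commute)
              then obtain z where z: "z \<in> Z" "{x, y} \<subseteq> ball z (\<rho> z)"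
                using d(2)[of "{x, y}"] x y True closure_subset[of \<Omega>] by (auto simp: dist_norm)
              then have "ennreal \<bar>u x - u y\<bar> \<le> ennreal (C z * norm (x - y)) * (?M x + ?M y)"
                using elim(1) y by blast
              also have "\<dots> \<le> ennreal (C1 * norm (x - y)) * (?M x + ?M y)"
                using Cz[OF z(1)] by (intro mult_right_mono ennreal_leI) auto
              finally show ?thesis .
            next
              case False
              have "C0 = C0 / d * d" using d(1) by simp
              also have "\<dots> \<le> C0 / d * norm (x - y)" using False C0(1) d(1) by (intro mult_left_mono) auto
              also have "\<dots> \<le> C1 * norm (x - y)" using sumC by (intro mult_right_mono) (simp_all add: C1_def)
              finally have "ennreal C0 * (?M x + ?M y) \<le> ennreal (C1 * norm (x - y)) * (?M x + ?M y)"
                by (intro mult_right_mono ennreal_leI) auto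
              then show ?thesis using elim(2) y by (auto intro: order_trans)
            qed
          qed
        qed
      qed
    qed
  qed
  moreover have "0 \<le> C1" using C0(1) d(1) sumC by (simp add: C1_def)
  ultimately show ?thesis using R by blast
qed

section \<open>Polar coordinates\<close>

text \<open>The cone measure: \<open>DIM('a)\<close> times the volume of the part of the unit ball
  lying over a set of directions. The origin has no direction and is removed.\<close>

definition sphere_measure :: "'a::euclidean_space measure" where
  "sphere_measure = distr (density lborel (\<lambda>v. ennreal (real DIM('a)) * indicator (ball 0 1 - {0}) v)) borel (\<lambda>v. v /\<^sub>R norm v)"

lemma sets_sphere_measure [simp, measurable_cong]: "sets sphere_measure = sets borel"
  by (simp add: sphere_measure_def)

lemma space_sphere_measure [simp]: "space sphere_measure = UNIV"
  by (simp add: sphere_measure_def)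

lemma nn_integral_sphere_measure:
  fixes f :: "'a::euclidean_space \<Rightarrow> ennreal"
  assumes [measurable]: "f \<in> borel_measurable borel"
  shows "(\<integral>\<^sup>+\<omega>. f \<omega> \<partial>sphere_measure) =
    (\<integral>\<^sup>+v. ennreal (real DIM('a)) * indicator (ball 0 1 - {0}) v * f (v /\<^sub>R norm v) \<partial>lborel)"
proof -
  have [measurable]: "ball 0 1 - {0} \<in> sets (borel :: 'a measure)" by simp
  show ?thesis
    unfolding sphere_measure_def by (simp add: nn_integral_distr nn_integral_density)
qed

lemma emeasure_sphere_measure_UNIV:
  "emeasure (sphere_measure :: 'a::euclidean_space measure) UNIV = ennreal (real DIM('a) * unit_ball_vol (real DIM('a)))"
proof -
  have "emeasure (sphere_measure :: 'a measure) UNIV = (\<integral>\<^sup>+\<omega>. 1 \<partial>(sphere_measure :: 'a measure))"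
    by simp
  also have "\<dots> = (\<integral>\<^sup>+v. ennreal (real DIM('a)) * indicator (ball 0 1 - {0}) (v::'a) \<partial>lborel)"
    by (subst nn_integral_sphere_measure) simp_all
  also have "\<dots> = ennreal (real DIM('a)) * emeasure lborel (ball 0 1 - {0::'a})"
    by (subst nn_integral_cmult_indicator) auto
  also have "emeasure lborel (ball 0 1 - {0::'a}) = emeasure lborel (ball (0::'a) 1)"
    by (intro emeasure_Diff_null_set) (auto simp: null_sets_def)
  finally show ?thesis by (simp add: emeasure_ball ennreal_mult'')
qed

lemma finite_measure_sphere_measure: "finite_measure (sphere_measure :: 'a::euclidean_space measure)"
  by (rule finite_measureI) (simp add: emeasure_sphere_measure_UNIV)

lemma AE_sphere_measure: "AE \<omega> in (sphere_measure :: 'a::euclidean_space measure). norm \<omega> = 1"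
proof -
  have [measurable]: "ball 0 1 - {0} \<in> sets (borel :: 'a measure)" by simp
  show ?thesis
    unfolding sphere_measure_def
    by (subst AE_distr_iff) (auto simp: AE_density indicator_def intro!: AE_I2)
qed

lemma nn_integral_inverse_power_tail:
  assumes "0 < a" "0 < n"
  shows "(\<integral>\<^sup>+t. ennreal (real n * inverse (t ^ Suc n)) * indicator {a<..} t \<partial>lborel) = ennreal (inverse (a ^ n))"
proof -
  have "(\<integral>\<^sup>+t. ennreal (real n * inverse (t ^ Suc n)) * indicator {a<..} t \<partial>lborel) =
      (\<integral>\<^sup>+t. ennreal (real n * inverse (t ^ Suc n)) * indicator {a..} t \<partial>lborel)"
  proof (rule nn_integral_cong_AE)
    have "AE t in lborel. t \<noteq> a" by (rule AE_lborel_singleton)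
    then show "AE t in lborel. ennreal (real n * inverse (t ^ Suc n)) * indicator {a<..} t =
        ennreal (real n * inverse (t ^ Suc n)) * indicator {a..} t"
      by eventually_elim (auto simp: indicator_def)
  qed
  also have "\<dots> = ennreal (0 - (- inverse (a ^ n)))"
  proof (rule nn_integral_FTC_atLeast)
    fix t assume t: "a \<le> t"
    then show "((\<lambda>t. - inverse (t ^ n)) has_real_derivative real n * inverse (t ^ Suc n)) (at t)"
      using assms by (auto intro!: derivative_eq_intros simp: field_simps power_Suc[symmetric] power_add[symmetric] simp del: power_Suc)
    show "0 \<le> real n * inverse (t ^ Suc n)" using t assms by simp
  next
    have "((\<lambda>t. inverse (t ^ n)) \<longlongrightarrow> 0) (at_top :: real filter)"
      using assms by (intro tendsto_inverse_0_at_top filterlim_pow_at_top) (auto simp: filterlim_ident)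
    then show "((\<lambda>t. - inverse (t ^ n)) \<longlongrightarrow> 0) (at_top :: real filter)"
      using tendsto_minus by fastforce
  qed simp
  finally show ?thesis by simp
qed

text \<open>Writing \<open>\<omega> = v / \<bar>v\<bar>\<close> with \<open>v\<close> in the unit ball and \<open>s = t \<bar>v\<bar>\<close> reduces polar coordinates to
  the scaling of Lebesgue measure.\<close>

theorem nn_integral_polar:
  fixes F :: "'a::euclidean_space \<Rightarrow> ennreal"
  assumes [measurable]: "F \<in> borel_measurable borel"
  shows "(\<integral>\<^sup>+y. F y \<partial>lborel) =
    (\<integral>\<^sup>+\<omega>. (\<integral>\<^sup>+s. ennreal (s ^ (DIM('a) - 1)) * F (s *\<^sub>R \<omega>) * indicator {0<..} s \<partial>lborel) \<partial>sphere_measure)"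
proof -
  let ?n = "DIM('a)"
  let ?B = "ball 0 1 - {0} :: 'a set"
  have n: "0 < ?n" by simp
  have [measurable]: "?B \<in> sets borel" by simp
  have "(\<integral>\<^sup>+\<omega>. (\<integral>\<^sup>+s. ennreal (s ^ (?n - 1)) * F (s *\<^sub>R \<omega>) * indicator {0<..} s \<partial>lborel) \<partial>sphere_measure) =
    (\<integral>\<^sup>+v. ennreal (real ?n) * indicator ?B v * (\<integral>\<^sup>+s. ennreal (s ^ (?n - 1)) * F (s *\<^sub>R (v /\<^sub>R norm v)) * indicator {0<..} s \<partial>lborel) \<partial>lborel)"
    by (rule nn_integral_sphere_measure) measurable
  \<comment> \<open>Substitution \<open>s = t * norm v\<close>; the powers of \<open>norm v\<close>
    combine to \<open>norm v ^ ?n\<close>.\<close>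
  also have "\<dots> = (\<integral>\<^sup>+v. (\<integral>\<^sup>+t. ennreal (real ?n * t ^ (?n - 1)) * indicator {0<..} t * (indicator ?B v * ennreal (norm v ^ ?n) * F (t *\<^sub>R v)) \<partial>lborel) \<partial>lborel)"
  proof (rule nn_integral_cong)
    fix v :: 'a
    show "ennreal (real ?n) * indicator ?B v * (\<integral>\<^sup>+s. ennreal (s ^ (?n - 1)) * F (s *\<^sub>R (v /\<^sub>R norm v)) * indicator {0<..} s \<partial>lborel) =
      (\<integral>\<^sup>+t. ennreal (real ?n * t ^ (?n - 1)) * indicator {0<..} t * (indicator ?B v * ennreal (norm v ^ ?n) * F (t *\<^sub>R v)) \<partial>lborel)"
    proof (cases "v \<in> ?B")
      case True
      then have v: "0 < norm v" by simp
      have "(\<integral>\<^sup>+s. ennreal (s ^ (?n - 1)) * F (s *\<^sub>R (v /\<^sub>R norm v)) * indicator {0<..} s \<partial>lborel) =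
          ennreal (norm v ^ DIM(real)) * (\<integral>\<^sup>+t. ennreal ((0 + norm v *\<^sub>R t) ^ (?n - 1)) * F ((0 + norm v *\<^sub>R t) *\<^sub>R (v /\<^sub>R norm v)) * indicator {0<..} (0 + norm v *\<^sub>R t) \<partial>lborel)"
        by (rule nn_integral_lborel_affine[symmetric]) (use v in auto)
      also have "\<dots> = (\<integral>\<^sup>+t. ennreal (norm v) * (ennreal ((norm v * t) ^ (?n - 1)) * F (t *\<^sub>R v) * indicator {0<..} (norm v * t)) \<partial>lborel)"
      proof -
        have e: "(0 + norm v *\<^sub>R t) *\<^sub>R (v /\<^sub>R norm v) = t *\<^sub>R v" for t
          using v by simp
        show ?thesis unfolding e by (subst nn_integral_cmult[symmetric]) auto
      qed
      also have "\<dots> = (\<integral>\<^sup>+t. ennreal (t ^ (?n - 1)) * indicator {0<..} t * (ennreal (norm v ^ ?n) * F (t *\<^sub>R v)) \<partial>lborel)"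
      proof (rule nn_integral_cong)
        fix t :: real
        show "ennreal (norm v) * (ennreal ((norm v * t) ^ (?n - 1)) * F (t *\<^sub>R v) * indicator {0<..} (norm v * t)) =
            ennreal (t ^ (?n - 1)) * indicator {0<..} t * (ennreal (norm v ^ ?n) * F (t *\<^sub>R v))"
        proof (cases "0 < t")
          case True
          have "ennreal (norm v) * ennreal ((norm v * t) ^ (?n - 1)) = ennreal (t ^ (?n - 1)) * ennreal (norm v ^ ?n)"
            using v True n power_Suc[of "norm v" "?n - 1"]
            by (subst (1 2) ennreal_mult''[symmetric]) (auto simp: power_mult_distrib mult_ac)
          then show ?thesis using True v by (simp add: mult_ac zero_less_mult_iff) (metis mult.assoc mult.commute)
        qed (use v in \<open>simp add: indicator_def zero_less_mult_iff\<close>)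
      qed
      finally have 1: "(\<integral>\<^sup>+s. ennreal (s ^ (?n - 1)) * F (s *\<^sub>R (v /\<^sub>R norm v)) * indicator {0<..} s \<partial>lborel) =
        (\<integral>\<^sup>+t. ennreal (t ^ (?n - 1)) * indicator {0<..} t * (ennreal (norm v ^ ?n) * F (t *\<^sub>R v)) \<partial>lborel)" .
      have "ennreal (real ?n) * (\<integral>\<^sup>+t. ennreal (t ^ (?n - 1)) * indicator {0<..} t * (ennreal (norm v ^ ?n) * F (t *\<^sub>R v)) \<partial>lborel) =
        (\<integral>\<^sup>+t. ennreal (real ?n) * (ennreal (t ^ (?n - 1)) * indicator {0<..} t * (ennreal (norm v ^ ?n) * F (t *\<^sub>R v))) \<partial>lborel)"
        by (subst nn_integral_cmult) auto
      also have "\<dots> = (\<integral>\<^sup>+t. ennreal (real ?n * t ^ (?n - 1)) * indicator {0<..} t * (indicator ?B v * ennreal (norm v ^ ?n) * F (t *\<^sub>R v)) \<partial>lborel)"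
        unfolding indicator_simps(1)[OF True]
        by (intro nn_integral_cong) (simp add: ennreal_mult' mult.assoc)
      finally show ?thesis
        unfolding 1 unfolding indicator_simps(1)[OF True] by (simp only: mult_1_right)
    qed simp
  qed
  also have "\<dots> = (\<integral>\<^sup>+t. (\<integral>\<^sup>+v. ennreal (real ?n * t ^ (?n - 1)) * indicator {0<..} t * (indicator ?B v * ennreal (norm v ^ ?n) * F (t *\<^sub>R v)) \<partial>lborel) \<partial>lborel)"
    by (rule lborel_pair.Fubini') measurable
  \<comment> \<open>With \<open>y = t *\<^sub>R v\<close> the condition \<open>norm v < 1\<close>
    becomes \<open>norm y < t\<close>, and the integral of \<open>n / t^(n+1)\<close> over
    \<open>t > norm y\<close> will cancel the factor \<open>norm y ^ ?n\<close>.\<close>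
  also have "\<dots> = (\<integral>\<^sup>+t. (\<integral>\<^sup>+y. F y * ennreal (norm y ^ ?n) * (ennreal (real ?n * inverse (t ^ Suc ?n)) * indicator {norm y<..} t) \<partial>lborel) \<partial>lborel)"
  proof (rule nn_integral_cong)
    fix t :: real
    show "(\<integral>\<^sup>+v. ennreal (real ?n * t ^ (?n - 1)) * indicator {0<..} t * (indicator ?B v * ennreal (norm v ^ ?n) * F (t *\<^sub>R v)) \<partial>lborel) =
      (\<integral>\<^sup>+y. F y * ennreal (norm y ^ ?n) * (ennreal (real ?n * inverse (t ^ Suc ?n)) * indicator {norm y<..} t) \<partial>lborel)"
    proof (cases "0 < t")
      case True
      let ?G = "\<lambda>y. F y * ennreal (norm y ^ ?n) * (ennreal (real ?n * inverse (t ^ Suc ?n)) * indicator {norm y<..} t)"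
      have [measurable]: "?G \<in> borel_measurable borel"
      proof -
        have *: "(\<lambda>y::'a. indicator {norm y<..} t :: ennreal) = indicator {y. norm y < t}" by (auto simp: indicator_def)
        have [measurable]: "(\<lambda>y::'a. indicator {norm y<..} t :: ennreal) \<in> borel_measurable borel"
          unfolding * by measurable
        show ?thesis by measurable
      qed
      have "(\<integral>\<^sup>+y. ?G y \<partial>lborel) = ennreal (t ^ ?n) * (\<integral>\<^sup>+v. ?G (0 + t *\<^sub>R v) \<partial>lborel)"
        by (rule nn_integral_lborel_affine[symmetric]) (fact | rule True)+
      also have "\<dots> = (\<integral>\<^sup>+v. ennreal (t ^ ?n) * ?G (t *\<^sub>R v) \<partial>lborel)"
      proof -
        have "(\<lambda>v. ?G (0 + t *\<^sub>R v)) \<in> borel_measurable lborel"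
          by (rule measurable_compose[OF _ \<open>?G \<in> borel_measurable borel\<close>]) simp
        then show ?thesis by (subst nn_integral_cmult) simp_all
      qed
      also have "\<dots> = (\<integral>\<^sup>+v. ennreal (real ?n * t ^ (?n - 1)) * indicator {0<..} t * (indicator ?B v * ennreal (norm v ^ ?n) * F (t *\<^sub>R v)) \<partial>lborel)"
      proof (rule nn_integral_cong)
        fix v :: 'a
        have eq: "t ^ ?n * (norm (t *\<^sub>R v) ^ ?n * (real ?n * inverse (t ^ Suc ?n))) = real ?n * t ^ (?n - 1) * norm v ^ ?n"
        proof -
          obtain m where m: "?n = Suc m" using n by (metis Suc_pred)
          have "t ^ Suc m * ((t * s) ^ Suc m * (k * inverse (t ^ Suc (Suc m)))) = k * t ^ m * s ^ Suc m" for s k :: real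
            using True by (simp add: power_mult_distrib field_simps)
          from this[of "norm v" "real ?n"] show ?thesis using True unfolding m by simp
        qed
        show "ennreal (t ^ ?n) * ?G (t *\<^sub>R v) =
          ennreal (real ?n * t ^ (?n - 1)) * indicator {0<..} t * (indicator ?B v * ennreal (norm v ^ ?n) * F (t *\<^sub>R v))"
        proof (cases "v \<in> ?B")
          case v: True
          then have "norm (t *\<^sub>R v) < t" using True by simp
          then have "ennreal (t ^ ?n) * ?G (t *\<^sub>R v) =
             (ennreal (t ^ ?n) * (ennreal (norm (t *\<^sub>R v) ^ ?n) * ennreal (real ?n * inverse (t ^ Suc ?n)))) * F (t *\<^sub>R v)"
            by (simp add: mult_ac)
          also have "ennreal (t ^ ?n) * (ennreal (norm (t *\<^sub>R v) ^ ?n) * ennreal (real ?n * inverse (t ^ Suc ?n))) =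
              ennreal (real ?n * t ^ (?n - 1)) * ennreal (norm v ^ ?n)"
            using True eq by (simp only: ennreal_mult''[symmetric] zero_le_power norm_ge_zero of_nat_0_le_iff
                mult_nonneg_nonneg inverse_nonnegative_iff_nonnegative less_imp_le)
          finally show ?thesis using True v by (simp add: mult_ac)
        next
          case v: False
          then consider "v = 0" | "1 \<le> norm v" by (auto simp: not_less)
          then show ?thesis
          proof cases
            case 2
            then have "\<not> norm (t *\<^sub>R v) < t" using True by simp
            then show ?thesis using v by (simp add: indicator_def)
          qed (use n in simp)
        qed
      qed
      finally show ?thesis ..
    next
      case False
      then have "\<not> norm y < t" for y :: 'a by (metis norm_ge_zero order.strict_trans1)
      then show ?thesis using False by (simp add: indicator_def)
    qed
  qed
  also have "\<dots> = (\<integral>\<^sup>+y. (\<integral>\<^sup>+t. F y * ennreal (norm y ^ ?n) * (ennreal (real ?n * inverse (t ^ Suc ?n)) * indicator {norm y<..} t) \<partial>lborel) \<partial>lborel)"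
  proof (rule lborel_pair.Fubini')
    have "(\<lambda>(y::'a, t::real). indicator {norm y<..} t :: ennreal) = (\<lambda>(y, t). if norm y < t then 1 else 0)"
      by (auto simp: indicator_def)
    then have [measurable]: "(\<lambda>p. indicator {norm (fst p :: 'a)<..} (snd p :: real) :: ennreal) \<in> borel_measurable (lborel \<Otimes>\<^sub>M lborel)"
      by (simp add: case_prod_beta')
    show "(\<lambda>(y, t). F y * ennreal (norm y ^ ?n) * (ennreal (real ?n * inverse (t ^ Suc ?n)) * indicator {norm y<..} t)) \<in> borel_measurable (lborel \<Otimes>\<^sub>M lborel)"
      unfolding case_prod_beta' by measurable
  qed
  also have "\<dots> = (\<integral>\<^sup>+y. F y \<partial>lborel)"
  proof (rule nn_integral_cong_AE)
    have "AE y in lborel. y \<noteq> (0::'a)" by (rule AE_lborel_singleton)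
    then show "AE y in lborel. (\<integral>\<^sup>+t. F y * ennreal (norm y ^ ?n) * (ennreal (real ?n * inverse (t ^ Suc ?n)) * indicator {norm y<..} t) \<partial>lborel) = F y"
    proof eventually_elim
      case (elim y)
      have "(\<integral>\<^sup>+t. F y * ennreal (norm y ^ ?n) * (ennreal (real ?n * inverse (t ^ Suc ?n)) * indicator {norm y<..} t) \<partial>lborel) =
        F y * ennreal (norm y ^ ?n) * ennreal (inverse (norm y ^ ?n))"
        using elim n by (subst nn_integral_cmult) (auto simp: nn_integral_inverse_power_tail simp del: power_Suc)
      also have "\<dots> = F y * ennreal (norm y ^ ?n * inverse (norm y ^ ?n))"
        by (subst ennreal_mult'') (auto simp: mult.assoc)
      finally show ?case using elim by simp
    qed
  qed
  finally show ?thesis ..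
qed

section \<open>The uniform bound\<close>

text \<open>The factor \<open>min \<tau> (inverse \<tau>)\<close> with
  \<open>\<tau> = A * norm v\<close> makes the weight \<open>inverse (norm v ^ DIM('a))\<close>
  integrable both at 0 and at infinity. The weight times volume is invariant under dilations, so the
  total integral depends on \<open>A\<close> only through the two powers.\<close>

definition kern :: "real \<Rightarrow> real \<Rightarrow> real \<Rightarrow> 'a::euclidean_space \<Rightarrow> real" where
  "kern q r A v = (A powr q + A powr r) * (inverse (norm v ^ DIM('a)) * min (A * norm v) (inverse (A * norm v)))"

lemma kern_nonneg: "0 \<le> A \<Longrightarrow> 0 \<le> kern q r A v"
  unfolding kern_def by (intro mult_nonneg_nonneg) auto

lemma borel_measurable_kern [measurable]:
  assumes [measurable]: "f \<in> borel_measurable M" "h \<in> borel_measurable M"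
  shows "(\<lambda>z. kern q r (f z) (h z :: 'a::euclidean_space)) \<in> borel_measurable M"
  unfolding kern_def by measurable

text \<open>In terms of \<open>\<tau> = A * norm v\<close> the left side is at most
  \<open>min 1 (\<tau> powr (p + 1)) * \<tau> powr (- p) * A powr p\<close> times the weight. The
  first two factors give \<tau> as long as \<open>\<tau> \<le> 1\<close> and at most
  \<open>1 / \<tau>\<close> beyond, since \<open>p > 1\<close>; \<open>A powr p\<close> is below one
  of the extreme powers according to whether \<open>A \<le> 1\<close>.\<close>

lemma powr_le_kern:
  fixes v :: "'a::euclidean_space"
  assumes p: "1 < q" "q \<le> p" "p \<le> r" and T: "0 \<le> T" "T \<le> A * norm v" and v: "v \<noteq> 0" and A: "0 \<le> A"
  shows "min 1 (T powr (p + 1)) / norm v powr (real DIM('a) + p) \<le> kern q r A v"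
proof (cases "A = 0")
  case True
  then have "T = 0" using T by simp
  then show ?thesis using kern_nonneg[OF A, of q r v] by simp
next
  case False
  then have A: "0 < A" using assms by simp
  let ?s = "norm v"
  have s: "0 < ?s" using v by simp
  define \<tau> where "\<tau> = A * ?s"
  have \<tau>: "0 < \<tau>" using A s by (simp add: \<tau>_def)
  have 1: "min 1 (T powr (p + 1)) \<le> min 1 (\<tau> powr (p + 1))"
    using T p by (intro min.mono powr_mono2) (auto simp: \<tau>_def)
  have 2: "min 1 (\<tau> powr (p + 1)) * \<tau> powr (- p) \<le> min \<tau> (inverse \<tau>)"
  proof (cases "\<tau> \<le> 1")
    case True
    have "\<tau> powr (p + 1) * \<tau> powr (- p) = \<tau>" using \<tau> by (simp flip: powr_add)
    moreover have "min 1 (\<tau> powr (p + 1)) * \<tau> powr (- p) \<le> \<tau> powr (p + 1) * \<tau> powr (- p)"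
      by (intro mult_right_mono) auto
    moreover have "\<tau> \<le> inverse \<tau>" using True \<tau> by (simp add: field_simps mult_le_one)
    ultimately show ?thesis by simp
  next
    case False
    have "min 1 (\<tau> powr (p + 1)) * \<tau> powr (- p) \<le> 1 * \<tau> powr (- p)"
      by (intro mult_right_mono) auto
    also have "\<dots> \<le> \<tau> powr (- 1)" unfolding mult_1_left using False p by (intro powr_mono) auto
    also have "\<dots> = inverse \<tau>" using \<tau> by (simp add: powr_minus)
    finally have "min 1 (\<tau> powr (p + 1)) * \<tau> powr (- p) \<le> inverse \<tau>" .
    moreover have "inverse \<tau> \<le> \<tau>" using False \<tau> by (smt (verit) inverse_le_1_iff)
    ultimately show ?thesis by simp
  qed
  have 3: "A powr p \<le> A powr q + A powr r"
  proof (cases "A \<le> 1")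
    case True
    then have "A powr p \<le> A powr q" using A p by (simp add: powr_mono')
    then show ?thesis by (simp add: add_increasing2)
  next
    case False
    then have "A powr p \<le> A powr r" using p by (simp add: powr_mono)
    then show ?thesis by (simp add: add_increasing)
  qed
  have "min 1 (T powr (p + 1)) / ?s powr (real DIM('a) + p) \<le> min 1 (\<tau> powr (p + 1)) / ?s powr (real DIM('a) + p)"
    using 1 by (intro divide_right_mono) auto
  also have "\<dots> = min 1 (\<tau> powr (p + 1)) * \<tau> powr (- p) * (A powr p * inverse (?s ^ DIM('a)))"
  proof -
    have "\<tau> powr (- p) = inverse (A powr p) * inverse (?s powr p)"
      using A s by (simp add: \<tau>_def powr_minus powr_mult)
    moreover have "?s powr (real DIM('a) + p) = ?s ^ DIM('a) * ?s powr p"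
      using s by (simp add: powr_add powr_realpow)
    ultimately show ?thesis using A s by (simp add: field_simps)
  qed
  also have "\<dots> \<le> min \<tau> (inverse \<tau>) * ((A powr q + A powr r) * inverse (?s ^ DIM('a)))"
    using 2 3 \<tau> s by (intro mult_mono mult_right_mono mult_nonneg_nonneg) auto
  also have "\<dots> = kern q r A v" by (simp add: kern_def \<tau>_def mult_ac)
  finally show ?thesis .
qed

definition kern_const :: "'a::euclidean_space itself \<Rightarrow> ennreal" where
  "kern_const _ = (\<integral>\<^sup>+v. ennreal (inverse (norm (v::'a) ^ DIM('a)) * min (norm v) (inverse (norm v))) \<partial>lborel)"

lemma nn_integral_kern:
  assumes A: "0 \<le> A"
  shows "(\<integral>\<^sup>+v. ennreal (kern q r A (v::'a::euclidean_space)) \<partial>lborel) = ennreal (A powr q + A powr r) * kern_const TYPE('a)"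
proof (cases "A = 0")
  case True
  then show ?thesis by (simp add: kern_def)
next
  case False
  then have A: "0 < A" using A by simp
  let ?f = "\<lambda>v::'a. ennreal (inverse (norm v ^ DIM('a)) * min (norm v) (inverse (norm v)))"
  have "ennreal (kern q r A v) = ennreal (A powr q + A powr r) * (ennreal (A ^ DIM('a)) * ?f (0 + A *\<^sub>R v))" for v :: 'a
  proof -
    have "kern q r A v = (A powr q + A powr r) * (A ^ DIM('a) * (inverse (norm (A *\<^sub>R v) ^ DIM('a)) * min (norm (A *\<^sub>R v)) (inverse (norm (A *\<^sub>R v)))))"
      using A by (simp add: kern_def power_mult_distrib)
    also have "ennreal \<dots> = ennreal (A powr q + A powr r) * (ennreal (A ^ DIM('a)) * ?f (A *\<^sub>R v))"
      using A by (subst ennreal_mult, simp, simp, subst ennreal_mult) auto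
    finally show ?thesis by simp
  qed
  then have "(\<integral>\<^sup>+v. ennreal (kern q r A (v::'a)) \<partial>lborel) =
      ennreal (A powr q + A powr r) * (ennreal (A ^ DIM('a)) * (\<integral>\<^sup>+v. ?f (0 + A *\<^sub>R v) \<partial>lborel))"
    by (simp add: nn_integral_cmult)
  also have "ennreal (A ^ DIM('a)) * (\<integral>\<^sup>+v. ?f (0 + A *\<^sub>R v) \<partial>lborel) = kern_const TYPE('a)"
    unfolding kern_const_def by (rule nn_integral_lborel_affine) (use A in auto)
  finally show ?thesis .
qed

text \<open>In polar coordinates the weight cancels the Jacobian up to \<open>1 / s\<close>, leaving
  an integrand at most 1 for \<open>s \<le> 1\<close> and at most \<open>1 / s^2\<close>
  beyond.\<close>

lemma kern_const_finite: "kern_const TYPE('a::euclidean_space) < \<infinity>"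
proof -
  let ?n = "DIM('a)"
  let ?h = "\<lambda>s::real. indicator {0..1} s + ennreal (real 1 * inverse (s ^ Suc 1)) * indicator {1<..} s"
  have "kern_const TYPE('a) = (\<integral>\<^sup>+\<omega>. (\<integral>\<^sup>+s. ennreal (s ^ (?n - 1)) * ennreal (inverse (norm (s *\<^sub>R (\<omega>::'a)) ^ ?n) * min (norm (s *\<^sub>R \<omega>)) (inverse (norm (s *\<^sub>R \<omega>)))) * indicator {0<..} s \<partial>lborel) \<partial>sphere_measure)"
    unfolding kern_const_def by (rule nn_integral_polar) simp
  also have "\<dots> \<le> (\<integral>\<^sup>+\<omega>. (\<integral>\<^sup>+s. ?h s \<partial>lborel) \<partial>(sphere_measure :: 'a measure))"
  proof (rule nn_integral_mono_AE)
    show "AE \<omega> in (sphere_measure :: 'a measure). (\<integral>\<^sup>+s. ennreal (s ^ (?n - 1)) * ennreal (inverse (norm (s *\<^sub>R \<omega>) ^ ?n) * min (norm (s *\<^sub>R \<omega>)) (inverse (norm (s *\<^sub>R \<omega>)))) * indicator {0<..} s \<partial>lborel) \<le> (\<integral>\<^sup>+s. ?h s \<partial>lborel)"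
      using AE_sphere_measure
    proof eventually_elim
      case (elim \<omega>)
      show ?case
      proof (rule nn_integral_mono)
        fix s :: real
        show "ennreal (s ^ (?n - 1)) * ennreal (inverse (norm (s *\<^sub>R \<omega>) ^ ?n) * min (norm (s *\<^sub>R \<omega>)) (inverse (norm (s *\<^sub>R \<omega>)))) * indicator {0<..} s \<le> ?h s"
        proof (cases "0 < s")
          case True
          obtain m where m: "?n = Suc m" by (metis Suc_pred DIM_positive)
          have "ennreal (s ^ (?n - 1)) * ennreal (inverse (norm (s *\<^sub>R \<omega>) ^ ?n) * min (norm (s *\<^sub>R \<omega>)) (inverse (norm (s *\<^sub>R \<omega>)))) =
              ennreal (s ^ m * (inverse (s ^ Suc m) * min s (inverse s)))"
            using True elim unfolding m by (simp add: ennreal_mult)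
          also have "s ^ m * (inverse (s ^ Suc m) * min s (inverse s)) = inverse s * min s (inverse s)"
            using True by simp
          also have "ennreal \<dots> \<le> ?h s"
          proof (cases "s \<le> 1")
            case le: True
            have "inverse s * min s (inverse s) \<le> inverse s * s" using True by (intro mult_left_mono) auto
            then have "ennreal (inverse s * min s (inverse s)) \<le> 1" using True by simp
            then show ?thesis using True le by simp
          next
            case False
            have "inverse s * min s (inverse s) \<le> inverse s * inverse s" using True by (intro mult_left_mono) auto
            then show ?thesis using False by (simp add: ennreal_leI)
          qed
          finally show ?thesis using True by simp
        qed simp
      qed
    qed
  qed
  also have "(\<integral>\<^sup>+s. ?h s \<partial>lborel) = 1 + ennreal (inverse (1 ^ 1))"
    by (subst nn_integral_add, simp, simp, subst nn_integral_inverse_power_tail) simp_all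
  also have "(\<integral>\<^sup>+\<omega>. 1 + ennreal (inverse (1 ^ 1)) \<partial>(sphere_measure :: 'a measure)) < \<infinity>"
    by (simp add: emeasure_sphere_measure_UNIV ennreal_mult_less_top)
  finally show ?thesis .
qed

section \<open>The functional in the Borel setting\<close>

definition lam_kernel :: "('a::euclidean_space \<Rightarrow> real) \<Rightarrow> ('a \<Rightarrow> real \<Rightarrow> real) \<Rightarrow> real \<Rightarrow> ('a \<Rightarrow> real) \<Rightarrow> 'a \<Rightarrow> 'a \<Rightarrow> ennreal" where
  "lam_kernel p \<phi> \<delta> u x y = ennreal (\<delta> powr p x * \<phi> x (\<bar>u x - u y\<bar> / \<delta>) / norm (x - y) powr (real DIM('a) + p x))"

text \<open>The setting after passing to Borel representatives: the bounds on the exponent and on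
  \<phi> hold at every point of \<Omega>, and only the Lipschitz-type estimate keeps its null sets.
  \<open>G\<close> will be a multiple of the maximal function of the gradient.\<close>

locale nonlocal_data =
  fixes \<Omega> :: "'a::euclidean_space set" and p u G :: "'a \<Rightarrow> real" and \<phi> :: "'a \<Rightarrow> real \<Rightarrow> real" and q r c :: real
  assumes \<Omega>: "open \<Omega>" "emeasure lborel \<Omega> < \<infinity>"
    and p [measurable]: "p \<in> borel_measurable borel" and u [measurable]: "u \<in> borel_measurable borel"
    and G [measurable]: "G \<in> borel_measurable borel"
    and \<phi> [measurable]: "case_prod \<phi> \<in> borel_measurable (borel \<Otimes>\<^sub>M borel)"
    and p_bounds: "1 < q" "\<And>x. x \<in> \<Omega> \<Longrightarrow> q \<le> p x \<and> p x \<le> r"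
    and G0: "\<And>x. 0 \<le> G x" and c: "0 \<le> c"
    and \<phi>_le: "\<And>x t. x \<in> \<Omega> \<Longrightarrow> 0 \<le> t \<Longrightarrow> 0 \<le> \<phi> x t \<and> \<phi> x t \<le> c * min 1 (t powr (p x + 1))"
    and lip: "AE x in lborel. x \<in> \<Omega> \<longrightarrow> (AE y in lborel. y \<in> \<Omega> \<longrightarrow> \<bar>u x - u y\<bar> \<le> norm (x - y) * (G x + G y))"
    and G_int: "(\<integral>\<^sup>+x\<in>\<Omega>. ennreal ((2 * G x) powr q + (2 * G x) powr r) \<partial>lborel) < \<infinity>"
begin

lemma measurable_\<Omega> [measurable]: "\<Omega> \<in> sets borel"
  using \<Omega> by simp

lemma borel_measurable_\<phi> [measurable]:
  assumes [measurable]: "f \<in> M \<rightarrow>\<^sub>M borel" "h \<in> M \<rightarrow>\<^sub>M borel"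
  shows "(\<lambda>z. \<phi> (f z) (h z)) \<in> borel_measurable M"
  using measurable_compose[OF measurable_Pair[OF assms] \<phi>] by simp

lemma borel_measurable_lam_kernel [measurable]:
  assumes [measurable]: "f \<in> M \<rightarrow>\<^sub>M borel" "h \<in> M \<rightarrow>\<^sub>M borel"
  shows "(\<lambda>z. lam_kernel p \<phi> \<delta> u (f z) (h z)) \<in> borel_measurable M"
  unfolding lam_kernel_def by measurable

text \<open>Rescaling by \<delta> absorbs \<open>\<delta> powr p x\<close> and leaves only the
  Jacobian \<open>inverse (\<delta> ^ DIM('a))\<close>, so the integral of the bound does not depend
  on \<delta>.\<close>

lemma lam_kernel_le:
  assumes x: "x \<in> \<Omega>" and ne: "x \<noteq> y" and \<delta>: "0 < \<delta>" and A: "\<bar>u x - u y\<bar> \<le> norm (x - y) * A" "0 \<le> A"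
  shows "lam_kernel p \<phi> \<delta> u x y \<le> ennreal (c * (inverse (\<delta> ^ DIM('a)) * kern q r A ((y - x) /\<^sub>R \<delta>)))"
  unfolding lam_kernel_def
proof (rule ennreal_leI)
  let ?T = "\<bar>u x - u y\<bar> / \<delta>" and ?v = "(y - x) /\<^sub>R \<delta>"
  have nv: "norm ?v = norm (x - y) / \<delta>" using \<delta> by (simp add: norm_minus_commute divide_inverse mult.commute)
  have d: "norm (x - y) powr (real DIM('a) + p x) = \<delta> ^ DIM('a) * \<delta> powr p x * norm ?v powr (real DIM('a) + p x)"
  proof -
    have "norm (x - y) = \<delta> * norm ?v" using nv \<delta> by simp
    then show ?thesis using \<delta> by (simp add: powr_mult powr_add powr_realpow del: norm_scaleR)
  qed
  have "\<phi> x ?T \<le> c * min 1 (?T powr (p x + 1))" using \<phi>_le[OF x, of ?T] \<delta> by simp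
  then have "\<delta> powr p x * \<phi> x ?T / norm (x - y) powr (real DIM('a) + p x) \<le>
      \<delta> powr p x * (c * min 1 (?T powr (p x + 1))) / norm (x - y) powr (real DIM('a) + p x)"
    by (intro divide_right_mono mult_left_mono) auto
  also have "\<dots> = c * (inverse (\<delta> ^ DIM('a)) * (min 1 (?T powr (p x + 1)) / norm ?v powr (real DIM('a) + p x)))"
    unfolding d using \<delta> by (simp add: field_simps del: norm_scaleR)
  also have "\<dots> \<le> c * (inverse (\<delta> ^ DIM('a)) * kern q r A ?v)"
  proof (intro mult_left_mono powr_le_kern)
    have "\<bar>u x - u y\<bar> / \<delta> \<le> norm (x - y) * A / \<delta>" using A \<delta> by (intro divide_right_mono) auto
    then show "?T \<le> A * norm ?v" unfolding nv by (simp add: mult.commute)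
  qed (use p_bounds x ne \<delta> A c in auto)
  finally show "\<delta> powr p x * \<phi> x ?T / norm (x - y) powr (real DIM('a) + p x) \<le> c * (inverse (\<delta> ^ DIM('a)) * kern q r A ?v)" .
qed

lemma nn_integral_kern_scaled:
  fixes x :: 'a
  assumes "0 < \<delta>" "0 \<le> A"
  shows "(\<integral>\<^sup>+y. ennreal (inverse (\<delta> ^ DIM('a)) * kern q r A ((y - x) /\<^sub>R \<delta>)) \<partial>lborel) = ennreal (A powr q + A powr r) * kern_const TYPE('a)"
proof -
  have eq: "(x + \<delta> *\<^sub>R v - x) /\<^sub>R \<delta> = v" for v using assms by simp
  have "(\<integral>\<^sup>+y. ennreal (inverse (\<delta> ^ DIM('a)) * kern q r A ((y - x) /\<^sub>R \<delta>)) \<partial>lborel) =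
    ennreal (\<delta> ^ DIM('a)) * (\<integral>\<^sup>+v. ennreal (inverse (\<delta> ^ DIM('a)) * kern q r A ((x + \<delta> *\<^sub>R v - x) /\<^sub>R \<delta>)) \<partial>lborel)"
    by (rule nn_integral_lborel_affine[where f = "\<lambda>y. ennreal (inverse (\<delta> ^ DIM('a)) * kern q r A ((y - x) /\<^sub>R \<delta>))" and a = x and c = \<delta>, symmetric]) (use assms in auto)
  also have "\<dots> = ennreal (\<delta> ^ DIM('a)) * (ennreal (inverse (\<delta> ^ DIM('a))) * (\<integral>\<^sup>+v. ennreal (kern q r A (v::'a)) \<partial>lborel))"
    unfolding eq using assms by (simp add: ennreal_mult' nn_integral_cmult)
  also have "\<dots> = (\<integral>\<^sup>+v. ennreal (kern q r A (v::'a)) \<partial>lborel)"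
    using assms by (simp add: mult.assoc[symmetric] ennreal_mult'[symmetric])
  also have "\<dots> = ennreal (A powr q + A powr r) * kern_const TYPE('a)"
    by (rule nn_integral_kern) (use assms in auto)
  finally show ?thesis .
qed

lemma kern_minus: "kern q r A ((y - x) /\<^sub>R \<delta>) = kern q r A ((x - y) /\<^sub>R \<delta>)" for x y :: 'a
  by (simp add: kern_def norm_minus_commute)

text \<open>As \<open>G\<close> is nonnegative, the level \<open>- 1\<close> gives the full
  integral; in this way the tail estimate also contains the uniform bound.\<close>

definition tail :: "real \<Rightarrow> ennreal" where
  "tail K = (\<integral>\<^sup>+x. indicator {x\<in>\<Omega>. K < G x} x * ennreal ((2 * G x) powr q + (2 * G x) powr r) \<partial>lborel)"

text \<open>Each pair is charged to the point where \<open>G\<close> is larger, and the other variable is integrated first.\<close>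

lemma nn_integral_lam_kernel_tail:
  assumes \<delta>: "0 < \<delta>"
  shows "(\<integral>\<^sup>+x. (\<integral>\<^sup>+y. indicator \<Omega> x * indicator \<Omega> y * indicator {(x, y). K < G x \<or> K < G y} (x, y) * lam_kernel p \<phi> \<delta> u x y \<partial>lborel) \<partial>lborel)
    \<le> ennreal (2 * c) * kern_const TYPE('a) * tail K"
proof -
  define W where "W x = indicator {x\<in>\<Omega>. K < G x} x * ennreal c" for x
  define k where "k A x y = ennreal (inverse (\<delta> ^ DIM('a)) * kern q r A ((y - x) /\<^sub>R \<delta>))" for A and x y :: 'a
  have [measurable]: "W \<in> borel_measurable borel" unfolding W_def by measurable
  have [measurable]: "(\<lambda>z. k (f z) (g z) (h z)) \<in> borel_measurable M"
    if [measurable]: "f \<in> borel_measurable M" "g \<in> borel_measurable M" "h \<in> borel_measurable M" for f g h and M :: "'c measure"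
    unfolding k_def by measurable
  have bound: "indicator \<Omega> x * indicator \<Omega> y * indicator {(x, y). K < G x \<or> K < G y} (x, y) * lam_kernel p \<phi> \<delta> u x y \<le>
      W x * k (2 * G x) x y + W y * k (2 * G y) x y"
    if xy: "x \<in> \<Omega>" "y \<in> \<Omega>" "x \<noteq> y" and l: "\<bar>u x - u y\<bar> \<le> norm (x - y) * (G x + G y)" for x y
  proof (cases "K < G x \<or> K < G y")
    case True
    have ck: "ennreal (c * (inverse (\<delta> ^ DIM('a)) * kern q r A ((y - x) /\<^sub>R \<delta>))) = ennreal c * k A x y" for A
      unfolding k_def using c by (rule ennreal_mult')
    show ?thesis
    proof (cases "G y \<le> G x")
      case le: True
      have "\<bar>u x - u y\<bar> \<le> norm (x - y) * (2 * G x)"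
        using l le by (elim order_trans) (intro mult_left_mono, auto)
      from lam_kernel_le[OF xy(1,3) \<delta> this] G0[of x]
      have "lam_kernel p \<phi> \<delta> u x y \<le> ennreal c * k (2 * G x) x y" by (simp add: ck)
      moreover have "W x = ennreal c" using True le xy by (auto simp: W_def)
      ultimately show ?thesis using xy True by (simp add: add_increasing2)
    next
      case le: False
      have "\<bar>u x - u y\<bar> \<le> norm (x - y) * (2 * G y)"
        using l le by (elim order_trans) (intro mult_left_mono, auto)
      from lam_kernel_le[OF xy(1,3) \<delta> this] G0[of y]
      have "lam_kernel p \<phi> \<delta> u x y \<le> ennreal c * k (2 * G y) x y" by (simp add: ck)
      moreover have "W y = ennreal c" using True le xy by (auto simp: W_def)
      ultimately show ?thesis using xy True by (simp add: add_increasing)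
    qed
  qed simp
  have tailW: "(\<integral>\<^sup>+x. W x * (ennreal ((2 * G x) powr q + (2 * G x) powr r) * kern_const TYPE('a)) \<partial>lborel) =
      ennreal c * kern_const TYPE('a) * tail K"
    unfolding tail_def W_def
    by (subst nn_integral_cmult[symmetric]) (auto intro!: nn_integral_cong simp: mult_ac)
  have "(\<integral>\<^sup>+x. (\<integral>\<^sup>+y. indicator \<Omega> x * indicator \<Omega> y * indicator {(x, y). K < G x \<or> K < G y} (x, y) * lam_kernel p \<phi> \<delta> u x y \<partial>lborel) \<partial>lborel)
    \<le> (\<integral>\<^sup>+x. (\<integral>\<^sup>+y. W x * k (2 * G x) x y + W y * k (2 * G y) x y \<partial>lborel) \<partial>lborel)"
  proof (rule nn_integral_mono_AE)
    show "AE x in lborel. (\<integral>\<^sup>+y. indicator \<Omega> x * indicator \<Omega> y * indicator {(x, y). K < G x \<or> K < G y} (x, y) * lam_kernel p \<phi> \<delta> u x y \<partial>lborel)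
      \<le> (\<integral>\<^sup>+y. W x * k (2 * G x) x y + W y * k (2 * G y) x y \<partial>lborel)"
      using lip
    proof eventually_elim
      case (elim x)
      show ?case
      proof (cases "x \<in> \<Omega>")
        case True
        show ?thesis
        proof (rule nn_integral_mono_AE)
          have "AE y in lborel. y \<in> \<Omega> \<longrightarrow> \<bar>u x - u y\<bar> \<le> norm (x - y) * (G x + G y)"
            using elim True by simp
          moreover have "AE y in lborel. y \<noteq> x" by (rule AE_lborel_singleton)
          ultimately show "AE y in lborel. indicator \<Omega> x * indicator \<Omega> y * indicator {(x, y). K < G x \<or> K < G y} (x, y) * lam_kernel p \<phi> \<delta> u x y
            \<le> W x * k (2 * G x) x y + W y * k (2 * G y) x y"
          proof eventually_elim
            case (elim y)
            then show ?case using bound[OF True, of y] by (cases "y \<in> \<Omega>") auto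
          qed
        qed
      qed simp
    qed
  qed
  also have "\<dots> = (\<integral>\<^sup>+x. (\<integral>\<^sup>+y. W x * k (2 * G x) x y \<partial>lborel) + (\<integral>\<^sup>+y. W y * k (2 * G y) x y \<partial>lborel) \<partial>lborel)"
    by (intro nn_integral_cong nn_integral_add) measurable
  also have "\<dots> = (\<integral>\<^sup>+x. (\<integral>\<^sup>+y. W x * k (2 * G x) x y \<partial>lborel) \<partial>lborel) + (\<integral>\<^sup>+x. (\<integral>\<^sup>+y. W y * k (2 * G y) x y \<partial>lborel) \<partial>lborel)"
    by (intro nn_integral_add) measurable
  also have "(\<integral>\<^sup>+x. (\<integral>\<^sup>+y. W y * k (2 * G y) x y \<partial>lborel) \<partial>lborel) = (\<integral>\<^sup>+y. (\<integral>\<^sup>+x. W y * k (2 * G y) x y \<partial>lborel) \<partial>lborel)"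
    by (rule lborel_pair.Fubini') measurable
  also have "\<dots> = (\<integral>\<^sup>+y. W y * (ennreal ((2 * G y) powr q + (2 * G y) powr r) * kern_const TYPE('a)) \<partial>lborel)"
  proof (rule nn_integral_cong)
    fix y :: 'a
    have "(\<integral>\<^sup>+x. W y * k (2 * G y) x y \<partial>lborel) = W y * (\<integral>\<^sup>+x. k (2 * G y) x y \<partial>lborel)"
      by (rule nn_integral_cmult) measurable
    also have "(\<integral>\<^sup>+x. k (2 * G y) x y \<partial>lborel) = ennreal ((2 * G y) powr q + (2 * G y) powr r) * kern_const TYPE('a)"
      unfolding k_def kern_minus[where y = y] by (rule nn_integral_kern_scaled) (use \<delta> G0 in auto)
    finally show "(\<integral>\<^sup>+x. W y * k (2 * G y) x y \<partial>lborel) = W y * (ennreal ((2 * G y) powr q + (2 * G y) powr r) * kern_const TYPE('a))" .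
  qed
  also have "(\<integral>\<^sup>+x. (\<integral>\<^sup>+y. W x * k (2 * G x) x y \<partial>lborel) \<partial>lborel) = (\<integral>\<^sup>+x. W x * (ennreal ((2 * G x) powr q + (2 * G x) powr r) * kern_const TYPE('a)) \<partial>lborel)"
  proof (rule nn_integral_cong)
    fix x :: 'a
    have "(\<integral>\<^sup>+y. W x * k (2 * G x) x y \<partial>lborel) = W x * (\<integral>\<^sup>+y. k (2 * G x) x y \<partial>lborel)"
      by (rule nn_integral_cmult) measurable
    also have "(\<integral>\<^sup>+y. k (2 * G x) x y \<partial>lborel) = ennreal ((2 * G x) powr q + (2 * G x) powr r) * kern_const TYPE('a)"
      unfolding k_def by (rule nn_integral_kern_scaled) (use \<delta> G0 in auto)
    finally show "(\<integral>\<^sup>+y. W x * k (2 * G x) x y \<partial>lborel) = W x * (ennreal ((2 * G x) powr q + (2 * G x) powr r) * kern_const TYPE('a))" .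
  qed
  finally show ?thesis
    unfolding tailW using c by (simp add: mult_2[symmetric] mult.assoc ennreal_mult)
qed

lemma tail_tendsto_0: "(\<lambda>m. tail (real m)) \<longlonglongrightarrow> 0"
proof -
  let ?w = "\<lambda>x. ennreal ((2 * G x) powr q + (2 * G x) powr r) * indicator \<Omega> x"
  have "(\<lambda>m. tail (real m)) \<longlonglongrightarrow> (\<integral>\<^sup>+x. 0 \<partial>(lborel :: 'a measure))"
    unfolding tail_def
  proof (rule nn_integral_dominated_convergence[where w = ?w])
    show "AE x in lborel. (\<lambda>m. indicator {x \<in> \<Omega>. real m < G x} x * ennreal ((2 * G x) powr q + (2 * G x) powr r)) \<longlonglongrightarrow> 0"
    proof (rule AE_I2)
      fix x
      have "eventually (\<lambda>m. G x \<le> real m) sequentially"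
        by (rule eventually_sequentiallyI[of "nat \<lceil>G x\<rceil>"]) linarith
      then have "eventually (\<lambda>m. indicator {x \<in> \<Omega>. real m < G x} x * ennreal ((2 * G x) powr q + (2 * G x) powr r) = 0) sequentially"
        by eventually_elim (simp add: indicator_def)
      then show "(\<lambda>m. indicator {x \<in> \<Omega>. real m < G x} x * ennreal ((2 * G x) powr q + (2 * G x) powr r)) \<longlonglongrightarrow> 0"
        by (rule tendsto_eventually)
    qed
  qed (use G_int in \<open>auto simp: indicator_def\<close>)
  then show ?thesis by simp
qed

end

section \<open>The limit\<close>

lemma borel_sandwich:
  fixes A :: "'a::euclidean_space set"
  assumes A: "A \<in> sets borel" "emeasure lborel A < \<infinity>" and e: "0 < e"
  obtains K U where "compact K" "open U" "K \<subseteq> A" "A \<subseteq> U" "emeasure lborel (U - K) \<le> ennreal e"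
proof -
  obtain U where U: "open U" "A \<subseteq> U" "emeasure lborel (U - A) < ennreal (e / 2)"
    using outer_regular_lborel[OF A(1), of "e / 2"] e by auto
  \<comment> \<open>Inner regularity is applied to a finite measure, Lebesgue measure restricted to
    \<open>A\<close>.\<close>
  let ?M = "density lborel (indicator A)"
  have M: "emeasure ?M B = emeasure lborel (A \<inter> B)" if "B \<in> sets borel" for B
    using that A(1) by (simp add: emeasure_density indicator_inter_arith[symmetric])
  have "emeasure ?M A = (SUP K \<in> {K. K \<subseteq> A \<and> compact K}. emeasure ?M K)"
    using A by (intro inner_regular) (auto simp: M)
  moreover have "emeasure ?M A \<noteq> \<infinity>" using A by (simp add: M)
  ultimately obtain K where K: "K \<subseteq> A" "compact K" "emeasure ?M A < emeasure ?M K + ennreal (e / 2)"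
  proof -
    assume that: "\<And>K. K \<subseteq> A \<Longrightarrow> compact K \<Longrightarrow> emeasure ?M A < emeasure ?M K + ennreal (e / 2) \<Longrightarrow> thesis"
      and 1: "emeasure ?M A = (SUP K \<in> {K. K \<subseteq> A \<and> compact K}. emeasure ?M K)" "emeasure ?M A \<noteq> \<infinity>"
    have ne: "{K. K \<subseteq> A \<and> compact K} \<noteq> {}" using compact_empty by blast
    have "0 < e / 2" using e by simp
    from SUP_approx_ennreal[OF this ne 1] show thesis using that by blast
  qed
  have Kb: "K \<in> sets borel" using K(2) by (simp add: borel_compact)
  have lt: "emeasure lborel A < emeasure lborel K + ennreal (e / 2)"
    using K A Kb by (simp add: M Int_absorb1)
  have Kfin: "emeasure lborel K \<noteq> \<infinity>" using emeasure_mono[OF K(1), of lborel] A by (auto simp: top_unique)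
  have K4: "emeasure lborel (A - K) \<le> ennreal (e / 2)"
  proof -
    have "emeasure lborel (A - K) = emeasure lborel A - emeasure lborel K"
      using A Kb K Kfin by (intro emeasure_Diff) auto
    also have "\<dots> \<le> (emeasure lborel K + ennreal (e / 2)) - emeasure lborel K"
      using lt by (intro ennreal_minus_mono) auto
    also have "\<dots> = ennreal (e / 2)" using Kfin by simp
    finally show ?thesis .
  qed
  have m: "U - A \<in> sets lborel" "A - K \<in> sets lborel" "U - K \<in> sets lborel"
    using U(1) Kb A(1) by auto
  have "emeasure lborel (U - K) \<le> emeasure lborel ((U - A) \<union> (A - K))"
    using m by (intro emeasure_mono) auto
  also have "\<dots> \<le> emeasure lborel (U - A) + emeasure lborel (A - K)"
    using m by (intro emeasure_subadditive)
  also have "\<dots> \<le> ennreal (e / 2) + ennreal (e / 2)"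
    using U(3) K4 by (intro add_mono) auto
  also have "\<dots> = ennreal e" using e by (simp flip: ennreal_plus)
  finally show ?thesis using that U K by blast
qed

text \<open>For an indicator, enclose \<open>A\<close> between a compact \<open>K\<close> and an
  open \<open>U\<close>. A shift that carries neither direction of \<open>K\<close> out of
  \<open>U\<close> can change membership in \<open>A\<close> only if one of the two points lies in
  \<open>U - K\<close>. Sums and dominated limits follow by splitting \<open>e\<close> into halves
  and thirds.\<close>

lemma L1_translation_continuity:
  fixes g :: "'a::euclidean_space \<Rightarrow> 'b::{banach, second_countable_topology}"
  assumes "integrable lborel g" and "0 < e"
  shows "\<exists>d>0. \<forall>h. norm h < d \<longrightarrow> (\<integral>\<^sup>+x. ennreal (norm (g (x + h) - g x)) \<partial>lborel) \<le> ennreal e"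
  using assms
proof (induction arbitrary: e rule: integrable_induct)
  case (base A c)
  have A [measurable]: "A \<in> sets borel" using base by simp
  \<comment> \<open>\<open>U - K\<close> is counted twice, once shifted; the added 1 keeps the
    denominator positive when \<open>c = 0\<close>.\<close>
  define e' where "e' = e / (2 * (norm c + 1))"
  have e': "0 < e'" using base by (simp add: e'_def add_nonneg_pos)
  obtain K U where KU: "compact K" "open U" "K \<subseteq> A" "A \<subseteq> U" "emeasure lborel (U - K) \<le> ennreal e'"
    using borel_sandwich[OF A _ e'] base by blast
  then obtain d where d: "0 < d" "(\<Union>x\<in>K. ball x d) \<subseteq> U"
    using compact_subset_open_imp_ball_epsilon_subset[of K U] by blast
  have [measurable]: "U - K \<in> sets borel" using KU by (auto simp: borel_compact)
  show ?case
  proof (intro exI[of _ d] conjI allI impI d(1))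
    fix h :: 'a assume h: "norm h < d"
    have near: "x + h \<in> U" "x - h \<in> U" if "x \<in> K" for x
      using that d(2) h by (auto simp: dist_norm intro!: subsetD[OF d(2)] bexI[of _ x])
    have pt: "ennreal (norm (indicator A (x + h) *\<^sub>R c - indicator A x *\<^sub>R c)) \<le>
      ennreal (norm c) * (indicator (U - K) x + indicator (U - K) (x + h))" for x
    proof (cases "x \<in> A \<longleftrightarrow> x + h \<in> A")
      case True
      then show ?thesis by (auto simp: indicator_def)
    next
      case False
      then have "x \<in> U - K \<or> x + h \<in> U - K"
        using near(1)[of x] near(2)[of "x + h"] KU(3,4) by auto
      then have "ennreal (norm c) * 1 \<le> ennreal (norm c) * (indicator (U - K) x + indicator (U - K) (x + h))"
        by (intro mult_left_mono) (auto simp: indicator_def)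
      moreover have "norm (indicator A (x + h) *\<^sub>R c - indicator A x *\<^sub>R c) = norm c"
        using False by (auto simp: indicator_def)
      ultimately show ?thesis by simp
    qed
    have "(\<integral>\<^sup>+x. ennreal (norm (indicator A (x + h) *\<^sub>R c - indicator A x *\<^sub>R c)) \<partial>lborel) \<le>
      (\<integral>\<^sup>+x. ennreal (norm c) * (indicator (U - K) x + indicator (U - K) (x + h)) \<partial>lborel)"
      by (intro nn_integral_mono pt)
    also have "\<dots> = ennreal (norm c) * ((\<integral>\<^sup>+x. indicator (U - K) x \<partial>lborel) + (\<integral>\<^sup>+x. indicator (U - K) (x + h) \<partial>lborel))"
      by (simp add: nn_integral_cmult nn_integral_add)
    also have "(\<integral>\<^sup>+x. indicator (U - K) (x + h) \<partial>lborel) = (\<integral>\<^sup>+x. indicator (U - K) x \<partial>lborel)"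
      by (rule nn_integral_lborel_plus) simp
    also have "(\<integral>\<^sup>+x. indicator (U - K) x \<partial>lborel) = emeasure lborel (U - K)" by simp
    also have "ennreal (norm c) * (emeasure lborel (U - K) + emeasure lborel (U - K)) \<le> ennreal (norm c) * (ennreal e' + ennreal e')"
      using KU(5) by (intro mult_left_mono add_mono) auto
    also have "\<dots> = ennreal (norm c * (2 * e'))"
      using e' by (simp add: ennreal_mult flip: ennreal_plus)
    also have "\<dots> \<le> ennreal e"
    proof (rule ennreal_leI)
      have "norm c * (2 * (e / (2 * N))) = e * (norm c / N)" for N by simp
      then have "norm c * (2 * e') = e * (norm c / (norm c + 1))" unfolding e'_def .
      also have "\<dots> \<le> e * 1" using base by (intro mult_left_mono) (auto simp: divide_le_eq add_nonneg_pos)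
      finally show "norm c * (2 * e') \<le> e" by simp
    qed
    finally show "(\<integral>\<^sup>+x. ennreal (norm (indicator A (x + h) *\<^sub>R c - indicator A x *\<^sub>R c)) \<partial>lborel) \<le> ennreal e" .
  qed
next
  case (add f g)
  have [measurable]: "f \<in> borel_measurable borel" "g \<in> borel_measurable borel"
    using add.hyps borel_measurable_integrable by fastforce+
  obtain d1 d2 where d: "0 < d1" "0 < d2"
    "\<And>h. norm h < d1 \<Longrightarrow> (\<integral>\<^sup>+x. ennreal (norm (f (x + h) - f x)) \<partial>lborel) \<le> ennreal (e / 2)"
    "\<And>h. norm h < d2 \<Longrightarrow> (\<integral>\<^sup>+x. ennreal (norm (g (x + h) - g x)) \<partial>lborel) \<le> ennreal (e / 2)"
    using add.IH[of "e / 2"] add.prems by auto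
  show ?case
  proof (intro exI[of _ "min d1 d2"] conjI allI impI)
    fix h :: 'a assume h: "norm h < min d1 d2"
    have "(\<integral>\<^sup>+x. ennreal (norm (f (x + h) + g (x + h) - (f x + g x))) \<partial>lborel) \<le>
      (\<integral>\<^sup>+x. ennreal (norm (f (x + h) - f x)) + ennreal (norm (g (x + h) - g x)) \<partial>lborel)"
      by (intro nn_integral_mono) (auto simp flip: ennreal_plus intro!: ennreal_leI simp: norm_diff_triangle_ineq)
    also have "\<dots> = (\<integral>\<^sup>+x. ennreal (norm (f (x + h) - f x)) \<partial>lborel) + (\<integral>\<^sup>+x. ennreal (norm (g (x + h) - g x)) \<partial>lborel)"
      by (rule nn_integral_add) measurable
    also have "\<dots> \<le> ennreal (e / 2) + ennreal (e / 2)"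
      using d h by (intro add_mono) auto
    also have "\<dots> = ennreal e" using add.prems by (simp flip: ennreal_plus)
    finally show "(\<integral>\<^sup>+x. ennreal (norm (f (x + h) + g (x + h) - (f x + g x))) \<partial>lborel) \<le> ennreal e" .
  qed (use d in auto)
next
  case (lim f s)
  have [measurable]: "f \<in> borel_measurable borel" "s i \<in> borel_measurable borel" for i
    using lim.hyps borel_measurable_integrable by fastforce+
  have fint: "(\<integral>\<^sup>+x. ennreal (3 * norm (f x)) \<partial>lborel) < \<infinity>"
    using integrable_mult_right[OF integrable_norm[OF lim.hyps(4)], of 3]
    unfolding integrable_iff_bounded by simp
  have "(\<lambda>i. \<integral>\<^sup>+x. ennreal (norm (f x - s i x)) \<partial>lborel) \<longlonglongrightarrow> (\<integral>\<^sup>+x. 0 \<partial>(lborel :: 'a measure))"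
  proof (rule nn_integral_dominated_convergence[where w = "\<lambda>x. ennreal (3 * norm (f x))"])
    show "AE x in lborel. ennreal (norm (f x - s i x)) \<le> ennreal (3 * norm (f x))" for i
    proof (intro AE_I2 ennreal_leI)
      fix x
      have "norm (f x - s i x) \<le> norm (f x) + norm (s i x)" by (rule norm_triangle_ineq4)
      then show "norm (f x - s i x) \<le> 3 * norm (f x)" using lim.hyps(3)[of x i] by simp
    qed
    show "AE x in lborel. (\<lambda>i. ennreal (norm (f x - s i x))) \<longlonglongrightarrow> 0"
    proof (rule AE_I2)
      fix x
      have "(\<lambda>i. norm (f x - s i x)) \<longlonglongrightarrow> norm (f x - f x)"
        using lim.hyps(2)[of x] by (intro tendsto_intros) auto
      then show "(\<lambda>i. ennreal (norm (f x - s i x))) \<longlonglongrightarrow> 0"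
        using tendsto_ennrealI by fastforce
    qed
  qed (use fint in auto)
  then have "(\<lambda>i. \<integral>\<^sup>+x. ennreal (norm (f x - s i x)) \<partial>lborel) \<longlonglongrightarrow> 0" by simp
  then have "eventually (\<lambda>i. (\<integral>\<^sup>+x. ennreal (norm (f x - s i x)) \<partial>lborel) < ennreal (e / 3)) sequentially"
    using lim.prems by (intro order_tendstoD(2)) auto
  then obtain i where i: "(\<integral>\<^sup>+x. ennreal (norm (f x - s i x)) \<partial>lborel) < ennreal (e / 3)"
    by (auto simp: eventually_sequentially)
  obtain d where d: "0 < d" "\<And>h. norm h < d \<Longrightarrow> (\<integral>\<^sup>+x. ennreal (norm (s i (x + h) - s i x)) \<partial>lborel) \<le> ennreal (e / 3)"
    using lim.IH[of "e / 3" i] lim.prems by auto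
  show ?case
  proof (intro exI[of _ d] conjI allI impI d(1))
    fix h :: 'a assume h: "norm h < d"
    have "(\<integral>\<^sup>+x. ennreal (norm (f (x + h) - f x)) \<partial>lborel) \<le>
      (\<integral>\<^sup>+x. ennreal (norm (f (x + h) - s i (x + h))) + (ennreal (norm (s i (x + h) - s i x)) + ennreal (norm (f x - s i x))) \<partial>lborel)"
    proof (rule nn_integral_mono)
      fix x
      have "norm (f (x + h) - f x) = norm ((f (x + h) - s i (x + h)) + ((s i (x + h) - s i x) - (f x - s i x)))" by simp
      also have "\<dots> \<le> norm (f (x + h) - s i (x + h)) + (norm (s i (x + h) - s i x) + norm (f x - s i x))"
        by (rule order_trans[OF norm_triangle_ineq add_left_mono[OF norm_triangle_ineq4]])
      finally show "ennreal (norm (f (x + h) - f x)) \<le> ennreal (norm (f (x + h) - s i (x + h))) + (ennreal (norm (s i (x + h) - s i x)) + ennreal (norm (f x - s i x)))"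
        by (simp flip: ennreal_plus add: ennreal_leI)
    qed
    also have "\<dots> = (\<integral>\<^sup>+x. ennreal (norm (f (x + h) - s i (x + h))) \<partial>lborel) +
        ((\<integral>\<^sup>+x. ennreal (norm (s i (x + h) - s i x)) \<partial>lborel) + (\<integral>\<^sup>+x. ennreal (norm (f x - s i x)) \<partial>lborel))"
      by (subst nn_integral_add, measurable, subst nn_integral_add, measurable)
    also have "(\<integral>\<^sup>+x. ennreal (norm (f (x + h) - s i (x + h))) \<partial>lborel) = (\<integral>\<^sup>+x. ennreal (norm (f x - s i x)) \<partial>lborel)"
      by (rule nn_integral_lborel_plus[of "\<lambda>x. ennreal (norm (f x - s i x))"]) measurable
    also have "(\<integral>\<^sup>+x. ennreal (norm (f x - s i x)) \<partial>lborel) + ((\<integral>\<^sup>+x. ennreal (norm (s i (x + h) - s i x)) \<partial>lborel) + (\<integral>\<^sup>+x. ennreal (norm (f x - s i x)) \<partial>lborel))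
       \<le> ennreal (e / 3) + (ennreal (e / 3) + ennreal (e / 3))"
      using i d(2)[OF h] by (intro add_mono) auto
    also have "\<dots> = ennreal e" using lim.prems by (simp flip: ennreal_plus)
    finally show "(\<integral>\<^sup>+x. ennreal (norm (f (x + h) - f x)) \<partial>lborel) \<le> ennreal e" .
  qed
qed

text \<open>By the segment formula the error is the mean over \<open>t\<close> of \<open>(g (x + t
  *\<^sub>R (\<delta> *\<^sub>R v)) - g x) \<bullet> v\<close>. For fixed \<open>v\<close> its
  integral in \<open>x\<close> is therefore controlled by the continuity of translations, uniformly
  for \<open>v\<close> in a ball.\<close>

lemma nn_integral_difference_quotient:
  fixes u :: "'a::euclidean_space \<Rightarrow> real"
  assumes \<Omega>: "open \<Omega>" and ug: "borel_weak_gradient \<Omega> u g" and g: "integrable lborel g"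
    and K: "compact K" "K \<subseteq> \<Omega>" and e: "0 < e"
  shows "eventually (\<lambda>\<delta>. (\<integral>\<^sup>+x. (\<integral>\<^sup>+v. indicator K x * indicator (cball 0 R) v *
      ennreal \<bar>(u (x + \<delta> *\<^sub>R v) - u x) / \<delta> - g x \<bullet> v\<bar> \<partial>lborel) \<partial>lborel) \<le> ennreal e) (at_right 0)"
proof -
  have [measurable]: "u \<in> borel_measurable borel" "g \<in> borel_measurable borel"
    using ug by (auto simp: borel_weak_gradient_def loc_int_def)
  have [measurable]: "K \<in> sets borel" using K by (simp add: borel_compact)
  have [measurable]: "cball 0 R \<in> sets (borel :: 'a measure)" by simp
  obtain b where b: "emeasure lborel (cball (0::'a) R) = ennreal b" "0 \<le> b"
  proof -
    have "emeasure lborel (cball (0::'a) R) \<le> emeasure lborel (ball (0::'a) (\<bar>R\<bar> + 1))"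
      by (intro emeasure_mono) auto
    then have "emeasure lborel (cball (0::'a) R) \<noteq> \<infinity>"
      using emeasure_ball_finite[of "0::'a" "\<bar>R\<bar> + 1"] by (auto simp: top_unique)
    then show ?thesis using that by (cases "emeasure lborel (cball (0::'a) R)") auto
  qed
  define e' where "e' = e / (\<bar>R\<bar> * b + 1)"
  have e': "0 < e'" using e b by (simp add: e'_def add_nonneg_pos)
  obtain d where d: "0 < d" "\<And>h. norm h < d \<Longrightarrow> (\<integral>\<^sup>+x. ennreal (norm (g (x + h) - g x)) \<partial>lborel) \<le> ennreal e'"
    using L1_translation_continuity[OF g e'] by blast
  obtain d' where d': "0 < d'" "(\<Union>x\<in>K. ball x d') \<subseteq> \<Omega>"
    using compact_subset_open_imp_ball_epsilon_subset[OF K(1) \<Omega> K(2)] by blast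
  define d0 where "d0 = min d d' / (\<bar>R\<bar> + 1)"
  have d0: "0 < d0" using d d' by (simp add: d0_def add_nonneg_pos)
  have "eventually (\<lambda>\<delta>. 0 < \<delta> \<and> \<delta> < d0) (at_right (0::real))"
    using eventually_at_right_real[OF d0] by (auto elim: eventually_mono)
  then show ?thesis
  proof eventually_elim
    case (elim \<delta>)
    then have \<delta>: "0 < \<delta>" "\<delta> < d0" by auto
    have small: "norm (t *\<^sub>R (\<delta> *\<^sub>R v)) < min d d'" if "v \<in> cball 0 R" "t \<in> {0..1}" for v :: 'a and t
    proof -
      have "norm (t *\<^sub>R (\<delta> *\<^sub>R v)) = t * (\<delta> * norm v)" using that \<delta> by simp
      also have "\<dots> \<le> 1 * (\<delta> * norm v)" using that \<delta> by (intro mult_right_mono) auto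
      also have "\<dots> \<le> \<delta> * \<bar>R\<bar>" using that \<delta> by simp
      also have "\<dots> \<le> \<delta> * (\<bar>R\<bar> + 1)" using \<delta> by (intro mult_left_mono) auto
      also have "\<dots> < d0 * (\<bar>R\<bar> + 1)" using \<delta> by (intro mult_strict_right_mono) auto
      also have "\<dots> = min d d'" by (simp add: d0_def)
      finally show ?thesis .
    qed
    have one: "(\<integral>\<^sup>+x. indicator K x * ennreal \<bar>(u (x + \<delta> *\<^sub>R v) - u x) / \<delta> - g x \<bullet> v\<bar> \<partial>lborel) \<le> ennreal (\<bar>R\<bar> * e')"
      if v: "v \<in> cball 0 R" for v
    proof -
      have "AE x in lborel. indicator K x * ennreal \<bar>(u (x + \<delta> *\<^sub>R v) - u x) / \<delta> - g x \<bullet> v\<bar> \<le>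
          (\<integral>\<^sup>+t. indicator {0..1} t * ennreal (\<bar>R\<bar> * norm (g (x + t *\<^sub>R (\<delta> *\<^sub>R v)) - g x)) \<partial>lborel)"
        using segment_formula[OF \<Omega> ug, of "\<delta> *\<^sub>R v"]
      proof eventually_elim
        case (elim x)
        show ?case
        proof (cases "x \<in> K")
          case True
          have "x \<in> seg_dom \<Omega> (\<delta> *\<^sub>R v)"
            unfolding seg_dom_def
          proof safe
            fix t :: real assume "t \<in> {0..1}"
            then have "x + t *\<^sub>R (\<delta> *\<^sub>R v) \<in> ball x d'" using small[OF v] by (simp add: dist_norm)
            then show "x + t *\<^sub>R \<delta> *\<^sub>R v \<in> \<Omega>" using d'(2) True by blast
          qed
          with elim have seg: "u (x + \<delta> *\<^sub>R v) - u x = (LINT t|lborel. indicator {0..1} t * (g (x + t *\<^sub>R (\<delta> *\<^sub>R v)) \<bullet> (\<delta> *\<^sub>R v)))"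
            by simp
          let ?J = "\<lambda>t. indicator {0..1} t * ((g (x + t *\<^sub>R (\<delta> *\<^sub>R v)) - g x) \<bullet> v)"
          show ?thesis
          proof (cases "integrable lborel (\<lambda>t. indicator {0..1} t * (g (x + t *\<^sub>R (\<delta> *\<^sub>R v)) \<bullet> v))")
            case int: True
            have int1: "integrable lborel (\<lambda>t. indicator {0..1::real} t * (g x \<bullet> v))"
              by (intro integrable_mult_left) simp
            have "(u (x + \<delta> *\<^sub>R v) - u x) / \<delta> = (LINT t|lborel. indicator {0..1} t * (g (x + t *\<^sub>R (\<delta> *\<^sub>R v)) \<bullet> v))"
              unfolding seg using \<delta> by (simp add: mult.left_commute)
            moreover have "g x \<bullet> v = (LINT t|lborel. indicator {0..1::real} t * (g x \<bullet> v))" by simp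
            ultimately have "(u (x + \<delta> *\<^sub>R v) - u x) / \<delta> - g x \<bullet> v = (LINT t|lborel. ?J t)"
              using Bochner_Integration.integral_diff[OF int int1] by (simp add: right_diff_distrib inner_diff_left)
            also have "ennreal \<bar>\<dots>\<bar> \<le> (\<integral>\<^sup>+t. ennreal \<bar>?J t\<bar> \<partial>lborel)"
              using integral_norm_bound_ennreal[of lborel ?J] Bochner_Integration.integrable_diff[OF int int1]
              by (simp add: right_diff_distrib inner_diff_left)
            also have "\<dots> \<le> (\<integral>\<^sup>+t. indicator {0..1} t * ennreal (\<bar>R\<bar> * norm (g (x + t *\<^sub>R (\<delta> *\<^sub>R v)) - g x)) \<partial>lborel)"
            proof (rule nn_integral_mono)
              fix t :: real
              have "\<bar>(g (x + t *\<^sub>R (\<delta> *\<^sub>R v)) - g x) \<bullet> v\<bar> \<le> norm (g (x + t *\<^sub>R (\<delta> *\<^sub>R v)) - g x) * norm v"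
                by (rule Cauchy_Schwarz_ineq2)
              also have "\<dots> \<le> norm (g (x + t *\<^sub>R (\<delta> *\<^sub>R v)) - g x) * \<bar>R\<bar>"
                using v by (intro mult_left_mono) auto
              finally show "ennreal \<bar>?J t\<bar> \<le> indicator {0..1} t * ennreal (\<bar>R\<bar> * norm (g (x + t *\<^sub>R (\<delta> *\<^sub>R v)) - g x))"
                by (auto simp: indicator_def mult.commute intro!: ennreal_leI)
            qed
            finally show ?thesis using True by simp
          next
            \<comment> \<open>The segment integral may be a default value here, but the right side
              is infinite: otherwise adding the constant \<open>g x \<bullet> v\<close> on the unit
              interval would restore integrability.\<close>
            case False
            have "(\<integral>\<^sup>+t. indicator {0..1} t * ennreal (\<bar>R\<bar> * norm (g (x + t *\<^sub>R (\<delta> *\<^sub>R v)) - g x)) \<partial>lborel) = \<infinity>"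
            proof (rule ccontr)
              assume "\<not> ?thesis"
              then have fin: "(\<integral>\<^sup>+t. indicator {0..1} t * ennreal (\<bar>R\<bar> * norm (g (x + t *\<^sub>R (\<delta> *\<^sub>R v)) - g x)) \<partial>lborel) < \<infinity>"
                by (simp add: less_top)
              have "integrable lborel ?J"
              proof (rule integrableI_bounded)
                have "(\<integral>\<^sup>+t. ennreal (norm (?J t)) \<partial>lborel) \<le> (\<integral>\<^sup>+t. indicator {0..1} t * ennreal (\<bar>R\<bar> * norm (g (x + t *\<^sub>R (\<delta> *\<^sub>R v)) - g x)) \<partial>lborel)"
                proof (rule nn_integral_mono)
                  fix t :: real
                  have "\<bar>(g (x + t *\<^sub>R (\<delta> *\<^sub>R v)) - g x) \<bullet> v\<bar> \<le> norm (g (x + t *\<^sub>R (\<delta> *\<^sub>R v)) - g x) * norm v"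
                    by (rule Cauchy_Schwarz_ineq2)
                  also have "\<dots> \<le> norm (g (x + t *\<^sub>R (\<delta> *\<^sub>R v)) - g x) * \<bar>R\<bar>"
                    using v by (intro mult_left_mono) auto
                  finally show "ennreal (norm (?J t)) \<le> indicator {0..1} t * ennreal (\<bar>R\<bar> * norm (g (x + t *\<^sub>R (\<delta> *\<^sub>R v)) - g x))"
                    by (auto simp: indicator_def mult.commute intro!: ennreal_leI)
                qed
                also note fin
                finally show "(\<integral>\<^sup>+t. ennreal (norm (?J t)) \<partial>lborel) < \<infinity>" .
              qed measurable
              moreover have "integrable lborel (\<lambda>t. indicator {0..1::real} t * (g x \<bullet> v))"
                by (intro integrable_mult_left) simp
              ultimately have "integrable lborel (\<lambda>t. ?J t + indicator {0..1::real} t * (g x \<bullet> v))"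
                by (rule Bochner_Integration.integrable_add)
              then show False using False by (simp add: inner_diff_left right_diff_distrib)
            qed
            then show ?thesis by simp
          qed
        qed simp
      qed
      then have "(\<integral>\<^sup>+x. indicator K x * ennreal \<bar>(u (x + \<delta> *\<^sub>R v) - u x) / \<delta> - g x \<bullet> v\<bar> \<partial>lborel) \<le>
          (\<integral>\<^sup>+x. (\<integral>\<^sup>+t. indicator {0..1} t * ennreal (\<bar>R\<bar> * norm (g (x + t *\<^sub>R (\<delta> *\<^sub>R v)) - g x)) \<partial>lborel) \<partial>lborel)"
        by (rule nn_integral_mono_AE)
      also have "\<dots> = (\<integral>\<^sup>+t. (\<integral>\<^sup>+x. indicator {0..1} t * ennreal (\<bar>R\<bar> * norm (g (x + t *\<^sub>R (\<delta> *\<^sub>R v)) - g x)) \<partial>lborel) \<partial>lborel)"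
        by (rule lborel_pair.Fubini') measurable
      also have "\<dots> \<le> (\<integral>\<^sup>+t. indicator {0..1::real} t * ennreal (\<bar>R\<bar> * e') \<partial>lborel)"
      proof (rule nn_integral_mono)
        fix t :: real
        show "(\<integral>\<^sup>+x. indicator {0..1} t * ennreal (\<bar>R\<bar> * norm (g (x + t *\<^sub>R (\<delta> *\<^sub>R v)) - g x)) \<partial>lborel) \<le> indicator {0..1} t * ennreal (\<bar>R\<bar> * e')"
        proof (cases "t \<in> {0..1}")
          case True
          have "(\<integral>\<^sup>+x. ennreal (\<bar>R\<bar> * norm (g (x + t *\<^sub>R (\<delta> *\<^sub>R v)) - g x)) \<partial>lborel) =
              ennreal \<bar>R\<bar> * (\<integral>\<^sup>+x. ennreal (norm (g (x + t *\<^sub>R (\<delta> *\<^sub>R v)) - g x)) \<partial>lborel)"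
            by (simp add: ennreal_mult' nn_integral_cmult)
          also have "\<dots> \<le> ennreal \<bar>R\<bar> * ennreal e'"
            using small[OF v True] by (intro mult_left_mono d(2)) auto
          also have "\<dots> = ennreal (\<bar>R\<bar> * e')" by (simp add: ennreal_mult')
          finally show ?thesis using True by simp
        qed simp
      qed
      also have "\<dots> = ennreal (\<bar>R\<bar> * e')" by (simp add: nn_integral_multc)
      finally show ?thesis .
    qed
    have "(\<integral>\<^sup>+x. (\<integral>\<^sup>+v. indicator K x * indicator (cball 0 R) v * ennreal \<bar>(u (x + \<delta> *\<^sub>R v) - u x) / \<delta> - g x \<bullet> v\<bar> \<partial>lborel) \<partial>lborel) =
      (\<integral>\<^sup>+v. (\<integral>\<^sup>+x. indicator K x * indicator (cball 0 R) v * ennreal \<bar>(u (x + \<delta> *\<^sub>R v) - u x) / \<delta> - g x \<bullet> v\<bar> \<partial>lborel) \<partial>lborel)"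
      by (rule lborel_pair.Fubini') measurable
    also have "\<dots> \<le> (\<integral>\<^sup>+v. ennreal (\<bar>R\<bar> * e') * indicator (cball (0::'a) R) v \<partial>lborel)"
    proof (rule nn_integral_mono)
      fix v :: 'a
      show "(\<integral>\<^sup>+x. indicator K x * indicator (cball 0 R) v * ennreal \<bar>(u (x + \<delta> *\<^sub>R v) - u x) / \<delta> - g x \<bullet> v\<bar> \<partial>lborel) \<le> ennreal (\<bar>R\<bar> * e') * indicator (cball 0 R) v"
        using one[of v] by (cases "v \<in> cball 0 R") simp_all
    qed
    also have "\<dots> = ennreal (\<bar>R\<bar> * e') * ennreal b"
      using b by (subst nn_integral_cmult_indicator) auto
    also have "\<dots> = ennreal (\<bar>R\<bar> * e' * b)" using b by (simp add: ennreal_mult'')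
    also have "\<dots> \<le> ennreal e"
    proof (rule ennreal_leI)
      have "\<bar>R\<bar> * e' * b = e * (\<bar>R\<bar> * b / (\<bar>R\<bar> * b + 1))" by (simp add: e'_def)
      also have "\<dots> \<le> e * 1" using e b by (intro mult_left_mono) (auto simp: divide_le_eq add_nonneg_pos)
      finally show "\<bar>R\<bar> * e' * b \<le> e" by simp
    qed
    finally show ?case .
  qed
qed

lemma AE_lborel_affine:
  fixes P :: "'a::euclidean_space \<Rightarrow> bool"
  assumes [measurable]: "Measurable.pred borel P" and "AE y in lborel. P y" and c: "0 < c"
  shows "AE v in lborel. P (a + c *\<^sub>R v)"
proof -
  have "(\<integral>\<^sup>+y. indicator {y. \<not> P y} y \<partial>lborel) = 0"
    using assms(2) by (subst (asm) AE_iff_nn_integral) auto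
  then have "ennreal (c ^ DIM('a)) * (\<integral>\<^sup>+v. indicator {y. \<not> P y} (a + c *\<^sub>R v) \<partial>lborel) = 0"
    by (subst nn_integral_lborel_affine) (use c in auto)
  then have "(\<integral>\<^sup>+v. indicator {y. \<not> P y} (a + c *\<^sub>R v) \<partial>lborel) = 0"
    using c by simp
  moreover have "(\<lambda>v. indicator {y. \<not> P y} (a + c *\<^sub>R v)) = (indicator {v. \<not> P (a + c *\<^sub>R v)} :: 'a \<Rightarrow> ennreal)"
    by (auto simp: indicator_def)
  ultimately show ?thesis
    by (subst AE_iff_nn_integral) auto
qed

text \<open>A failing limit yields arguments tending to 0 whose values avoid a neighbourhood of
  \<open>l\<close>, and the \<open>m\<close>-th argument may be taken so small that
  \<open>E m\<close> holds as well. With \<open>E m\<close> bounding an integral error by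
  \<open>(1/2) ^ Suc m\<close>, the errors become summable, and pointwise convergence holds along
  the whole sequence.\<close>

lemma tendsto_at_rightI_sequence:
  fixes f :: "real \<Rightarrow> 'b::topological_space"
  assumes E: "\<And>m. eventually (E m) (at_right 0)"
    and seq: "\<And>d. (\<And>m. 0 < d m) \<Longrightarrow> d \<longlonglongrightarrow> 0 \<Longrightarrow> (\<And>m::nat. E m (d m)) \<Longrightarrow> (\<lambda>m. f (d m)) \<longlonglongrightarrow> l"
  shows "(f \<longlongrightarrow> l) (at_right 0)"
proof (rule ccontr)
  assume "\<not> ?thesis"
  then obtain S where S: "open S" "l \<in> S" "\<not> eventually (\<lambda>x. f x \<in> S) (at_right 0)"
    by (auto simp: tendsto_def)
  then have fr: "frequently (\<lambda>x. f x \<notin> S) (at_right 0)" by (simp add: frequently_def)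
  have "\<exists>d. f d \<notin> S \<and> E m d \<and> 0 < d \<and> d < inverse (real (Suc m))" for m
  proof -
    have "eventually (\<lambda>d. 0 < d \<and> d < inverse (real (Suc m))) (at_right 0)"
      using eventually_at_right_real[of 0 "inverse (real (Suc m))"] by (auto elim: eventually_mono)
    then have "eventually (\<lambda>d. E m d \<and> 0 < d \<and> d < inverse (real (Suc m))) (at_right 0)"
      using E[of m] by eventually_elim auto
    from frequently_ex[OF frequently_eventually_frequently[OF fr this]] show ?thesis by auto
  qed
  then obtain d where d: "\<And>m. f (d m) \<notin> S" "\<And>m. E m (d m)" "\<And>m. 0 < d m" "\<And>m. d m < inverse (real (Suc m))"
    by metis
  have "d \<longlonglongrightarrow> 0"
    by (rule tendsto_sandwich[OF _ _ tendsto_const LIMSEQ_inverse_real_of_nat])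
      (use d(3,4) in \<open>auto intro!: always_eventually less_imp_le\<close>)
  from seq[OF d(3) this d(2)] have "eventually (\<lambda>m. f (d m) \<in> S) sequentially"
    using S by (auto simp: tendsto_def)
  then show False using d(1) by (auto simp: eventually_sequentially)
qed

section \<open>Passage to the limit\<close>

locale nonlocal_limit = nonlocal_data +
  fixes g :: "'a \<Rightarrow> 'a" and D :: "real set"
  assumes wg: "borel_weak_gradient \<Omega> u g" and g_int: "integrable lborel g"
    and D: "finite D" "0 \<notin> D"
    and \<phi>_cont: "\<And>x t. x \<in> \<Omega> \<Longrightarrow> 0 \<le> t \<Longrightarrow> t \<notin> D \<Longrightarrow> continuous (at t within {0..}) (\<phi> x)"
begin

lemma borel_measurable_g [measurable]: "g \<in> borel_measurable borel"
  using wg by (simp add: borel_weak_gradient_def loc_int_def)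

definition resc :: "real \<Rightarrow> 'a \<Rightarrow> 'a \<Rightarrow> ennreal" where
  "resc \<delta> x v = indicator \<Omega> x * indicator \<Omega> (x + \<delta> *\<^sub>R v) *
     ennreal (\<phi> x (\<bar>u x - u (x + \<delta> *\<^sub>R v)\<bar> / \<delta>) / norm v powr (real DIM('a) + p x))"

definition limf :: "'a \<Rightarrow> 'a \<Rightarrow> ennreal" where
  "limf x v = indicator \<Omega> x * ennreal (\<phi> x \<bar>g x \<bullet> v\<bar> / norm v powr (real DIM('a) + p x))"

text \<open>The order of integration is opposite to that of \<open>Lambda\<close>, because the
  substitution \<open>y = x + \<delta> *\<^sub>R v\<close> is made for fixed
  \<open>x\<close>.\<close>

definition lam :: "real \<Rightarrow> ennreal" where
  "lam \<delta> = (\<integral>\<^sup>+x. (\<integral>\<^sup>+y. indicator \<Omega> x * indicator \<Omega> y * lam_kernel p \<phi> \<delta> u x y \<partial>lborel) \<partial>lborel)"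

lemma borel_measurable_resc [measurable]:
  assumes [measurable]: "f \<in> M \<rightarrow>\<^sub>M borel" "h \<in> M \<rightarrow>\<^sub>M borel"
  shows "(\<lambda>z. resc \<delta> (f z) (h z)) \<in> borel_measurable M"
  unfolding resc_def by measurable

lemma borel_measurable_limf [measurable]:
  assumes [measurable]: "f \<in> M \<rightarrow>\<^sub>M borel" "h \<in> M \<rightarrow>\<^sub>M borel"
  shows "(\<lambda>z. limf (f z) (h z)) \<in> borel_measurable M"
  unfolding limf_def by measurable

lemma resc_eq:
  assumes \<delta>: "0 < \<delta>"
  shows "resc \<delta> x v = ennreal (\<delta> ^ DIM('a)) * (indicator \<Omega> x * indicator \<Omega> (x + \<delta> *\<^sub>R v) * lam_kernel p \<phi> \<delta> u x (x + \<delta> *\<^sub>R v))"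
proof -
  let ?a = "\<phi> x (\<bar>u x - u (x + \<delta> *\<^sub>R v)\<bar> / \<delta>)"
  have "\<delta> ^ DIM('a) * (\<delta> powr p x * ?a / norm (x - (x + \<delta> *\<^sub>R v)) powr (real DIM('a) + p x)) =
      ?a / norm v powr (real DIM('a) + p x)"
    using \<delta> by (cases "v = 0") (auto simp: powr_mult powr_add powr_realpow field_simps)
  then show ?thesis
    unfolding resc_def lam_kernel_def using \<delta>
    by (subst mult.left_commute) (simp add: ennreal_mult'[symmetric])
qed

lemma lam_eq_resc:
  assumes \<delta>: "0 < \<delta>"
  shows "lam \<delta> = (\<integral>\<^sup>+x. (\<integral>\<^sup>+v. resc \<delta> x v \<partial>lborel) \<partial>lborel)"
  unfolding lam_def
proof (rule nn_integral_cong)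
  fix x :: 'a
  let ?f = "\<lambda>y. indicator \<Omega> x * indicator \<Omega> y * lam_kernel p \<phi> \<delta> u x y"
  have "(\<integral>\<^sup>+y. ?f y \<partial>lborel) = ennreal (\<delta> ^ DIM('a)) * (\<integral>\<^sup>+v. ?f (x + \<delta> *\<^sub>R v) \<partial>lborel)"
    by (rule nn_integral_lborel_affine[symmetric]) (use \<delta> in auto)
  also have "\<dots> = (\<integral>\<^sup>+v. resc \<delta> x v \<partial>lborel)"
    unfolding resc_eq[OF \<delta>] by (rule nn_integral_cmult[symmetric]) measurable
  finally show "(\<integral>\<^sup>+y. ?f y \<partial>lborel) = (\<integral>\<^sup>+v. resc \<delta> x v \<partial>lborel)" .
qed

lemma AE_lip_pair:
  assumes \<delta>: "0 < \<delta>"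
  shows "AE z in lborel \<Otimes>\<^sub>M lborel. fst z \<in> \<Omega> \<longrightarrow> fst z + \<delta> *\<^sub>R snd z \<in> \<Omega> \<longrightarrow>
    \<bar>u (fst z) - u (fst z + \<delta> *\<^sub>R snd z)\<bar> \<le> norm (fst z - (fst z + \<delta> *\<^sub>R snd z)) * (G (fst z) + G (fst z + \<delta> *\<^sub>R snd z))"
proof (rule lborel_pair.AE_pair_measure)
  let ?P = "\<lambda>x y. y \<in> \<Omega> \<longrightarrow> \<bar>u x - u y\<bar> \<le> norm (x - y) * (G x + G y)"
  have m: "Measurable.pred borel (?P x)" for x by measurable
  have "AE x in lborel. AE v in lborel. x \<in> \<Omega> \<longrightarrow> ?P x (x + \<delta> *\<^sub>R v)"
    using lip
  proof eventually_elim
    case (elim x)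
    show ?case
    proof (cases "x \<in> \<Omega>")
      case True
      then have "AE y in lborel. ?P x y" using elim by simp
      from AE_lborel_affine[OF m this \<delta>] have "AE v in lborel. ?P x (x + \<delta> *\<^sub>R v)" .
      then show ?thesis by eventually_elim blast
    qed simp
  qed
  then show "AE x in lborel. AE v in lborel. fst (x, v) \<in> \<Omega> \<longrightarrow> fst (x, v) + \<delta> *\<^sub>R snd (x, v) \<in> \<Omega> \<longrightarrow>
    \<bar>u (fst (x, v)) - u (fst (x, v) + \<delta> *\<^sub>R snd (x, v))\<bar> \<le> norm (fst (x, v) - (fst (x, v) + \<delta> *\<^sub>R snd (x, v))) * (G (fst (x, v)) + G (fst (x, v) + \<delta> *\<^sub>R snd (x, v)))"
    by simp
qed measurable

text \<open>If \<open>g x\<close> is nonzero, each value in \<open>D\<close> is attained at most on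
  two parallel hyperplanes, which are null. If \<open>g x = 0\<close>, the inner product is 0, which
  does not belong to \<open>D\<close>.\<close>

lemma AE_inner_notin_D: "AE z in lborel \<Otimes>\<^sub>M lborel. \<bar>g (fst z) \<bullet> snd z\<bar> \<notin> D"
proof (rule lborel_pair.AE_pair_measure)
  show "AE x in lborel. AE v in lborel. \<bar>g (fst (x, v)) \<bullet> snd (x, v)\<bar> \<notin> D"
  proof (rule AE_I2)
    fix x :: 'a
    have hyp: "AE v in lborel. g x \<bullet> v \<noteq> d" if "g x \<noteq> 0" for d
    proof -
      have "{v. g x \<bullet> v = d} \<in> null_sets lebesgue"
        using negligible_hyperplane[of "g x" d] that by (simp add: negligible_iff_null_sets)
      moreover have "{v. g x \<bullet> v = d} \<in> sets lborel" by (simp add: closed_hyperplane)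
      ultimately have "{v. g x \<bullet> v = d} \<in> null_sets lborel" by (auto simp: null_sets_def)
      from AE_not_in[OF this] show ?thesis by simp
    qed
    show "AE v in lborel. \<bar>g (fst (x, v)) \<bullet> snd (x, v)\<bar> \<notin> D"
    proof (cases "g x = 0")
      case False
      have "AE v in lborel. \<forall>d\<in>D. g x \<bullet> v \<noteq> d \<and> g x \<bullet> v \<noteq> - d"
        using hyp[OF False] by (intro AE_finite_allI D(1) AE_conjI) auto
      then show ?thesis by eventually_elim (auto simp: abs_if)
    qed (use D in simp)
  qed
  have "D \<in> sets borel" using D(1) by (simp add: finite_imp_closed)
  then show "{z \<in> space (lborel \<Otimes>\<^sub>M lborel). \<bar>g (fst z) \<bullet> snd z\<bar> \<notin> D} \<in> sets (lborel \<Otimes>\<^sub>M lborel)"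
    by measurable
qed

text \<open>The arguments of \<phi> are nonnegative, so continuity within \<open>{0..}\<close>
  suffices, also at 0. Openness of \<Omega> makes the second indicator eventually 1.\<close>

lemma resc_tendsto_limf:
  assumes d: "\<And>m. 0 < d m" "d \<longlonglongrightarrow> 0" and x: "x \<in> \<Omega>"
    and q: "(\<lambda>m. \<bar>(u (x + d m *\<^sub>R v) - u x) / d m - g x \<bullet> v\<bar>) \<longlonglongrightarrow> 0"
    and nD: "\<bar>g x \<bullet> v\<bar> \<notin> D"
  shows "(\<lambda>m. resc (d m) x v) \<longlonglongrightarrow> limf x v"
proof -
  have "(\<lambda>m. (u (x + d m *\<^sub>R v) - u x) / d m) \<longlonglongrightarrow> g x \<bullet> v"
    using q by (simp add: LIM_zero_iff tendsto_rabs_zero_iff)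
  then have "(\<lambda>m. \<bar>(u (x + d m *\<^sub>R v) - u x) / d m\<bar>) \<longlonglongrightarrow> \<bar>g x \<bullet> v\<bar>"
    by (rule tendsto_rabs)
  moreover have "\<bar>(u (x + d m *\<^sub>R v) - u x) / d m\<bar> = \<bar>u x - u (x + d m *\<^sub>R v)\<bar> / d m" for m
    using d(1)[of m] by (simp add: abs_minus_commute)
  ultimately have T: "(\<lambda>m. \<bar>u x - u (x + d m *\<^sub>R v)\<bar> / d m) \<longlonglongrightarrow> \<bar>g x \<bullet> v\<bar>" by simp
  have "continuous (at \<bar>g x \<bullet> v\<bar> within {0..}) (\<phi> x)" by (rule \<phi>_cont[OF x _ nD]) simp
  then have \<phi>T: "(\<lambda>m. \<phi> x (\<bar>u x - u (x + d m *\<^sub>R v)\<bar> / d m)) \<longlonglongrightarrow> \<phi> x \<bar>g x \<bullet> v\<bar>"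
    by (rule continuous_within_tendsto_compose'[OF _ _ T]) (use d(1) in \<open>auto simp: less_imp_le\<close>)
  have "(\<lambda>m. x + d m *\<^sub>R v) \<longlonglongrightarrow> x + 0 *\<^sub>R v"
    using d(2) by (intro tendsto_intros)
  then have ev: "eventually (\<lambda>m. x + d m *\<^sub>R v \<in> \<Omega>) sequentially"
    using \<Omega>(1) x by (auto simp: tendsto_def)
  have "(\<lambda>m. ennreal (\<phi> x (\<bar>u x - u (x + d m *\<^sub>R v)\<bar> / d m) / norm v powr (real DIM('a) + p x))) \<longlonglongrightarrow> limf x v"
    unfolding limf_def using x \<phi>T by (cases "v = 0") (auto intro!: tendsto_ennrealI tendsto_intros)
  then show ?thesis
    by (rule Lim_transform_eventually) (use ev in eventually_elim, simp add: resc_def x)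
qed

text \<open>Only the pairs with \<open>G \<le> K\<close> at both ends are rescaled; the others are
  estimated in the original variables by a bound free of \<delta>.\<close>

lemma lam_le_near_plus_tail:
  assumes \<delta>: "0 < \<delta>"
  shows "lam \<delta> \<le> (\<integral>\<^sup>+z. indicator {z. G (fst z) \<le> K \<and> G (fst z + \<delta> *\<^sub>R snd z) \<le> K} z * resc \<delta> (fst z) (snd z) \<partial>(lborel \<Otimes>\<^sub>M lborel))
     + ennreal (2 * c) * kern_const TYPE('a) * tail K"
proof -
  let ?T = "\<lambda>x y. indicator \<Omega> x * indicator \<Omega> y * indicator {(x, y). K < G x \<or> K < G y} (x, y) * lam_kernel p \<phi> \<delta> u x y"
  let ?N = "\<lambda>x y. indicator \<Omega> x * indicator \<Omega> y * indicator {(x, y). G x \<le> K \<and> G y \<le> K} (x, y) * lam_kernel p \<phi> \<delta> u x y"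
  have N: "(\<lambda>(x, y). ?N x y) \<in> borel_measurable (lborel \<Otimes>\<^sub>M lborel)" and T: "(\<lambda>(x, y). ?T x y) \<in> borel_measurable (lborel \<Otimes>\<^sub>M lborel)"
    by measurable
  have N1: "?N x \<in> borel_measurable lborel" and T1: "?T x \<in> borel_measurable lborel" for x
    using measurable_Pair2[OF N, of x] measurable_Pair2[OF T, of x]
    by (simp_all only: prod.case space_lborel space_borel UNIV_I simp_thms True_implies_equals)
  have "lam \<delta> = (\<integral>\<^sup>+x. (\<integral>\<^sup>+y. ?N x y + ?T x y \<partial>lborel) \<partial>lborel)"
    unfolding lam_def by (intro nn_integral_cong) (auto simp: indicator_def not_le)
  also have "\<dots> = (\<integral>\<^sup>+x. (\<integral>\<^sup>+y. ?N x y \<partial>lborel) + (\<integral>\<^sup>+y. ?T x y \<partial>lborel) \<partial>lborel)"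
    by (intro nn_integral_cong nn_integral_add[OF N1 T1])
  also have "\<dots> = (\<integral>\<^sup>+x. (\<integral>\<^sup>+y. ?N x y \<partial>lborel) \<partial>lborel) + (\<integral>\<^sup>+x. (\<integral>\<^sup>+y. ?T x y \<partial>lborel) \<partial>lborel)"
    by (intro nn_integral_add lborel.borel_measurable_nn_integral N T)
  also have "\<dots> \<le> (\<integral>\<^sup>+x. (\<integral>\<^sup>+y. ?N x y \<partial>lborel) \<partial>lborel) + ennreal (2 * c) * kern_const TYPE('a) * tail K"
    by (intro add_left_mono nn_integral_lam_kernel_tail \<delta>)
  also have "(\<integral>\<^sup>+x. (\<integral>\<^sup>+y. ?N x y \<partial>lborel) \<partial>lborel) =
    (\<integral>\<^sup>+x. (\<integral>\<^sup>+v. indicator {z. G (fst z) \<le> K \<and> G (fst z + \<delta> *\<^sub>R snd z) \<le> K} (x, v) * resc \<delta> x v \<partial>lborel) \<partial>lborel)"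
  proof (rule nn_integral_cong)
    fix x :: 'a
    have "(\<integral>\<^sup>+y. ?N x y \<partial>lborel) = ennreal (\<delta> ^ DIM('a)) * (\<integral>\<^sup>+v. ?N x (x + \<delta> *\<^sub>R v) \<partial>lborel)"
      by (rule nn_integral_lborel_affine[symmetric], use N1[of x] in \<open>simp only: measurable_lborel1 measurable_lborel2\<close>, rule \<delta>)
    also have "\<dots> = (\<integral>\<^sup>+v. ennreal (\<delta> ^ DIM('a)) * ?N x (x + \<delta> *\<^sub>R v) \<partial>lborel)"
    proof (rule nn_integral_cmult[symmetric])
      show "(\<lambda>v. ?N x (x + \<delta> *\<^sub>R v)) \<in> borel_measurable lborel"
        by (rule measurable_compose[OF _ N1[of x]]) simp
    qed
    also have "\<dots> = (\<integral>\<^sup>+v. indicator {z. G (fst z) \<le> K \<and> G (fst z + \<delta> *\<^sub>R snd z) \<le> K} (x, v) * resc \<delta> x v \<partial>lborel)"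
      unfolding resc_eq[OF \<delta>] by (intro nn_integral_cong) (auto simp: indicator_def)
    finally show "(\<integral>\<^sup>+y. ?N x y \<partial>lborel) = (\<integral>\<^sup>+v. indicator {z. G (fst z) \<le> K \<and> G (fst z + \<delta> *\<^sub>R snd z) \<le> K} (x, v) * resc \<delta> x v \<partial>lborel)" .
  qed
  also have "\<dots> = (\<integral>\<^sup>+z. indicator {z. G (fst z) \<le> K \<and> G (fst z + \<delta> *\<^sub>R snd z) \<le> K} z * resc \<delta> (fst z) (snd z) \<partial>(lborel \<Otimes>\<^sub>M lborel))"
    by (subst lborel.nn_integral_fst[symmetric]) auto
  finally show ?thesis .
qed

text \<open>Fatou bounds the lower limit. For the upper limit, pairs with \<open>G \<le> K\<close>
  at both ends are dominated by \<open>kern q r (2 * K)\<close>, so the reverse Fatou lemma applies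
  to them; the remaining pairs cost a multiple of \<open>tail K\<close> uniformly along the
  sequence, and \<open>K\<close> tends to infinity last.\<close>

lemma lam_tendsto_sequence:
  assumes d: "\<And>m. 0 < d m" "d \<longlonglongrightarrow> 0"
    and q: "AE z in lborel \<Otimes>\<^sub>M lborel. fst z \<in> \<Omega> \<longrightarrow>
      (\<lambda>m. \<bar>(u (fst z + d m *\<^sub>R snd z) - u (fst z)) / d m - g (fst z) \<bullet> snd z\<bar>) \<longlonglongrightarrow> 0"
  shows "(\<lambda>m. lam (d m)) \<longlonglongrightarrow> (\<integral>\<^sup>+z. limf (fst z) (snd z) \<partial>(lborel \<Otimes>\<^sub>M lborel))" (is "_ \<longlonglongrightarrow> ?L")
proof -
  let ?M = "lborel \<Otimes>\<^sub>M lborel :: ('a \<times> 'a) measure"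
  have conv: "AE z in ?M. (\<lambda>m. resc (d m) (fst z) (snd z)) \<longlonglongrightarrow> limf (fst z) (snd z)"
    using q AE_inner_notin_D
  proof eventually_elim
    case (elim z)
    show ?case
    proof (cases "fst z \<in> \<Omega>")
      case True
      then show ?thesis using elim by (intro resc_tendsto_limf d) auto
    qed (simp add: resc_def limf_def)
  qed
  have lam_pair: "lam (d m) = (\<integral>\<^sup>+z. resc (d m) (fst z) (snd z) \<partial>?M)" for m
    unfolding lam_eq_resc[OF d(1)] by (subst lborel.nn_integral_fst[symmetric]) auto
  have "?L = (\<integral>\<^sup>+z. liminf (\<lambda>m. resc (d m) (fst z) (snd z)) \<partial>?M)"
    using conv by (intro nn_integral_cong_AE) (auto elim!: eventually_mono simp: tendsto_iff_Liminf_eq_Limsup)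
  also have "\<dots> \<le> liminf (\<lambda>m. lam (d m))"
    unfolding lam_pair by (rule nn_integral_liminf) measurable
  finally have low: "?L \<le> liminf (\<lambda>m. lam (d m))" .
  have up: "limsup (\<lambda>m. lam (d m)) \<le> ?L + ennreal (2 * c) * kern_const TYPE('a) * tail (real K)" for K :: nat
  proof -
    let ?I = "\<lambda>m z. indicator {z. G (fst z) \<le> real K \<and> G (fst z + d m *\<^sub>R snd z) \<le> real K} z * resc (d m) (fst z) (snd z)"
    \<comment> \<open>Integrable, since \<Omega> has finite measure and the kernel has finite mass
      in \<open>v\<close>.\<close>
    let ?w = "\<lambda>z. indicator \<Omega> (fst z) * (ennreal c * ennreal (kern q r (2 * real K) (snd z)))"
    have [measurable]: "?I m \<in> borel_measurable ?M" for m by measurable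
    have "limsup (\<lambda>m. \<integral>\<^sup>+z. ?I m z \<partial>?M) \<le> (\<integral>\<^sup>+z. limsup (\<lambda>m. ?I m z) \<partial>?M)"
    proof (rule nn_integral_limsup[where w = ?w])
      show "?w \<in> borel_measurable ?M" by measurable
      show "(\<integral>\<^sup>+z. ?w z \<partial>?M) < \<infinity>"
      proof -
        have "(\<integral>\<^sup>+z. ?w z \<partial>?M) = (\<integral>\<^sup>+x. (\<integral>\<^sup>+v. indicator \<Omega> x * (ennreal c * ennreal (kern q r (2 * real K) (v::'a))) \<partial>lborel) \<partial>lborel)"
          by (subst lborel.nn_integral_fst[symmetric]) auto
        also have "\<dots> = emeasure lborel \<Omega> * (ennreal c * (ennreal ((2 * real K) powr q + (2 * real K) powr r) * kern_const TYPE('a)))"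
          by (simp add: nn_integral_cmult nn_integral_multc nn_integral_kern)
        also have "\<dots> < \<infinity>"
          using \<Omega>(2) kern_const_finite[where 'a='a] by (simp add: ennreal_mult_less_top)
        finally show ?thesis .
      qed
      fix m
      have "AE z in ?M. snd z \<noteq> 0"
      proof (rule lborel_pair.AE_pair_measure)
        show "{z \<in> space ?M. snd z \<noteq> 0} \<in> sets ?M" by measurable
      qed (simp add: AE_lborel_singleton)
      then show "AE z in ?M. ?I m z \<le> ?w z"
        using AE_lip_pair[OF d(1)[of m]]
      proof eventually_elim
        case (elim z)
        obtain x v where z: "z = (x, v)" by (cases z)
        show ?case
        proof (cases "x \<in> \<Omega> \<and> x + d m *\<^sub>R v \<in> \<Omega> \<and> G x \<le> real K \<and> G (x + d m *\<^sub>R v) \<le> real K")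
          case True
          let ?y = "x + d m *\<^sub>R v"
          have "\<bar>u x - u ?y\<bar> \<le> norm (x - ?y) * (G x + G ?y)" using elim True by (simp add: z)
          also have "\<dots> \<le> norm (x - ?y) * (2 * real K)" using True by (intro mult_left_mono) auto
          finally have "\<bar>u x - u ?y\<bar> \<le> norm (x - ?y) * (2 * real K)" .
          moreover have "x \<noteq> ?y" using elim d(1)[of m] by (simp add: z)
          ultimately have "lam_kernel p \<phi> (d m) u x ?y \<le> ennreal (c * (inverse (d m ^ DIM('a)) * kern q r (2 * real K) ((?y - x) /\<^sub>R d m)))"
            using True d(1)[of m] by (intro lam_kernel_le) auto
          also have "(?y - x) /\<^sub>R d m = v" using d(1)[of m] by simp
          finally have "resc (d m) x v \<le> ennreal (d m ^ DIM('a)) * ennreal (c * (inverse (d m ^ DIM('a)) * kern q r (2 * real K) v))"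
            unfolding resc_eq[OF d(1)] using True by (simp add: mult_left_mono)
          also have "\<dots> = ennreal (c * kern q r (2 * real K) v)"
          proof -
            have "a * (c * (inverse a * k)) = c * k" if "0 < a" for a k :: real
              using that by (simp add: field_simps)
            moreover have "0 < d m ^ DIM('a)" using d(1)[of m] by simp
            ultimately have eq: "d m ^ DIM('a) * (c * (inverse (d m ^ DIM('a)) * kern q r (2 * real K) v)) = c * kern q r (2 * real K) v" .
            show ?thesis
              unfolding eq[symmetric] using d(1)[of m] by (intro ennreal_mult'[symmetric]) simp
          qed
          also have "\<dots> = ennreal c * ennreal (kern q r (2 * real K) v)" using c by (rule ennreal_mult')
          finally show ?thesis using True by (simp add: z)
        next
          case False
          then have "?I m z = 0" by (auto simp: z resc_def indicator_def)
          then show ?thesis by (simp only: zero_le)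
        qed
      qed
    qed measurable
    also have "\<dots> \<le> (\<integral>\<^sup>+z. limf (fst z) (snd z) \<partial>?M)"
    proof (rule nn_integral_mono_AE)
      show "AE z in ?M. limsup (\<lambda>m. ?I m z) \<le> limf (fst z) (snd z)"
        using conv
      proof eventually_elim
        case (elim z)
        have "limsup (\<lambda>m. ?I m z) \<le> limsup (\<lambda>m. resc (d m) (fst z) (snd z))"
          by (intro Limsup_mono always_eventually allI) (auto simp: indicator_def)
        also have "\<dots> = limf (fst z) (snd z)"
          using elim by (simp add: tendsto_iff_Liminf_eq_Limsup)
        finally show ?case .
      qed
    qed
    finally have near: "limsup (\<lambda>m. \<integral>\<^sup>+z. ?I m z \<partial>?M) \<le> ?L" .
    let ?t = "ennreal (2 * c) * kern_const TYPE('a) * tail (real K)"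
    have "limsup (\<lambda>m. lam (d m)) \<le> limsup (\<lambda>m. (\<integral>\<^sup>+z. ?I m z \<partial>?M) + ?t)"
      by (intro Limsup_mono always_eventually allI lam_le_near_plus_tail d)
    also have "\<dots> \<le> limsup (\<lambda>m. \<integral>\<^sup>+z. ?I m z \<partial>?M) + ?t"
      using Limsup_compose_continuous_mono[of "\<lambda>s. s + ?t" sequentially "\<lambda>m. \<integral>\<^sup>+z. ?I m z \<partial>?M"]
      by (simp add: mono_def add_right_mono continuous_on_add_ennreal continuous_on_id continuous_on_const)
    also have "\<dots> \<le> ?L + ?t" by (intro add_right_mono near)
    finally show ?thesis .
  qed
  have "(\<lambda>K. ?L + ennreal (2 * c) * kern_const TYPE('a) * tail (real K)) \<longlonglongrightarrow> ?L + ennreal (2 * c) * kern_const TYPE('a) * 0"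
    using kern_const_finite[where 'a='a]
    by (intro tendsto_add tendsto_const tendsto_mult_ennreal tail_tendsto_0) (auto simp: ennreal_mult_eq_top_iff)
  then have "limsup (\<lambda>m. lam (d m)) \<le> ?L"
    using up by (intro LIMSEQ_le_const) auto
  then show ?thesis
    using low Liminf_le_Limsup[of sequentially "\<lambda>m. lam (d m)"]
    by (intro Liminf_eq_Limsup) auto
qed

theorem lam_tendsto: "(lam \<longlongrightarrow> (\<integral>\<^sup>+x. (\<integral>\<^sup>+v. limf x v \<partial>lborel) \<partial>lborel)) (at_right 0)"
proof -
  obtain K where K: "\<And>m. compact (K m)" "\<And>m. K m \<subseteq> \<Omega>" "\<And>m. K m \<subseteq> interior (K (Suc m))" "(\<Union>m. K m) = \<Omega>"
    using open_Union_compact_subsets[OF \<Omega>(1)] by metis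
  have "K m \<subseteq> K (Suc m)" for m
    using K(3) interior_subset by (rule subset_trans)
  from lift_Suc_mono_le[of K, OF this] have K_mono: "K m \<subseteq> K m'" if "m \<le> m'" for m m'
    using that .
  have [measurable]: "K m \<in> sets borel" for m using K(1) by (simp add: borel_compact)
  have [measurable]: "cball 0 s \<in> sets (borel :: 'a measure)" for s by simp
  \<comment> \<open>Stage \<open>m\<close> controls the error on a compact set times a ball; these
    sets exhaust all pairs, and the bounds are summable.\<close>
  let ?E = "\<lambda>m \<delta>. (\<integral>\<^sup>+x. (\<integral>\<^sup>+v. indicator (K m) x * indicator (cball 0 (real m)) v *
      ennreal \<bar>(u (x + \<delta> *\<^sub>R v) - u x) / \<delta> - g x \<bullet> v\<bar> \<partial>lborel) \<partial>lborel) \<le> ennreal ((1/2) ^ Suc m)"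
  have L: "(\<integral>\<^sup>+x. (\<integral>\<^sup>+v. limf x v \<partial>lborel) \<partial>lborel) = (\<integral>\<^sup>+z. limf (fst z) (snd z) \<partial>(lborel \<Otimes>\<^sub>M lborel))"
    by (subst lborel.nn_integral_fst[symmetric]) auto
  show ?thesis
    unfolding L
  proof (rule tendsto_at_rightI_sequence[where E = ?E])
    show "eventually (?E m) (at_right 0)" for m
      by (rule nn_integral_difference_quotient[OF \<Omega>(1) wg g_int K(1,2)]) simp
  next
    fix d :: "nat \<Rightarrow> real"
    assume d: "\<And>m. 0 < d m" "d \<longlonglongrightarrow> 0" and E: "\<And>m. ?E m (d m)"
    let ?h = "\<lambda>m z. indicator (K m) (fst z) * indicator (cball 0 (real m)) (snd z) *
      ennreal \<bar>(u (fst z + d m *\<^sub>R snd z) - u (fst z)) / d m - g (fst z) \<bullet> snd z\<bar>"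
    have [measurable]: "?h m \<in> borel_measurable (lborel \<Otimes>\<^sub>M lborel)" for m by measurable
    have "(\<integral>\<^sup>+z. (\<Sum>m. ?h m z) \<partial>(lborel \<Otimes>\<^sub>M lborel)) = (\<Sum>m. \<integral>\<^sup>+z. ?h m z \<partial>(lborel \<Otimes>\<^sub>M lborel))"
      by (rule nn_integral_suminf) measurable
    also have "\<dots> \<le> (\<Sum>m. ennreal ((1/2) ^ Suc m))"
    proof (intro suminf_le)
      fix m
      have "(\<integral>\<^sup>+z. ?h m z \<partial>(lborel \<Otimes>\<^sub>M lborel)) = (\<integral>\<^sup>+x. (\<integral>\<^sup>+v. ?h m (x, v) \<partial>lborel) \<partial>lborel)"
        by (subst lborel.nn_integral_fst[symmetric]) auto
      then show "(\<integral>\<^sup>+z. ?h m z \<partial>(lborel \<Otimes>\<^sub>M lborel)) \<le> ennreal ((1/2) ^ Suc m)"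
        using E[of m] by simp
    qed auto
    also have "\<dots> = ennreal 1"
      using power_half_series by (intro suminf_ennreal_eq) auto
    finally have "(\<integral>\<^sup>+z. (\<Sum>m. ?h m z) \<partial>(lborel \<Otimes>\<^sub>M lborel)) \<noteq> \<infinity>" by (auto simp: top_unique)
    \<comment> \<open>A nonnegative series with finite integral converges almost everywhere, so its
      terms tend to 0 there.\<close>
    then have "AE z in lborel \<Otimes>\<^sub>M lborel. (\<Sum>m. ?h m z) \<noteq> \<infinity>"
      by (intro nn_integral_PInf_AE) measurable
    then have "AE z in lborel \<Otimes>\<^sub>M lborel. fst z \<in> \<Omega> \<longrightarrow>
      (\<lambda>m. \<bar>(u (fst z + d m *\<^sub>R snd z) - u (fst z)) / d m - g (fst z) \<bullet> snd z\<bar>) \<longlonglongrightarrow> 0"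
    proof eventually_elim
      case (elim z)
      show ?case
      proof
        assume x: "fst z \<in> \<Omega>"
        let ?a = "\<lambda>m. \<bar>(u (fst z + d m *\<^sub>R snd z) - u (fst z)) / d m - g (fst z) \<bullet> snd z\<bar>"
        let ?r = "\<lambda>m. indicator (K m) (fst z) * indicator (cball 0 (real m)) (snd z) * ?a m"
        have hr: "?h m z = ennreal (?r m)" for m by (simp add: indicator_def)
        have "summable ?r"
          using elim unfolding hr by (intro summable_suminf_not_top) auto
        then have "?r \<longlonglongrightarrow> 0" by (rule summable_LIMSEQ_zero)
        then have h0: "(\<lambda>m. ?h m z) \<longlonglongrightarrow> 0"
          unfolding hr using tendsto_ennrealI by fastforce
        obtain m0 where m0: "fst z \<in> K m0" using x K(4) by auto
        have "eventually (\<lambda>m. ?h m z = ennreal (?a m)) sequentially"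
        proof (rule eventually_sequentiallyI[of "max m0 (nat \<lceil>norm (snd z)\<rceil>)"])
          fix m assume m: "max m0 (nat \<lceil>norm (snd z)\<rceil>) \<le> m"
          then have "fst z \<in> K m" using K_mono[of m0 m] m0 by auto
          moreover have "norm (snd z) \<le> real m" using m by linarith
          ultimately show "?h m z = ennreal (?a m)" by simp
        qed
        then have "(\<lambda>m. ennreal (?a m)) \<longlonglongrightarrow> ennreal 0"
          using h0 by (simp add: Lim_transform_eventually)
        then show "?a \<longlonglongrightarrow> 0" by (subst (asm) tendsto_ennreal_iff) auto
      qed
    qed
    then show "(\<lambda>m. lam (d m)) \<longlonglongrightarrow> (\<integral>\<^sup>+z. limf (fst z) (snd z) \<partial>(lborel \<Otimes>\<^sub>M lborel))"
      by (rule lam_tendsto_sequence[OF d])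
  qed
qed

end

section \<open>Hausdorff measure of the sphere\<close>

text \<open>If all distances were below \<open>a + b\<close>, then \<open>Y\<close> would lie
  between \<open>Sup X - (a + b)\<close> and \<open>Inf X + (a + b)\<close>; the length of that
  interval and the length of the hull of \<open>X\<close> add up to exactly
  \<open>2 * (a + b)\<close>. This is the one-dimensional reason why symmetrisation does not
  increase the diameter.\<close>

lemma ex_far_points:
  fixes X Y :: "real set"
  assumes X: "ennreal (2 * a) < emeasure lborel X" and Y: "ennreal (2 * b) < emeasure lborel Y"
    and ab: "0 \<le> a" "0 \<le> b"
  shows "\<exists>s\<in>X. \<exists>t\<in>Y. a + b \<le> \<bar>s - t\<bar>"
proof (rule ccontr)
  assume "\<not> ?thesis"
  then have lt: "\<bar>s - t\<bar> < a + b" if "s \<in> X" "t \<in> Y" for s t using that by force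
  have ne: "X \<noteq> {}" "Y \<noteq> {}" using X Y by auto
  then obtain s0 t0 where st0: "s0 \<in> X" "t0 \<in> Y" by auto
  have bX: "bdd_above X" "bdd_below X"
    using lt[OF _ st0(2)] by (force intro: bdd_aboveI[of _ "t0 + (a + b)"] bdd_belowI[of _ "t0 - (a + b)"] simp: abs_less_iff)+
  have "X \<subseteq> {Inf X .. Sup X}" using bX by (auto intro: cInf_lower cSup_upper)
  then have "emeasure lborel X \<le> emeasure lborel {Inf X .. Sup X}" by (intro emeasure_mono) auto
  moreover have IS: "Inf X \<le> Sup X" using bX ne by (intro cInf_le_cSup)
  ultimately have 1: "emeasure lborel X \<le> ennreal (Sup X - Inf X)" by simp
  have tY: "Sup X - (a + b) \<le> t \<and> t \<le> Inf X + (a + b)" if "t \<in> Y" for t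
  proof
    have "s \<le> t + (a + b)" if "s \<in> X" for s using lt[OF that \<open>t \<in> Y\<close>] by simp
    then have "Sup X \<le> t + (a + b)" using ne by (intro cSup_least)
    then show "Sup X - (a + b) \<le> t" by simp
    have "t - (a + b) \<le> s" if "s \<in> X" for s using lt[OF that \<open>t \<in> Y\<close>] by simp
    then have "t - (a + b) \<le> Inf X" using ne by (intro cInf_greatest)
    then show "t \<le> Inf X + (a + b)" by simp
  qed
  then have "Y \<subseteq> {Sup X - (a + b) .. Inf X + (a + b)}" by auto
  then have "emeasure lborel Y \<le> emeasure lborel {Sup X - (a + b) .. Inf X + (a + b)}" by (intro emeasure_mono) auto
  moreover have "Sup X - (a + b) \<le> Inf X + (a + b)" using tY[OF st0(2)] by simp
  ultimately have 2: "emeasure lborel Y \<le> ennreal (Inf X + (a + b) - (Sup X - (a + b)))" by simp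
  have "2 * a < Sup X - Inf X" using X 1 ab by (metis ennreal_less_iff less_le_trans mult_nonneg_nonneg zero_le_numeral)
  moreover have "2 * b < Inf X + (a + b) - (Sup X - (a + b))"
    using Y 2 ab by (metis ennreal_less_iff less_le_trans mult_nonneg_nonneg zero_le_numeral)
  ultimately show False by simp
qed

lemma emeasure_centered_interval: "emeasure lborel {y::real. ennreal (2 * \<bar>y\<bar>) < l} = l"
proof (cases l)
  case (real r)
  have "{y::real. ennreal (2 * \<bar>y\<bar>) < l} = {- r / 2 <..< r / 2}"
    using real by (auto simp: ennreal_less_iff abs_if split: if_splits)
  then show ?thesis using real by simp
next
  case top
  then show ?thesis by simp
qed

text \<open>Products indexed by a set rather than by a vector type: the slices of the space
  orthogonal to a basis vector \<open>e\<close> have the index set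
  \<open>Basis - {e}\<close>.\<close>

abbreviation lborelI :: "'i set \<Rightarrow> ('i \<Rightarrow> real) measure" where
  "lborelI I \<equiv> Pi\<^sub>M I (\<lambda>_. lborel)"

definition sq_diam_le :: "'i set \<Rightarrow> real \<Rightarrow> ('i \<Rightarrow> real) set \<Rightarrow> bool" where
  "sq_diam_le I d A \<longleftrightarrow> (\<forall>x\<in>A. \<forall>y\<in>A. (\<Sum>i\<in>I. (x i - y i)\<^sup>2) \<le> d\<^sup>2)"

text \<open>On each line in direction \<open>i\<close> the set is replaced by the centred open
  interval of the same length. Fubini preserves the measure, \<open>ex_far_points\<close> controls
  the diameter, and the reflections in \<open>J\<close> survive because they do not change the
  length of a slice; they are carried along so that the coordinates can be treated one after the
  other.\<close>

lemma steiner_symmetrization: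
  assumes I: "finite I" "i \<in> I" and B: "B \<in> sets (lborelI I)" and diam: "sq_diam_le I d B"
    and sym: "\<And>j x. j \<in> J \<Longrightarrow> x \<in> B \<Longrightarrow> x(j := - x j) \<in> B" and J: "J \<subseteq> I" "i \<notin> J"
  shows "\<exists>B'\<in>sets (lborelI I). emeasure (lborelI I) B' = emeasure (lborelI I) B \<and> sq_diam_le I d B' \<and>
    (\<forall>j\<in>insert i J. \<forall>x\<in>B'. x(j := - x j) \<in> B')"
proof -
  interpret product_sigma_finite "\<lambda>_. lborel :: real measure" by standard
  have ins: "insert i I = I" "insert i (I - {i}) = I" using I by auto
  define l where "l x = (\<integral>\<^sup>+t. indicator B (x(i := t)) \<partial>lborel)" for x
  have upd: "(\<lambda>(f, y). f(i := y)) \<in> measurable (lborelI I \<Otimes>\<^sub>M lborel) (lborelI I)"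
    using measurable_add_dim[of i I "\<lambda>_. lborel"] by (simp add: ins)
  have "(\<lambda>(x, t). indicator B (x(i := t)) :: ennreal) \<in> borel_measurable (lborelI I \<Otimes>\<^sub>M lborel)"
    using measurable_compose[OF upd borel_measurable_indicator[OF B]] by (simp add: case_prod_beta')
  then have l [measurable]: "l \<in> borel_measurable (lborelI I)"
    unfolding l_def by (rule lborel.borel_measurable_nn_integral)
  define B' where "B' = {x \<in> space (lborelI I). ennreal (2 * \<bar>x i\<bar>) < l x}"
  have xi [measurable]: "(\<lambda>x. x i) \<in> borel_measurable (lborelI I)"
    using measurable_component_singleton[OF I(2), of "\<lambda>_. lborel"] by simp
  have B' [measurable]: "B' \<in> sets (lborelI I)" unfolding B'_def by measurable
  have l_upd: "l (x(i := t)) = l x" for x t by (simp add: l_def)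
  have slice: "{t. x(i := t) \<in> B} \<in> sets lborel" if "x \<in> space (lborelI (I - {i}))" for x
  proof -
    have "(\<lambda>t. x(i := t)) \<in> measurable lborel (lborelI I)"
      using measurable_component_update[OF that, of i] by (simp add: ins)
    from measurable_sets[OF this B] show ?thesis by (simp add: vimage_def)
  qed
  have l_eq: "l x = emeasure lborel {t. x(i := t) \<in> B}" if "{t. x(i := t) \<in> B} \<in> sets lborel" for x
  proof -
    have "(\<lambda>t. indicator B (x(i := t)) :: ennreal) = indicator {t. x(i := t) \<in> B}" by (auto simp: indicator_def)
    then show ?thesis using that by (simp add: l_def)
  qed
  have sliceI: "{t. x(i := t) \<in> B} \<in> sets lborel" if "x \<in> space (lborelI I)" for x
  proof -
    have r: "restrict x (I - {i}) \<in> space (lborelI (I - {i}))" using that by (auto simp: space_PiM)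
    have eq: "(restrict x (I - {i}))(i := t) = x(i := t)" for t
      using that by (auto simp: space_PiM PiE_def extensional_def restrict_def fun_eq_iff)
    from slice[OF r] show ?thesis by (simp only: eq)
  qed
  have "emeasure (lborelI I) B' = (\<integral>\<^sup>+x. indicator B' x \<partial>lborelI (insert i (I - {i})))" by (simp add: ins)
  also have "\<dots> = (\<integral>\<^sup>+x. (\<integral>\<^sup>+y. indicator B' (x(i := y)) \<partial>lborel) \<partial>lborelI (I - {i}))"
    using I by (intro product_nn_integral_insert) (auto simp: ins)
  also have "\<dots> = (\<integral>\<^sup>+x. (\<integral>\<^sup>+y. indicator B (x(i := y)) \<partial>lborel) \<partial>lborelI (I - {i}))"
  proof (rule nn_integral_cong)
    fix x assume x: "x \<in> space (lborelI (I - {i}))"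
    have xs: "x(i := y) \<in> space (lborelI I)" for y
      using x I(2) by (auto simp: space_PiM PiE_def extensional_def)
    have "(\<lambda>y. indicator B' (x(i := y)) :: ennreal) = indicator {y. ennreal (2 * \<bar>y\<bar>) < l x}"
      using xs by (auto simp: B'_def l_upd indicator_def fun_eq_iff)
    then have "(\<integral>\<^sup>+y. indicator B' (x(i := y)) \<partial>lborel) = (\<integral>\<^sup>+y. indicator {y. ennreal (2 * \<bar>y\<bar>) < l x} y \<partial>lborel)" by simp
    also have "\<dots> = emeasure lborel {y::real. ennreal (2 * \<bar>y\<bar>) < l x}" by (rule nn_integral_indicator) measurable
    also have "\<dots> = l x" by (rule emeasure_centered_interval)
    finally show "(\<integral>\<^sup>+y. indicator B' (x(i := y)) \<partial>lborel) = (\<integral>\<^sup>+y. indicator B (x(i := y)) \<partial>lborel)" by (simp add: l_def)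
  qed
  also have "\<dots> = (\<integral>\<^sup>+x. indicator B x \<partial>lborelI (insert i (I - {i})))"
    using I B by (intro product_nn_integral_insert[symmetric]) (auto simp: ins)
  also have "\<dots> = emeasure (lborelI I) B" using B by (simp add: ins)
  finally have meas: "emeasure (lborelI I) B' = emeasure (lborelI I) B" .
  have "sq_diam_le I d B'"
    unfolding sq_diam_le_def
  proof (intro ballI)
    fix x y assume xy: "x \<in> B'" "y \<in> B'"
    then have sp: "x \<in> space (lborelI I)" "y \<in> space (lborelI I)"
      and lt: "ennreal (2 * \<bar>x i\<bar>) < emeasure lborel {t. x(i := t) \<in> B}" "ennreal (2 * \<bar>y i\<bar>) < emeasure lborel {t. y(i := t) \<in> B}"
      using l_eq[OF sliceI] by (auto simp: B'_def)
    \<comment> \<open>Two points of the symmetrised set are compared with points of the original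
      slices whose \<open>i\<close>-th coordinates are at least as far apart; the other coordinates
      agree.\<close>
    from ex_far_points[OF lt] obtain s t where st: "x(i := s) \<in> B" "y(i := t) \<in> B" "\<bar>x i\<bar> + \<bar>y i\<bar> \<le> \<bar>s - t\<bar>" by auto
    have split: "(\<Sum>j\<in>I. (f j - g j)\<^sup>2) = (f i - g i)\<^sup>2 + (\<Sum>j\<in>I - {i}. (f j - g j)\<^sup>2)" for f g :: "'a \<Rightarrow> real"
      using I by (simp add: sum.remove)
    have "\<bar>x i - y i\<bar> \<le> \<bar>s - t\<bar>" using st(3) by simp
    then have "(x i - y i)\<^sup>2 \<le> (s - t)\<^sup>2" by (simp add: abs_le_square_iff)
    then have "(\<Sum>j\<in>I. (x j - y j)\<^sup>2) \<le> (\<Sum>j\<in>I. ((x(i := s)) j - (y(i := t)) j)\<^sup>2)"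
      unfolding split by (simp cong: sum.cong_simp)
    also have "\<dots> \<le> d\<^sup>2" using diam st(1,2) by (auto simp: sq_diam_le_def simp del: fun_upd_apply)
    finally show "(\<Sum>j\<in>I. (x j - y j)\<^sup>2) \<le> d\<^sup>2" .
  qed
  moreover have "x(j := - x j) \<in> B'" if j: "j \<in> insert i J" and x: "x \<in> B'" for j x
  proof -
    have jI: "j \<in> I" using j J I by auto
    have sp: "x(j := - x j) \<in> space (lborelI I)"
      using x jI by (auto simp: B'_def space_PiM PiE_def extensional_def)
    show ?thesis
    proof (cases "j = i")
      case True
      then show ?thesis using x sp by (simp add: B'_def l_upd)
    next
      case False
      then have jJ: "j \<in> J" using j by simp
      have "x(j := - x j, i := t) \<in> B \<longleftrightarrow> x(i := t) \<in> B" for t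
      proof
        assume "x(j := - x j, i := t) \<in> B"
        moreover have "(x(j := - x j, i := t))(j := - (x(j := - x j, i := t)) j) = x(i := t)"
          using False by (auto simp: fun_eq_iff)
        ultimately show "x(i := t) \<in> B" using sym[OF jJ] by metis
      next
        assume "x(i := t) \<in> B"
        moreover have "(x(i := t))(j := - (x(i := t)) j) = x(j := - x j, i := t)"
          using False by (auto simp: fun_eq_iff)
        ultimately show "x(j := - x j, i := t) \<in> B" using sym[OF jJ] by metis
      qed
      then have "l (x(j := - x j)) = l x" by (simp add: l_def indicator_def)
      then show ?thesis using x sp False by (simp add: B'_def)
    qed
  qed
  ultimately show ?thesis using B' meas by blast
qed

text \<open>After symmetrisation in every coordinate the set is invariant under the antipodal map. A
  point and its antipode are at twice the distance to the origin, so the set lies in the ball of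
  radius \<open>d / 2\<close>.\<close>

lemma isodiametric_pos:
  assumes I: "finite I" and A: "A \<in> sets (lborelI I)" and diam: "sq_diam_le I d A" and d: "0 < d"
  shows "emeasure (lborelI I) A \<le> ennreal (unit_ball_vol (real (card I)) * (d / 2) ^ card I)"
proof -
  have "\<exists>B\<in>sets (lborelI I). emeasure (lborelI I) B = emeasure (lborelI I) A \<and> sq_diam_le I d B \<and>
    (\<forall>j\<in>J. \<forall>x\<in>B. x(j := - x j) \<in> B)" if "J \<subseteq> I" for J
    using finite_subset[OF that I] that
  proof (induction J rule: finite_induct)
    case empty
    then show ?case using A diam by auto
  next
    case (insert i J)
    then obtain B where B: "B \<in> sets (lborelI I)" "emeasure (lborelI I) B = emeasure (lborelI I) A" "sq_diam_le I d B"
      "\<And>j x. j \<in> J \<Longrightarrow> x \<in> B \<Longrightarrow> x(j := - x j) \<in> B" by blast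
    have iJ: "i \<in> I" "J \<subseteq> I" using insert.prems by auto
    from steiner_symmetrization[OF I iJ(1) B(1,3,4) iJ(2) insert.hyps(2)] show ?case unfolding B(2) .
  qed
  from this[OF order_refl] obtain B where B: "B \<in> sets (lborelI I)" "emeasure (lborelI I) B = emeasure (lborelI I) A"
    "sq_diam_le I d B" "\<And>j x. j \<in> I \<Longrightarrow> x \<in> B \<Longrightarrow> x(j := - x j) \<in> B" by blast
  \<comment> \<open>The composition of the coordinate reflections in \<open>J\<close>; for
    \<open>J = I\<close> it is the antipodal map.\<close>
  have flip: "(\<lambda>i. if i \<in> J then - x i else x i) \<in> B" if "J \<subseteq> I" "x \<in> B" for J x
    using finite_subset[OF that(1) I] that(1)
  proof (induction J rule: finite_induct)
    case empty
    then show ?case using that by simp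
  next
    case (insert j J)
    have "(\<lambda>i. if i \<in> insert j J then - x i else x i) =
        (\<lambda>i. if i \<in> J then - x i else x i)(j := - (if j \<in> J then - x j else x j))"
      using insert.hyps by (auto simp: fun_eq_iff)
    then show ?case using B(4)[of j "\<lambda>i. if i \<in> J then - x i else x i"] insert by simp
  qed
  have "B \<subseteq> {f. sqrt (\<Sum>i\<in>I. (f i)\<^sup>2) \<le> d / 2} \<inter> space (lborelI I)"
  proof
    fix x assume x: "x \<in> B"
    have "(\<Sum>i\<in>I. (x i - (if i \<in> I then - x i else x i))\<^sup>2) \<le> d\<^sup>2"
      using bspec[OF bspec[OF B(3)[unfolded sq_diam_le_def] x] flip[OF order_refl x]] .
    also have "(\<Sum>i\<in>I. (x i - (if i \<in> I then - x i else x i))\<^sup>2) = 4 * (\<Sum>i\<in>I. (x i)\<^sup>2)"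
      by (simp add: sum_distrib_left power2_eq_square cong: sum.cong_simp)
    finally have "(\<Sum>i\<in>I. (x i)\<^sup>2) \<le> (d / 2)\<^sup>2" by (simp add: power_divide)
    then have "sqrt (\<Sum>i\<in>I. (x i)\<^sup>2) \<le> d / 2" using d by (intro real_le_lsqrt) (auto intro: sum_nonneg)
    then show "x \<in> {f. sqrt (\<Sum>i\<in>I. (f i)\<^sup>2) \<le> d / 2} \<inter> space (lborelI I)"
      using sets.sets_into_space[OF B(1)] x by auto
  qed
  then have "emeasure (lborelI I) B \<le> emeasure (lborelI I) ({f. sqrt (\<Sum>i\<in>I. (f i)\<^sup>2) \<le> d / 2} \<inter> space (lborelI I))"
  proof (rule emeasure_mono)
    have "{f \<in> space (lborelI I). sqrt (\<Sum>i\<in>I. (f i)\<^sup>2) \<le> d / 2} \<in> sets (lborelI I)" by measurable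
    then show "{f. sqrt (\<Sum>i\<in>I. (f i)\<^sup>2) \<le> d / 2} \<inter> space (lborelI I) \<in> sets (lborelI I)"
      by (simp add: Int_def conj_commute)
  qed
  also have "\<dots> = ennreal (unit_ball_vol (real (card I)) * (d / 2) ^ card I)"
    using I d by (intro emeasure_cball_aux) auto
  finally show ?thesis using B(2) by simp
qed

text \<open>The case \<open>d = 0\<close> is a limit of positive diameters. For empty
  \<open>I\<close>, which belongs to the sphere on a line, the bound reads 1 because
  \<open>0 ^ 0 = 1\<close>.\<close>

theorem isodiametric:
  assumes I: "finite I" and A: "A \<in> sets (lborelI I)" and diam: "sq_diam_le I d A" and d: "0 \<le> d"
  shows "emeasure (lborelI I) A \<le> ennreal (unit_ball_vol (real (card I)) * (d / 2) ^ card I)"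
proof -
  let ?r = "\<lambda>n. d + inverse (real (Suc n))"
  have "(\<lambda>n. ennreal (unit_ball_vol (real (card I)) * (?r n / 2) ^ card I)) \<longlonglongrightarrow>
      ennreal (unit_ball_vol (real (card I)) * ((d + 0) / 2) ^ card I)"
    by (intro tendsto_ennrealI tendsto_intros LIMSEQ_inverse_real_of_nat) auto
  moreover have "emeasure (lborelI I) A \<le> ennreal (unit_ball_vol (real (card I)) * (?r n / 2) ^ card I)" for n
  proof (rule isodiametric_pos[OF I A])
    show "0 < ?r n" using d by (simp add: add_nonneg_pos)
    have "d\<^sup>2 \<le> (?r n)\<^sup>2" using d by (intro power_mono) auto
    then show "sq_diam_le I (?r n) A" using diam unfolding sq_diam_le_def by force
  qed
  ultimately show ?thesis by (intro LIMSEQ_le_const) auto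
qed

section \<open>Slices of the sphere measure and the gnomonic projection\<close>

definition perp :: "'a::euclidean_space \<Rightarrow> ('a \<Rightarrow> real) \<Rightarrow> 'a" where
  "perp e f = (\<Sum>b\<in>Basis - {e}. f b *\<^sub>R b)"

lemma perp_inner: "e \<in> Basis \<Longrightarrow> perp e f \<bullet> e = 0"
  by (auto simp: perp_def inner_sum_left inner_Basis intro!: sum.neutral)

lemma norm_perp_diff: "(norm (perp e f - perp e h))\<^sup>2 = (\<Sum>b\<in>Basis - {e}. (f b - h b)\<^sup>2)"
proof -
  have "perp e f - perp e h = (\<Sum>b\<in>Basis - {e}. (f b - h b) *\<^sub>R b)"
    by (simp add: perp_def scaleR_diff_left sum_subtractf)
  also have "(norm \<dots>)\<^sup>2 = (\<Sum>b\<in>Basis - {e}. norm ((f b - h b) *\<^sub>R b) ^ 2)"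
    by (rule norm_sum_Pythagorean) (auto simp: pairwise_def orthogonal_def inner_Basis)
  finally show ?thesis by simp
qed

lemma norm_perp: "(norm (perp e f))\<^sup>2 = (\<Sum>b\<in>Basis - {e}. (f b)\<^sup>2)"
  using norm_perp_diff[of e f "\<lambda>_. 0"] by (simp add: perp_def)

lemma borel_measurable_perp [measurable]: "perp (e::'a::euclidean_space) \<in> borel_measurable (lborelI (Basis - {e}))"
  unfolding perp_def[abs_def] by (intro borel_measurable_sum borel_measurable_scaleR borel_measurable_const) simp

text \<open>The height along \<open>e\<close> is the outer variable, so every slice becomes a set in
  the product space to which the isodiametric inequality applies.\<close>

lemma nn_integral_slices:
  fixes F :: "'a::euclidean_space \<Rightarrow> ennreal"
  assumes [measurable]: "F \<in> borel_measurable borel" and e: "e \<in> Basis"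
  shows "(\<integral>\<^sup>+v. F v \<partial>lborel) = (\<integral>\<^sup>+s. (\<integral>\<^sup>+f. F (s *\<^sub>R e + perp e f) \<partial>lborelI (Basis - {e})) \<partial>lborel)"
proof -
  interpret product_sigma_finite "\<lambda>_. lborel :: real measure" by standard
  have ins: "insert e (Basis - {e}) = Basis" using e by auto
  have S: "(\<lambda>f. \<Sum>b\<in>Basis. f b *\<^sub>R b) \<in> borel_measurable (lborelI (Basis :: 'a set))"
    by (intro borel_measurable_sum borel_measurable_scaleR borel_measurable_const) simp
  have "(\<integral>\<^sup>+v. F v \<partial>lborel) = (\<integral>\<^sup>+f. F (\<Sum>b\<in>Basis. f b *\<^sub>R b) \<partial>lborelI (insert e (Basis - {e})))"
    unfolding ins using S by (subst lborel_eq) (simp add: nn_integral_distr)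
  also have "\<dots> = (\<integral>\<^sup>+s. (\<integral>\<^sup>+f. F (\<Sum>b\<in>Basis. (f(e := s)) b *\<^sub>R b) \<partial>lborelI (Basis - {e})) \<partial>lborel)"
  proof (rule product_nn_integral_insert_rev)
    show "(\<lambda>f. F (\<Sum>b\<in>Basis. f b *\<^sub>R b)) \<in> borel_measurable (lborelI (insert e (Basis - {e})))"
      unfolding ins by (rule measurable_compose[OF S]) simp
  qed auto
  also have "(\<lambda>s f. \<Sum>b\<in>Basis. (f(e := s)) b *\<^sub>R b) = (\<lambda>s f. s *\<^sub>R e + perp e f)"
  proof (intro ext)
    fix s and f :: "'a \<Rightarrow> real"
    have "(\<Sum>b\<in>Basis. (f(e := s)) b *\<^sub>R b) = (f(e := s)) e *\<^sub>R e + (\<Sum>b\<in>Basis - {e}. (f(e := s)) b *\<^sub>R b)"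
      using e by (simp only: sum.remove finite_Basis)
    also have "(\<Sum>b\<in>Basis - {e}. (f(e := s)) b *\<^sub>R b) = perp e f"
      unfolding perp_def by (intro sum.cong) auto
    finally show "(\<Sum>b\<in>Basis. (f(e := s)) b *\<^sub>R b) = s *\<^sub>R e + perp e f" by simp
  qed
  finally show ?thesis by (simp add: fun_eq_iff)
qed

lemma nn_integral_power_Icc:
  assumes "0 \<le> m" "0 < n"
  shows "(\<integral>\<^sup>+s. ennreal (real n * s ^ (n - 1)) * indicator {0<..<m} s \<partial>lborel) = ennreal (m ^ n)"
proof -
  have "(\<integral>\<^sup>+s. ennreal (real n * s ^ (n - 1)) * indicator {0<..<m} s \<partial>lborel) =
      (\<integral>\<^sup>+s. ennreal (real n * s ^ (n - 1)) * indicator {0..m} s \<partial>lborel)"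
  proof (rule nn_integral_cong_AE)
    have "AE s in lborel. s \<noteq> 0 \<and> s \<noteq> m" by (intro AE_conjI AE_lborel_singleton)
    then show "AE s in lborel. ennreal (real n * s ^ (n - 1)) * indicator {0<..<m} s = ennreal (real n * s ^ (n - 1)) * indicator {0..m} s"
      by eventually_elim (auto simp: indicator_def)
  qed
  also have "\<dots> = ennreal (m ^ n - 0 ^ n)"
  proof (rule nn_integral_FTC_Icc)
    show "((\<lambda>s. s ^ n) has_real_derivative real n * s ^ (n - 1)) (at s)" for s
      using DERIV_pow[of n s UNIV] by simp
  qed (use assms in \<open>auto intro!: mult_nonneg_nonneg\<close>)
  finally show ?thesis using assms by simp
qed

lemma card_Basis_minus: "e \<in> Basis \<Longrightarrow> card ((Basis :: 'a::euclidean_space set) - {e}) = DIM('a) - 1"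
  by simp

lemma slice_inner_norm:
  assumes e: "e \<in> Basis"
  shows "(s *\<^sub>R e + perp e f) \<bullet> e = s" "(norm (s *\<^sub>R e + perp e f))\<^sup>2 = s\<^sup>2 + (norm (perp e f))\<^sup>2"
proof -
  show 1: "(s *\<^sub>R e + perp e f) \<bullet> e = s"
    using e by (simp add: inner_add_left perp_inner)
  have "e \<bullet> perp e f = 0" using perp_inner[OF e] by (simp add: inner_commute)
  then show "(norm (s *\<^sub>R e + perp e f))\<^sup>2 = s\<^sup>2 + (norm (perp e f))\<^sup>2"
    using e perp_inner[OF e] by (simp add: power2_norm_eq_inner inner_add_left inner_add_right) (simp add: power2_eq_square)
qed

lemma norm_diff_unit:
  fixes x y :: "'a::real_inner"
  assumes "norm x = 1" "norm y = 1"
  shows "(norm (x - y))\<^sup>2 = 2 - 2 * (x \<bullet> y)"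
proof -
  have "x \<bullet> x = 1" "y \<bullet> y = 1" using assms by (simp_all add: norm_eq_1)
  then show ?thesis by (simp add: power2_norm_eq_inner inner_diff_left inner_diff_right inner_commute)
qed

text \<open>\<open>1 - d\<^sup>2 / 2\<close> bounds from below the inner product of \<open>e\<close>
  with a unit vector at distance at most \<open>d\<close>. The first term comes from the difference
  of the numerators, the second from the variation of the divisor.\<close>

definition gnom_const :: "real \<Rightarrow> real" where
  "gnom_const d = 1 / (1 - d\<^sup>2 / 2) + d / (1 - d\<^sup>2 / 2)\<^sup>2"

text \<open>The gnomonic projection \<open>\<omega> \<mapsto> \<omega> / (\<omega> \<bullet> e)\<close> of a small cap has Lipschitz constant close to \<open>1\<close>.\<close>

lemma gnomonic_lipschitz:
  fixes x y e :: "'a::real_inner"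
  assumes n: "norm x = 1" "norm y = 1" "norm e = 1" and d: "norm (x - e) \<le> d" "norm (y - e) \<le> d" "0 \<le> d" "d \<le> 1 / 2"
  shows "0 < x \<bullet> e" "norm (x /\<^sub>R (x \<bullet> e) - y /\<^sub>R (y \<bullet> e)) \<le> gnom_const d * norm (x - y)"
proof -
  define m where "m = 1 - d\<^sup>2 / 2"
  have "d\<^sup>2 \<le> (1 / 2)\<^sup>2" using d by (intro power_mono) auto
  then have m: "1 / 2 \<le> m" by (simp add: m_def power2_eq_square)
  have ge: "m \<le> z \<bullet> e" if "norm z = 1" "norm (z - e) \<le> d" for z
  proof -
    have "(norm (z - e))\<^sup>2 \<le> d\<^sup>2" using that by (intro power_mono) auto
    then show ?thesis using norm_diff_unit[OF that(1) n(3)] by (simp add: m_def)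
  qed
  have a: "m \<le> x \<bullet> e" "m \<le> y \<bullet> e" using ge n d by auto
  show "0 < x \<bullet> e" using a m by simp
  have y0: "0 < y \<bullet> e" using a m by simp
  \<comment> \<open>Expressing the inner products by distances to \<open>e\<close> and factoring the
    difference of squares gains a factor \<open>d\<close>; without it the constant would not tend to
    1.\<close>
  have "2 * \<bar>x \<bullet> e - y \<bullet> e\<bar> = \<bar>(norm (y - e))\<^sup>2 - (norm (x - e))\<^sup>2\<bar>"
    using norm_diff_unit[OF n(1,3)] norm_diff_unit[OF n(2,3)] by (simp add: abs_if)
  also have "\<dots> = \<bar>norm (y - e) - norm (x - e)\<bar> * (norm (y - e) + norm (x - e))"
    by (simp add: power2_eq_square square_diff_square_factored abs_mult mult.commute)
  also have "\<dots> \<le> norm (x - y) * (d + d)"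
  proof (intro mult_mono add_mono d)
    show "\<bar>norm (y - e) - norm (x - e)\<bar> \<le> norm (x - y)"
      using norm_triangle_ineq3[of "y - e" "x - e"] by (simp add: norm_minus_commute)
  qed auto
  finally have ab: "\<bar>x \<bullet> e - y \<bullet> e\<bar> \<le> d * norm (x - y)" by (simp add: mult.commute)
  have "norm (x /\<^sub>R (x \<bullet> e) - y /\<^sub>R (y \<bullet> e)) = norm ((x - y) /\<^sub>R (x \<bullet> e) + (inverse (x \<bullet> e) - inverse (y \<bullet> e)) *\<^sub>R y)"
    by (simp add: algebra_simps)
  also have "\<dots> \<le> norm ((x - y) /\<^sub>R (x \<bullet> e)) + norm ((inverse (x \<bullet> e) - inverse (y \<bullet> e)) *\<^sub>R y)"
    by (rule norm_triangle_ineq)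
  also have "\<dots> = norm (x - y) / (x \<bullet> e) + \<bar>inverse (x \<bullet> e) - inverse (y \<bullet> e)\<bar>"
  proof -
    have "norm (w /\<^sub>R c) = norm w / c" if "0 < c" for w :: 'a and c
      using that by (simp add: divide_inverse mult.commute)
    moreover have "norm (c *\<^sub>R y) = \<bar>c\<bar>" for c using n by simp
    ultimately show ?thesis using \<open>0 < x \<bullet> e\<close> by metis
  qed
  also have "\<bar>inverse (x \<bullet> e) - inverse (y \<bullet> e)\<bar> = \<bar>x \<bullet> e - y \<bullet> e\<bar> / ((x \<bullet> e) * (y \<bullet> e))"
  proof -
    have "\<bar>inverse a - inverse b\<bar> = \<bar>a - b\<bar> / (a * b)" if "0 < a" "0 < b" for a b :: real
    proof -
      have "inverse a - inverse b = (b - a) / (a * b)" using that by (simp add: field_simps)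
      then show ?thesis using that by (simp add: abs_mult abs_minus_commute)
    qed
    then show ?thesis using \<open>0 < x \<bullet> e\<close> y0 by blast
  qed
  also have "norm (x - y) / (x \<bullet> e) + \<bar>x \<bullet> e - y \<bullet> e\<bar> / ((x \<bullet> e) * (y \<bullet> e)) \<le> norm (x - y) / m + (d * norm (x - y)) / (m * m)"
    using a m ab by (intro add_mono frac_le mult_mono) auto
  also have "\<dots> = gnom_const d * norm (x - y)"
    unfolding gnom_const_def m_def[symmetric] by (simp add: power2_eq_square distrib_right)
  finally show "norm (x /\<^sub>R (x \<bullet> e) - y /\<^sub>R (y \<bullet> e)) \<le> gnom_const d * norm (x - y)" .
qed

lemma gnom_const_pos: "0 \<le> d \<Longrightarrow> d \<le> 1 / 2 \<Longrightarrow> 0 \<le> gnom_const d"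
proof -
  assume d: "0 \<le> d" "d \<le> 1 / 2"
  then have "d\<^sup>2 \<le> (1 / 2)\<^sup>2" by (intro power_mono) auto
  then have "0 \<le> 1 - d\<^sup>2 / 2" by (simp add: power2_eq_square)
  then show ?thesis using d by (simp add: gnom_const_def)
qed

lemma emeasure_sphere_measure_slices:
  fixes U :: "'a::euclidean_space set"
  assumes e: "e \<in> Basis" and [measurable]: "U \<in> sets borel"
  shows "emeasure sphere_measure U = (\<integral>\<^sup>+s. ennreal (real DIM('a)) *
    emeasure (lborelI (Basis - {e})) {f \<in> space (lborelI (Basis - {e})). s *\<^sub>R e + perp e f \<in> ball 0 1 - {0} \<and>
      (s *\<^sub>R e + perp e f) /\<^sub>R norm (s *\<^sub>R e + perp e f) \<in> U} \<partial>lborel)"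
proof -
  let ?v = "\<lambda>s f. s *\<^sub>R e + perp e f"
  have [measurable]: "ball 0 1 - {0} \<in> sets (borel :: 'a measure)" by simp
  have "emeasure sphere_measure U = (\<integral>\<^sup>+\<omega>. indicator U \<omega> \<partial>sphere_measure)" by simp
  also have "\<dots> = (\<integral>\<^sup>+v. ennreal (real DIM('a)) * indicator (ball 0 1 - {0}) v * indicator U (v /\<^sub>R norm v) \<partial>lborel)"
    by (rule nn_integral_sphere_measure) simp
  also have "\<dots> = (\<integral>\<^sup>+s. (\<integral>\<^sup>+f. ennreal (real DIM('a)) * indicator (ball 0 1 - {0}) (?v s f) * indicator U (?v s f /\<^sub>R norm (?v s f)) \<partial>lborelI (Basis - {e})) \<partial>lborel)"
    by (rule nn_integral_slices[OF _ e]) measurable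
  also have "\<dots> = (\<integral>\<^sup>+s. ennreal (real DIM('a)) * emeasure (lborelI (Basis - {e})) {f \<in> space (lborelI (Basis - {e})). ?v s f \<in> ball 0 1 - {0} \<and> ?v s f /\<^sub>R norm (?v s f) \<in> U} \<partial>lborel)"
  proof (rule nn_integral_cong)
    fix s :: real
    let ?A = "{f \<in> space (lborelI (Basis - {e})). ?v s f \<in> ball 0 1 - {0} \<and> ?v s f /\<^sub>R norm (?v s f) \<in> U}"
    have A: "?A \<in> sets (lborelI (Basis - {e}))" by measurable
    have "(\<integral>\<^sup>+f. ennreal (real DIM('a)) * indicator (ball 0 1 - {0}) (?v s f) * indicator U (?v s f /\<^sub>R norm (?v s f)) \<partial>lborelI (Basis - {e})) =
       (\<integral>\<^sup>+f. ennreal (real DIM('a)) * indicator ?A f \<partial>lborelI (Basis - {e}))"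
      by (intro nn_integral_cong) (auto simp: indicator_def)
    also have "\<dots> = ennreal (real DIM('a)) * emeasure (lborelI (Basis - {e})) ?A"
      using A by (rule nn_integral_cmult_indicator)
    finally show "(\<integral>\<^sup>+f. ennreal (real DIM('a)) * indicator (ball 0 1 - {0}) (?v s f) * indicator U (?v s f /\<^sub>R norm (?v s f)) \<partial>lborelI (Basis - {e})) =
      ennreal (real DIM('a)) * emeasure (lborelI (Basis - {e})) ?A" .
  qed
  finally show ?thesis .
qed

text \<open>The cone over \<open>U\<close> is cut into slices at height \<open>s\<close> along
  \<open>e\<close>. Up to a translation each slice lies in \<open>s\<close> times the gnomonic
  image, so its diameter is at most \<open>s * (gnom_const d * D)\<close>; the isodiametric
  inequality bounds its volume, and \<open>real n * s ^ (n - 1)\<close> integrates to 1 over the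
  unit interval.\<close>

lemma sphere_measure_le:
  fixes U :: "'a::euclidean_space set"
  assumes e: "e \<in> Basis" and U: "U \<in> sets borel" "U \<subseteq> cball e d" and d: "0 \<le> d" "d \<le> 1 / 2"
    and unit: "\<And>x. x \<in> U \<Longrightarrow> norm x = 1"
    and D: "\<And>x y. x \<in> U \<Longrightarrow> y \<in> U \<Longrightarrow> norm (x - y) \<le> D" "0 \<le> D"
  shows "emeasure sphere_measure U \<le> ennreal (unit_ball_vol (real (DIM('a) - 1)) * (gnom_const d * D / 2) ^ (DIM('a) - 1))"
proof -
  let ?n = "DIM('a)"
  let ?L = "gnom_const d"
  let ?v = "\<lambda>s f. s *\<^sub>R e + perp e f"
  let ?A = "\<lambda>s. {f \<in> space (lborelI (Basis - {e})). ?v s f \<in> ball 0 1 - {0} \<and> ?v s f /\<^sub>R norm (?v s f) \<in> U}"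
  let ?W = "unit_ball_vol (real (?n - 1)) * (?L * D / 2) ^ (?n - 1)"
  have ne: "norm e = 1" using e by simp
  have L0: "0 \<le> ?L" using d by (rule gnom_const_pos)
  have W0: "0 \<le> ?W" using L0 D(2) by (intro mult_nonneg_nonneg zero_le_power) auto
  have near: "norm (x - e) \<le> d" if "x \<in> U" for x using that U(2) by (auto simp: dist_norm norm_minus_commute)
  have geo: "0 < s \<and> s < 1 \<and> perp e f = s *\<^sub>R ((?v s f /\<^sub>R norm (?v s f)) /\<^sub>R ((?v s f /\<^sub>R norm (?v s f)) \<bullet> e) - e)"
    if f: "f \<in> ?A s" for s f
  proof -
    let ?x = "?v s f /\<^sub>R norm (?v s f)"
    have x: "?x \<in> U" and v: "0 < norm (?v s f)" "norm (?v s f) < 1" using f by auto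
    have xe: "?x \<bullet> e = s / norm (?v s f)" using slice_inner_norm(1)[OF e, of s f] by (simp add: divide_inverse mult.commute)
    have "0 < ?x \<bullet> e" using gnomonic_lipschitz(1)[OF unit[OF x] unit[OF x] ne near[OF x] near[OF x] d] .
    then have s: "0 < s" using v unfolding xe by (simp add: zero_less_divide_iff)
    have "s \<le> norm (?v s f) * norm e" using slice_inner_norm(1)[OF e, of s f] norm_cauchy_schwarz[of "?v s f" e] by simp
    then have "s < 1" using v ne by simp
    have "?x /\<^sub>R (?x \<bullet> e) = ?v s f /\<^sub>R s"
      unfolding xe using v s by (simp add: field_simps)
    then have "s *\<^sub>R (?x /\<^sub>R (?x \<bullet> e) - e) = perp e f" using s by (simp add: algebra_simps)
    then show ?thesis using s \<open>s < 1\<close> by simp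
  qed
  have slice: "ennreal (real ?n) * emeasure (lborelI (Basis - {e})) (?A s) \<le> ennreal ?W * (ennreal (real ?n * s ^ (?n - 1)) * indicator {0<..<1} s)" for s
  proof (cases "s \<in> {0<..<1}")
    case True
    have [measurable]: "U \<in> sets borel" "ball 0 1 - {0} \<in> sets (borel :: 'a measure)" using U by auto
    have "sq_diam_le (Basis - {e}) (s * (?L * D)) (?A s)"
      unfolding sq_diam_le_def norm_perp_diff[symmetric]
    proof (intro ballI power_mono)
      fix f h assume f: "f \<in> ?A s" and h: "h \<in> ?A s"
      let ?x = "?v s f /\<^sub>R norm (?v s f)" and ?y = "?v s h /\<^sub>R norm (?v s h)"
      have xy: "?x \<in> U" "?y \<in> U" using f h by auto
      have pf: "perp e f = s *\<^sub>R (?x /\<^sub>R (?x \<bullet> e) - e)" and ph: "perp e h = s *\<^sub>R (?y /\<^sub>R (?y \<bullet> e) - e)"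
        using geo[OF f] geo[OF h] by blast+
      have "perp e f - perp e h = s *\<^sub>R (?x /\<^sub>R (?x \<bullet> e) - ?y /\<^sub>R (?y \<bullet> e))"
        by (subst pf, subst ph) (simp only: scaleR_diff_right diff_diff_eq2 diff_add_cancel add_diff_eq[symmetric] diff_add_eq)
      then have "norm (perp e f - perp e h) = s * norm (?x /\<^sub>R (?x \<bullet> e) - ?y /\<^sub>R (?y \<bullet> e))"
        using True by (simp only: norm_scaleR) simp
      also have "\<dots> \<le> s * (?L * norm (?x - ?y))"
        using True gnomonic_lipschitz(2)[OF unit[OF xy(1)] unit[OF xy(2)] ne near[OF xy(1)] near[OF xy(2)] d]
        by (intro mult_left_mono) auto
      also have "\<dots> \<le> s * (?L * D)"
        using True L0 D(1)[OF xy] by (intro mult_left_mono) auto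
      finally show "norm (perp e f - perp e h) \<le> s * (?L * D)" .
    qed auto
    moreover have "?A s \<in> sets (lborelI (Basis - {e}))" by measurable
    ultimately have "emeasure (lborelI (Basis - {e})) (?A s) \<le> ennreal (unit_ball_vol (real (card (Basis - {e}))) * (s * (?L * D) / 2) ^ card (Basis - {e}))"
      using True L0 D(2) by (intro isodiametric) auto
    also have "unit_ball_vol (real (card (Basis - {e}))) * (s * (?L * D) / 2) ^ card (Basis - {e}) = ?W * s ^ (?n - 1)"
      unfolding card_Basis_minus[OF e] by (simp add: power_mult_distrib power_divide)
    finally have "ennreal (real ?n) * emeasure (lborelI (Basis - {e})) (?A s) \<le> ennreal (real ?n) * ennreal (?W * s ^ (?n - 1))"
      by (rule mult_left_mono) simp
    also have "\<dots> = ennreal ?W * ennreal (real ?n * s ^ (?n - 1))"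
    proof -
      have "ennreal a * ennreal (w * t) = ennreal w * ennreal (a * t)" if "0 \<le> a" "0 \<le> w" "0 \<le> t" for a w t
        using that by (simp add: ennreal_mult mult.left_commute)
      then show ?thesis using W0 True by simp
    qed
    finally show ?thesis using True by simp
  next
    case False
    then have "?A s = {}" using geo[of _ s] by auto
    then show ?thesis by (simp only: emeasure_empty mult_zero_right zero_le)
  qed
  have "emeasure sphere_measure U \<le> (\<integral>\<^sup>+s. ennreal ?W * (ennreal (real ?n * s ^ (?n - 1)) * indicator {0<..<1} s) \<partial>lborel)"
    unfolding emeasure_sphere_measure_slices[OF e U(1)] by (intro nn_integral_mono slice)
  also have "\<dots> = ennreal ?W * (\<integral>\<^sup>+s. ennreal (real ?n * s ^ (?n - 1)) * indicator {0<..<1} s \<partial>lborel)"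
    by (rule nn_integral_cmult) measurable
  also have "\<dots> = ennreal ?W" by (subst nn_integral_power_Icc) auto
  finally show ?thesis .
qed

text \<open>At each height \<open>s\<close> below \<open>1 - r\<^sup>2 / 2\<close> the cone over the
  cap contains the disc of radius \<open>r * s\<close>, and the volumes of these discs are
  integrated. Compared with a flat disc of radius \<open>r\<close> the loss is a factor tending to
  1.\<close>

lemma sphere_measure_cap_ge:
  fixes e :: "'a::euclidean_space"
  assumes e: "e \<in> Basis" and r: "0 < r" "r \<le> 1"
  shows "ennreal (unit_ball_vol (real (DIM('a) - 1)) * r ^ (DIM('a) - 1) * (1 - r\<^sup>2 / 2) ^ DIM('a)) \<le> emeasure sphere_measure (cball e r)"
proof -
  let ?n = "DIM('a)"
  let ?v = "\<lambda>s f. s *\<^sub>R e + perp e f"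
  let ?A = "\<lambda>s. {f \<in> space (lborelI (Basis - {e})). ?v s f \<in> ball 0 1 - {0} \<and> ?v s f /\<^sub>R norm (?v s f) \<in> cball e r}"
  define m where "m = 1 - r\<^sup>2 / 2"
  have r2: "r\<^sup>2 \<le> 1" using r by (simp add: power_le_one)
  have m: "0 < m" using r2 by (simp add: m_def)
  have ne: "norm e = 1" using e by simp
  \<comment> \<open>It yields \<open>m * norm v \<le> s\<close> for all points \<open>v\<close> of
    the disc at height \<open>s\<close>, which places them both in the unit ball and over the
    cap.\<close>
  have mr: "m\<^sup>2 * (1 + r\<^sup>2) \<le> 1"
  proof -
    have "m\<^sup>2 * (1 + r\<^sup>2) = 1 - r\<^sup>2 * r\<^sup>2 * (3 - r\<^sup>2) / 4"
      by (simp add: m_def power2_eq_square field_simps)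
    moreover have "0 \<le> r\<^sup>2 * r\<^sup>2 * (3 - r\<^sup>2)" using r2 by simp
    ultimately show ?thesis by simp
  qed
  let ?W = "unit_ball_vol (real (?n - 1)) * r ^ (?n - 1)"
  have W0: "0 \<le> ?W" using r by simp
  have slice: "ennreal ?W * (ennreal (real ?n * s ^ (?n - 1)) * indicator {0<..<m} s) \<le> ennreal (real ?n) * emeasure (lborelI (Basis - {e})) (?A s)" for s
  proof (cases "s \<in> {0<..<m}")
    case True
    then have s: "0 < s" "s < m" by auto
    have [measurable]: "cball e r \<in> sets borel" "ball 0 1 - {0} \<in> sets (borel :: 'a measure)" by auto
    let ?C = "{f. sqrt (\<Sum>b\<in>Basis - {e}. (f b)\<^sup>2) \<le> r * s} \<inter> space (lborelI (Basis - {e}))"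
    have "?C \<subseteq> ?A s"
    proof
      fix f assume f: "f \<in> ?C"
      have w: "norm (perp e f) \<le> r * s"
        using f by (simp add: norm_perp[symmetric])
      have "(norm (?v s f))\<^sup>2 = s\<^sup>2 + (norm (perp e f))\<^sup>2" by (rule slice_inner_norm(2)[OF e])
      also have "(norm (perp e f))\<^sup>2 \<le> (r * s)\<^sup>2" using w by (intro power_mono) auto
      finally have nv: "(norm (?v s f))\<^sup>2 \<le> s\<^sup>2 * (1 + r\<^sup>2)" by (simp add: power_mult_distrib algebra_simps)
      then have "m\<^sup>2 * (norm (?v s f))\<^sup>2 \<le> m\<^sup>2 * (s\<^sup>2 * (1 + r\<^sup>2))" by (rule mult_left_mono) simp
      also have "\<dots> = s\<^sup>2 * (m\<^sup>2 * (1 + r\<^sup>2))" by simp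
      also have "\<dots> \<le> s\<^sup>2 * 1" using mr by (intro mult_left_mono) auto
      finally have "(m * norm (?v s f))\<^sup>2 \<le> s\<^sup>2" by (simp add: power_mult_distrib)
      then have ms: "m * norm (?v s f) \<le> s" by (rule power2_le_imp_le) (use s in simp)
      then have "m * norm (?v s f) < m * 1" using s by linarith
      then have v1: "norm (?v s f) < 1" using m by simp
      have v0: "?v s f \<noteq> 0" using slice_inner_norm(1)[OF e, of s f] s by auto
      then have nx: "norm (?v s f /\<^sub>R norm (?v s f)) = 1" by simp
      have "(norm (?v s f /\<^sub>R norm (?v s f) - e))\<^sup>2 = 2 - 2 * (s / norm (?v s f))"
        using norm_diff_unit[OF nx ne] slice_inner_norm(1)[OF e, of s f] by (simp add: divide_inverse mult.commute)
      also have "\<dots> \<le> 2 - 2 * m"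
        using ms v0 by (simp add: pos_le_divide_eq)
      also have "\<dots> = r\<^sup>2" by (simp add: m_def)
      finally have "norm (?v s f /\<^sub>R norm (?v s f) - e) \<le> r" by (rule power2_le_imp_le) (use r in simp)
      then have "dist e (?v s f /\<^sub>R norm (?v s f)) \<le> r" by (simp only: dist_norm norm_minus_commute)
      then show "f \<in> ?A s" using f v0 v1 by simp
    qed
    then have "emeasure (lborelI (Basis - {e})) ?C \<le> emeasure (lborelI (Basis - {e})) (?A s)"
      by (rule emeasure_mono) measurable
    also have "emeasure (lborelI (Basis - {e})) ?C = ennreal (unit_ball_vol (real (card (Basis - {e}))) * (r * s) ^ card (Basis - {e}))"
      using r s by (intro emeasure_cball_aux) auto
    also have "unit_ball_vol (real (card (Basis - {e}))) * (r * s) ^ card (Basis - {e}) = ?W * s ^ (?n - 1)"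
      unfolding card_Basis_minus[OF e] by (simp add: power_mult_distrib)
    finally have "ennreal (real ?n) * ennreal (?W * s ^ (?n - 1)) \<le> ennreal (real ?n) * emeasure (lborelI (Basis - {e})) (?A s)"
      by (rule mult_left_mono) simp
    moreover have "ennreal (real ?n) * ennreal (?W * s ^ (?n - 1)) = ennreal ?W * ennreal (real ?n * s ^ (?n - 1))"
    proof -
      have "ennreal a * ennreal (w * t) = ennreal w * ennreal (a * t)" if "0 \<le> a" "0 \<le> w" "0 \<le> t" for a w t
        using that by (simp add: ennreal_mult mult.left_commute)
      then show ?thesis using W0 s by simp
    qed
    ultimately show ?thesis using True by simp
  qed simp
  have "ennreal (?W * m ^ ?n) = ennreal ?W * (\<integral>\<^sup>+s. ennreal (real ?n * s ^ (?n - 1)) * indicator {0<..<m} s \<partial>lborel)"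
    using m W0 by (subst nn_integral_power_Icc) (auto simp: ennreal_mult)
  also have "\<dots> = (\<integral>\<^sup>+s. ennreal ?W * (ennreal (real ?n * s ^ (?n - 1)) * indicator {0<..<m} s) \<partial>lborel)"
    by (rule nn_integral_cmult[symmetric]) measurable
  also have "\<dots> \<le> emeasure sphere_measure (cball e r)"
    by (subst emeasure_sphere_measure_slices[OF e], simp) (intro nn_integral_mono slice)
  finally show ?thesis by (simp add: m_def)
qed

section \<open>Rotation invariance\<close>

lemma nn_integral_lborel_reflect:
  fixes f :: "'a::euclidean_space \<Rightarrow> ennreal"
  assumes [measurable]: "f \<in> borel_measurable borel"
  shows "(\<integral>\<^sup>+x. f (a - x) \<partial>lborel) = (\<integral>\<^sup>+x. f x \<partial>lborel)"
  by (subst (2) lborel_affine[of "-1" a]) (auto simp: nn_integral_density nn_integral_distr)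

lemma borel_measurable_orthogonal: "orthogonal_transformation (f :: 'a::euclidean_space \<Rightarrow> 'a) \<Longrightarrow> f \<in> borel_measurable borel"
  by (intro borel_measurable_continuous_onI linear_continuous_on) (simp add: orthogonal_transformation_linear linear_conv_bounded_linear[symmetric])

text \<open>Uniqueness of Haar measure by the usual Fubini argument, the constant being read off from the unit ball.\<close>

lemma nn_integral_lborel_orthogonal:
  fixes f :: "'a::euclidean_space \<Rightarrow> 'a"
  assumes f: "orthogonal_transformation f" and F: "F \<in> borel_measurable borel"
  shows "(\<integral>\<^sup>+x. F (f x) \<partial>lborel) = (\<integral>\<^sup>+x. F x \<partial>lborel)"
proof -
  have [measurable]: "F \<in> borel_measurable borel" by (rule F)
  have [measurable]: "f \<in> borel_measurable borel" by (rule borel_measurable_orthogonal[OF f])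
  have lin: "linear f" and nf: "norm (f x) = norm x" for x
    using f by (auto simp: orthogonal_transformation)
  have surj: "surj f" using f by (rule orthogonal_transformation_surj)
  let ?B = "ball 0 1 :: 'a set"
  have [measurable]: "?B \<in> sets borel" by simp
  let ?b = "emeasure lborel ?B"
  have fB: "indicator ?B (f x) = (indicator ?B x :: ennreal)" for x using nf by (simp add: indicator_def)
  have "(\<integral>\<^sup>+x. F (f x) \<partial>lborel) * ?b = (\<integral>\<^sup>+x. F (f x) * (\<integral>\<^sup>+y. indicator ?B y \<partial>lborel) \<partial>lborel)"
    by (simp add: nn_integral_multc)
  also have "\<dots> = (\<integral>\<^sup>+x. (\<integral>\<^sup>+y. F (f x) * indicator ?B (y + f x) \<partial>lborel) \<partial>lborel)"
  proof (rule nn_integral_cong)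
    fix x :: 'a
    have "(\<integral>\<^sup>+y. indicator ?B (y + f x) \<partial>lborel) = (\<integral>\<^sup>+y. indicator ?B y \<partial>lborel)"
      by (rule nn_integral_lborel_plus) measurable
    then show "F (f x) * (\<integral>\<^sup>+y. indicator ?B y \<partial>lborel) = (\<integral>\<^sup>+y. F (f x) * indicator ?B (y + f x) \<partial>lborel)"
      by (subst nn_integral_cmult) auto
  qed
  also have "\<dots> = (\<integral>\<^sup>+y. (\<integral>\<^sup>+x. F (f x) * indicator ?B (y + f x) \<partial>lborel) \<partial>lborel)"
    by (rule lborel_pair.Fubini') measurable
  also have "\<dots> = (\<integral>\<^sup>+y. (\<integral>\<^sup>+x. F (f x - y) * indicator ?B (f x) \<partial>lborel) \<partial>lborel)"
  proof (rule nn_integral_cong)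
    fix y :: 'a
    obtain z where z: "y = f z" using surj by (metis surjD)
    have "(\<integral>\<^sup>+x. F (f x - y) * indicator ?B (f x) \<partial>lborel) = (\<integral>\<^sup>+x. F (f (x + z) - y) * indicator ?B (f (x + z)) \<partial>lborel)"
      by (rule nn_integral_lborel_plus[symmetric]) measurable
    also have "\<dots> = (\<integral>\<^sup>+x. F (f x) * indicator ?B (y + f x) \<partial>lborel)"
      by (simp add: linear_add[OF lin] z add.commute)
    finally show "(\<integral>\<^sup>+x. F (f x) * indicator ?B (y + f x) \<partial>lborel) = (\<integral>\<^sup>+x. F (f x - y) * indicator ?B (f x) \<partial>lborel)" ..
  qed
  also have "\<dots> = (\<integral>\<^sup>+x. (\<integral>\<^sup>+y. F (f x - y) * indicator ?B (f x) \<partial>lborel) \<partial>lborel)"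
    by (rule lborel_pair.Fubini') measurable
  also have "\<dots> = (\<integral>\<^sup>+x. (\<integral>\<^sup>+y. F y \<partial>lborel) * indicator ?B x \<partial>lborel)"
  proof (rule nn_integral_cong)
    fix x :: 'a
    have "(\<integral>\<^sup>+y. F (f x - y) * indicator ?B (f x) \<partial>lborel) = (\<integral>\<^sup>+y. F (f x - y) \<partial>lborel) * indicator ?B (f x)"
      by (rule nn_integral_multc, rule measurable_compose[OF _ F], simp)
    also have "\<dots> = (\<integral>\<^sup>+y. F y \<partial>lborel) * indicator ?B x"
      unfolding fB nn_integral_lborel_reflect[OF F, of "f x"] ..
    finally show "(\<integral>\<^sup>+y. F (f x - y) * indicator ?B (f x) \<partial>lborel) = (\<integral>\<^sup>+y. F y \<partial>lborel) * indicator ?B x" .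
  qed
  also have "\<dots> = (\<integral>\<^sup>+x. F x \<partial>lborel) * ?b"
    by (subst nn_integral_cmult) auto
  finally show ?thesis
    using emeasure_ball_pos[of 1 "0::'a"] emeasure_ball_finite[of "0::'a" 1]
    by (metis infinity_ennreal_def mult_divide_eq_ennreal zero_less_one)
qed

lemma nn_integral_sphere_measure_orthogonal:
  fixes f :: "'a::euclidean_space \<Rightarrow> 'a"
  assumes f: "orthogonal_transformation f" and F: "F \<in> borel_measurable borel"
  shows "(\<integral>\<^sup>+x. F (f x) \<partial>sphere_measure) = (\<integral>\<^sup>+x. F x \<partial>sphere_measure)"
proof -
  have [measurable]: "F \<in> borel_measurable borel" by (rule F)
  have [measurable]: "f \<in> borel_measurable borel" by (rule borel_measurable_orthogonal[OF f])
  have [measurable]: "ball 0 1 - {0} \<in> sets (borel :: 'a measure)" by simp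
  have lin: "linear f" and nf: "norm (f x) = norm x" for x
    using f by (auto simp: orthogonal_transformation)
  let ?G = "\<lambda>v. ennreal (real DIM('a)) * indicator (ball 0 1 - {0}) v * F (v /\<^sub>R norm v)"
  have ind: "indicator (ball 0 1 - {0}) (f v) = (indicator (ball 0 1 - {0}) v :: ennreal)" for v :: 'a
  proof -
    have "f v = 0 \<longleftrightarrow> v = 0" using nf[of v] by (metis norm_eq_zero)
    then show ?thesis using nf by (simp add: indicator_def)
  qed
  have "(\<integral>\<^sup>+x. F (f x) \<partial>sphere_measure) = (\<integral>\<^sup>+v. ennreal (real DIM('a)) * indicator (ball 0 1 - {0}) v * F (f (v /\<^sub>R norm v)) \<partial>lborel)"
    by (rule nn_integral_sphere_measure) measurable
  also have "\<dots> = (\<integral>\<^sup>+v. ?G (f v) \<partial>lborel)"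
    by (intro nn_integral_cong) (simp only: ind nf linear_scale[OF lin])
  also have "\<dots> = (\<integral>\<^sup>+v. ?G v \<partial>lborel)"
    by (rule nn_integral_lborel_orthogonal[OF f]) measurable
  also have "\<dots> = (\<integral>\<^sup>+x. F x \<partial>sphere_measure)"
    by (rule nn_integral_sphere_measure[symmetric]) measurable
  finally show ?thesis .
qed

lemma hausdorff_outer_isometry_le:
  fixes T :: "'a::metric_space \<Rightarrow> 'a"
  assumes T: "\<And>x y. dist (T x) (T y) = dist x y"
  shows "hausdorff_outer k (T ` A) \<le> hausdorff_outer k A"
  unfolding hausdorff_outer_def
proof (rule SUP_mono)
  fix d :: real assume d: "d \<in> {0<..}"
  have "hausdorff_content k d (T ` A) \<le> hausdorff_content k d A"
    unfolding hausdorff_content_def[of k d A]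
  proof (rule INF_greatest, safe)
    fix U :: "nat \<Rightarrow> 'a set"
    assume cov: "A \<subseteq> (\<Union>i. U i)" and U: "\<forall>i. bounded (U i) \<and> diameter (U i) \<le> d"
    have bT: "bounded (T ` U i)" for i
    proof -
      obtain x e where "\<forall>y\<in>U i. dist x y \<le> e" using U[THEN spec, of i] unfolding bounded_def by blast
      then show ?thesis unfolding bounded_def using T by (intro exI[of _ "T x"] exI[of _ e]) auto
    qed
    have dT: "diameter (T ` U i) \<le> diameter (U i)" for i
    proof (cases "U i = {}")
      case False
      have "(SUP p\<in>T ` U i \<times> T ` U i. dist (fst p) (snd p)) \<le> diameter (U i)"
        using False U diameter_bounded_bound[of "U i"] by (intro cSUP_least) (auto simp: T)
      then show ?thesis using False by (simp add: diameter_def case_prod_beta')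
    qed simp
    have "hausdorff_content k d (T ` A) \<le> (\<Sum>i. hausdorff_gauge k (T ` U i))"
    proof (intro hausdorff_content_le bT)
      show "T ` A \<subseteq> (\<Union>i. T ` U i)" using cov by blast
      show "diameter (T ` U i) \<le> d" for i using dT[of i] U[THEN spec, of i] by linarith
    qed
    also have "\<dots> \<le> (\<Sum>i. hausdorff_gauge k (U i))"
    proof (intro suminf_le)
      fix i
      show "hausdorff_gauge k (T ` U i) \<le> hausdorff_gauge k (U i)"
        using dT[of i] diameter_ge_0[OF bT[of i]]
        unfolding hausdorff_gauge_def by (auto intro!: ennreal_leI mult_left_mono power_mono)
    qed auto
    finally show "hausdorff_content k d (T ` A) \<le> (\<Sum>i. hausdorff_gauge k (U i))" .
  qed
  then show "\<exists>e\<in>{0<..}. hausdorff_content k d (T ` A) \<le> hausdorff_content k e A" using d by blast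
qed

text \<open>A density on the whole space rather than a restricted space, so that it lives on the
  same Borel sets as \<open>sphere_measure\<close>.\<close>

definition hausdorff_sphere :: "'a::euclidean_space measure" where
  "hausdorff_sphere = density (hausdorff_measure (DIM('a) - 1)) (indicator (sphere 0 1))"

lemma sets_hausdorff_sphere [simp, measurable_cong]: "sets hausdorff_sphere = sets borel"
  by (simp add: hausdorff_sphere_def)

lemma space_hausdorff_sphere [simp]: "space hausdorff_sphere = UNIV"
  by (simp add: hausdorff_sphere_def)

lemma emeasure_hausdorff_sphere:
  fixes A :: "'a::euclidean_space set"
  assumes "A \<in> sets borel"
  shows "emeasure hausdorff_sphere A = hausdorff_outer (DIM('a) - 1) (sphere 0 1 \<inter> A)"
proof -
  have [measurable]: "sphere 0 1 \<in> sets (borel :: 'a measure)" by (simp add: closed_sphere borel_closed)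
  have "emeasure hausdorff_sphere A = (\<integral>\<^sup>+x. indicator (sphere 0 1) x * indicator A x \<partial>hausdorff_measure (DIM('a) - 1))"
    unfolding hausdorff_sphere_def using assms by (intro emeasure_density) auto
  also have "\<dots> = emeasure (hausdorff_measure (DIM('a) - 1)) (sphere 0 1 \<inter> A)"
    using assms by (simp add: indicator_inter_arith[symmetric])
  also have "\<dots> = hausdorff_outer (DIM('a) - 1) (sphere 0 1 \<inter> A)"
    using assms by (intro emeasure_hausdorff_measure) auto
  finally show ?thesis .
qed

lemma AE_hausdorff_sphere: "AE x in (hausdorff_sphere :: 'a::euclidean_space measure). norm x = 1"
proof -
  have [measurable]: "sphere 0 1 \<in> sets (borel :: 'a measure)" by (simp add: closed_sphere borel_closed)
  show ?thesis
    unfolding hausdorff_sphere_def by (subst AE_density) (auto simp: indicator_def)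
qed

lemma nn_integral_hausdorff_sphere_orthogonal:
  fixes f :: "'a::euclidean_space \<Rightarrow> 'a"
  assumes f: "orthogonal_transformation f" and F: "F \<in> borel_measurable borel"
  shows "(\<integral>\<^sup>+x. F (f x) \<partial>hausdorff_sphere) = (\<integral>\<^sup>+x. F x \<partial>hausdorff_sphere)"
proof -
  have [measurable]: "f \<in> borel_measurable borel" by (rule borel_measurable_orthogonal[OF f])
  have inj: "inj f" and surj: "surj f" using f by (auto simp: orthogonal_transformation_inj orthogonal_transformation_surj)
  have invf: "orthogonal_transformation (inv f)" using f by (rule orthogonal_transformation_inv)
  have iso: "dist (h x) (h y) = dist x y" if "orthogonal_transformation h" for h and x y :: 'a
    using that linear_diff[of h x y] by (simp add: orthogonal_transformation dist_norm flip: linear_diff)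
  have nf: "norm (f x) = norm x" for x using f by (simp add: orthogonal_transformation)
  have "distr hausdorff_sphere borel f = hausdorff_sphere"
  proof (rule measure_eqI)
    fix A assume "A \<in> sets (distr hausdorff_sphere borel f)"
    then have A: "A \<in> sets borel" by simp
    have fA: "f -` A \<in> sets borel" using measurable_sets[OF \<open>f \<in> borel_measurable borel\<close> A] by simp
    have v: "sphere 0 1 \<inter> f -` A = f -` (sphere 0 1 \<inter> A)" using nf by auto
    have 1: "sphere 0 1 \<inter> A = f ` (sphere 0 1 \<inter> f -` A)"
      unfolding v by (rule surj_image_vimage_eq[OF surj, symmetric])
    have 2: "sphere 0 1 \<inter> f -` A = inv f ` (sphere 0 1 \<inter> A)"
      unfolding v by (rule bij_vimage_eq_inv_image) (use inj surj in \<open>simp add: bij_def\<close>)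
    have "hausdorff_outer (DIM('a) - 1) (sphere 0 1 \<inter> f -` A) = hausdorff_outer (DIM('a) - 1) (sphere 0 1 \<inter> A)"
    proof (rule antisym)
      show "hausdorff_outer (DIM('a) - 1) (sphere 0 1 \<inter> f -` A) \<le> hausdorff_outer (DIM('a) - 1) (sphere 0 1 \<inter> A)"
        unfolding 2 by (intro hausdorff_outer_isometry_le iso invf)
      show "hausdorff_outer (DIM('a) - 1) (sphere 0 1 \<inter> A) \<le> hausdorff_outer (DIM('a) - 1) (sphere 0 1 \<inter> f -` A)"
        by (subst 1) (intro hausdorff_outer_isometry_le iso f)
    qed
    then show "emeasure (distr hausdorff_sphere borel f) A = emeasure hausdorff_sphere A"
      using A fA by (simp add: emeasure_distr emeasure_hausdorff_sphere)
  qed simp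
  moreover have "(\<integral>\<^sup>+x. F x \<partial>distr hausdorff_sphere borel f) = (\<integral>\<^sup>+x. F (f x) \<partial>hausdorff_sphere)"
    using F by (intro nn_integral_distr) auto
  ultimately show ?thesis by simp
qed

text \<open>The reflection in the hyperplane orthogonal to \<open>a - b\<close>.\<close>

lemma orthogonal_transformation_exists_unit:
  fixes a b :: "'a::euclidean_space"
  assumes ab: "norm a = 1" "norm b = 1"
  obtains f where "orthogonal_transformation f" "f a = b"
proof (cases "a = b")
  case True
  then show ?thesis using that[of "\<lambda>x. x"] by (simp add: orthogonal_transformation_def linear_ident)
next
  case False
  define w where "w = a - b"
  define f where "f x = x - (2 * (x \<bullet> w) / (w \<bullet> w)) *\<^sub>R w" for x
  have w: "w \<bullet> w \<noteq> 0" using False by (simp add: w_def)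
  have 1: "a \<bullet> a = 1" "b \<bullet> b = 1" using ab by (simp_all add: norm_eq_1)
  have "w \<bullet> w = 2 * (a \<bullet> w)"
    by (simp add: w_def inner_diff_left inner_diff_right 1 inner_commute)
  then have "f a = b" using w by (simp add: f_def) (simp add: w_def)
  moreover have "linear f"
    by (rule linearI) (simp_all add: f_def inner_add_left algebra_simps add_divide_distrib)
  moreover have "f x \<bullet> f y = x \<bullet> y" for x y
  proof -
    have "f x \<bullet> f y = x \<bullet> y - (2 * (y \<bullet> w) / (w \<bullet> w)) * (x \<bullet> w) - (2 * (x \<bullet> w) / (w \<bullet> w)) * (y \<bullet> w)
        + (2 * (x \<bullet> w) / (w \<bullet> w)) * ((2 * (y \<bullet> w) / (w \<bullet> w)) * (w \<bullet> w))"
      by (simp add: f_def inner_diff_left inner_diff_right inner_commute[of w x] inner_commute[of w y])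
    then show ?thesis using w by simp
  qed
  ultimately show ?thesis using that[of f] by (auto simp: orthogonal_transformation_def)
qed

text \<open>Integrate \<open>h (x \<bullet> y)\<close> over both measures. By rotation invariance
  the inner integral is the same for every unit vector in the outer variable, in either order of
  integration. The indicators of caps and the integrand of \<open>sphere_gamma\<close> are of this
  zonal kind.\<close>

lemma zonal_integrals:
  fixes \<mu> \<nu> :: "'a::euclidean_space measure"
  assumes \<mu>: "finite_measure \<mu>" "sets \<mu> = sets borel" "AE x in \<mu>. norm x = 1"
      "\<And>f F. orthogonal_transformation f \<Longrightarrow> F \<in> borel_measurable borel \<Longrightarrow> (\<integral>\<^sup>+x. F (f x) \<partial>\<mu>) = (\<integral>\<^sup>+x. F x \<partial>\<mu>)"
    and \<nu>: "finite_measure \<nu>" "sets \<nu> = sets borel" "AE x in \<nu>. norm x = 1"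
      "\<And>f F. orthogonal_transformation f \<Longrightarrow> F \<in> borel_measurable borel \<Longrightarrow> (\<integral>\<^sup>+x. F (f x) \<partial>\<nu>) = (\<integral>\<^sup>+x. F x \<partial>\<nu>)"
    and h: "h \<in> borel_measurable borel" and e: "norm e = 1"
  shows "emeasure \<nu> UNIV * (\<integral>\<^sup>+x. h (x \<bullet> e) \<partial>\<mu>) = emeasure \<mu> UNIV * (\<integral>\<^sup>+x. h (x \<bullet> e) \<partial>\<nu>)"
proof -
  have [measurable]: "h \<in> borel_measurable borel" by (rule h)
  have [measurable_cong]: "sets \<mu> = sets borel" "sets \<nu> = sets borel" by fact+
  have sp: "space \<mu> = UNIV" "space \<nu> = UNIV" using sets_eq_imp_space_eq[OF \<mu>(2)] sets_eq_imp_space_eq[OF \<nu>(2)] by auto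
  interpret P: pair_sigma_finite \<mu> \<nu>
    unfolding pair_sigma_finite_def using \<mu>(1) \<nu>(1) by (auto simp: finite_measure_def)
  have indep: "(\<integral>\<^sup>+x. h (x \<bullet> e') \<partial>\<rho>) = (\<integral>\<^sup>+x. h (x \<bullet> e) \<partial>\<rho>)" if ne: "norm e' = 1"
    and inv: "\<And>f F. orthogonal_transformation f \<Longrightarrow> F \<in> borel_measurable borel \<Longrightarrow> (\<integral>\<^sup>+x. F (f x) \<partial>\<rho>) = (\<integral>\<^sup>+x. F x \<partial>\<rho>)"
    for e' and \<rho> :: "'a measure"
  proof -
    obtain f where f: "orthogonal_transformation f" "f e = e'"
      by (rule orthogonal_transformation_exists_unit[OF e ne])
    have "(\<integral>\<^sup>+x. h (x \<bullet> e') \<partial>\<rho>) = (\<integral>\<^sup>+x. h (f x \<bullet> e') \<partial>\<rho>)"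
      by (rule inv[OF f(1), symmetric]) measurable
    also have "\<dots> = (\<integral>\<^sup>+x. h (x \<bullet> e) \<partial>\<rho>)"
      using f by (simp add: orthogonal_transformation_def f(2)[symmetric])
    finally show ?thesis .
  qed
  have "emeasure \<nu> UNIV * (\<integral>\<^sup>+x. h (x \<bullet> e) \<partial>\<mu>) = (\<integral>\<^sup>+y. (\<integral>\<^sup>+x. h (x \<bullet> e) \<partial>\<mu>) \<partial>\<nu>)"
    by (simp add: sp mult.commute)
  also have "\<dots> = (\<integral>\<^sup>+y. (\<integral>\<^sup>+x. h (x \<bullet> y) \<partial>\<mu>) \<partial>\<nu>)"
    using \<nu>(3) by (intro nn_integral_cong_AE) (auto elim!: eventually_mono simp: indep[OF _ \<mu>(4)])
  also have "\<dots> = (\<integral>\<^sup>+x. (\<integral>\<^sup>+y. h (x \<bullet> y) \<partial>\<nu>) \<partial>\<mu>)"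
    by (rule P.Fubini') measurable
  also have "\<dots> = (\<integral>\<^sup>+x. (\<integral>\<^sup>+y. h (y \<bullet> e) \<partial>\<nu>) \<partial>\<mu>)"
    using \<mu>(3) by (intro nn_integral_cong_AE) (auto elim!: eventually_mono simp: indep[OF _ \<nu>(4), symmetric] inner_commute)
  also have "\<dots> = emeasure \<mu> UNIV * (\<integral>\<^sup>+x. h (x \<bullet> e) \<partial>\<nu>)"
    by (simp add: sp mult.commute)
  finally show ?thesis .
qed

text \<open>Slicing works along a coordinate axis; a rotation moves the centre to an arbitrary unit
  vector.\<close>

lemma sphere_measure_le_any:
  fixes U :: "'a::euclidean_space set"
  assumes p: "norm p = 1" and U: "U \<in> sets borel" "U \<subseteq> cball p d" and d: "0 \<le> d" "d \<le> 1 / 2"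
    and unit: "\<And>x. x \<in> U \<Longrightarrow> norm x = 1"
    and D: "\<And>x y. x \<in> U \<Longrightarrow> y \<in> U \<Longrightarrow> norm (x - y) \<le> D" "0 \<le> D"
  shows "emeasure sphere_measure U \<le> ennreal (unit_ball_vol (real (DIM('a) - 1)) * (gnom_const d * D / 2) ^ (DIM('a) - 1))"
proof -
  obtain e :: 'a where e: "e \<in> Basis" using nonempty_Basis by blast
  have "norm e = 1" using e by simp
  then obtain f where f: "orthogonal_transformation f" "f e = p"
    using orthogonal_transformation_exists_unit[of e p] p by blast
  have lin: "linear f" and nf: "norm (f x) = norm x" for x
    using f by (auto simp: orthogonal_transformation)
  have df: "norm (f x - f y) = norm (x - y)" for x y using nf by (simp flip: linear_diff[OF lin])
  have fU: "f -` U \<in> sets borel"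
    using measurable_sets[OF borel_measurable_orthogonal[OF f(1)] U(1)] by simp
  have "emeasure sphere_measure U = (\<integral>\<^sup>+x. indicator U x \<partial>sphere_measure)" using U by simp
  also have "\<dots> = (\<integral>\<^sup>+x. indicator U (f x) \<partial>sphere_measure)"
    using U by (intro nn_integral_sphere_measure_orthogonal[OF f(1), symmetric]) auto
  also have "\<dots> = (\<integral>\<^sup>+x. indicator (f -` U) x \<partial>sphere_measure)" by (simp add: indicator_def)
  also have "\<dots> = emeasure sphere_measure (f -` U)" using fU by simp
  also have "\<dots> \<le> ennreal (unit_ball_vol (real (DIM('a) - 1)) * (gnom_const d * D / 2) ^ (DIM('a) - 1))"
  proof (rule sphere_measure_le[OF e fU _ d])
    show "f -` U \<subseteq> cball e d"
    proof
      fix x assume "x \<in> f -` U"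
      then have "norm (f e - f x) \<le> d" using U(2) f(2) by (auto simp: dist_norm)
      then show "x \<in> cball e d" by (simp add: df dist_norm)
    qed
    show "norm x = 1" if "x \<in> f -` U" for x using that unit[of "f x"] nf by simp
    show "norm (x - y) \<le> D" if "x \<in> f -` U" "y \<in> f -` U" for x y
      using that D(1)[of "f x" "f y"] df by simp
  qed fact
  finally show ?thesis .
qed

lemma sphere_measure_cball_eq:
  fixes p e :: "'a::euclidean_space"
  assumes "norm p = 1" "norm e = 1"
  shows "emeasure sphere_measure (cball p r) = emeasure sphere_measure (cball e r)"
proof -
  obtain f where f: "orthogonal_transformation f" "f e = p"
    using orthogonal_transformation_exists_unit[of e p] assms by blast
  have lin: "linear f" and nf: "norm (f x) = norm x" for x
    using f by (auto simp: orthogonal_transformation)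
  have "norm (f e - f x) = norm (e - x)" for x using nf by (simp flip: linear_diff[OF lin])
  then have "indicator (cball p r) (f x) = (indicator (cball e r) x :: ennreal)" for x
    by (simp add: indicator_def dist_norm f(2)[symmetric])
  then show ?thesis
    using nn_integral_sphere_measure_orthogonal[OF f(1) borel_measurable_indicator[of "cball p r" borel]] by simp
qed

lemma emeasure_sphere_measure_Int:
  fixes A :: "'a::euclidean_space set"
  assumes "A \<in> sets borel"
  shows "emeasure sphere_measure (A \<inter> sphere 0 1) = emeasure sphere_measure A"
proof (rule emeasure_eq_AE)
  show "AE x in sphere_measure. (x \<in> A \<inter> sphere 0 1) = (x \<in> A)"
    using AE_sphere_measure by eventually_elim auto
qed (use assms in \<open>auto intro!: borel_closed sets.Int\<close>)

section \<open>Lower bound for the Hausdorff measure of the sphere\<close>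

definition sphere_area :: "'a::euclidean_space itself \<Rightarrow> real" where
  "sphere_area _ = real DIM('a) * unit_ball_vol (real DIM('a))"

lemma sphere_area_pos: "0 < sphere_area TYPE('a::euclidean_space)"
  unfolding sphere_area_def by (intro mult_pos_pos) auto

lemma emeasure_sphere_measure_UNIV': "emeasure (sphere_measure :: 'a::euclidean_space measure) UNIV = ennreal (sphere_area TYPE('a))"
  by (simp add: emeasure_sphere_measure_UNIV sphere_area_def)

lemma gnom_const_tendsto: "(gnom_const \<longlongrightarrow> 1) (at_right 0)"
proof -
  have "((\<lambda>d::real. 1 / (1 - d\<^sup>2 / 2) + d / (1 - d\<^sup>2 / 2)\<^sup>2) \<longlongrightarrow> 1 / (1 - 0\<^sup>2 / 2) + 0 / (1 - 0\<^sup>2 / 2)\<^sup>2) (at_right 0)"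
    by (intro tendsto_intros) auto
  then show ?thesis by (simp add: gnom_const_def[abs_def])
qed

lemma gnom_const_ge_1: "0 \<le> d \<Longrightarrow> d \<le> 1 / 2 \<Longrightarrow> 1 \<le> gnom_const d"
proof -
  assume d: "0 \<le> d" "d \<le> 1 / 2"
  then have "d\<^sup>2 \<le> (1 / 2)\<^sup>2" by (intro power_mono) auto
  then have m: "0 < 1 - d\<^sup>2 / 2" by (simp add: power2_eq_square)
  then have "1 \<le> 1 / (1 - d\<^sup>2 / 2)" by (simp add: pos_le_divide_eq)
  moreover have "0 \<le> d / (1 - d\<^sup>2 / 2)\<^sup>2" using d by simp
  ultimately show ?thesis unfolding gnom_const_def by linarith
qed

lemma gnom_const_le_2: "0 \<le> d \<Longrightarrow> d \<le> 1 / 2 \<Longrightarrow> gnom_const d \<le> 2"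
proof -
  assume d: "0 \<le> d" "d \<le> 1 / 2"
  define m where "m = 1 - d\<^sup>2 / 2"
  have "d\<^sup>2 \<le> (1 / 2)\<^sup>2" using d by (intro power_mono) auto
  then have m: "7 / 8 \<le> m" by (simp add: m_def power2_eq_square)
  have "(7 / 8)\<^sup>2 \<le> m\<^sup>2" using m by (intro power_mono) auto
  then have "1 / m + d / m\<^sup>2 \<le> 1 / (7 / 8) + (1 / 2) / (7 / 8)\<^sup>2"
    using m d by (intro add_mono frac_le) auto
  also have "\<dots> \<le> 2" by (simp add: power2_eq_square)
  finally show ?thesis by (simp add: gnom_const_def m_def)
qed

text \<open>A covering set may be replaced by its closure, which is Borel and has the same diameter.
  Its trace on the sphere then has sphere measure at most
  \<open>gnom_const d ^ (DIM('a) - 1)\<close> times its gauge, and summation over the cover gives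
  the claim.\<close>

lemma sphere_area_le_content:
  assumes d: "0 < d" "d \<le> 1 / 2"
  shows "ennreal (sphere_area TYPE('a::euclidean_space) / gnom_const d ^ (DIM('a) - 1)) \<le> hausdorff_content (DIM('a) - 1) d (sphere (0::'a) 1)"
proof -
  let ?k = "DIM('a) - 1" and ?L = "gnom_const d" and ?s = "sphere_area TYPE('a)"
  have L: "1 \<le> ?L" using d by (intro gnom_const_ge_1) auto
  then have Lk: "0 < ?L ^ ?k" by simp
  show ?thesis
    unfolding hausdorff_content_def
  proof (rule INF_greatest, safe)
    fix U :: "nat \<Rightarrow> 'a set"
    assume cov: "sphere 0 1 \<subseteq> (\<Union>i. U i)" and U: "\<forall>i. bounded (U i) \<and> diameter (U i) \<le> d"
    let ?C = "\<lambda>i. closure (U i) \<inter> sphere 0 1"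
    have C: "?C i \<in> sets borel" for i by (intro sets.Int borel_closed closed_closure closed_sphere)
    have "ennreal ?s = emeasure sphere_measure (UNIV \<inter> sphere (0::'a) 1)"
      by (subst emeasure_sphere_measure_Int) (simp_all add: emeasure_sphere_measure_UNIV')
    also have "\<dots> \<le> emeasure sphere_measure (\<Union>i. ?C i)"
    proof (rule emeasure_mono)
      show "UNIV \<inter> sphere 0 1 \<subseteq> (\<Union>i. ?C i)"
      proof
        fix x :: 'a assume x: "x \<in> UNIV \<inter> sphere 0 1"
        then obtain i where "x \<in> U i" using cov by blast
        then have "x \<in> ?C i" using x closure_subset[of "U i"] by blast
        then show "x \<in> (\<Union>i. ?C i)" by blast
      qed
      show "(\<Union>i. ?C i) \<in> sets sphere_measure" using C by auto
    qed
    also have "\<dots> \<le> (\<Sum>i. emeasure sphere_measure (?C i))"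
      using C by (intro emeasure_subadditive_countably) auto
    also have "\<dots> \<le> (\<Sum>i. ennreal (?L ^ ?k) * hausdorff_gauge ?k (U i))"
    proof (intro suminf_le)
      fix i
      show "emeasure sphere_measure (?C i) \<le> ennreal (?L ^ ?k) * hausdorff_gauge ?k (U i)"
      proof (cases "?C i = {}")
        case False
        then obtain p where p: "p \<in> ?C i" by blast
        have bU: "bounded (U i)" and dU: "diameter (U i) \<le> d" using U by auto
        have dist: "norm (x - y) \<le> diameter (U i)" if "x \<in> ?C i" "y \<in> ?C i" for x y
          using diameter_bounded_bound[of "closure (U i)" x y] that bounded_closure[OF bU] diameter_closure[OF bU] by (simp add: dist_norm)
        have "emeasure sphere_measure (?C i) \<le> ennreal (unit_ball_vol (real ?k) * (?L * diameter (U i) / 2) ^ ?k)"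
        proof (rule sphere_measure_le_any[OF _ C])
          show "norm p = 1" using p by simp
          show "?C i \<subseteq> cball p d"
          proof
            fix x assume "x \<in> ?C i"
            then have "norm (p - x) \<le> d" using dist[OF p] dU by (meson order_trans)
            then show "x \<in> cball p d" by (simp only: mem_cball dist_norm)
          qed
        qed (use d dist diameter_ge_0[OF bU] in auto)
        also have "unit_ball_vol (real ?k) * (?L * diameter (U i) / 2) ^ ?k = ?L ^ ?k * (unit_ball_vol (real ?k) * (diameter (U i) / 2) ^ ?k)"
          by (simp add: power_mult_distrib power_divide)
        also have "ennreal \<dots> = ennreal (?L ^ ?k) * ennreal (unit_ball_vol (real ?k) * (diameter (U i) / 2) ^ ?k)"
          using L by (intro ennreal_mult') simp
        also have "ennreal (unit_ball_vol (real ?k) * (diameter (U i) / 2) ^ ?k) = hausdorff_gauge ?k (U i)"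
          using p by (auto simp: hausdorff_gauge_def)
        finally show ?thesis .
      qed (simp only: emeasure_empty zero_le)
    qed auto
    also have "\<dots> = ennreal (?L ^ ?k) * (\<Sum>i. hausdorff_gauge ?k (U i))" by simp
    finally have le: "ennreal ?s \<le> ennreal (?L ^ ?k) * (\<Sum>i. hausdorff_gauge ?k (U i))" .
    show "ennreal (?s / ?L ^ ?k) \<le> (\<Sum>i. hausdorff_gauge ?k (U i))"
    proof (cases "\<Sum>i. hausdorff_gauge ?k (U i)")
      case (real g)
      then have "?s \<le> ?L ^ ?k * g" using le Lk by (simp add: ennreal_mult'[symmetric])
      then show ?thesis using real Lk by (simp add: pos_divide_le_eq mult.commute)
    qed simp
  qed
qed

lemma sphere_area_le_hausdorff:
  "ennreal (sphere_area TYPE('a::euclidean_space)) \<le> hausdorff_outer (DIM('a) - 1) (sphere (0::'a) 1)"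
proof (rule tendsto_upperbound)
  have "((\<lambda>d. sphere_area TYPE('a) / gnom_const d ^ (DIM('a) - 1)) \<longlongrightarrow> sphere_area TYPE('a) / 1 ^ (DIM('a) - 1)) (at_right 0)"
    by (intro tendsto_intros gnom_const_tendsto) simp
  then show "((\<lambda>d. ennreal (sphere_area TYPE('a) / gnom_const d ^ (DIM('a) - 1))) \<longlongrightarrow> ennreal (sphere_area TYPE('a))) (at_right 0)"
    by (intro tendsto_ennrealI) simp
  have "eventually (\<lambda>d::real. 0 < d \<and> d \<le> 1 / 2) (at_right 0)"
    using eventually_at_right_real[of 0 "1 / 2"] by (auto elim: eventually_mono)
  then show "eventually (\<lambda>d. ennreal (sphere_area TYPE('a) / gnom_const d ^ (DIM('a) - 1)) \<le> hausdorff_outer (DIM('a) - 1) (sphere (0::'a) 1)) (at_right 0)"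
  proof eventually_elim
    case (elim d)
    then have "hausdorff_content (DIM('a) - 1) d (sphere (0::'a) 1) \<le> hausdorff_outer (DIM('a) - 1) (sphere (0::'a) 1)"
      unfolding hausdorff_outer_def by (intro SUP_upper) auto
    then show ?case using sphere_area_le_content[of d, where 'a='a] elim by (auto intro: order_trans)
  qed
qed simp

section \<open>Packings by caps and the upper bound\<close>

lemma hausdorff_content_insert:
  assumes U: "bounded U" "diameter U \<le> d" and d: "0 < d"
  shows "hausdorff_content k d (U \<union> B) \<le> hausdorff_gauge k U + hausdorff_content k d B"
proof -
  have "hausdorff_content k d (\<Union>i. binaryset U B i) \<le> (\<Sum>i. hausdorff_content k d (binaryset U B i))"
    by (rule hausdorff_content_countably_subadditive)
  also have "\<dots> = hausdorff_content k d U + hausdorff_content k d B"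
    by (rule suminf_binaryset_eq) (rule hausdorff_content_empty[OF d])
  also have "hausdorff_content k d U \<le> (\<Sum>i. hausdorff_gauge k (if i = (0::nat) then U else {}))"
    using U d by (intro hausdorff_content_le) auto
  also have "(\<Sum>i. hausdorff_gauge k (if i = (0::nat) then U else {})) = hausdorff_gauge k U"
    by (subst suminf_finite[of "{0}"]) (auto simp: hausdorff_gauge_def)
  finally show ?thesis by (simp add: UN_binaryset_eq add_right_mono)
qed

lemma hausdorff_content_finite_cover:
  assumes "finite P" and d: "0 < d" and U: "\<And>p. p \<in> P \<Longrightarrow> bounded (U p) \<and> diameter (U p) \<le> d"
  shows "hausdorff_content k d ((\<Union>p\<in>P. U p) \<union> B) \<le> (\<Sum>p\<in>P. hausdorff_gauge k (U p)) + hausdorff_content k d B"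
  using assms(1) U
proof (induction P rule: finite_induct)
  case (insert p P)
  have "hausdorff_content k d ((\<Union>p\<in>insert p P. U p) \<union> B) = hausdorff_content k d (U p \<union> ((\<Union>p\<in>P. U p) \<union> B))"
    by (simp add: Un_assoc)
  also have "\<dots> \<le> hausdorff_gauge k (U p) + hausdorff_content k d ((\<Union>p\<in>P. U p) \<union> B)"
    using insert.prems by (intro hausdorff_content_insert d) auto
  also have "\<dots> \<le> hausdorff_gauge k (U p) + ((\<Sum>p\<in>P. hausdorff_gauge k (U p)) + hausdorff_content k d B)"
    using insert by (intro add_left_mono insert.IH) auto
  finally show ?case using insert.hyps by (simp add: add.assoc)
qed simp

lemma hausdorff_gauge_cap_le:
  fixes p :: "'a::euclidean_space"
  assumes "0 \<le> r"
  shows "bounded (sphere 0 1 \<inter> cball p r)" "diameter (sphere 0 1 \<inter> cball p r) \<le> 2 * r"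
    "hausdorff_gauge k (sphere 0 1 \<inter> cball p r) \<le> ennreal (unit_ball_vol (real k) * r ^ k)"
proof -
  show b: "bounded (sphere 0 1 \<inter> cball p r)" by (simp add: bounded_Int)
  show d: "diameter (sphere 0 1 \<inter> cball p r) \<le> 2 * r"
  proof (rule diameter_le)
    fix x y assume "x \<in> sphere 0 1 \<inter> cball p r" "y \<in> sphere 0 1 \<inter> cball p r"
    then have "dist x y \<le> r + r" using dist_triangle2[of x y p] by (simp add: dist_commute)
    then show "norm (x - y) \<le> 2 * r" by (simp add: dist_norm)
  qed (use assms in simp)
  show "hausdorff_gauge k (sphere 0 1 \<inter> cball p r) \<le> ennreal (unit_ball_vol (real k) * r ^ k)"
    unfolding hausdorff_gauge_def using d diameter_ge_0[OF b]
    by (auto intro!: ennreal_leI mult_left_mono power_mono)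
qed

text \<open>Congruent caps have equal positive mass, so disjoint families are bounded in size and
  one of greatest size exists. Since no cap can be added, the doubled caps cover the sphere.\<close>

lemma sphere_packing:
  assumes r: "0 < r" "r \<le> 1" and e: "e \<in> (Basis :: 'a::euclidean_space set)"
  obtains P where "finite P" "P \<subseteq> sphere (0::'a) 1" "disjoint_family_on (\<lambda>p. cball p r) P"
    "sphere 0 1 \<subseteq> (\<Union>p\<in>P. cball p (2 * r))"
proof -
  let ?m = "measure (sphere_measure :: 'a measure)"
  interpret finite_measure "sphere_measure :: 'a measure" by (rule finite_measure_sphere_measure)
  have r2: "r\<^sup>2 \<le> 1" using r by (simp add: power_le_one)
  have "0 < unit_ball_vol (real (DIM('a) - 1)) * r ^ (DIM('a) - 1) * (1 - r\<^sup>2 / 2) ^ DIM('a)"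
    using r r2 by (intro mult_pos_pos zero_less_power) auto
  then have t: "0 < ?m (cball e r)"
    using sphere_measure_cap_ge[OF e r] by (simp add: emeasure_eq_measure)
  let ?Q = "\<lambda>P. finite P \<and> P \<subseteq> sphere (0::'a) 1 \<and> disjoint_family_on (\<lambda>p. cball p r) P"
  have bound: "real (card P) * ?m (cball e r) \<le> ?m UNIV" if P: "?Q P" for P
  proof -
    have "real (card P) * ?m (cball e r) = (\<Sum>p\<in>P. ?m (cball p r))"
    proof -
      have "?m (cball p r) = ?m (cball e r)" if "p \<in> P" for p
        using sphere_measure_cball_eq[of p e r] P e that by (auto simp: measure_def)
      then show ?thesis by simp
    qed
    also have "\<dots> = ?m (\<Union>p\<in>P. cball p r)"
      using P by (intro finite_measure_finite_Union[symmetric]) auto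
    also have "\<dots> \<le> ?m UNIV" using bounded_measure[of "\<Union>p\<in>P. cball p r"] by simp
    finally show ?thesis .
  qed
  define b where "b = nat \<lceil>?m UNIV / ?m (cball e r)\<rceil>"
  have "\<forall>P. ?Q P \<longrightarrow> card P < Suc b"
  proof (intro allI impI)
    fix P assume "?Q P"
    then have "real (card P) \<le> ?m UNIV / ?m (cball e r)" using bound t by (simp add: pos_le_divide_eq)
    then show "card P < Suc b" unfolding b_def by linarith
  qed
  moreover have "?Q {}" by (simp add: disjoint_family_on_def)
  ultimately obtain P where P: "?Q P" and max: "\<And>P'. ?Q P' \<Longrightarrow> card P' \<le> card P"
    using ex_has_greatest_nat[of ?Q "{}" card "Suc b"] by blast
  have "sphere 0 1 \<subseteq> (\<Union>p\<in>P. cball p (2 * r))"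
  proof (rule ccontr)
    assume "\<not> ?thesis"
    then obtain x where x1: "x \<in> sphere 0 1" "x \<notin> (\<Union>p\<in>P. cball p (2 * r))" by blast
    have x: "x \<in> sphere 0 1" "2 * r < dist p x" if "p \<in> P" for p
      using x1 that by (auto simp: not_le)
    have xP: "x \<notin> P" using x(2)[of x] r by auto
    have "cball p r \<inter> cball x r = {}" if "p \<in> P" for p
    proof (rule ccontr)
      assume "\<not> ?thesis"
      then obtain z where "dist p z \<le> r" "dist x z \<le> r" by auto
      then have "dist p x \<le> 2 * r" using dist_triangle2[of p x z] by simp
      then show False using x(2)[OF that] by simp
    qed
    then have "?Q (insert x P)" using P x1(1) by (auto simp: disjoint_family_on_def)
    from max[OF this] show False using P xP by simp
  qed
  then show ?thesis using that P by blast
qed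

lemma eventually_cap_const:
  fixes c :: real
  assumes "1 < c"
  shows "eventually (\<lambda>r::real. 0 < r \<and> r \<le> 1 / 4 \<and> inverse ((1 - r\<^sup>2 / 2) ^ n) < c) (at_right 0)"
proof -
  have "((\<lambda>r::real. inverse ((1 - r\<^sup>2 / 2) ^ n)) \<longlongrightarrow> inverse ((1 - 0\<^sup>2 / 2) ^ n)) (at_right 0)"
    by (intro tendsto_intros) auto
  then have "eventually (\<lambda>r::real. inverse ((1 - r\<^sup>2 / 2) ^ n) < c) (at_right 0)"
    using assms by (intro order_tendstoD(2)) auto
  moreover have "eventually (\<lambda>r::real. 0 < r \<and> r \<le> 1 / 4) (at_right 0)"
    using eventually_at_right_real[of 0 "1 / 4"] by (auto elim: eventually_mono)
  ultimately show ?thesis by eventually_elim auto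
qed

text \<open>The mass \<open>t\<close> of a cap is compared with the volume of a flat disc of radius
  \<open>r\<close>: the disc exceeds \<open>t\<close> at most by a factor close to 1, and the discs
  of all packed caps amount to a fixed fraction of the area. The factor 4 arises because a cap of
  radius \<open>2 * r\<close> has diameter at most \<open>4 * r\<close> and the gnomonic constant is
  at most 2.\<close>

lemma packing_bounds:
  assumes r: "0 < r" "r \<le> 1 / 4"
  obtains P and t :: real where "finite P" "P \<subseteq> sphere (0::'a::euclidean_space) 1" "disjoint_family_on (\<lambda>p. cball p r) P"
    "sphere 0 1 \<subseteq> (\<Union>p\<in>P. cball p (2 * r))" "0 < t" "\<And>p. p \<in> sphere (0::'a) 1 \<Longrightarrow> emeasure sphere_measure (cball p r) = ennreal t"
    "unit_ball_vol (real (DIM('a) - 1)) * r ^ (DIM('a) - 1) \<le> t * inverse ((1 - r\<^sup>2 / 2) ^ DIM('a))"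
    "real (card P) * t \<le> sphere_area TYPE('a)"
    "sphere_area TYPE('a) \<le> 4 ^ (DIM('a) - 1) * (real (card P) * (unit_ball_vol (real (DIM('a) - 1)) * r ^ (DIM('a) - 1)))"
proof -
  let ?k = "DIM('a) - 1" and ?s = "sphere_area TYPE('a)" and ?\<sigma> = "sphere_measure :: 'a measure"
  interpret finite_measure ?\<sigma> by (rule finite_measure_sphere_measure)
  obtain e :: 'a where e: "e \<in> Basis" using nonempty_Basis by blast
  have ne: "norm e = 1" using e by simp
  have r1: "r \<le> 1" using r by simp
  obtain P where P: "finite P" "P \<subseteq> sphere (0::'a) 1" "disjoint_family_on (\<lambda>p. cball p r) P"
    "sphere 0 1 \<subseteq> (\<Union>p\<in>P. cball p (2 * r))"
    using sphere_packing[OF r(1) r1 e] by blast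
  define t where "t = measure ?\<sigma> (cball e r)"
  have t: "emeasure ?\<sigma> (cball p r) = ennreal t" if "p \<in> sphere 0 1" for p
    using sphere_measure_cball_eq[of p e r] ne that by (simp add: t_def emeasure_eq_measure)
  have mt: "measure ?\<sigma> (cball p r) = t" if "p \<in> P" for p
    using t[of p] P(2) that by (auto simp: emeasure_eq_measure t_def)
  have r2: "r\<^sup>2 \<le> (1 / 4)\<^sup>2" using r by (intro power_mono) auto
  have m0: "0 < 1 - r\<^sup>2 / 2" using r2 by (simp add: power2_eq_square)
  let ?W = "unit_ball_vol (real ?k) * r ^ ?k"
  have W: "0 < ?W" using r by (intro mult_pos_pos zero_less_power) auto
  have cap: "?W * (1 - r\<^sup>2 / 2) ^ DIM('a) \<le> t"
    using sphere_measure_cap_ge[OF e r(1) r1] by (simp add: emeasure_eq_measure t_def)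
  moreover have "0 < ?W * (1 - r\<^sup>2 / 2) ^ DIM('a)" using W m0 by simp
  ultimately have t0: "0 < t" by linarith
  have W_le: "?W \<le> t * inverse ((1 - r\<^sup>2 / 2) ^ DIM('a))"
    using cap m0 by (simp add: divide_inverse[symmetric] pos_le_divide_eq)
  have s: "measure ?\<sigma> UNIV = ?s"
    using emeasure_sphere_measure_UNIV'[where 'a='a] sphere_area_pos[where 'a='a] by (simp add: emeasure_eq_measure)
  have up: "real (card P) * t \<le> ?s"
  proof -
    have "real (card P) * t = (\<Sum>p\<in>P. measure ?\<sigma> (cball p r))" using mt by simp
    also have "\<dots> = measure ?\<sigma> (\<Union>p\<in>P. cball p r)"
      using P by (intro finite_measure_finite_Union[symmetric]) auto
    also have "\<dots> \<le> ?s" using bounded_measure[of "\<Union>p\<in>P. cball p r"] s by simp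
    finally show ?thesis .
  qed
  have low: "?s \<le> 4 ^ ?k * (real (card P) * ?W)"
  proof -
    have cap2: "emeasure ?\<sigma> (cball p (2 * r) \<inter> sphere 0 1) \<le> ennreal (4 ^ ?k * ?W)" if p: "p \<in> P" for p
    proof -
      have d: "0 \<le> 2 * r" "2 * r \<le> 1 / 2" using r by auto
      have B: "cball p (2 * r) \<inter> sphere 0 1 \<in> sets borel" by (intro sets.Int borel_closed closed_cball closed_sphere)
      have "emeasure ?\<sigma> (cball p (2 * r) \<inter> sphere 0 1) \<le> ennreal (unit_ball_vol (real ?k) * (gnom_const (2 * r) * (4 * r) / 2) ^ ?k)"
      proof (rule sphere_measure_le_any[OF _ B _ d])
        show "norm p = 1" using p P(2) by auto
        fix x y assume "x \<in> cball p (2 * r) \<inter> sphere 0 1" "y \<in> cball p (2 * r) \<inter> sphere 0 1"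
        then have "dist x y \<le> 2 * r + 2 * r" using dist_triangle2[of x y p] by (simp add: dist_commute)
        then show "norm (x - y) \<le> 4 * r" by (simp add: dist_norm)
      qed (use r in auto)
      also have "\<dots> \<le> ennreal (unit_ball_vol (real ?k) * (4 * r) ^ ?k)"
      proof (intro ennreal_leI mult_left_mono power_mono)
        have "gnom_const (2 * r) * (2 * r) \<le> 2 * (2 * r)"
          using gnom_const_le_2[OF d] r by (intro mult_right_mono) auto
        then show "gnom_const (2 * r) * (4 * r) / 2 \<le> 4 * r" by simp
        show "0 \<le> gnom_const (2 * r) * (4 * r) / 2" using gnom_const_pos[OF d] r by simp
      qed simp
      also have "unit_ball_vol (real ?k) * (4 * r) ^ ?k = 4 ^ ?k * ?W" by (simp add: power_mult_distrib)
      finally show ?thesis .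
    qed
    have "ennreal ?s = emeasure ?\<sigma> (UNIV \<inter> sphere 0 1)"
      by (subst emeasure_sphere_measure_Int) (simp_all add: emeasure_sphere_measure_UNIV')
    also have "\<dots> \<le> emeasure ?\<sigma> (\<Union>p\<in>P. cball p (2 * r) \<inter> sphere 0 1)"
      using P by (intro emeasure_mono) (auto intro!: borel_closed closed_sphere)
    also have "\<dots> \<le> (\<Sum>p\<in>P. emeasure ?\<sigma> (cball p (2 * r) \<inter> sphere 0 1))"
      using P(1) by (intro emeasure_subadditive_finite) (auto intro!: borel_closed closed_sphere)
    also have "\<dots> \<le> (\<Sum>p\<in>P. ennreal (4 ^ ?k * ?W))" by (intro sum_mono cap2)
    also have "\<dots> = ennreal (real (card P) * (4 ^ ?k * ?W))"
      using W by (simp add: ennreal_mult ennreal_of_nat_eq_real_of_nat)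
    finally have "?s \<le> real (card P) * (4 ^ ?k * ?W)"
      using W by (subst (asm) ennreal_le_iff) auto
    then show ?thesis by (simp only: mult.left_commute)
  qed
  show thesis by (rule that[OF P t0 t W_le up low])
qed

lemma hausdorff_outer_leI:
  assumes d0: "0 < d0" and le: "\<And>d. 0 < d \<Longrightarrow> d \<le> d0 \<Longrightarrow> hausdorff_content k d A \<le> c"
  shows "hausdorff_outer k A \<le> c"
  unfolding hausdorff_outer_def
proof (rule SUP_least)
  fix d :: real assume "d \<in> {0<..}"
  then have "hausdorff_content k d A \<le> hausdorff_content k (min d d0) A"
    by (intro hausdorff_content_antimono) simp
  also have "\<dots> \<le> c" using \<open>d \<in> {0<..}\<close> d0 by (intro le) auto
  finally show "hausdorff_content k d A \<le> c" .
qed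

text \<open>A crude bound from covering by doubled caps. Finiteness is what admits the Hausdorff
  measure to the Fubini comparison with the sphere measure.\<close>

lemma hausdorff_sphere_finite: "hausdorff_outer (DIM('a) - 1) (sphere (0::'a::euclidean_space) 1) < \<infinity>"
proof -
  let ?k = "DIM('a) - 1" and ?s = "sphere_area TYPE('a)"
  obtain r0 :: real where r0: "0 < r0" "\<And>r. 0 < r \<Longrightarrow> r < r0 \<Longrightarrow> r \<le> 1 / 4 \<and> inverse ((1 - r\<^sup>2 / 2) ^ DIM('a)) < 2"
    using eventually_cap_const[of 2 "DIM('a)"] unfolding eventually_at_right_field by auto
  have "hausdorff_outer ?k (sphere (0::'a) 1) \<le> ennreal (2 ^ ?k * (2 * ?s))"
  proof (rule hausdorff_outer_leI)
    show "0 < 2 * r0" using r0 by simp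
    fix d :: real assume d: "0 < d" "d \<le> 2 * r0"
    \<comment> \<open>The doubled caps have radius \<open>2 * r\<close>, hence diameter at most
      \<open>4 * r = d\<close>.\<close>
    define r where "r = d / 4"
    have r: "0 < r" "r < r0" using d r0 by (auto simp: r_def)
    note rr = r0(2)[OF r]
    obtain P and t :: real where P: "finite P" "P \<subseteq> sphere (0::'a) 1" "disjoint_family_on (\<lambda>p. cball p r) P"
      "sphere 0 1 \<subseteq> (\<Union>p\<in>P. cball p (2 * r))" and t: "0 < t"
      and W: "unit_ball_vol (real ?k) * r ^ ?k \<le> t * inverse ((1 - r\<^sup>2 / 2) ^ DIM('a))"
      and up: "real (card P) * t \<le> ?s"
      using packing_bounds[OF r(1), where 'a='a] rr by metis
    have W2: "unit_ball_vol (real ?k) * r ^ ?k \<le> t * 2"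
      using W rr t mult_left_mono[of "inverse ((1 - r\<^sup>2 / 2) ^ DIM('a))" 2 t] by linarith
    have "hausdorff_content ?k d (sphere (0::'a) 1) \<le> hausdorff_content ?k d ((\<Union>p\<in>P. sphere 0 1 \<inter> cball p (2 * r)) \<union> {})"
      using P(4) by (intro hausdorff_content_mono) auto
    also have "\<dots> \<le> (\<Sum>p\<in>P. hausdorff_gauge ?k (sphere 0 1 \<inter> cball p (2 * r))) + hausdorff_content ?k d ({} :: 'a set)"
    proof (rule hausdorff_content_finite_cover[OF P(1) d(1)])
      show "bounded (sphere 0 1 \<inter> cball p (2 * r)) \<and> diameter (sphere 0 1 \<inter> cball p (2 * r)) \<le> d" for p :: 'a
        using hausdorff_gauge_cap_le(1,2)[of "2 * r" p] r by (simp add: r_def)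
    qed
    also have "\<dots> \<le> (\<Sum>p\<in>P. ennreal (unit_ball_vol (real ?k) * (2 * r) ^ ?k)) + 0"
    proof (intro add_mono sum_mono)
      show "hausdorff_gauge ?k (sphere 0 1 \<inter> cball p (2 * r)) \<le> ennreal (unit_ball_vol (real ?k) * (2 * r) ^ ?k)" for p :: 'a
        by (rule hausdorff_gauge_cap_le(3)) (use r in simp)
      show "hausdorff_content ?k d ({} :: 'a set) \<le> 0" using d by (simp add: hausdorff_content_empty)
    qed
    also have "\<dots> = ennreal (real (card P) * (unit_ball_vol (real ?k) * (2 * r) ^ ?k))"
      using r by (simp add: ennreal_mult ennreal_of_nat_eq_real_of_nat)
    also have "\<dots> \<le> ennreal (2 ^ ?k * (2 * ?s))"
    proof (rule ennreal_leI)
      have "real (card P) * (unit_ball_vol (real ?k) * (2 * r) ^ ?k) = 2 ^ ?k * (real (card P) * (unit_ball_vol (real ?k) * r ^ ?k))"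
        by (simp add: power_mult_distrib)
      also have "\<dots> \<le> 2 ^ ?k * (real (card P) * (t * 2))"
        using W2 by (intro mult_left_mono) auto
      also have "\<dots> \<le> 2 ^ ?k * (2 * ?s)"
        using up by (intro mult_left_mono) auto
      finally show "real (card P) * (unit_ball_vol (real ?k) * (2 * r) ^ ?k) \<le> 2 ^ ?k * (2 * ?s)" .
    qed
    finally show "hausdorff_content ?k d (sphere (0::'a) 1) \<le> ennreal (2 ^ ?k * (2 * ?s))" .
  qed
  then show ?thesis by (auto intro: le_less_trans)
qed

lemma emeasure_hausdorff_sphere_UNIV:
  "emeasure (hausdorff_sphere :: 'a::euclidean_space measure) UNIV = hausdorff_outer (DIM('a) - 1) (sphere (0::'a) 1)"
  using emeasure_hausdorff_sphere[of "UNIV :: 'a set"] by simp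

lemma finite_measure_hausdorff_sphere: "finite_measure (hausdorff_sphere :: 'a::euclidean_space measure)"
  using hausdorff_sphere_finite[where 'a='a] by (intro finite_measureI) (auto simp: emeasure_hausdorff_sphere_UNIV)

lemma zonal_hausdorff_sphere:
  fixes e :: "'a::euclidean_space"
  assumes "h \<in> borel_measurable borel" "norm e = 1"
  shows "ennreal (sphere_area TYPE('a)) * (\<integral>\<^sup>+x. h (x \<bullet> e) \<partial>hausdorff_sphere) =
    emeasure (hausdorff_sphere :: 'a measure) UNIV * (\<integral>\<^sup>+x. h (x \<bullet> e) \<partial>sphere_measure)"
  unfolding emeasure_sphere_measure_UNIV'[symmetric]
  by (rule zonal_integrals[OF
    finite_measure_hausdorff_sphere sets_hausdorff_sphere AE_hausdorff_sphere _
    finite_measure_sphere_measure sets_sphere_measure AE_sphere_measure _ assms])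
    (rule nn_integral_hausdorff_sphere_orthogonal nn_integral_sphere_measure_orthogonal; assumption)+

text \<open>For unit vectors, \<open>dist p x \<le> r\<close> means
  \<open>1 - r\<^sup>2 / 2 \<le> x \<bullet> p\<close>, so indicators of caps are zonal.\<close>

lemma hausdorff_sphere_cap:
  fixes p :: "'a::euclidean_space"
  assumes p: "norm p = 1" and r: "0 \<le> r"
  shows "ennreal (sphere_area TYPE('a)) * emeasure hausdorff_sphere (cball p r) =
    emeasure (hausdorff_sphere :: 'a measure) UNIV * emeasure sphere_measure (cball p r)"
proof -
  let ?h = "indicator {1 - r\<^sup>2 / 2..} :: real \<Rightarrow> ennreal"
  have h: "?h (x \<bullet> p) = indicator (cball p r) x" if "norm x = 1" for x
  proof -
    have "dist p x \<le> r \<longleftrightarrow> (norm (x - p))\<^sup>2 \<le> r\<^sup>2"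
      using r by (simp add: dist_norm norm_minus_commute)
    also have "\<dots> \<longleftrightarrow> 1 - r\<^sup>2 / 2 \<le> x \<bullet> p"
      unfolding norm_diff_unit[OF that p] by (simp add: field_simps)
    finally show ?thesis by (simp add: indicator_def)
  qed
  have I: "(\<integral>\<^sup>+x. ?h (x \<bullet> p) \<partial>\<mu>) = emeasure \<mu> (cball p r)"
    if "AE x in \<mu>. norm x = 1" "sets \<mu> = sets borel" for \<mu> :: "'a measure"
  proof -
    have "(\<integral>\<^sup>+x. ?h (x \<bullet> p) \<partial>\<mu>) = (\<integral>\<^sup>+x. indicator (cball p r) x \<partial>\<mu>)"
      using that(1) by (intro nn_integral_cong_AE) (auto elim!: eventually_mono simp: h)
    also have "\<dots> = emeasure \<mu> (cball p r)" by (rule nn_integral_indicator) (simp add: that(2))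
    finally show ?thesis .
  qed
  have m: "?h \<in> borel_measurable borel" by measurable
  show ?thesis
    using zonal_hausdorff_sphere[OF m p]
    unfolding I[OF AE_hausdorff_sphere sets_hausdorff_sphere] I[OF AE_sphere_measure sets_sphere_measure] .
qed

text \<open>Suppose the total \<open>h\<close> exceeded the area by a factor \<open>c > 1\<close>.
  Every cap would then have Hausdorff measure \<open>c * t\<close>, although its gauge is at most
  \<open>t\<close> times a factor close to 1. Covering each packed cap by itself and the remainder
  almost optimally saves a fixed amount at every small scale \<open>d\<close>, so all contents would
  stay below some \<open>h' < h\<close>.\<close>

theorem hausdorff_sphere_eq:
  "hausdorff_outer (DIM('a) - 1) (sphere (0::'a::euclidean_space) 1) = ennreal (sphere_area TYPE('a))"
proof (rule antisym[OF _ sphere_area_le_hausdorff])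
  let ?k = "DIM('a) - 1" and ?s = "sphere_area TYPE('a)" and ?H = "hausdorff_sphere :: 'a measure"
  interpret H: finite_measure ?H by (rule finite_measure_hausdorff_sphere)
  have s: "0 < ?s" by (rule sphere_area_pos)
  define h where "h = measure ?H UNIV"
  have h: "hausdorff_outer ?k (sphere (0::'a) 1) = ennreal h"
    unfolding emeasure_hausdorff_sphere_UNIV[symmetric] h_def by (rule H.emeasure_eq_measure)
  show "hausdorff_outer ?k (sphere (0::'a) 1) \<le> ennreal ?s"
  proof (rule ccontr)
    assume "\<not> ?thesis"
    then have hs: "?s < h" using s unfolding h by (auto simp: not_le ennreal_less_iff)
    define c where "c = h / ?s"
    have c: "1 < c" using hs s by (simp add: c_def)
    \<comment> \<open>\<open>c - \<gamma>\<close> is the midpoint between 1 and \<open>c\<close>, so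
      small caps have gauge at most \<open>(c - \<gamma>) * t\<close>.\<close>
    define \<gamma> where "\<gamma> = (c - 1) / 2"
    have \<gamma>: "0 < \<gamma>" using c by (simp add: \<gamma>_def)
    obtain r0 :: real where r0: "0 < r0" "\<And>r. 0 < r \<Longrightarrow> r < r0 \<Longrightarrow> r \<le> 1 / 4 \<and> inverse ((1 - r\<^sup>2 / 2) ^ DIM('a)) < min 2 (c - \<gamma>)"
      using eventually_cap_const[of "min 2 (c - \<gamma>)" "DIM('a)"] c unfolding eventually_at_right_field \<gamma>_def by (auto simp: field_simps)
    \<comment> \<open>The saving: the packed caps have total sphere measure at least
      \<open>?s / (4 ^ ?k * 2)\<close>, and each unit of it saves \<gamma>.\<close>
    define h' where "h' = h - ?s / (4 ^ ?k * 2) * \<gamma>"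
    have "hausdorff_outer ?k (sphere (0::'a) 1) \<le> ennreal h'"
    proof (rule hausdorff_outer_leI)
      show "0 < r0" by (rule r0)
      fix d :: real assume d: "0 < d" "d \<le> r0"
      define r where "r = d / 2"
      have r: "0 < r" "r < r0" using d by (auto simp: r_def)
      note rr = r0(2)[OF r]
      define M where "M = inverse ((1 - r\<^sup>2 / 2) ^ DIM('a))"
      have M: "M < 2" "M < c - \<gamma>" using rr by (auto simp: M_def)
      obtain P and t :: real where P: "finite P" "P \<subseteq> sphere (0::'a) 1" "disjoint_family_on (\<lambda>p. cball p r) P"
        and t: "0 < t" "\<And>p. p \<in> sphere (0::'a) 1 \<Longrightarrow> emeasure sphere_measure (cball p r) = ennreal t"
        and W: "unit_ball_vol (real ?k) * r ^ ?k \<le> t * inverse ((1 - r\<^sup>2 / 2) ^ DIM('a))"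
        and low: "?s \<le> 4 ^ ?k * (real (card P) * (unit_ball_vol (real ?k) * r ^ ?k))"
        using packing_bounds[OF r(1), where 'a='a] rr by metis
      define w where "w = unit_ball_vol (real ?k) * r ^ ?k"
      define N where "N = real (card P)"
      have N: "0 \<le> N" by (simp add: N_def)
      have wM: "w \<le> t * M" using W by (simp add: w_def M_def)
      have w0: "0 \<le> w" using r by (simp add: w_def)
      have mH: "measure ?H (cball p r) = c * t" if "p \<in> P" for p
      proof -
        have p: "norm p = 1" using that P(2) by auto
        have "ennreal ?s * emeasure ?H (cball p r) = emeasure ?H UNIV * ennreal t"
          using hausdorff_sphere_cap[OF p, of r] t(2)[of p] p r by simp
        moreover have "emeasure ?H UNIV = ennreal h" unfolding h_def by (rule H.emeasure_eq_measure)
        ultimately have "ennreal (?s * measure ?H (cball p r)) = ennreal (h * t)"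
          using s t(1) by (simp add: H.emeasure_eq_measure[of "cball p r"] ennreal_mult' ennreal_mult'')
        then have "?s * measure ?H (cball p r) = h * t"
          using s t(1) hs by (subst (asm) ennreal_inj) auto
        then show ?thesis using s by (simp add: c_def field_simps)
      qed
      let ?C = "\<Union>p\<in>P. cball p r"
      have C: "?C \<in> sets borel" using P(1) by (intro sets.finite_UN) auto
      have "measure ?H ?C = (\<Sum>p\<in>P. measure ?H (cball p r))"
        using P by (intro H.finite_measure_finite_Union) auto
      also have "\<dots> = N * (c * t)" using mH by (simp add: N_def)
      finally have mC: "measure ?H ?C = N * (c * t)" .
      have rest: "measure ?H (UNIV - ?C) = h - N * (c * t)"
        using H.finite_measure_compl[of ?C] C by (simp add: mC h_def)
      \<comment> \<open>Each packed cap contributes its gauge, the rest of the sphere its full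
        Hausdorff measure.\<close>
      have "hausdorff_content ?k d (sphere (0::'a) 1) \<le> hausdorff_content ?k d ((\<Union>p\<in>P. sphere 0 1 \<inter> cball p r) \<union> (sphere 0 1 \<inter> (UNIV - ?C)))"
        by (intro hausdorff_content_mono) auto
      also have "\<dots> \<le> (\<Sum>p\<in>P. hausdorff_gauge ?k (sphere 0 1 \<inter> cball p r)) + hausdorff_content ?k d (sphere 0 1 \<inter> (UNIV - ?C))"
      proof (rule hausdorff_content_finite_cover[OF P(1) d(1)])
        show "bounded (sphere 0 1 \<inter> cball p r) \<and> diameter (sphere 0 1 \<inter> cball p r) \<le> d" for p :: 'a
          using hausdorff_gauge_cap_le(1,2)[of r p] r by (simp add: r_def)
      qed
      also have "\<dots> \<le> (\<Sum>p\<in>P. ennreal w) + hausdorff_outer ?k (sphere 0 1 \<inter> (UNIV - ?C))"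
      proof (intro add_mono sum_mono)
        show "hausdorff_gauge ?k (sphere 0 1 \<inter> cball p r) \<le> ennreal w" for p :: 'a
          unfolding w_def by (rule hausdorff_gauge_cap_le(3)) (use r in simp)
        show "hausdorff_content ?k d (sphere 0 1 \<inter> (UNIV - ?C)) \<le> hausdorff_outer ?k (sphere 0 1 \<inter> (UNIV - ?C))"
          unfolding hausdorff_outer_def using d by (intro SUP_upper) auto
      qed
      also have "hausdorff_outer ?k (sphere 0 1 \<inter> (UNIV - ?C)) = ennreal (h - N * (c * t))"
        using emeasure_hausdorff_sphere[of "UNIV - ?C"] C rest H.emeasure_eq_measure[of "UNIV - ?C"] by simp
      also have "(\<Sum>p\<in>P. ennreal w) = ennreal (N * w)"
        using w0 by (simp add: N_def ennreal_mult ennreal_of_nat_eq_real_of_nat)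
      also have "ennreal (N * w) + ennreal (h - N * (c * t)) = ennreal (N * w + (h - N * (c * t)))"
        using w0 N rest measure_nonneg[of ?H "UNIV - ?C"] by (intro ennreal_plus[symmetric]) auto
      also have "\<dots> \<le> ennreal h'"
      proof (rule ennreal_leI)
        have "N * w \<le> N * (t * M)" using wM N by (rule mult_left_mono)
        also have "N * (t * M) \<le> N * (t * (c - \<gamma>))" using M t N by (intro mult_left_mono) auto
        finally have 1: "N * w + (h - N * (c * t)) \<le> h - (N * t) * \<gamma>" by (simp add: algebra_simps)
        have "w \<le> t * 2" using wM M(1) t(1) mult_left_mono[of M 2 t] by linarith
        then have "N * w \<le> N * (t * 2)" using N by (rule mult_left_mono)
        then have A: "4 ^ ?k * (N * w) \<le> 4 ^ ?k * (N * (t * 2))" by (rule mult_left_mono) simp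
        have "?s \<le> 4 ^ ?k * (N * (t * 2))" by (rule order_trans[OF low[folded w_def N_def] A])
        then have "?s / (4 ^ ?k * 2) \<le> N * t" by (simp add: divide_le_eq mult_ac)
        then have "?s / (4 ^ ?k * 2) * \<gamma> \<le> (N * t) * \<gamma>" using \<gamma> by (intro mult_right_mono) auto
        then show "N * w + (h - N * (c * t)) \<le> h'" using 1 by (simp add: h'_def)
      qed
      finally show "hausdorff_content ?k d (sphere (0::'a) 1) \<le> ennreal h'" .
    qed
    then have "h \<le> h' \<or> h \<le> 0" unfolding h by (cases "0 \<le> h'") (auto simp: ennreal_le_iff ennreal_neg)
    moreover have "0 < ?s / (4 ^ ?k * 2) * \<gamma>" using s \<gamma> by simp
    ultimately show False using hs s by (simp add: h'_def)
  qed
qed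

text \<open>Two identifications at once: Hausdorff measure with the cone measure on zonal functions,
  and \<open>e\<close> with \<open>e'\<close> by a rotation. The integrand is bounded on the sphere
  and hence integrable, so the Bochner integral in \<open>sphere_gamma\<close> is the true
  value.\<close>

theorem sphere_gamma_eq:
  fixes e e' :: "'a::euclidean_space"
  assumes e: "norm e = 1" "norm e' = 1" and q: "0 \<le> q"
  shows "(\<integral>\<^sup>+x. ennreal (\<bar>x \<bullet> e'\<bar> powr q) \<partial>sphere_measure) = ennreal (sphere_gamma e q)"
proof -
  let ?h = "\<lambda>t. ennreal (\<bar>t\<bar> powr q)" and ?H = "hausdorff_sphere :: 'a measure" and ?s = "sphere_area TYPE('a)"
  have s: "ennreal ?s \<noteq> 0" "ennreal ?s \<noteq> top" using sphere_area_pos[where 'a='a] by auto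
  have HU: "emeasure ?H UNIV = ennreal ?s" by (simp only: emeasure_hausdorff_sphere_UNIV hausdorff_sphere_eq)
  have z: "(\<integral>\<^sup>+x. ?h (x \<bullet> a) \<partial>?H) = (\<integral>\<^sup>+x. ?h (x \<bullet> a) \<partial>sphere_measure)" if "norm a = 1" for a :: 'a
  proof -
    have "ennreal ?s * (\<integral>\<^sup>+x. ?h (x \<bullet> a) \<partial>?H) = ennreal ?s * (\<integral>\<^sup>+x. ?h (x \<bullet> a) \<partial>sphere_measure)"
      unfolding HU[symmetric] by (subst HU, rule zonal_hausdorff_sphere[OF _ that]) measurable
    then show ?thesis using s by (simp only: ennreal_mult_cancel_left simp_thms)
  qed
  have rot: "(\<integral>\<^sup>+x. ?h (x \<bullet> e') \<partial>(sphere_measure :: 'a measure)) = (\<integral>\<^sup>+x. ?h (x \<bullet> e) \<partial>sphere_measure)"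
  proof -
    obtain f where f: "orthogonal_transformation f" "f e = e'"
      using orthogonal_transformation_exists_unit[OF e] by blast
    have "(\<integral>\<^sup>+x. ?h (x \<bullet> e') \<partial>(sphere_measure :: 'a measure)) = (\<integral>\<^sup>+x. ?h (f x \<bullet> e') \<partial>sphere_measure)"
      by (rule nn_integral_sphere_measure_orthogonal[OF f(1), symmetric]) measurable
    moreover have "f x \<bullet> e' = x \<bullet> e" for x
      unfolding f(2)[symmetric] using f(1) by (simp add: orthogonal_transformation_def)
    ultimately show ?thesis by (simp only:)
  qed
  have [measurable]: "sphere 0 1 \<in> sets (borel :: 'a measure)" by (simp add: closed_sphere borel_closed)
  let ?R = "restrict_space (hausdorff_measure (DIM('a) - 1)) (sphere (0::'a) 1)"
  have R: "(\<integral>\<^sup>+x. ?h (x \<bullet> e) \<partial>?R) = (\<integral>\<^sup>+x. ?h (x \<bullet> e) \<partial>?H)"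
    unfolding hausdorff_sphere_def
    by (subst nn_integral_restrict_space) (auto simp: nn_integral_density mult.commute)
  have fin: "(\<integral>\<^sup>+x. ?h (x \<bullet> e) \<partial>?H) < \<infinity>"
  proof -
    have "(\<integral>\<^sup>+x. ?h (x \<bullet> e) \<partial>?H) \<le> (\<integral>\<^sup>+x. 1 \<partial>?H)"
    proof (rule nn_integral_mono_AE)
      show "AE x in ?H. ?h (x \<bullet> e) \<le> 1"
        using AE_hausdorff_sphere
      proof eventually_elim
        case (elim x)
        then have "\<bar>x \<bullet> e\<bar> \<le> 1" using Cauchy_Schwarz_ineq2[of x e] e by simp
        then show ?case using q by (simp add: powr_le1)
      qed
    qed
    also have "\<dots> < \<infinity>" by (simp add: HU)
    finally show ?thesis .
  qed
  have "integrable ?R (\<lambda>x. \<bar>x \<bullet> e\<bar> powr q)"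
  proof (rule integrableI_bounded)
    show "(\<lambda>x. \<bar>x \<bullet> e\<bar> powr q) \<in> borel_measurable ?R"
      by (rule measurable_restrict_space1) simp
    show "(\<integral>\<^sup>+x. ennreal (norm (\<bar>x \<bullet> e\<bar> powr q)) \<partial>?R) < \<infinity>" using fin R by simp
  qed
  then have "(\<integral>\<^sup>+x. ?h (x \<bullet> e) \<partial>?R) = ennreal (sphere_gamma e q)"
    unfolding sphere_gamma_def by (intro nn_integral_eq_integral) auto
  then show ?thesis using R z[OF e(1)] rot by simp
qed

section \<open>The radial integral\<close>

text \<open>Substitution \<open>t = s * c\<close>. For \<open>c = 0\<close> both sides vanish, the
  left because \<open>f 0 = 0\<close> and the right because \<open>0 powr q = 0\<close>.\<close>

lemma nn_integral_radial_scale: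
  fixes f :: "real \<Rightarrow> real" and q c :: real
  assumes [measurable]: "f \<in> borel_measurable borel" and f0: "f 0 = 0" and c: "0 \<le> c"
  shows "(\<integral>\<^sup>+s. ennreal (f (s * c) * s powr (- (q + 1))) * indicator {0<..} s \<partial>lborel) =
    ennreal (c powr q) * (\<integral>\<^sup>+t. ennreal (f t * t powr (- (q + 1))) * indicator {0<..} t \<partial>lborel)" (is "?L = _ * ?I")
proof (cases "c = 0")
  case False
  then have c: "0 < c" using c by simp
  let ?h = "\<lambda>t. ennreal (f t * t powr (- (q + 1))) * indicator {0<..} t"
  have eq: "ennreal (f (s * c) * s powr (- (q + 1))) * indicator {0<..} s = ennreal (c powr (q + 1)) * ?h (0 + c *\<^sub>R s)" for s
  proof (cases "0 < s")
    case True
    have "c powr (q + 1) * (f (c * s) * (c * s) powr (- (q + 1))) = f (c * s) * s powr (- (q + 1)) * (c powr (q + 1) * c powr (- (q + 1)))"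
      using True c by (simp add: powr_mult)
    also have "c powr (q + 1) * c powr (- (q + 1)) = 1" using c by (simp add: powr_add[symmetric])
    finally have E: "c powr (q + 1) * (f (c * s) * (c * s) powr (- (q + 1))) = f (c * s) * s powr (- (q + 1))" by simp
    have "ennreal (c powr (q + 1)) * ?h (0 + c *\<^sub>R s) = ennreal (c powr (q + 1) * (f (c * s) * (c * s) powr (- (q + 1))))"
      using True c by (simp add: ennreal_mult')
    also have "\<dots> = ennreal (f (c * s) * s powr (- (q + 1)))" by (simp only: E)
    finally show ?thesis using True by (simp add: mult.commute)
  qed (use c in \<open>auto simp: zero_less_mult_iff\<close>)
  have "?L = ennreal (c powr (q + 1)) * (\<integral>\<^sup>+s. ?h (0 + c *\<^sub>R s) \<partial>lborel)"
    unfolding eq by (rule nn_integral_cmult) measurable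
  also have "c powr (q + 1) = c powr q * c ^ DIM(real)" using c by (simp add: powr_add)
  also have "ennreal (c powr q * c ^ DIM(real)) * (\<integral>\<^sup>+s. ?h (0 + c *\<^sub>R s) \<partial>lborel) =
      ennreal (c powr q) * (ennreal (c ^ DIM(real)) * (\<integral>\<^sup>+s. ?h (0 + c *\<^sub>R s) \<partial>lborel))"
    using c by (simp add: ennreal_mult' mult.assoc)
  also have "ennreal (c ^ DIM(real)) * (\<integral>\<^sup>+s. ?h (0 + c *\<^sub>R s) \<partial>lborel) = ?I"
    by (rule nn_integral_lborel_affine) (use c in auto)
  finally show ?thesis .
qed (simp add: f0)

text \<open>In polar coordinates the radial integral in direction \<omega> is
  \<open>\<bar>w \<bullet> \<omega>\<bar> powr q\<close> times a constant. The remaining spherical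
  integral is \<open>norm w powr q * sphere_gamma e q\<close>, and the normalisation cancels the
  constants.\<close>

lemma nn_integral_radial_kernel:
  fixes w e :: "'a::euclidean_space" and f :: "real \<Rightarrow> real"
  assumes f [measurable]: "f \<in> borel_measurable borel" and f0: "f 0 = 0" "\<And>t. 0 \<le> t \<Longrightarrow> 0 \<le> f t"
    and q: "1 \<le> q" and e: "norm e = 1"
    and norm1: "sphere_gamma e q * (LBINT t:{0<..}. f t * t powr (- (q + 1))) = 1"
  shows "(\<integral>\<^sup>+v. ennreal (f \<bar>w \<bullet> v\<bar> / norm v powr (real DIM('a) + q)) \<partial>lborel) = ennreal (norm w powr q)"
proof -
  let ?n = "DIM('a)" and ?\<sigma> = "sphere_measure :: 'a measure"
  define I where "I = (\<integral>\<^sup>+t. ennreal (f t * t powr (- (q + 1))) * indicator {0<..} t \<partial>lborel)"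
  have I: "I = ennreal (LBINT t:{0<..}. f t * t powr (- (q + 1)))"
  proof -
    \<comment> \<open>A non-integrable function would have Bochner integral 0, contradicting the
      normalisation.\<close>
    have "integrable lborel (\<lambda>t. indicator {0<..} t *\<^sub>R (f t * t powr (- (q + 1))))"
    proof (rule ccontr)
      assume "\<not> ?thesis"
      from not_integrable_integral_eq[OF this] norm1 show False unfolding set_lebesgue_integral_def by simp
    qed
    from nn_integral_eq_integral[OF this] have "(\<integral>\<^sup>+t. ennreal (indicator {0<..} t *\<^sub>R (f t * t powr (- (q + 1)))) \<partial>lborel) =
        ennreal (LBINT t:{0<..}. f t * t powr (- (q + 1)))"
      unfolding set_lebesgue_integral_def by (auto simp: f0 indicator_def)
    moreover have "I = (\<integral>\<^sup>+t. ennreal (indicator {0<..} t *\<^sub>R (f t * t powr (- (q + 1)))) \<partial>lborel)"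
      unfolding I_def by (intro nn_integral_cong) (auto simp: indicator_def)
    ultimately show ?thesis by simp
  qed
  have sg: "0 \<le> sphere_gamma e q" unfolding sphere_gamma_def by (intro Bochner_Integration.integral_nonneg) simp
  have "(\<integral>\<^sup>+v. ennreal (f \<bar>w \<bullet> v\<bar> / norm v powr (real ?n + q)) \<partial>lborel) =
      (\<integral>\<^sup>+\<omega>. (\<integral>\<^sup>+s. ennreal (s ^ (?n - 1)) * ennreal (f \<bar>w \<bullet> (s *\<^sub>R \<omega>)\<bar> / norm (s *\<^sub>R \<omega>) powr (real ?n + q)) * indicator {0<..} s \<partial>lborel) \<partial>?\<sigma>)"
    by (rule nn_integral_polar) measurable
  also have "\<dots> = (\<integral>\<^sup>+\<omega>. ennreal (\<bar>w \<bullet> \<omega>\<bar> powr q) * I \<partial>?\<sigma>)"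
  proof (rule nn_integral_cong_AE)
    show "AE \<omega> in ?\<sigma>. (\<integral>\<^sup>+s. ennreal (s ^ (?n - 1)) * ennreal (f \<bar>w \<bullet> (s *\<^sub>R \<omega>)\<bar> / norm (s *\<^sub>R \<omega>) powr (real ?n + q)) * indicator {0<..} s \<partial>lborel) =
        ennreal (\<bar>w \<bullet> \<omega>\<bar> powr q) * I"
      using AE_sphere_measure
    proof eventually_elim
      case (elim \<omega>)
      have "ennreal (s ^ (?n - 1)) * ennreal (f \<bar>w \<bullet> (s *\<^sub>R \<omega>)\<bar> / norm (s *\<^sub>R \<omega>) powr (real ?n + q)) * indicator {0<..} s =
          ennreal (f (s * \<bar>w \<bullet> \<omega>\<bar>) * s powr (- (q + 1))) * indicator {0<..} s" for s
      proof (cases "0 < s")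
        case True
        have "s ^ (?n - 1) / s powr (real ?n + q) = s powr (real (?n - 1) - (real ?n + q))"
          using True by (simp only: powr_realpow[symmetric] powr_diff)
        also have "real (?n - 1) - (real ?n + q) = - (q + 1)" using DIM_positive[where 'a='a] by (simp add: of_nat_diff)
        finally have E: "s ^ (?n - 1) / s powr (real ?n + q) = s powr (- (q + 1))" .
        have "s ^ (?n - 1) * (f (s * \<bar>w \<bullet> \<omega>\<bar>) / s powr (real ?n + q)) = f (s * \<bar>w \<bullet> \<omega>\<bar>) * s powr (- (q + 1))"
          unfolding E[symmetric] by (simp only: times_divide_eq_right mult.commute)
        moreover have "norm (s *\<^sub>R \<omega>) = s" "\<bar>w \<bullet> (s *\<^sub>R \<omega>)\<bar> = s * \<bar>w \<bullet> \<omega>\<bar>" using True elim by (auto simp: abs_mult)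
        moreover have "ennreal (s ^ (?n - 1)) * ennreal z = ennreal (s ^ (?n - 1) * z)" for z
          using True by (intro ennreal_mult'[symmetric]) simp
        ultimately show ?thesis by (simp only:)
      qed simp
      then show ?case unfolding I_def by (simp only: nn_integral_radial_scale[OF f f0(1) abs_ge_zero])
    qed
  qed
  also have "\<dots> = (\<integral>\<^sup>+\<omega>. ennreal (\<bar>\<omega> \<bullet> w\<bar> powr q) \<partial>?\<sigma>) * I"
    by (subst nn_integral_multc) (auto simp: inner_commute)
  also have "(\<integral>\<^sup>+\<omega>. ennreal (\<bar>\<omega> \<bullet> w\<bar> powr q) \<partial>?\<sigma>) = ennreal (norm w powr q) * ennreal (sphere_gamma e q)"
  proof (cases "w = 0")
    case False
    define e' where "e' = w /\<^sub>R norm w"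
    have w: "w = norm w *\<^sub>R e'" and e': "norm e' = 1" using False by (auto simp: e'_def)
    have "ennreal (\<bar>\<omega> \<bullet> w\<bar> powr q) = ennreal (norm w powr q) * ennreal (\<bar>\<omega> \<bullet> e'\<bar> powr q)" for \<omega>
      by (subst (1) w) (simp add: abs_mult powr_mult ennreal_mult')
    then have "(\<integral>\<^sup>+\<omega>. ennreal (\<bar>\<omega> \<bullet> w\<bar> powr q) \<partial>?\<sigma>) = ennreal (norm w powr q) * (\<integral>\<^sup>+\<omega>. ennreal (\<bar>\<omega> \<bullet> e'\<bar> powr q) \<partial>?\<sigma>)"
      by (simp only:) (intro nn_integral_cmult, measurable)
    then show ?thesis using sphere_gamma_eq[OF e e', of q] q by simp
  qed simp
  also have "ennreal (norm w powr q) * ennreal (sphere_gamma e q) * I = ennreal (norm w powr q)"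
    unfolding I mult.assoc by (subst ennreal_mult'[OF sg, symmetric]) (simp only: norm1 ennreal_1 mult_1_right)
  finally show ?thesis .
qed

lemma set_lebesgue_integral_finite_difference:
  fixes f h :: "real \<Rightarrow> real"
  assumes "finite D" "\<And>t. t \<in> A \<Longrightarrow> t \<notin> D \<Longrightarrow> f t = h t"
  shows "(LBINT t:A. f t) = (LBINT t:A. h t)"
  unfolding set_lebesgue_integral_def
  by (rule integral_discrete_difference[of D]) (use assms in \<open>auto simp: countable_finite indicator_def\<close>)

section \<open>Borel representatives\<close>

lemma borel_Int_space_lebesgue: "S \<in> sets borel \<Longrightarrow> S \<inter> space lebesgue \<in> sets (lebesgue :: 'a::euclidean_space measure)"
  by simp

lemma AE_lebesgue_on_iff:
  "S \<in> sets borel \<Longrightarrow> (AE x in lebesgue_on S. P x) \<longleftrightarrow> (AE x in lborel. x \<in> S \<longrightarrow> P x)"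
  by (subst AE_restrict_space_iff) (simp_all add: AE_completion_iff)

lemma nn_integral_lebesgue_on_borel:
  "S \<in> sets borel \<Longrightarrow> (\<integral>\<^sup>+x. f x \<partial>lebesgue_on S) = (\<integral>\<^sup>+x. indicator S x * f x \<partial>lborel)"
  by (subst nn_integral_restrict_space) (simp_all add: nn_integral_completion mult.commute)

text \<open>Fubini is applied to Borel functions over \<open>lborel\<close>, whereas the function
  spaces are defined over \<open>lebesgue_on\<close>; integrals and integrability pass to a Borel
  function that agrees almost everywhere.\<close>

lemma lebesgue_on_version:
  fixes f f' :: "'a::euclidean_space \<Rightarrow> 'b::{banach, second_countable_topology}"
  assumes S [measurable]: "S \<in> sets borel" and f: "f \<in> borel_measurable (lebesgue_on S)"
    and f' [measurable]: "f' \<in> borel_measurable borel" and eq: "AE x in lborel. x \<in> S \<longrightarrow> f x = f' x"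
  shows "(LINT x|lebesgue_on S. f x) = (LINT x|lborel. indicator S x *\<^sub>R f' x)"
    and "integrable (lebesgue_on S) f \<longleftrightarrow> integrable lborel (\<lambda>x. indicator S x *\<^sub>R f' x)"
proof -
  note sp = borel_Int_space_lebesgue[OF S]
  have m: "(\<lambda>x. indicator S x *\<^sub>R f x) \<in> borel_measurable lebesgue"
    using f by (subst (asm) borel_measurable_restrict_space_iff[OF sp])
  have m'0: "(\<lambda>x. indicator S x *\<^sub>R f' x) \<in> borel_measurable lborel" by measurable
  then have m': "(\<lambda>x. indicator S x *\<^sub>R f' x) \<in> borel_measurable lebesgue" by (rule measurable_completion)
  have ae: "AE x in lebesgue. indicator S x *\<^sub>R f x = indicator S x *\<^sub>R f' x"
    using eq unfolding AE_completion_iff by (auto elim!: eventually_mono simp: indicator_def)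
  show "(LINT x|lebesgue_on S. f x) = (LINT x|lborel. indicator S x *\<^sub>R f' x)"
    unfolding integral_restrict_space[OF sp] integral_cong_AE[OF m m' ae] by (rule integral_completion[OF m'0])
  show "integrable (lebesgue_on S) f \<longleftrightarrow> integrable lborel (\<lambda>x. indicator S x *\<^sub>R f' x)"
    unfolding integrable_restrict_space[OF sp] integrable_cong_AE[OF m m' ae] by (rule integrable_completion[OF m'0])
qed

lemma lebesgue_on_borel_versionE:
  fixes f :: "'a::euclidean_space \<Rightarrow> 'b::euclidean_space"
  assumes S [measurable]: "S \<in> sets borel" and f [measurable]: "f \<in> borel_measurable (lebesgue_on S)"
  obtains f' where "f' \<in> borel_measurable borel" "\<And>x. x \<notin> S \<Longrightarrow> f' x = 0" "AE x in lborel. x \<in> S \<longrightarrow> f x = f' x"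
proof -
  have "\<exists>h\<in>borel_measurable lborel. AE x in lborel. indicator S x *\<^sub>R (f x \<bullet> i) = h x" for i :: 'b
  proof (rule completion_ex_borel_measurable_real)
    have "(\<lambda>x. f x \<bullet> i) \<in> borel_measurable (lebesgue_on S)" by measurable
    then show "(\<lambda>x. indicator S x *\<^sub>R (f x \<bullet> i)) \<in> borel_measurable lebesgue"
      by (subst (asm) borel_measurable_restrict_space_iff[OF borel_Int_space_lebesgue[OF S]])
  qed
  then have "\<forall>i. \<exists>h. h \<in> borel_measurable borel \<and> (AE x in lborel. indicator S x *\<^sub>R (f x \<bullet> i) = h x)"
    by (simp add: Bex_def)
  from choice[OF this] obtain h where h: "\<And>i. h i \<in> borel_measurable borel"
      "\<And>i. AE x in lborel. indicator S x *\<^sub>R (f x \<bullet> i) = h i x"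
    by blast
  note [measurable] = h(1)
  show thesis
  proof (rule that)
    show "(\<lambda>x. indicator S x *\<^sub>R (\<Sum>i\<in>Basis. h i x *\<^sub>R i)) \<in> borel_measurable borel" by measurable
    have "AE x in lborel. \<forall>i\<in>Basis. indicator S x *\<^sub>R (f x \<bullet> i) = h i x"
      by (intro AE_finite_allI h) simp
    then show "AE x in lborel. x \<in> S \<longrightarrow> f x = indicator S x *\<^sub>R (\<Sum>i\<in>Basis. h i x *\<^sub>R i)"
    proof eventually_elim
      case (elim x)
      have "(\<Sum>i\<in>Basis. h i x *\<^sub>R i) = (\<Sum>i\<in>Basis. (f x \<bullet> i) *\<^sub>R i)" if "x \<in> S"
        using elim that by (intro sum.cong) auto
      then show ?case by (simp add: euclidean_representation)
    qed
  qed simp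
qed

text \<open>Integrability on compact sets gives measurability there, and countably many compact sets
  exhaust \<Omega>.\<close>

lemma locally_integrable_on_measurable:
  fixes f :: "'a::euclidean_space \<Rightarrow> 'b::euclidean_space"
  assumes \<Omega>: "open \<Omega>" and f: "f locally_integrable_on \<Omega>"
  shows "f \<in> borel_measurable (lebesgue_on \<Omega>)"
proof -
  obtain K :: "nat \<Rightarrow> 'a set" where K: "\<And>m. compact (K m)" "\<And>m. K m \<subseteq> \<Omega>" "(\<Union>m. K m) = \<Omega>"
    using open_Union_compact_subsets[OF \<Omega>] by metis
  have b: "K m \<in> sets borel" for m using K(1) by (intro borel_closed compact_imp_closed)
  have KL: "K m \<in> sets lebesgue" "\<Omega> \<in> sets lebesgue" for m using b[of m] borel_open[OF \<Omega>] by simp_all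
  show ?thesis
  proof (rule measurable_piecewise_restrict[of "range K"])
    fix X assume "X \<in> range K"
    then obtain m where X: "X = K m" by blast
    have "restrict_space (lebesgue_on \<Omega>) (K m) = lebesgue_on (\<Omega> \<inter> K m)"
      by (rule restrict_restrict_space) (use KL in auto)
    also have "\<Omega> \<inter> K m = K m" using K(2) by blast
    finally show "f \<in> borel_measurable (restrict_space (lebesgue_on \<Omega>) X)"
      using f K unfolding locally_integrable_on_def X by (metis borel_measurable_integrable)
    show "X \<inter> space (lebesgue_on \<Omega>) \<in> sets (lebesgue_on \<Omega>)"
      using KL X K(2)[of m] by (auto simp: sets_restrict_space_iff Int_absorb2 Int_commute)
  qed (use K in auto)
qed

lemma loc_int_version:
  fixes f f' :: "'a::euclidean_space \<Rightarrow> 'b::euclidean_space"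
  assumes "open \<Omega>" and f: "f locally_integrable_on \<Omega>" and f': "f' \<in> borel_measurable borel"
    and eq: "AE x in lborel. x \<in> \<Omega> \<longrightarrow> f x = f' x"
  shows "loc_int \<Omega> f'"
  unfolding loc_int_def set_integrable_def
proof (intro conjI allI impI f')
  fix K assume K: "compact K \<and> K \<subseteq> \<Omega>"
  then have i: "integrable (lebesgue_on K) f" using f by (auto simp: locally_integrable_on_def)
  have "AE x in lborel. x \<in> K \<longrightarrow> f x = f' x" using eq by (rule eventually_mono) (use K in auto)
  then show "integrable lborel (\<lambda>x. indicator K x *\<^sub>R f' x)"
    using lebesgue_on_version(2)[of K f f'] i K f' by (auto simp: borel_closed compact_imp_closed)
qed

text \<open>Test functions and their derivatives vanish off \<Omega>, so integrals over \<Omega>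
  become integrals over the whole space.\<close>

lemma weak_gradient_version:
  assumes \<Omega>: "open \<Omega>" and wg: "weak_gradient \<Omega> u g"
    and u' [measurable]: "u' \<in> borel_measurable borel" and equ: "AE x in lborel. x \<in> \<Omega> \<longrightarrow> u x = u' x"
    and g' [measurable]: "g' \<in> borel_measurable borel" and eqg: "AE x in lborel. x \<in> \<Omega> \<longrightarrow> g x = g' x"
  shows "borel_weak_gradient \<Omega> u' g'"
  unfolding borel_weak_gradient_def
proof (intro conjI allI impI ballI)
  have li: "u locally_integrable_on \<Omega>" "g locally_integrable_on \<Omega>" using wg by (auto simp: weak_gradient_def)
  show "loc_int \<Omega> u'" by (rule loc_int_version[OF \<Omega> li(1) u' equ])
  show "loc_int \<Omega> g'" by (rule loc_int_version[OF \<Omega> li(2) g' eqg])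
  have \<Omega>b: "\<Omega> \<in> sets borel" using \<Omega> by simp
  note um [measurable] = locally_integrable_on_measurable[OF \<Omega> li(1)] locally_integrable_on_measurable[OF \<Omega> li(2)]
  fix \<psi> and i :: 'a assume \<psi>: "test_function \<Omega> \<psi>" and i: "i \<in> Basis"
  have c: "continuous_on UNIV \<psi>" "continuous_on UNIV (\<lambda>x. frechet_derivative \<psi> (at x) i)"
    using test_function_derivative[OF \<psi>] i by auto
  have [measurable]: "\<psi> \<in> borel_measurable borel" "(\<lambda>x. frechet_derivative \<psi> (at x) i) \<in> borel_measurable borel"
    using c by (auto intro: borel_measurable_continuous_onI)
  have [measurable]: "h \<in> borel_measurable (lebesgue_on \<Omega>)" if "h \<in> borel_measurable borel" for h :: "'a \<Rightarrow> real"
    using that by (intro measurable_restrict_space1 measurable_completion) simp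
  obtain K where K: "compact K" "K \<subseteq> \<Omega>" "\<And>x. x \<notin> K \<Longrightarrow> \<psi> x = 0" "\<And>x i. x \<notin> K \<Longrightarrow> frechet_derivative \<psi> (at x) i = 0"
    using test_function_supp[OF \<psi>] by metis
  have off: "\<psi> x = 0" "frechet_derivative \<psi> (at x) i = 0" if "x \<notin> \<Omega>" for x using K that by blast+
  have "(LINT x|lebesgue_on \<Omega>. u x * frechet_derivative \<psi> (at x) i) =
      (LINT x|lborel. indicator \<Omega> x *\<^sub>R (u' x * frechet_derivative \<psi> (at x) i))"
    by (rule lebesgue_on_version(1)[OF \<Omega>b]) (use equ in \<open>auto elim!: eventually_mono\<close>)
  also have "\<dots> = (LINT x|lborel. u' x * frechet_derivative \<psi> (at x) i)"
    by (rule Bochner_Integration.integral_cong) (auto simp: indicator_def off)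
  finally have 1: "(LINT x|lebesgue_on \<Omega>. u x * frechet_derivative \<psi> (at x) i) = (LINT x|lborel. u' x * frechet_derivative \<psi> (at x) i)" .
  have "(LINT x|lebesgue_on \<Omega>. (g x \<bullet> i) * \<psi> x) = (LINT x|lborel. indicator \<Omega> x *\<^sub>R ((g' x \<bullet> i) * \<psi> x))"
    by (rule lebesgue_on_version(1)[OF \<Omega>b]) (use eqg in \<open>auto elim!: eventually_mono\<close>)
  also have "\<dots> = (LINT x|lborel. (g' x \<bullet> i) * \<psi> x)"
    by (rule Bochner_Integration.integral_cong) (auto simp: indicator_def off)
  finally have 2: "(LINT x|lebesgue_on \<Omega>. (g x \<bullet> i) * \<psi> x) = (LINT x|lborel. (g' x \<bullet> i) * \<psi> x)" .
  show "(LINT x|lborel. u' x * frechet_derivative \<psi> (at x) i) = - (LINT x|lborel. (g' x \<bullet> i) * \<psi> x)"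
    unfolding 1[symmetric] 2[symmetric] using wg \<psi> i by (auto simp: weak_gradient_def)
qed

lemma borel_weak_gradient_unique:
  fixes u :: "'a::euclidean_space \<Rightarrow> real"
  assumes \<Omega>: "open \<Omega>" and 1: "borel_weak_gradient \<Omega> u g" and 2: "borel_weak_gradient \<Omega> u h"
  shows "AE x in lborel. x \<in> \<Omega> \<longrightarrow> g x = h x"
proof -
  have li: "loc_int \<Omega> (\<lambda>x. f x \<bullet> i)" if "loc_int \<Omega> f" for f :: "'a \<Rightarrow> 'a" and i
    using that unfolding loc_int_def set_integrable_def
    by (auto simp: inner_scaleR_left[symmetric] simp del: inner_scaleR_left intro: integrable_inner_left)
  have li: "loc_int \<Omega> (\<lambda>x. g x \<bullet> i)" "loc_int \<Omega> (\<lambda>x. h x \<bullet> i)" for i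
    using 1 2 li unfolding borel_weak_gradient_def by blast+
  have "AE x in lborel. x \<in> \<Omega> \<longrightarrow> g x \<bullet> i - h x \<bullet> i = 0" if i: "i \<in> Basis" for i
  proof (rule fundamental_lemma[OF \<Omega>])
    show "loc_int \<Omega> (\<lambda>x. g x \<bullet> i - h x \<bullet> i)"
      using li[of i] unfolding loc_int_def by (auto intro!: set_integral_diff(1))
    fix \<psi> assume \<psi>: "test_function \<Omega> \<psi>"
    obtain K where K: "compact K" "K \<subseteq> \<Omega>" "\<And>x. x \<notin> K \<Longrightarrow> \<psi> x = 0"
      using test_function_supp[OF \<psi>] by metis
    note int = integrable_loc_int_mult[OF _ K(1,2) test_function_derivative(3)[OF \<psi>] K(3)]
    have "(LINT x|lborel. (g x \<bullet> i - h x \<bullet> i) * \<psi> x) = (LINT x|lborel. (g x \<bullet> i) * \<psi> x) - (LINT x|lborel. (h x \<bullet> i) * \<psi> x)"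
      unfolding left_diff_distrib by (rule Bochner_Integration.integral_diff[OF int[OF li(1)] int[OF li(2)]])
    also have "\<dots> = 0"
    proof -
      have "(LINT x|lborel. u x * frechet_derivative \<psi> (at x) i) = - (LINT x|lborel. (g x \<bullet> i) * \<psi> x)"
        using 1 \<psi> i unfolding borel_weak_gradient_def by blast
      moreover have "(LINT x|lborel. u x * frechet_derivative \<psi> (at x) i) = - (LINT x|lborel. (h x \<bullet> i) * \<psi> x)"
        using 2 \<psi> i unfolding borel_weak_gradient_def by blast
      ultimately show ?thesis by linarith
    qed
    finally show "(LINT x|lborel. (g x \<bullet> i - h x \<bullet> i) * \<psi> x) = 0" .
  qed
  then have "AE x in lborel. \<forall>i\<in>Basis. x \<in> \<Omega> \<longrightarrow> g x \<bullet> i - h x \<bullet> i = 0"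
    by (intro AE_finite_allI) auto
  then show ?thesis by eventually_elim (auto intro: euclidean_eqI)
qed

text \<open>The two Sobolev spaces provide possibly different gradients, and \<open>wgrad\<close> is
  chosen without reference to either exponent. Uniqueness identifies all of them with one Borel
  function \<open>g\<close>, extended by 0 so that its maximal function is defined on the whole
  space.\<close>

lemma Sobolev_W1_versions:
  fixes u :: "'a::euclidean_space \<Rightarrow> real"
  assumes \<Omega>: "open \<Omega>" and u: "u \<in> Sobolev_W1 r \<Omega> \<inter> Sobolev_W1 q \<Omega>"
  obtains u' g where "u' \<in> borel_measurable borel" "g \<in> borel_measurable borel" "\<And>x. x \<notin> \<Omega> \<Longrightarrow> g x = 0"
    "AE x in lborel. x \<in> \<Omega> \<longrightarrow> u x = u' x" "AE x in lborel. x \<in> \<Omega> \<longrightarrow> wgrad \<Omega> u x = g x"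
    "borel_weak_gradient \<Omega> u' g"
    "\<And>s. s \<in> {q, r} \<Longrightarrow> 0 < s \<Longrightarrow> integrable lborel (\<lambda>x. norm (g x) powr s)"
    "\<And>s. s \<in> {q, r} \<Longrightarrow> 0 < s \<Longrightarrow> Lp_norm s \<Omega> (wgrad \<Omega> u) powr s = (LINT x|lborel. norm (g x) powr s)"
proof -
  have \<Omega>b: "\<Omega> \<in> sets borel" using \<Omega> by simp
  have ex: "\<exists>h \<in> Lp_space s \<Omega>. weak_gradient \<Omega> u h" if "s \<in> {q, r}" for s
    using u that by (auto simp: Sobolev_W1_def)
  then have wg: "weak_gradient \<Omega> u (wgrad \<Omega> u)"
    unfolding wgrad_def by (metis insertI1 someI)
  have lu: "u locally_integrable_on \<Omega>" and lg: "wgrad \<Omega> u locally_integrable_on \<Omega>"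
    using wg by (auto simp: weak_gradient_def)
  note um = locally_integrable_on_measurable[OF \<Omega> lu] and gm = locally_integrable_on_measurable[OF \<Omega> lg]
  obtain u' where u': "u' \<in> borel_measurable borel" "AE x in lborel. x \<in> \<Omega> \<longrightarrow> u x = u' x"
    using lebesgue_on_borel_versionE[OF \<Omega>b um] by metis
  obtain g where g: "g \<in> borel_measurable borel" "\<And>x. x \<notin> \<Omega> \<Longrightarrow> g x = 0"
      "AE x in lborel. x \<in> \<Omega> \<longrightarrow> wgrad \<Omega> u x = g x"
    using lebesgue_on_borel_versionE[OF \<Omega>b gm] by metis
  note [measurable] = g(1)
  have bwg: "borel_weak_gradient \<Omega> u' g" by (rule weak_gradient_version[OF \<Omega> wg u' g(1,3)])
  have gs: "(\<lambda>x. norm (g x) powr s) \<in> borel_measurable borel" for s by measurable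
  have off: "indicator \<Omega> x *\<^sub>R norm (g x) powr s = norm (g x) powr s" for x s
    using g(2)[of x] by (auto simp: indicator_def)
  show thesis
  proof (rule that[OF u'(1) g(1,2) u'(2) g(3) bwg])
    fix s assume s: "s \<in> {q, r}" "0 < s"
    obtain h where h: "h \<in> Lp_space s \<Omega>" "weak_gradient \<Omega> u h" using ex s by blast
    then have hm [measurable]: "h \<in> borel_measurable (lebesgue_on \<Omega>)" and hi: "integrable (lebesgue_on \<Omega>) (\<lambda>x. norm (h x) powr s)"
      by (auto simp: Lp_space_def)
    obtain h' where h': "h' \<in> borel_measurable borel" "AE x in lborel. x \<in> \<Omega> \<longrightarrow> h x = h' x"
      using lebesgue_on_borel_versionE[OF \<Omega>b hm] by metis
    have "AE x in lborel. x \<in> \<Omega> \<longrightarrow> h' x = g x"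
      by (rule borel_weak_gradient_unique[OF \<Omega> weak_gradient_version[OF \<Omega> h(2) u' h'] bwg])
    with h'(2) have "AE x in lborel. x \<in> \<Omega> \<longrightarrow> norm (h x) powr s = norm (g x) powr s" by eventually_elim auto
    from lebesgue_on_version(2)[OF \<Omega>b borel_measurable_integrable[OF hi] gs this, THEN iffD1, OF hi]
    show "integrable lborel (\<lambda>x. norm (g x) powr s)" unfolding off .
    have "(\<lambda>x. norm (wgrad \<Omega> u x) powr s) \<in> borel_measurable (lebesgue_on \<Omega>)"
      using gm by measurable
    moreover have "AE x in lborel. x \<in> \<Omega> \<longrightarrow> norm (wgrad \<Omega> u x) powr s = norm (g x) powr s"
      using g(3) by eventually_elim auto
    ultimately have "(LINT x|lebesgue_on \<Omega>. norm (wgrad \<Omega> u x) powr s) = (LINT x|lborel. norm (g x) powr s)"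
      using lebesgue_on_version(1)[OF \<Omega>b _ gs] unfolding off by blast
    moreover have "0 \<le> (LINT x|lborel. norm (g x) powr s)" by (intro Bochner_Integration.integral_nonneg) simp
    ultimately show "Lp_norm s \<Omega> (wgrad \<Omega> u) powr s = (LINT x|lborel. norm (g x) powr s)"
      using s by (simp add: Lp_norm_def powr_powr)
  qed
qed

lemma upper_gradient_norm_weak_gradient:
  fixes u :: "'a::euclidean_space \<Rightarrow> real"
  assumes \<Omega>: "open \<Omega>" and wg: "borel_weak_gradient \<Omega> u g" and off: "\<And>x. x \<notin> \<Omega> \<Longrightarrow> g x = 0" and int: "integrable lborel g"
  shows "upper_gradient \<Omega> u (\<lambda>x. ennreal (norm (g x)))"
proof (rule upper_gradientI[OF \<Omega>])
  show [measurable]: "u \<in> borel_measurable borel" using wg by (auto simp: borel_weak_gradient_def loc_int_def)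
  have [measurable]: "g \<in> borel_measurable borel" using int by auto
  show "(\<lambda>x. ennreal (norm (g x))) \<in> borel_measurable borel" by measurable
  show "ennreal (norm (g x)) = 0" if "x \<notin> \<Omega>" for x using off that by simp
  show "(\<integral>\<^sup>+x. ennreal (norm (g x)) \<partial>lborel) < \<infinity>" using int by (simp add: integrable_iff_bounded)
  fix v :: 'a
  show "AE x in lborel. x \<in> seg_dom \<Omega> v \<longrightarrow> ennreal \<bar>u (x + v) - u x\<bar> \<le> ennreal (norm v) * seg_avg (\<lambda>x. ennreal (norm (g x))) x v"
    using segment_formula[OF \<Omega> wg, of v]
  proof eventually_elim
    case (elim x)
    let ?f = "\<lambda>t. indicator {0..1} t * (g (x + t *\<^sub>R v) \<bullet> v)"
    \<comment> \<open>If the integrand is not integrable, the left side is the default value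
      0.\<close>
    have "ennreal \<bar>LINT t|lborel. ?f t\<bar> \<le> (\<integral>\<^sup>+t. ennreal \<bar>?f t\<bar> \<partial>lborel)"
      using integral_norm_bound_ennreal[of lborel ?f] by (cases "integrable lborel ?f") (auto simp: not_integrable_integral_eq)
    also have "\<dots> \<le> (\<integral>\<^sup>+t. ennreal (norm v) * (ennreal (norm (g (x + t *\<^sub>R v))) * indicator {0..1} t) \<partial>lborel)"
      using Cauchy_Schwarz_ineq2[of _ v]
      by (intro nn_integral_mono) (auto simp: indicator_def ennreal_mult'[symmetric] mult.commute[of "norm v"] intro!: ennreal_leI)
    also have "\<dots> = ennreal (norm v) * seg_avg (\<lambda>x. ennreal (norm (g x))) x v"
      unfolding seg_avg_def by (rule nn_integral_cmult) measurable
    finally show ?case using elim by simp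
  qed
qed

text \<open>The maximal function of an integrable function is finite almost everywhere, so
  \<open>enn2real\<close> loses nothing in the pointwise estimate; the strong type inequality bounds
  \<open>G\<close> in every power above 1.\<close>

lemma lip_bound_weak_gradient:
  fixes u :: "'a::euclidean_space \<Rightarrow> real" and g :: "'a \<Rightarrow> 'a"
  assumes \<Omega>: "open \<Omega>" and wg: "borel_weak_gradient \<Omega> u g" and off: "\<And>x. x \<notin> \<Omega> \<Longrightarrow> g x = 0" and int: "integrable lborel g"
    and lip: "lip_bound \<Omega> R \<Omega> C" and C: "0 \<le> C"
  defines "G \<equiv> (\<lambda>x. C * enn2real (max_fun R (\<lambda>x. ennreal (norm (g x))) x))"
  shows "AE x in lborel. x \<in> \<Omega> \<longrightarrow> (AE y in lborel. y \<in> \<Omega> \<longrightarrow> \<bar>u x - u y\<bar> \<le> norm (x - y) * (G x + G y))"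
    and "1 < q \<Longrightarrow> (\<integral>\<^sup>+x. ennreal ((2 * G x) powr q) \<partial>lborel) \<le>
      ennreal ((2 * C) powr q * (5 ^ DIM('a) * 2 powr q * q / (q - 1))) * (\<integral>\<^sup>+x. ennreal (norm (g x) powr q) \<partial>lborel)"
proof -
  let ?m = "max_fun R (\<lambda>x. ennreal (norm (g x)))"
  note ug = upper_gradient_norm_weak_gradient[OF \<Omega> wg off int]
  have [measurable]: "g \<in> borel_measurable borel" using int by auto
  have fin: "AE x in lborel. ?m x < \<infinity>"
    by (rule max_fun_AE_finite) (use int in \<open>auto simp: integrable_iff_bounded\<close>)
  have "AE x in lborel. x \<in> \<Omega> \<longrightarrow> (AE y in lborel. y \<in> \<Omega> \<longrightarrow>
      ennreal \<bar>u x - u y\<bar> \<le> ennreal (C * norm (x - y)) * (?m x + ?m y))"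
    using lip ug unfolding lip_bound_def by blast
  with fin show "AE x in lborel. x \<in> \<Omega> \<longrightarrow> (AE y in lborel. y \<in> \<Omega> \<longrightarrow> \<bar>u x - u y\<bar> \<le> norm (x - y) * (G x + G y))"
  proof eventually_elim
    case (elim x)
    show ?case
    proof
      assume "x \<in> \<Omega>"
      with elim have "AE y in lborel. y \<in> \<Omega> \<longrightarrow> ennreal \<bar>u x - u y\<bar> \<le> ennreal (C * norm (x - y)) * (?m x + ?m y)" by blast
      with fin show "AE y in lborel. y \<in> \<Omega> \<longrightarrow> \<bar>u x - u y\<bar> \<le> norm (x - y) * (G x + G y)"
      proof eventually_elim
        case (elim y)
        obtain a b where ab: "?m x = ennreal a" "0 \<le> a" "?m y = ennreal b" "0 \<le> b"
          using elim(1) \<open>?m x < \<infinity>\<close> by (cases "?m x"; cases "?m y") auto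
        show ?case
        proof
          assume "y \<in> \<Omega>"
          with elim have "ennreal \<bar>u x - u y\<bar> \<le> ennreal (C * norm (x - y)) * (ennreal a + ennreal b)" using ab by simp
          also have "\<dots> = ennreal (C * norm (x - y) * (a + b))" using ab C by (simp add: ennreal_mult' ennreal_plus)
          finally have "\<bar>u x - u y\<bar> \<le> C * norm (x - y) * (a + b)" using ab C by (subst (asm) ennreal_le_iff) auto
          then show "\<bar>u x - u y\<bar> \<le> norm (x - y) * (G x + G y)" using ab by (simp add: G_def algebra_simps)
        qed
      qed
    qed
  qed
  assume q: "1 < q"
  have "(\<integral>\<^sup>+x. ennreal ((2 * G x) powr q) \<partial>lborel) = (\<integral>\<^sup>+x. ennreal ((2 * C) powr q) * ennreal (enn2real (?m x) powr q) \<partial>lborel)"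
    unfolding G_def mult.assoc[symmetric] using C by (simp add: powr_mult ennreal_mult')
  also have "\<dots> = ennreal ((2 * C) powr q) * (\<integral>\<^sup>+x. ennreal (enn2real (?m x) powr q) \<partial>lborel)"
    by (rule nn_integral_cmult) measurable
  also have "\<dots> \<le> ennreal ((2 * C) powr q) * (ennreal (5 ^ DIM('a) * 2 powr q * q / (q - 1)) * (\<integral>\<^sup>+x. ennreal (norm (g x) powr q) \<partial>lborel))"
    by (intro mult_left_mono max_fun_strong_type q) auto
  finally show "(\<integral>\<^sup>+x. ennreal ((2 * G x) powr q) \<partial>lborel) \<le>
      ennreal ((2 * C) powr q * (5 ^ DIM('a) * 2 powr q * q / (q - 1))) * (\<integral>\<^sup>+x. ennreal (norm (g x) powr q) \<partial>lborel)"
    unfolding ennreal_mult'[OF powr_ge_zero] mult.assoc .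
qed

section \<open>The main theorem\<close>

lemma borel_measurable_lam_kernel:
  fixes p u :: "'a::euclidean_space \<Rightarrow> real"
  assumes [measurable]: "p \<in> borel_measurable borel" "u \<in> borel_measurable borel"
    and \<psi>: "case_prod \<psi> \<in> borel_measurable (borel \<Otimes>\<^sub>M borel)"
  shows "(\<lambda>(x, y). lam_kernel p \<psi> \<delta> u x y) \<in> borel_measurable (borel \<Otimes>\<^sub>M borel)"
proof -
  have "(\<lambda>z. \<psi> (fst z) (\<bar>u (fst z) - u (snd z)\<bar> / \<delta>)) \<in> borel_measurable (borel \<Otimes>\<^sub>M borel)"
    using measurable_compose[OF _ \<psi>, of "\<lambda>z. (fst z, \<bar>u (fst z) - u (snd z)\<bar> / \<delta>)" "borel \<Otimes>\<^sub>M borel"] by simp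
  then show ?thesis unfolding lam_kernel_def case_prod_unfold by measurable
qed

text \<open>The integrand of \<open>Lambda\<close> may fail to be measurable, but nonnegative
  integrals are monotone for arbitrary functions; the order of integration is exchanged on the Borel
  side only.\<close>

lemma Lambda_borel_compare:
  fixes \<Omega> :: "'a::euclidean_space set"
  assumes \<Omega>: "\<Omega> \<in> sets borel" and \<delta>: "0 < \<delta>"
    and u': "u' \<in> borel_measurable borel" "AE x in lborel. x \<in> \<Omega> \<longrightarrow> u x = u' x"
    and p': "p' \<in> borel_measurable borel" "AE x in lborel. x \<in> \<Omega> \<longrightarrow> p x = p' x"
    and \<psi>: "case_prod \<psi> \<in> borel_measurable (borel \<Otimes>\<^sub>M borel)"
  defines "I \<equiv> (\<integral>\<^sup>+x. (\<integral>\<^sup>+y. indicator \<Omega> x * indicator \<Omega> y * lam_kernel p' \<psi> \<delta> u' x y \<partial>lborel) \<partial>lborel)"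
  shows "AE x in lborel. x \<in> \<Omega> \<longrightarrow> (\<forall>t\<ge>0. \<phi> x t \<le> \<psi> x t) \<Longrightarrow> Lambda \<Omega> p \<phi> \<delta> u \<le> I"
    and "AE x in lborel. x \<in> \<Omega> \<longrightarrow> (\<forall>t\<ge>0. \<psi> x t \<le> \<phi> x t) \<Longrightarrow> I \<le> Lambda \<Omega> p \<phi> \<delta> u"
proof -
  have [measurable]: "\<Omega> \<in> sets borel" by fact
  have [measurable]: "(\<lambda>(x, y). lam_kernel p' \<psi> \<delta> u' x y) \<in> borel_measurable (borel \<Otimes>\<^sub>M borel)"
    by (rule borel_measurable_lam_kernel[OF p'(1) u'(1) \<psi>])
  have I: "I = (\<integral>\<^sup>+y. (\<integral>\<^sup>+x. indicator \<Omega> x * indicator \<Omega> y * lam_kernel p' \<psi> \<delta> u' x y \<partial>lborel) \<partial>lborel)"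
    unfolding I_def by (rule lborel_pair.Fubini'[symmetric]) (simp add: lborel_prod[symmetric] case_prod_unfold, measurable)
  have L: "Lambda \<Omega> p \<phi> \<delta> u = (\<integral>\<^sup>+y. indicator \<Omega> y * (\<integral>\<^sup>+x. indicator \<Omega> x * lam_kernel p \<phi> \<delta> u x y \<partial>lborel) \<partial>lborel)"
    unfolding Lambda_def lam_kernel_def nn_integral_lebesgue_on_borel[OF \<Omega>] by (rule refl)
  have mono: "f1 x t \<le> f2 x t \<Longrightarrow> \<delta> powr q * f1 x t / norm (x - y) powr s \<le> \<delta> powr q * f2 x t / norm (x - y) powr s"
    for f1 f2 :: "'a \<Rightarrow> real \<Rightarrow> real" and x y :: 'a and t q s :: real
    by (intro divide_right_mono mult_left_mono) auto
  show "Lambda \<Omega> p \<phi> \<delta> u \<le> I" if le: "AE x in lborel. x \<in> \<Omega> \<longrightarrow> (\<forall>t\<ge>0. \<phi> x t \<le> \<psi> x t)"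
    unfolding I L
  proof (rule nn_integral_mono_AE)
    show "AE y in lborel. indicator \<Omega> y * (\<integral>\<^sup>+x. indicator \<Omega> x * lam_kernel p \<phi> \<delta> u x y \<partial>lborel)
        \<le> (\<integral>\<^sup>+x. indicator \<Omega> x * indicator \<Omega> y * lam_kernel p' \<psi> \<delta> u' x y \<partial>lborel)"
      using u'(2)
    proof eventually_elim
      case (elim y)
      show ?case
      proof (cases "y \<in> \<Omega>")
        case True
        have "AE x in lborel. indicator \<Omega> x * lam_kernel p \<phi> \<delta> u x y \<le> indicator \<Omega> x * lam_kernel p' \<psi> \<delta> u' x y"
          using u'(2) p'(2) le by eventually_elim (use elim True \<delta> in \<open>auto simp: indicator_def lam_kernel_def intro!: ennreal_leI mono\<close>)
        then show ?thesis using True by (simp add: nn_integral_mono_AE)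
      qed simp
    qed
  qed
  show "I \<le> Lambda \<Omega> p \<phi> \<delta> u" if le: "AE x in lborel. x \<in> \<Omega> \<longrightarrow> (\<forall>t\<ge>0. \<psi> x t \<le> \<phi> x t)"
    unfolding I L
  proof (rule nn_integral_mono_AE)
    show "AE y in lborel. (\<integral>\<^sup>+x. indicator \<Omega> x * indicator \<Omega> y * lam_kernel p' \<psi> \<delta> u' x y \<partial>lborel) \<le>
        indicator \<Omega> y * (\<integral>\<^sup>+x. indicator \<Omega> x * lam_kernel p \<phi> \<delta> u x y \<partial>lborel)"
      using u'(2)
    proof eventually_elim
      case (elim y)
      show ?case
      proof (cases "y \<in> \<Omega>")
        case True
        have "AE x in lborel. indicator \<Omega> x * lam_kernel p' \<psi> \<delta> u' x y \<le> indicator \<Omega> x * lam_kernel p \<phi> \<delta> u x y"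
          using u'(2) p'(2) le by eventually_elim (use elim True \<delta> in \<open>auto simp: indicator_def lam_kernel_def intro!: ennreal_leI mono\<close>)
        then show ?thesis using True by (simp add: nn_integral_mono_AE)
      qed simp
    qed
  qed
qed

text \<open>The constant of the maximal inequality times \<open>(2 * C) powr q\<close>:
  \<open>G\<close> contains the factor \<open>C\<close>, and charging a pair to one of its points
  doubles \<open>G\<close>.\<close>

definition bound_const :: "'a::euclidean_space itself \<Rightarrow> real \<Rightarrow> real \<Rightarrow> real" where
  "bound_const _ C q = (2 * C) powr q * (5 ^ DIM('a) * 2 powr q * q / (q - 1))"

text \<open>All hypotheses that hold only almost everywhere are reduced here to Borel
  representatives and one exceptional null set \<open>N\<close>. The shape of the domain enters
  solely through \<open>lip_bound\<close>.\<close>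

lemma Lambda_bound_and_limit:
  fixes \<Omega> :: "'a::euclidean_space set" and p u :: "'a \<Rightarrow> real" and \<phi> :: "'a \<Rightarrow> real \<Rightarrow> real" and e :: 'a
  assumes \<Omega>: "open \<Omega>" "bounded \<Omega>" and pm: "1 < pm" "pm \<le> pp" and c: "0 \<le> c"
    and lip: "lip_bound \<Omega> R \<Omega> C" "0 \<le> C"
    and p: "p \<in> borel_measurable (lebesgue_on \<Omega>)" "AE x in lborel. x \<in> \<Omega> \<longrightarrow> pm \<le> p x \<and> p x \<le> pp"
    and \<phi>nn: "\<forall>x. \<forall>t\<ge>0. 0 \<le> \<phi> x t"
    and D: "finite D" "D \<subseteq> {0<..}" and cont: "continuous_on (UNIV \<times> ({0..} - D)) (\<lambda>(x, t). \<phi> x t)"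
    and \<phi>le: "AE x in lborel. x \<in> \<Omega> \<longrightarrow> (\<forall>t\<ge>0. \<phi> x t \<le> c * min 1 (t powr (p x + 1)))"
    and e: "norm e = 1"
    and norm1: "AE x in lborel. x \<in> \<Omega> \<longrightarrow>
      sphere_gamma e (p x) * (LBINT t:{0<..}. \<phi> x t * t powr (- (p x + 1))) = 1"
    and u: "u \<in> Sobolev_W1 pp \<Omega> \<inter> Sobolev_W1 pm \<Omega>"
  defines "B \<equiv> bound_const TYPE('a) C"
  shows "0 < \<delta> \<Longrightarrow> Lambda \<Omega> p \<phi> \<delta> u \<le> ennreal (2 * c * enn2real (kern_const TYPE('a)) *
      (B pm * Lp_norm pm \<Omega> (wgrad \<Omega> u) powr pm + B pp * Lp_norm pp \<Omega> (wgrad \<Omega> u) powr pp))" (is "_ \<Longrightarrow> ?bound \<delta>")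
    and "((\<lambda>\<delta>. Lambda \<Omega> p \<phi> \<delta> u) \<longlongrightarrow> (\<integral>\<^sup>+x. ennreal (norm (wgrad \<Omega> u x) powr p x) \<partial>lebesgue_on \<Omega>)) (at_right 0)" (is ?limit)
proof -
  have \<Omega>b [measurable]: "\<Omega> \<in> sets borel" using \<Omega>(1) by simp
  have \<phi>0: "0 \<le> \<phi> x t" if "0 \<le> t" for x t using \<phi>nn that by blast
  have \<Omega>fin: "emeasure lborel \<Omega> < \<infinity>" by (rule emeasure_bounded_finite) fact
  obtain u' g where u' [measurable]: "u' \<in> borel_measurable borel" and g [measurable]: "g \<in> borel_measurable borel"
    and off: "\<And>x. x \<notin> \<Omega> \<Longrightarrow> g x = 0"
    and equ: "AE x in lborel. x \<in> \<Omega> \<longrightarrow> u x = u' x" and eqg: "AE x in lborel. x \<in> \<Omega> \<longrightarrow> wgrad \<Omega> u x = g x"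
    and wg: "borel_weak_gradient \<Omega> u' g"
    and gi: "\<And>s. s \<in> {pm, pp} \<Longrightarrow> 0 < s \<Longrightarrow> integrable lborel (\<lambda>x. norm (g x) powr s)"
    and Lp: "\<And>s. s \<in> {pm, pp} \<Longrightarrow> 0 < s \<Longrightarrow> Lp_norm s \<Omega> (wgrad \<Omega> u) powr s = (LINT x|lborel. norm (g x) powr s)"
    using Sobolev_W1_versions[OF \<Omega>(1) u] by blast
  obtain p0 where p0 [measurable]: "p0 \<in> borel_measurable borel" and eqp0: "AE x in lborel. x \<in> \<Omega> \<longrightarrow> p x = p0 x"
    using lebesgue_on_borel_versionE[OF \<Omega>b p(1)] by metis
  \<comment> \<open>Clamping alters the exponent on a null subset of \<Omega> only, and makes its
    bounds hold everywhere.\<close>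
  define p' where "p' x = max pm (min pp (p0 x))" for x
  have p' [measurable]: "p' \<in> borel_measurable borel" unfolding p'_def by measurable
  have p'b: "pm \<le> p' x \<and> p' x \<le> pp" for x using pm by (auto simp: p'_def)
  have eqp: "AE x in lborel. x \<in> \<Omega> \<longrightarrow> p x = p' x"
    using eqp0 p(2) by eventually_elim (auto simp: p'_def)
  have "AE x in lborel. x \<in> \<Omega> \<longrightarrow> (\<forall>t\<ge>0. \<phi> x t \<le> c * min 1 (t powr (p' x + 1))) \<and>
      sphere_gamma e (p' x) * (LBINT t:{0<..}. \<phi> x t * t powr (- (p' x + 1))) = 1"
    using eqp \<phi>le norm1 by eventually_elim auto
  then obtain N where N: "N \<in> null_sets lborel" and
    good: "\<And>x. x \<notin> N \<Longrightarrow> x \<in> \<Omega> \<Longrightarrow> (\<forall>t\<ge>0. \<phi> x t \<le> c * min 1 (t powr (p' x + 1))) \<and>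
      sphere_gamma e (p' x) * (LBINT t:{0<..}. \<phi> x t * t powr (- (p' x + 1))) = 1"
    by (rule AE_E3) auto
  have Nb [measurable]: "N \<in> sets borel" using N by auto
  have AEN: "AE x in lborel. x \<notin> N" using N by (rule AE_not_in)
  define G where "G x = C * enn2real (max_fun R (\<lambda>x. ennreal (norm (g x))) x)" for x
  \<comment> \<open>On \<Omega>, which has finite measure,
    \<open>norm (g x) \<le> 1 + norm (g x) powr pm\<close>; elsewhere \<open>g\<close>
    vanishes.\<close>
  have gint: "integrable lborel g"
  proof (rule Bochner_Integration.integrable_bound)
    show "integrable lborel (\<lambda>x. indicator \<Omega> x + norm (g x) powr pm)"
      using gi[of pm] pm \<Omega>fin by (intro Bochner_Integration.integrable_add integrable_real_indicator) auto
    show "AE x in lborel. norm (g x) \<le> norm (indicator \<Omega> x + norm (g x) powr pm :: real)"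
    proof (rule AE_I2)
      fix x
      have "norm (g x) \<le> 1 + norm (g x) powr pm"
      proof (cases "norm (g x) \<le> 1")
        case False
        then have "norm (g x) powr 1 \<le> norm (g x) powr pm" using pm by (intro powr_mono) auto
        then show ?thesis using False by simp
      qed (simp add: add_increasing2)
      then show "norm (g x) \<le> norm (indicator \<Omega> x + norm (g x) powr pm :: real)"
        by (cases "x \<in> \<Omega>") (simp_all add: off)
    qed
  qed measurable
  note lipG = lip_bound_weak_gradient[OF \<Omega>(1) wg off gint lip, folded G_def]
  have G [measurable]: "G \<in> borel_measurable borel" unfolding G_def by measurable
  have G0: "0 \<le> G x" for x using lip(2) by (simp add: G_def)
  have nnL: "(\<integral>\<^sup>+x. ennreal (norm (g x) powr s) \<partial>lborel) = ennreal (Lp_norm s \<Omega> (wgrad \<Omega> u) powr s)"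
    if "s \<in> {pm, pp}" for s
  proof -
    have "0 < s" using that pm by auto
    then show ?thesis unfolding Lp[OF that \<open>0 < s\<close>] by (intro nn_integral_eq_integral gi that) auto
  qed
  have B0: "0 \<le> B s" if "s \<in> {pm, pp}" for s using that pm by (auto simp: B_def bound_const_def)
  have Gint: "(\<integral>\<^sup>+x\<in>\<Omega>. ennreal ((2 * G x) powr pm + (2 * G x) powr pp) \<partial>lborel) \<le>
      ennreal (B pm * Lp_norm pm \<Omega> (wgrad \<Omega> u) powr pm + B pp * Lp_norm pp \<Omega> (wgrad \<Omega> u) powr pp)" (is "?I \<le> ennreal ?E")
  proof -
    have "?I \<le> (\<integral>\<^sup>+x. ennreal ((2 * G x) powr pm) + ennreal ((2 * G x) powr pp) \<partial>lborel)"
      by (intro nn_integral_mono) (auto simp: indicator_def ennreal_plus)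
    also have "\<dots> = (\<integral>\<^sup>+x. ennreal ((2 * G x) powr pm) \<partial>lborel) + (\<integral>\<^sup>+x. ennreal ((2 * G x) powr pp) \<partial>lborel)"
      by (rule nn_integral_add) measurable
    also have "\<dots> \<le> ennreal (B pm) * ennreal (Lp_norm pm \<Omega> (wgrad \<Omega> u) powr pm) +
        ennreal (B pp) * ennreal (Lp_norm pp \<Omega> (wgrad \<Omega> u) powr pp)"
      using lipG(2)[of pm] lipG(2)[of pp] pm nnL[of pm] nnL[of pp] unfolding B_def bound_const_def
      by (intro add_mono) simp_all
    also have "\<dots> = ennreal ?E" using B0 by (simp add: ennreal_mult' ennreal_plus)
    finally show ?thesis .
  qed
  txt \<open>On \<open>D\<close> the function \<open>\<phi>\<close> need not be measurable in \<open>x\<close>, so the functional is squeezed between the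
    Borel modifications that are smallest and largest there; both have the same limit as \<open>D\<close> is finite.\<close>
  define \<Phi> where "\<Phi> b x t = indicator (- N) x * (indicator (UNIV \<times> ({0..} - D)) (x, t) * \<phi> x t + indicator D t * b x t)"
    for b :: "'a \<Rightarrow> real \<Rightarrow> real" and x t
  define lamF where "lamF b \<delta> = (\<integral>\<^sup>+x. (\<integral>\<^sup>+y. indicator \<Omega> x * indicator \<Omega> y * lam_kernel p' (\<Phi> b) \<delta> u' x y \<partial>lborel) \<partial>lborel)"
    for b \<delta>
  let ?ok = "\<lambda>b. case_prod b \<in> borel_measurable (borel \<Otimes>\<^sub>M borel) \<and> (\<forall>x t. 0 \<le> t \<longrightarrow> 0 \<le> b x t \<and> b x t \<le> c * min 1 (t powr (p' x + 1)))"
  have Db [measurable]: "D \<in> sets borel" using D(1) by (intro borel_closed finite_imp_closed)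
  have \<Phi>_meas: "case_prod (\<Phi> b) \<in> borel_measurable (borel \<Otimes>\<^sub>M borel)" if "?ok b" for b
  proof -
    have [measurable]: "case_prod b \<in> borel_measurable (borel \<Otimes>\<^sub>M borel)" using that by blast
    have "UNIV \<times> ({0..} - D) \<in> sets (borel \<Otimes>\<^sub>M borel :: ('a \<times> real) measure)" by measurable
    then have "UNIV \<times> ({0..} - D) \<in> sets (borel :: ('a \<times> real) measure)" by (simp only: borel_prod)
    from borel_measurable_continuous_on_indicator[OF this cont]
    have [measurable]: "(\<lambda>z. indicator (UNIV \<times> ({0..} - D)) z * case_prod \<phi> z) \<in> borel_measurable (borel \<Otimes>\<^sub>M borel)"
      by (simp add: borel_prod)
    have "(\<lambda>z. indicator (- N) (fst z) * (indicator (UNIV \<times> ({0..} - D)) z * case_prod \<phi> z + indicator D (snd z) * case_prod b z))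
        \<in> borel_measurable (borel \<Otimes>\<^sub>M borel)" by measurable
    then show ?thesis by (simp add: \<Phi>_def case_prod_unfold)
  qed
  have \<Phi>_off: "\<Phi> b x t = \<phi> x t" if "x \<notin> N" "0 \<le> t" "t \<notin> D" for b x t
    using that by (simp add: \<Phi>_def)
  have \<Phi>_on: "\<Phi> b x t = b x t" if "x \<notin> N" "t \<in> D" for b x t
    using that by (simp add: \<Phi>_def)
  have \<Phi>_N: "\<Phi> b x t = 0" if "x \<in> N" for b x t using that by (simp add: \<Phi>_def)
  have \<Phi>_le: "0 \<le> \<Phi> b x t \<and> \<Phi> b x t \<le> c * min 1 (t powr (p' x + 1))" if "?ok b" "x \<in> \<Omega>" "0 \<le> t" for b x t
  proof (cases "x \<in> N")
    case True
    then show ?thesis using c by (simp add: \<Phi>_N)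
  next
    case False
    then show ?thesis
      using that good[OF False] \<phi>0[of t x] by (cases "t \<in> D") (auto simp: \<Phi>_off \<Phi>_on)
  qed
  have NL: "nonlocal_limit \<Omega> p' u' G (\<Phi> b) pm pp c g D" if ok: "?ok b" for b
  proof
    show "open \<Omega>" "emeasure lborel \<Omega> < \<infinity>" "1 < pm" "0 \<le> c" "finite D" "borel_weak_gradient \<Omega> u' g" "integrable lborel g"
      by fact+
    show "p' \<in> borel_measurable borel" "u' \<in> borel_measurable borel" "G \<in> borel_measurable borel" by fact+
    show "case_prod (\<Phi> b) \<in> borel_measurable (borel \<Otimes>\<^sub>M borel)" by (rule \<Phi>_meas[OF ok])
    show "pm \<le> p' x \<and> p' x \<le> pp" "0 \<le> G x" for x by (fact p'b G0)+
    show "0 \<le> \<Phi> b x t \<and> \<Phi> b x t \<le> c * min 1 (t powr (p' x + 1))" if "x \<in> \<Omega>" "0 \<le> t" for x t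
      by (rule \<Phi>_le[OF ok that])
    show "AE x in lborel. x \<in> \<Omega> \<longrightarrow> (AE y in lborel. y \<in> \<Omega> \<longrightarrow> \<bar>u' x - u' y\<bar> \<le> norm (x - y) * (G x + G y))"
      by (rule lipG(1))
    show "(\<integral>\<^sup>+x\<in>\<Omega>. ennreal ((2 * G x) powr pm + (2 * G x) powr pp) \<partial>lborel) < \<infinity>"
      using Gint by (rule le_less_trans) simp
    show "0 \<notin> D" using D by auto
    show "continuous (at t within {0..}) (\<Phi> b x)" if "x \<in> \<Omega>" "0 \<le> t" "t \<notin> D" for x t
    proof (cases "x \<in> N")
      case True
      then have "\<Phi> b x = (\<lambda>t. 0)" using \<Phi>_N by blast
      then show ?thesis by simp
    next
      case False
      have oD: "open (- D)" using D(1) by (simp add: finite_imp_closed open_Compl)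
      have "continuous_on ({0..} - D) (\<lambda>t. case_prod \<phi> (x, t))"
        by (rule continuous_on_compose2[OF cont]) (auto intro!: continuous_intros)
      then have "continuous_on ({0..} - D) (\<Phi> b x)"
        by (rule continuous_on_eq) (simp add: \<Phi>_off[OF False])
      then have "continuous (at t within ({0..} - D)) (\<Phi> b x)"
        using that by (auto simp: continuous_on_eq_continuous_within)
      \<comment> \<open>Removing finitely many points other than \<open>t\<close> does not change
        the neighbourhoods of \<open>t\<close>.\<close>
      moreover have "at t within ({0..} - D) = at t within {0..}"
        by (rule at_within_nhd[where S = "- D"]) (use oD that in auto)
      ultimately show ?thesis by simp
    qed
  qed
  have lim_value: "(\<integral>\<^sup>+v. indicator \<Omega> x * ennreal (\<Phi> b x \<bar>g x \<bullet> v\<bar> / norm v powr (real DIM('a) + p' x)) \<partial>lborel) =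
      indicator \<Omega> x * ennreal (norm (g x) powr p' x)" if ok: "?ok b" and x: "x \<notin> N" for b x
  proof (cases "x \<in> \<Omega>")
    case True
    have "(\<lambda>t. case_prod (\<Phi> b) (x, t)) \<in> borel_measurable borel"
      by (rule measurable_compose[OF _ \<Phi>_meas[OF ok]]) simp
    then have m: "\<Phi> b x \<in> borel_measurable borel" by simp
    \<comment> \<open>The finite set \<open>D\<close> is null, so the modification keeps the
      normalisation.\<close>
    have "(LBINT t:{0<..}. \<Phi> b x t * t powr (- (p' x + 1))) = (LBINT t:{0<..}. \<phi> x t * t powr (- (p' x + 1)))"
      by (rule set_lebesgue_integral_finite_difference[OF D(1)]) (simp add: \<Phi>_off[OF x])
    then have n: "sphere_gamma e (p' x) * (LBINT t:{0<..}. \<Phi> b x t * t powr (- (p' x + 1))) = 1"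
      using good[OF x True] by simp
    have z: "\<Phi> b x 0 = 0" using \<Phi>_le[OF ok True, of 0] c by simp
    have q: "1 \<le> p' x" using p'b[of x] pm by simp
    have pos: "0 \<le> \<Phi> b x t" if "0 \<le> t" for t using \<Phi>_le[OF ok True that] by simp
    show ?thesis using nn_integral_radial_kernel[OF m z pos q e n, of "g x"] True by simp
  qed simp
  have target: "(\<integral>\<^sup>+x. ennreal (norm (wgrad \<Omega> u x) powr p x) \<partial>lebesgue_on \<Omega>) =
      (\<integral>\<^sup>+x. indicator \<Omega> x * ennreal (norm (g x) powr p' x) \<partial>lborel)"
    unfolding nn_integral_lebesgue_on_borel[OF \<Omega>b]
    by (rule nn_integral_cong_AE) (use eqg eqp in \<open>eventually_elim, auto simp: indicator_def\<close>)
  have lim: "(lamF b \<longlongrightarrow> (\<integral>\<^sup>+x. ennreal (norm (wgrad \<Omega> u x) powr p x) \<partial>lebesgue_on \<Omega>)) (at_right 0)" if ok: "?ok b" for b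
  proof -
    interpret L: nonlocal_limit \<Omega> p' u' G "\<Phi> b" pm pp c g D by (rule NL[OF ok])
    have "(\<integral>\<^sup>+x. (\<integral>\<^sup>+v. L.limf x v \<partial>lborel) \<partial>lborel) = (\<integral>\<^sup>+x. indicator \<Omega> x * ennreal (norm (g x) powr p' x) \<partial>lborel)"
      unfolding L.limf_def by (rule nn_integral_cong_AE) (use AEN in \<open>eventually_elim, auto simp: lim_value[OF ok]\<close>)
    moreover have "L.lam = lamF b" by (simp add: fun_eq_iff L.lam_def lamF_def)
    ultimately show ?thesis using L.lam_tendsto unfolding target by simp
  qed
  let ?lo = "\<lambda>x t. 0 :: real" and ?hi = "\<lambda>x t. c * min 1 (t powr (p' x + 1))"
  have ok_lo: "?ok ?lo" using c by (auto simp: case_prod_unfold)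
  have ok_hi: "?ok ?hi"
  proof (intro conjI allI impI)
    show "case_prod ?hi \<in> borel_measurable (borel \<Otimes>\<^sub>M borel)" unfolding case_prod_unfold by measurable
  qed (use c in auto)
  have lo: "lamF ?lo \<delta> \<le> Lambda \<Omega> p \<phi> \<delta> u" if "0 < \<delta>" for \<delta>
    unfolding lamF_def
  proof (rule Lambda_borel_compare(2)[OF \<Omega>b that u' equ p' eqp \<Phi>_meas[OF ok_lo]])
    show "AE x in lborel. x \<in> \<Omega> \<longrightarrow> (\<forall>t\<ge>0. \<Phi> ?lo x t \<le> \<phi> x t)"
      using AEN
    proof eventually_elim
      case (elim x)
      have "\<Phi> ?lo x t \<le> \<phi> x t" if "0 \<le> t" for t
        using elim that \<phi>0[OF that, of x] by (cases "t \<in> D") (auto simp: \<Phi>_off \<Phi>_on)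
      then show ?case by blast
    qed
  qed
  have hi: "Lambda \<Omega> p \<phi> \<delta> u \<le> lamF ?hi \<delta>" if "0 < \<delta>" for \<delta>
    unfolding lamF_def
  proof (rule Lambda_borel_compare(1)[OF \<Omega>b that u' equ p' eqp \<Phi>_meas[OF ok_hi]])
    show "AE x in lborel. x \<in> \<Omega> \<longrightarrow> (\<forall>t\<ge>0. \<phi> x t \<le> \<Phi> ?hi x t)"
      using AEN
    proof eventually_elim
      case (elim x)
      have "\<phi> x t \<le> \<Phi> ?hi x t" if "0 \<le> t" "x \<in> \<Omega>" for t
        using elim that good[OF elim that(2)] by (cases "t \<in> D") (auto simp: \<Phi>_off \<Phi>_on)
      then show ?case by blast
    qed
  qed
  show ?limit
  proof (rule tendsto_sandwich[OF _ _ lim[OF ok_lo] lim[OF ok_hi]])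
    show "eventually (\<lambda>\<delta>. lamF ?lo \<delta> \<le> Lambda \<Omega> p \<phi> \<delta> u) (at_right 0)"
      using eventually_at_right_less[of "0::real"] by eventually_elim (rule lo)
    show "eventually (\<lambda>\<delta>. Lambda \<Omega> p \<phi> \<delta> u \<le> lamF ?hi \<delta>) (at_right 0)"
      using eventually_at_right_less[of "0::real"] by eventually_elim (rule hi)
  qed
  show "?bound \<delta>" if \<delta>: "0 < \<delta>"
  proof -
    interpret L: nonlocal_limit \<Omega> p' u' G "\<Phi> ?hi" pm pp c g D by (rule NL[OF ok_hi])
    \<comment> \<open>At level \<open>- 1\<close> every pair belongs to the tail.\<close>
    have G1: "- 1 < G x" for x using G0[of x] by simp
    have "Lambda \<Omega> p \<phi> \<delta> u \<le> lamF ?hi \<delta>" by (rule hi[OF \<delta>])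
    also have "\<dots> \<le> ennreal (2 * c) * kern_const TYPE('a) * L.tail (- 1)"
      using L.nn_integral_lam_kernel_tail[OF \<delta>, of "- 1"] by (simp add: lamF_def G1)
    also have "L.tail (- 1) = (\<integral>\<^sup>+x\<in>\<Omega>. ennreal ((2 * G x) powr pm + (2 * G x) powr pp) \<partial>lborel)"
      unfolding L.tail_def by (simp add: G1 mult.commute)
    also have "ennreal (2 * c) * kern_const TYPE('a) * \<dots> \<le> ennreal (2 * c) * kern_const TYPE('a) * ennreal (B pm * Lp_norm pm \<Omega> (wgrad \<Omega> u) powr pm + B pp * Lp_norm pp \<Omega> (wgrad \<Omega> u) powr pp)"
      by (intro mult_left_mono Gint) simp
    also have "kern_const TYPE('a) = ennreal (enn2real (kern_const TYPE('a)))"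
      using kern_const_finite[where 'a='a] by simp
    also have "ennreal (2 * c) * ennreal (enn2real (kern_const TYPE('a))) * ennreal z = ennreal (2 * c * enn2real (kern_const TYPE('a)) * z)" for z
      using c by (simp add: ennreal_mult')
    finally show ?thesis .
  qed
qed

text \<open>The constant is fixed before \<open>p\<close>, \<phi>, \<open>e\<close> and
  \<open>u\<close>; it depends on the domain, the two extreme exponents and the bounds
  \<open>a\<close> and \<open>b\<close>.\<close>

theorem Lambda_smooth_bounded_domain:
  fixes \<Omega> :: "'a::euclidean_space set" and pm pp a b :: real
  assumes \<Omega>: "smooth_bounded_domain \<Omega>" and a: "0 \<le> a" and b: "0 \<le> b"
  shows "\<exists>C>0. \<forall>(p :: 'a \<Rightarrow> real) (\<phi> :: 'a \<Rightarrow> real \<Rightarrow> real) (e :: 'a) (u :: 'a \<Rightarrow> real).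
    (\<forall>x\<in>\<Omega>. 1 \<le> p x) \<and>
    p \<in> borel_measurable (lebesgue_on \<Omega>) \<and>
    ereal pm = ess_inf_on \<Omega> p \<and> ereal pp = ess_sup_on \<Omega> p \<and> 1 < pm \<and>
    (\<forall>x. \<forall>t\<ge>0. 0 \<le> \<phi> x t) \<and>
    (\<exists>D. finite D \<and> D \<subseteq> {0<..} \<and> continuous_on (UNIV \<times> ({0..} - D)) (\<lambda>(x, t). \<phi> x t)) \<and>
    (AE x in lebesgue. \<phi> x 0 = 0) \<and>
    (AE x in lebesgue_on \<Omega>. \<forall>t\<in>{0..1}. \<phi> x t \<le> a * t powr (p x + 1)) \<and>
    (AE x in lebesgue. \<forall>t\<ge>0. \<phi> x t \<le> b) \<and>
    norm e = 1 \<and>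
    (AE x in lebesgue_on \<Omega>.
       sphere_gamma e (p x) * (LBINT t:{0<..}. \<phi> x t * t powr (- (p x + 1))) = 1) \<and>
    u \<in> Sobolev_W1 pp \<Omega> \<inter> Sobolev_W1 pm \<Omega>
    \<longrightarrow>
    (\<forall>\<delta>>0. Lambda \<Omega> p \<phi> \<delta> u \<le>
       ennreal (C * (Lp_norm pp \<Omega> (wgrad \<Omega> u) powr pp + Lp_norm pm \<Omega> (wgrad \<Omega> u) powr pm))) \<and>
    ((\<lambda>\<delta>. Lambda \<Omega> p \<phi> \<delta> u) \<longlongrightarrow>
       (\<integral>\<^sup>+x. ennreal (norm (wgrad \<Omega> u x) powr p x) \<partial>lebesgue_on \<Omega>)) (at_right 0)"
proof -
  have dom: "open \<Omega>" "bounded \<Omega>" "\<Omega> \<noteq> {}" using \<Omega> by (auto simp: smooth_bounded_domain_def)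
  then have \<Omega>b: "\<Omega> \<in> sets borel" by simp
  obtain R C0 where C0: "0 \<le> C0" and lip: "lip_bound \<Omega> R \<Omega> C0"
    using lip_bound_smooth_bounded_domain[OF \<Omega>] by blast
  \<comment> \<open>One constant for both growth hypotheses: \<open>a\<close> governs
    \<open>t \<le> 1\<close>, and \<open>b\<close> the larger arguments.\<close>
  define c where "c = max a b"
  have c: "0 \<le> c" "a \<le> c" "b \<le> c" using a by (auto simp: c_def)
  define B where "B s = bound_const TYPE('a) C0 s" for s
  define k where "k = 2 * c * enn2real (kern_const TYPE('a))"
  have k: "0 \<le> k" using c by (simp add: k_def)
  \<comment> \<open>At this point \<open>pm\<close> and \<open>pp\<close> are arbitrary reals, so
    the values of \<open>B\<close> may be negative; the added 1 makes the constant positive.\<close>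
  define K where "K = k * (\<bar>B pm\<bar> + \<bar>B pp\<bar>) + 1"
  have K: "0 < K" using k by (simp add: K_def add_nonneg_pos)
  show ?thesis
  proof (rule exI[of _ K], rule conjI[OF K], intro allI, rule impI, goal_cases)
    case (1 p \<phi> e u)
    obtain D where p: "p \<in> borel_measurable (lebesgue_on \<Omega>)"
      and pmp: "ereal pm = ess_inf_on \<Omega> p" "ereal pp = ess_sup_on \<Omega> p" and pm1: "1 < pm"
      and \<phi>0: "\<forall>x. \<forall>t\<ge>0. 0 \<le> \<phi> x t"
      and D: "finite D" "D \<subseteq> {0<..}" "continuous_on (UNIV \<times> ({0..} - D)) (\<lambda>(x, t). \<phi> x t)"
      and \<phi>a: "AE x in lborel. x \<in> \<Omega> \<longrightarrow> (\<forall>t\<in>{0..1}. \<phi> x t \<le> a * t powr (p x + 1))"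
      and \<phi>b: "AE x in lborel. \<forall>t\<ge>0. \<phi> x t \<le> b"
      and e: "norm e = 1"
      and n: "AE x in lborel. x \<in> \<Omega> \<longrightarrow> sphere_gamma e (p x) * (LBINT t:{0<..}. \<phi> x t * t powr (- (p x + 1))) = 1"
      and u: "u \<in> Sobolev_W1 pp \<Omega> \<inter> Sobolev_W1 pm \<Omega>"
      using 1 unfolding AE_lebesgue_on_iff[OF \<Omega>b] AE_completion_iff by blast
    have "AE x in lborel. x \<in> \<Omega> \<longrightarrow> ereal (p x) \<le> ereal pp"
      using esssup_AE[of "\<lambda>x. ereal (p x)" "lebesgue_on \<Omega>"] unfolding pmp ess_sup_on_def AE_lebesgue_on_iff[OF \<Omega>b] .
    moreover have "AE x in lborel. x \<in> \<Omega> \<longrightarrow> - ereal (p x) \<le> - ereal pm"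
      using esssup_AE[of "\<lambda>x. - ereal (p x)" "lebesgue_on \<Omega>"]
      unfolding pmp ess_inf_on_def AE_lebesgue_on_iff[OF \<Omega>b] ereal_uminus_uminus .
    ultimately have pb: "AE x in lborel. x \<in> \<Omega> \<longrightarrow> pm \<le> p x \<and> p x \<le> pp"
      by eventually_elim simp
    \<comment> \<open>Otherwise almost no point of \<Omega> could satisfy both bounds, and a
      nonempty open set would be null.\<close>
    have pmpp: "pm \<le> pp"
    proof (rule ccontr)
      assume "\<not> pm \<le> pp"
      then have "AE x in lborel. x \<notin> \<Omega>" using pb by (auto elim!: eventually_mono)
      then have z: "emeasure lborel \<Omega> = 0" using emeasure_eq_0_AE[of "\<lambda>x. x \<in> \<Omega>" lborel] by simp
      obtain x r where r: "0 < r" "ball x r \<subseteq> \<Omega>" using dom open_contains_ball[of \<Omega>] by blast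
      have "emeasure lborel (ball x r) \<le> emeasure lborel \<Omega>" by (rule emeasure_mono) (use r \<Omega>b in auto)
      then show False using z emeasure_ball_pos[OF r(1), of x] by simp
    qed
    have \<phi>le: "AE x in lborel. x \<in> \<Omega> \<longrightarrow> (\<forall>t\<ge>0. \<phi> x t \<le> c * min 1 (t powr (p x + 1)))"
      using \<phi>a \<phi>b pb
    proof eventually_elim
      case (elim x)
      have "\<phi> x t \<le> c * min 1 (t powr (p x + 1))" if x: "x \<in> \<Omega>" and t: "0 \<le> t" for t
      proof (cases "t \<le> 1")
        case True
        have "t powr (p x + 1) \<le> 1" using True t elim x pm1 by (intro powr_le1) auto
        moreover have "\<phi> x t \<le> a * t powr (p x + 1)" using elim x t True by simp
        moreover have "a * t powr (p x + 1) \<le> c * t powr (p x + 1)" using c by (intro mult_right_mono) auto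
        ultimately show ?thesis by (simp add: min_absorb2)
      next
        case False
        have "1 \<le> t powr (p x + 1)" using False elim x pm1 by (intro ge_one_powr_ge_zero) auto
        moreover have "\<phi> x t \<le> b" using elim t by simp
        ultimately show ?thesis using c by (simp add: min_absorb1)
      qed
      then show ?case by blast
    qed
    note main = Lambda_bound_and_limit[OF dom(1,2) pm1 pmpp c(1) lip C0 p pb \<phi>0 D \<phi>le e n u]
    show ?case
    proof (intro conjI allI impI main(2))
      fix \<delta> :: real assume \<delta>: "0 < \<delta>"
      let ?L = "\<lambda>s. Lp_norm s \<Omega> (wgrad \<Omega> u) powr s"
      have "k * (B pm * ?L pm + B pp * ?L pp) \<le> k * ((\<bar>B pm\<bar> + \<bar>B pp\<bar>) * ?L pm + (\<bar>B pm\<bar> + \<bar>B pp\<bar>) * ?L pp)"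
        by (intro mult_left_mono add_mono mult_right_mono k) auto
      also have "\<dots> = (k * (\<bar>B pm\<bar> + \<bar>B pp\<bar>)) * (?L pp + ?L pm)" by (simp add: algebra_simps)
      also have "\<dots> \<le> K * (?L pp + ?L pm)" unfolding K_def by (intro mult_right_mono) auto
      finally show "Lambda \<Omega> p \<phi> \<delta> u \<le> ennreal (K * (?L pp + ?L pm))"
        using main(1)[OF \<delta>, folded B_def k_def] by (auto intro: order_trans ennreal_leI)
    qed
  qed
qed

theorem theorem2p1:
  fixes \<Omega> :: "(real ^ 'n) set" and pm pp a b :: real
  assumes \<Omega>: "smooth_bounded_domain \<Omega>"
    and "0 \<le> a" and "0 \<le> b"
  shows "\<exists>C>0. \<forall>(p :: real ^ 'n \<Rightarrow> real) (\<phi> :: real ^ 'n \<Rightarrow> real \<Rightarrow> real)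
      (e :: real ^ 'n) (u :: real ^ 'n \<Rightarrow> real).
    (\<forall>x\<in>\<Omega>. 1 \<le> p x) \<and>
    p \<in> borel_measurable (lebesgue_on \<Omega>) \<and>
    ereal pm = ess_inf_on \<Omega> p \<and> ereal pp = ess_sup_on \<Omega> p \<and> 1 < pm \<and>
    (\<forall>x. \<forall>t\<ge>0. 0 \<le> \<phi> x t) \<and>
    (\<exists>D. finite D \<and> D \<subseteq> {0<..} \<and> continuous_on (UNIV \<times> ({0..} - D)) (\<lambda>(x, t). \<phi> x t)) \<and>
    (AE x in lebesgue. \<phi> x 0 = 0) \<and>
    (AE x in lebesgue_on \<Omega>. \<forall>t\<in>{0..1}. \<phi> x t \<le> a * t powr (p x + 1)) \<and>
    (AE x in lebesgue. \<forall>t\<ge>0. \<phi> x t \<le> b) \<and>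
    norm e = 1 \<and>
    (AE x in lebesgue_on \<Omega>.
       sphere_gamma e (p x) * (LBINT t:{0<..}. \<phi> x t * t powr (- (p x + 1))) = 1) \<and>
    u \<in> Sobolev_W1 pp \<Omega> \<inter> Sobolev_W1 pm \<Omega>
    \<longrightarrow>
    (\<forall>\<delta>>0. Lambda \<Omega> p \<phi> \<delta> u \<le>
       ennreal (C * (Lp_norm pp \<Omega> (wgrad \<Omega> u) powr pp + Lp_norm pm \<Omega> (wgrad \<Omega> u) powr pm))) \<and>
    ((\<lambda>\<delta>. Lambda \<Omega> p \<phi> \<delta> u) \<longlongrightarrow>
       (\<integral>\<^sup>+x. ennreal (norm (wgrad \<Omega> u x) powr p x) \<partial>lebesgue_on \<Omega>)) (at_right 0)"
  by (rule Lambda_smooth_bounded_domain[OF assms])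

end
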